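(* Let $G$ be a finite group and $\mathfrak p:G\to\mathbb Z_2$ a homomorphism. Let $(\mathcal M_1,\mathrm{Ad}_{\Gamma_1},\alpha_1)$ and $(\mathcal M_2,\mathrm{Ad}_{\Gamma_2},\alpha_2)$ be graded $W^*$-$(G,\mathfrak p)$-dynamical systems with balanced, central and spatially graded type I von Neumann algebras (with grading operators $\Gamma_1,\Gamma_2$). Then the triple $(\mathcal M_1\hat\otimes\mathcal M_2,\mathrm{Ad}_{\Gamma_1\otimes\Gamma_2},\alpha_1\hat\otimes\alpha_2)$ is a graded $W^*$-$(G,\mathfrak p)$-dynamical system with a balanced, central and spatially graded type I von Neumann algebra. If $\mathrm{Ind}(\mathcal M_i,\mathrm{Ad}_{\Gamma_i},\alpha_i)=(\kappa_i,\mathfrak q_i,[\upsilon_i])$ for $i=1,2$, then $$\mathrm{Ind}(\mathcal M_1\hat\otimes\mathcal M_2,\mathrm{Ad}_{\Gamma_1\otimes\Gamma_2},\alpha_1\hat\otimes\alpha_2)=\big(\kappa_1+\kappa_2,\ \mathfrak q_1+\mathfrak q_2+\kappa_1\kappa_2\mathfrak p,\ [\upsilon_1\,\upsilon_2\,\epsilon_{\mathfrak p}(\kappa_1,\mathfrak q_1,\kappa_2,\mathfrak q_2)]\big),$$ where $\epsilon_{\mathfrak p}(\kappa_1,\mathfrak q_1,\kappa_2,\mathfrak q_2)$ is the group 2-cocycle $$\epsilon_{\mathfrak p}(\kappa_1,\mathfrak q_1,\kappa_2,\mathfrak q_2)(g,h)=(-1)^{\mathfrak q_1(g)\mathfrak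 q_2(h)+(\kappa_1-\kappa_2)(\kappa_1\mathfrak q_2(g)+\kappa_2\mathfrak q_1(g))\,\mathfrak p(h)},\qquad g,h\in G.$$
   Context: $\mathbb Z_2=\{0,1\}$ is written additively. **Projective representations.** A projective unitary/anti-unitary representation of $G$ relative to $\mathfrak p$ is a family $V_g$, unitary if $\mathfrak p(g)=0$, anti-unitary if $\mathfrak p(g)=1$, with $V_gV_h=\upsilon(g,h)V_{gh}$, $\upsilon(g,h)\in U(1)$, $\upsilon(e,g)=\upsilon(g,e)=1$; then $\upsilon$ is a 2-cocycle: $\overline{\upsilon(g,h)}^{\mathfrak p(f)}\upsilon(f,gh)=\upsilon(f,g)\upsilon(fg,h)$, where $\overline z^{0}=z$, $\overline z^{1}=\overline z$. Its class modulo coboundaries $b(g)\overline{b(h)}^{\mathfrak p(g)}/b(gh)$ lies in $H^2(G,U(1)_{\mathfrak p})$. **Graded systems.** A graded von Neumann algebra $(\mathcal M,\theta)$ is a von Neumann algebra with an involutive automorphism $\theta$; $\mathcal M^{(\sigma)}=\{x:\theta(x)=(-1)^\sigma x\}$, and $\partial x=\sigma$ for $x\in\mathcal M^{(\sigma)}$. It is spatially graded with grading operator $\Gamma$ if $\mathcal M\subset\mathcal B(\mathcal H)$ and $\Gamma$ is a self-adjoint unitary on $\mathcal H$ with $\theta=\mathrm{Ad}_\Gamma|_{\mathcal M}$. It is balanced if $\mathcal M^{(1)}$ contains a self-adjoint unitary, central if $Z(\mathcal M)\cap\mathcal M^{(0)}=\mathbb C1$, type I if $\mathcal M$ is. A graded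 $W^*$-$(G,\mathfrak p)$-dynamical system $(\mathcal M,\theta,\hat\alpha)$ has in addition an action $\hat\alpha$ of $G$ on $\mathcal M$ commuting with $\theta$, $\hat\alpha_g$ being a linear (resp. anti-linear) $*$-automorphism if $\mathfrak p(g)=0$ (resp. $1$). Two systems are equivalent if there is a $*$-isomorphism intertwining gradings and actions. **Index.** Let $\sigma_x,\sigma_y,\sigma_z$ be the Pauli matrices, $\mathfrak C=\mathrm{span}\{1,\sigma_x\}\subset M_2$, and for a Hilbert space $\mathcal K$ let $\Gamma_{\mathcal K}=1_{\mathcal K}\otimes\sigma_z$, $\mathcal R_{0,\mathcal K}=\mathcal B(\mathcal K)\otimes M_2$, $\mathcal R_{1,\mathcal K}=\mathcal B(\mathcal K)\otimes\mathfrak C$. $\mathcal S_\kappa$ ($\kappa=0,1$) is the set of systems $(\mathcal R_{\kappa,\mathcal K},\mathrm{Ad}_{\Gamma_{\mathcal K}},\mathrm{Ad}_{V_g})$ with $V$ a projective unitary/anti-unitary representation of $G$ on $\mathcal K\otimes\mathbb C^2$ relative to $\mathfrak p$ and $\mathfrak q:G\to\mathbb Z_2$ a homomorphism with $\mathrm{Ad}_{V_g}(\Gamma_{\mathcal K})=(-1)^{\mathfrak q(g)}\Gamma_{\mathcal K}$ and, if $\kappa=1$, also $\mathrm{Ad}_{V_g}(1\otimes\sigma_x)=(-1)^{\mathfrak q(g)}1\otimes\sigma_x$. For $\kappa=1$ there is a unique projective representation $V^{(0)}$ on $\mathcal K$ relative to $\mathfrak p$ with $V_g=V^{(0)}_g\otimes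 C^{\mathfrak p(g)}\sigma_y^{\mathfrak q(g)}$, $C$ = complex conjugation on $\mathbb C^2$. Every balanced, central, type I system is equivalent to a member of exactly one $\mathcal S_\kappa$, and $\mathrm{Ind}(\mathcal M,\theta,\hat\alpha):=(\kappa,\mathfrak q,[\upsilon])\in\mathbb Z_2\times H^1(G,\mathbb Z_2)\times H^2(G,U(1)_{\mathfrak p})$, with $[\upsilon]$ the class of $V$ if $\kappa=0$ and of $V^{(0)}$ if $\kappa=1$; this is well defined. Here $H^1(G,\mathbb Z_2)=\mathrm{Hom}(G,\mathbb Z_2)$. **Graded tensor product.** For spatially graded $\mathcal M_i\subset\mathcal B(\mathcal H_i)$ with grading operators $\Gamma_i$, $\mathcal M_1\hat\otimes\mathcal M_2$ is the von Neumann algebra on $\mathcal H_1\otimes\mathcal H_2$ generated by the elements $a\hat\otimes b:=a\Gamma_1^{\partial b}\otimes b$ ($a\in\mathcal M_1$, $b\in\mathcal M_2$ homogeneous); it is spatially graded by $\Gamma_1\otimes\Gamma_2$. $\alpha_1\hat\otimes\alpha_2$ is the family of linear/anti-linear $*$-automorphisms determined by $(\alpha_1\hat\otimes\alpha_2)_g(a\hat\otimes b)=\alpha_{1,g}(a)\hat\otimes\alpha_{2,g}(b)$ for homogeneous $a,b$ (these exist under the present hypotheses). *)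

theory Defs
  imports "HOL-Analysis.Analysis" "HOL-Library.Z2" "HOL-Algebra.Group"
begin

section \<open>Complex Hilbert spaces\<close>

text \<open>
  Nonzero complex Hilbert spaces. The metric and the topology are those of the underlying real
  Hilbert space, whose inner product is the real part of the complex one. The complex inner
  product is linear in its second argument. Excluding the zero space is what makes
  \<open>\<complex>1\<close> one-dimensional.
\<close>

class chilbert_space = real_inner + complete_space +
  fixes scaleC :: "complex \<Rightarrow> 'a \<Rightarrow> 'a" (infixr "*\<^sub>C" 75)
    and cinner :: "'a \<Rightarrow> 'a \<Rightarrow> complex"
  assumes scaleC_add_right: "c *\<^sub>C (x + y) = c *\<^sub>C x + c *\<^sub>C y"
    and scaleC_add_left: "(c + d) *\<^sub>C x = c *\<^sub>C x + d *\<^sub>C x"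
    and scaleC_scaleC: "c *\<^sub>C d *\<^sub>C x = (c * d) *\<^sub>C x"
    and scaleC_of_real: "complex_of_real r *\<^sub>C x = r *\<^sub>R x"
    and cinner_commute: "cinner x y = cnj (cinner y x)"
    and cinner_add_right: "cinner x (y + z) = cinner x y + cinner x z"
    and cinner_scaleC_right: "cinner x (c *\<^sub>C y) = c * cinner x y"
    and Re_cinner: "Re (cinner x y) = x \<bullet> y"
    and nonzero_space: "\<exists>x. x \<noteq> 0"

instantiation complex :: chilbert_space
begin

definition scaleC_complex :: "complex \<Rightarrow> complex \<Rightarrow> complex"
  where "scaleC_complex c x = c * x"

definition cinner_complex :: "complex \<Rightarrow> complex \<Rightarrow> complex"
  where "cinner_complex x y = cnj x * y"

instance
proof
  show "\<exists>x::complex. x \<noteq> 0" by (rule exI[of _ 1]) simp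
qed (simp_all add: scaleC_complex_def cinner_complex_def algebra_simps scaleR_conv_of_real
      inner_complex_def)

end

instantiation prod :: (chilbert_space, chilbert_space) chilbert_space
begin

definition scaleC_prod :: "complex \<Rightarrow> 'a \<times> 'b \<Rightarrow> 'a \<times> 'b"
  where "scaleC_prod c x = (c *\<^sub>C fst x, c *\<^sub>C snd x)"

definition cinner_prod :: "'a \<times> 'b \<Rightarrow> 'a \<times> 'b \<Rightarrow> complex"
  where "cinner_prod x y = cinner (fst x) (fst y) + cinner (snd x) (snd y)"

instance
proof
  obtain a :: 'a where "a \<noteq> 0" using nonzero_space by blast
  then show "\<exists>x::'a \<times> 'b. x \<noteq> 0" by (intro exI[of _ "(a, 0)"]) (simp add: zero_prod_def)
  show "cinner x y = cnj (cinner y x)" for x y :: "'a \<times> 'b"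
    using cinner_commute[of "fst x" "fst y"] cinner_commute[of "snd x" "snd y"]
    by (simp add: cinner_prod_def)
qed (simp_all add: scaleC_prod_def cinner_prod_def prod_eq_iff scaleC_add_right scaleC_add_left
      scaleC_scaleC scaleC_of_real cinner_add_right cinner_scaleC_right Re_cinner inner_prod_def
      algebra_simps)

end

lemma norm_scaleC: "norm (c *\<^sub>C x) = cmod c * norm x"
proof -
  have "cinner (c *\<^sub>C x) (c *\<^sub>C x) = c * cnj c * cinner x x"
    using cinner_commute[of "c *\<^sub>C x" x] cinner_commute[of x x]
    by (simp add: cinner_scaleC_right)
  also have "\<dots> = of_real ((cmod c)\<^sup>2) * cinner x x"
    by (simp only: complex_norm_square)
  finally have "(c *\<^sub>C x) \<bullet> (c *\<^sub>C x) = (cmod c)\<^sup>2 * (x \<bullet> x)"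
    by (simp flip: Re_cinner add: Re_complex_of_real)
  then have "(norm (c *\<^sub>C x))\<^sup>2 = (cmod c * norm x)\<^sup>2"
    by (simp add: power2_norm_eq_inner power_mult_distrib)
  then show ?thesis
    by (simp add: power2_eq_iff_nonneg)
qed

lemma bounded_linear_scaleC: "bounded_linear ((*\<^sub>C) c :: 'a::chilbert_space \<Rightarrow> 'a)"
proof
  show "c *\<^sub>C (r *\<^sub>R x) = r *\<^sub>R (c *\<^sub>C x)" for r and x :: 'a
    using scaleC_scaleC[of c "of_real r" x] scaleC_scaleC[of "of_real r" c x]
    by (simp add: scaleC_of_real mult.commute)
  show "\<exists>K. \<forall>x::'a. norm (c *\<^sub>C x) \<le> norm x * K"
    by (rule exI[of _ "cmod c"]) (simp add: norm_scaleC mult.commute)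
qed (rule scaleC_add_right)

definition closed_csubspace :: "'a::chilbert_space set \<Rightarrow> bool"
  where "closed_csubspace K \<longleftrightarrow>
    closed K \<and> K \<noteq> {} \<and> (\<forall>x\<in>K. \<forall>y\<in>K. x + y \<in> K) \<and> (\<forall>c. \<forall>x\<in>K. c *\<^sub>C x \<in> K)"

section \<open>Operators\<close>

text \<open>
  \<^typ>\<open>'a \<Rightarrow>\<^sub>L 'a\<close> consists of the bounded real-linear maps. It therefore contains both
  the complex-linear and the anti-linear bounded operators.
\<close>

type_synonym 'a op = "'a \<Rightarrow>\<^sub>L 'a"

definition conj_pow :: "bit \<Rightarrow> complex \<Rightarrow> complex"
  where "conj_pow s z = (if s = 0 then z else cnj z)"

definition sign :: "bit \<Rightarrow> complex"
  where "sign s = (if s = 0 then 1 else - 1)"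

definition Bounded_ops :: "'a::chilbert_space op set"
  where "Bounded_ops = {x :: 'a op. \<forall>c v. x (c *\<^sub>C v) = c *\<^sub>C x v}"

definition scale_op :: "complex \<Rightarrow> 'a::chilbert_space op \<Rightarrow> 'a op"
  where "scale_op c x = Blinfun (\<lambda>v. c *\<^sub>C x v)"

text \<open>
  The adjoint is taken with respect to the real inner product. For complex-linear operators this is
  the Hilbert space adjoint, and for anti-linear ones it is the usual anti-linear adjoint
  (lemmas \<open>adj_eqI_linear\<close> and \<open>adj_eqI_antilinear\<close> below).
  In particular it is the inverse for unitaries and for anti-unitaries.
\<close>

definition adj :: "'a::chilbert_space op \<Rightarrow> 'a op"
  where "adj x = Blinfun (adjoint (blinfun_apply x))"

lemma adj_eqI_linear:
  assumes "\<And>u v. cinner (blinfun_apply x u) v = cinner u (blinfun_apply y v)"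
  shows "adj x = y"
proof -
  have "\<forall>u v. blinfun_apply x u \<bullet> v = u \<bullet> blinfun_apply y v"
    using assms by (simp flip: Re_cinner)
  then have "adjoint (blinfun_apply x) = blinfun_apply y"
    by (rule adjoint_unique)
  then show ?thesis
    by (simp add: adj_def blinfun_apply_inverse)
qed

lemma adj_eqI_antilinear:
  assumes "\<And>u v. cinner (blinfun_apply x u) v = cnj (cinner u (blinfun_apply y v))"
  shows "adj x = y"
proof -
  have "\<forall>u v. blinfun_apply x u \<bullet> v = u \<bullet> blinfun_apply y v"
    using assms by (simp flip: Re_cinner)
  then have "adjoint (blinfun_apply x) = blinfun_apply y"
    by (rule adjoint_unique)
  then show ?thesis
    by (simp add: adj_def blinfun_apply_inverse)
qed

definition Ad :: "'a::chilbert_space op \<Rightarrow> 'a op \<Rightarrow> 'a op"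
  where "Ad V x = V o\<^sub>L x o\<^sub>L adj V"

definition projection_op :: "'a::chilbert_space op \<Rightarrow> bool"
  where "projection_op e \<longleftrightarrow> e \<in> Bounded_ops \<and> adj e = e \<and> e o\<^sub>L e = e"

definition sa_unitary :: "'a::chilbert_space op \<Rightarrow> bool"
  where "sa_unitary u \<longleftrightarrow> u \<in> Bounded_ops \<and> adj u = u \<and> u o\<^sub>L u = id_blinfun"

text \<open>
  The Hilbert spaces \<open>\<K>\<close> in the definition of the index are closed subspaces
  \<open>K\<close> of a Hilbert space type. Operators on \<open>K\<close> (linear or
  anti-linear) are extended by \<open>0\<close> to the orthogonal complement of
  \<open>K\<close>.
\<close>

definition lives_on :: "'a::chilbert_space set \<Rightarrow> 'a op \<Rightarrow> bool"
  where "lives_on K x \<longleftrightarrow>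
    range (blinfun_apply x) \<subseteq> K \<and> (\<forall>v. (\<forall>w\<in>K. cinner w v = 0) \<longrightarrow> x v = 0)"

definition B :: "'a::chilbert_space set \<Rightarrow> 'a op set"
  where "B K = {x \<in> Bounded_ops. lives_on K x}"

definition one_on :: "'a::chilbert_space set \<Rightarrow> 'a op"
  where "one_on K = (THE x :: 'a op. x \<in> B K \<and> (\<forall>v\<in>K. x v = v))"

definition unitary_antiunitary :: "bit \<Rightarrow> 'a::chilbert_space set \<Rightarrow> 'a op \<Rightarrow> bool"
  where "unitary_antiunitary s K V \<longleftrightarrow> lives_on K V \<and> V ` K = K \<and>
    (\<forall>c v. V (c *\<^sub>C v) = conj_pow s c *\<^sub>C V v) \<and>
    (\<forall>u\<in>K. \<forall>v\<in>K. cinner (V u) (V v) = conj_pow s (cinner u v))"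

section \<open>Hilbert space tensor products\<close>

text \<open>
  \<open>hilbert_tensor t\<close> says that \<^typ>\<open>'c\<close> with \<open>t u v\<close> in the role of
  \<open>u \<otimes> v\<close> is the Hilbert space tensor product of \<^typ>\<open>'a\<close> and
  \<^typ>\<open>'b\<close>, i.e. the completion of the algebraic tensor product. It determines
  \<^typ>\<open>'c\<close> and \<open>t\<close> up to a unique unitary. The real span of the range is already
  the complex span, because \<open>c *\<^sub>C t u v = t (c *\<^sub>C u) v\<close>.
\<close>

definition hilbert_tensor ::
  "('a::chilbert_space \<Rightarrow> 'b::chilbert_space \<Rightarrow> 'c::chilbert_space) \<Rightarrow> bool"
  where "hilbert_tensor t \<longleftrightarrow>
    (\<forall>u u' v. t (u + u') v = t u v + t u' v) \<and>
    (\<forall>u v v'. t u (v + v') = t u v + t u v') \<and>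
    (\<forall>c u v. t (c *\<^sub>C u) v = c *\<^sub>C t u v \<and> t u (c *\<^sub>C v) = c *\<^sub>C t u v) \<and>
    (\<forall>u u' v v'. cinner (t u v) (t u' v') = cinner u u' * cinner v v') \<and>
    closure (span {t u v | u v. True}) = UNIV"

definition op_tensor ::
  "('a::chilbert_space \<Rightarrow> 'b::chilbert_space \<Rightarrow> 'c::chilbert_space) \<Rightarrow> 'a op \<Rightarrow> 'b op \<Rightarrow> 'c op"
  where "op_tensor t a b = (THE z :: 'c op. \<forall>u v. z (t u v) = t (a u) (b v))"

section \<open>Graded von Neumann algebras\<close>

definition commutant :: "'a::chilbert_space op set \<Rightarrow> 'a op set"
  where "commutant S = {x \<in> Bounded_ops. \<forall>y\<in>S. x o\<^sub>L y = y o\<^sub>L x}"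

definition von_neumann_algebra :: "'a::chilbert_space op set \<Rightarrow> bool"
  where "von_neumann_algebra M \<longleftrightarrow>
    M \<subseteq> Bounded_ops \<and> adj ` M \<subseteq> M \<and> commutant (commutant M) = M"

definition center :: "'a::chilbert_space op set \<Rightarrow> 'a op set"
  where "center M = M \<inter> commutant M"

definition type_I :: "'a::chilbert_space op set \<Rightarrow> bool"
  where "type_I M \<longleftrightarrow> (\<forall>z\<in>center M. projection_op z \<and> z \<noteq> 0 \<longrightarrow>
    (\<exists>e\<in>M. projection_op e \<and> e \<noteq> 0 \<and> e o\<^sub>L z = e \<and>
      (\<forall>x\<in>M. \<forall>y\<in>M. (e o\<^sub>L x o\<^sub>L e) o\<^sub>L (e o\<^sub>L y o\<^sub>L e) = (e o\<^sub>L y o\<^sub>L e) o\<^sub>L (e o\<^sub>L x o\<^sub>L e))))"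

text \<open>Linear (\<open>s = 0\<close>) and anti-linear (\<open>s = 1\<close>) *-isomorphisms.\<close>

definition star_iso ::
  "bit \<Rightarrow> 'a::chilbert_space op set \<Rightarrow> 'b::chilbert_space op set \<Rightarrow> ('a op \<Rightarrow> 'b op) \<Rightarrow> bool"
  where "star_iso s M N \<phi> \<longleftrightarrow> bij_betw \<phi> M N \<and>
    (\<forall>x\<in>M. \<forall>y\<in>M. \<phi> (x + y) = \<phi> x + \<phi> y \<and> \<phi> (x o\<^sub>L y) = \<phi> x o\<^sub>L \<phi> y) \<and>
    (\<forall>x\<in>M. \<phi> (adj x) = adj (\<phi> x)) \<and>
    (\<forall>c. \<forall>x\<in>M. \<phi> (scale_op c x) = scale_op (conj_pow s c) (\<phi> x))"

definition graded_von_neumann_algebra ::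
  "'a::chilbert_space op set \<Rightarrow> ('a op \<Rightarrow> 'a op) \<Rightarrow> bool"
  where "graded_von_neumann_algebra M \<theta> \<longleftrightarrow>
    von_neumann_algebra M \<and> star_iso 0 M M \<theta> \<and> (\<forall>x\<in>M. \<theta> (\<theta> x) = x)"

definition homogeneous_part ::
  "'a::chilbert_space op set \<Rightarrow> ('a op \<Rightarrow> 'a op) \<Rightarrow> bit \<Rightarrow> 'a op set"
  where "homogeneous_part M \<theta> s = {x \<in> M. \<theta> x = scale_op (sign s) x}"

definition spatially_graded ::
  "'a::chilbert_space op set \<Rightarrow> ('a op \<Rightarrow> 'a op) \<Rightarrow> 'a op \<Rightarrow> bool"
  where "spatially_graded M \<theta> \<Gamma> \<longleftrightarrow>
    graded_von_neumann_algebra M \<theta> \<and> sa_unitary \<Gamma> \<and> (\<forall>x\<in>M. \<theta> x = Ad \<Gamma> x)"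

definition balanced :: "'a::chilbert_space op set \<Rightarrow> ('a op \<Rightarrow> 'a op) \<Rightarrow> bool"
  where "balanced M \<theta> \<longleftrightarrow> (\<exists>u\<in>homogeneous_part M \<theta> 1. sa_unitary u)"

definition central :: "'a::chilbert_space op set \<Rightarrow> ('a op \<Rightarrow> 'a op) \<Rightarrow> bool"
  where "central M \<theta> \<longleftrightarrow>
    center M \<inter> homogeneous_part M \<theta> 0 = range (\<lambda>c. scale_op c id_blinfun)"

section \<open>Homomorphisms to \<open>\<int>\<^sub>2\<close>, cocycles, dynamical systems\<close>

definition Z2_hom :: "('g, 'm) monoid_scheme \<Rightarrow> ('g \<Rightarrow> bit) \<Rightarrow> bool"
  where "Z2_hom G q \<longleftrightarrow> (\<forall>g\<in>carrier G. \<forall>h\<in>carrier G. q (g \<otimes>\<^bsub>G\<^esub> h) = q g + q h)"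

definition cocycle2 ::
  "('g, 'm) monoid_scheme \<Rightarrow> ('g \<Rightarrow> bit) \<Rightarrow> ('g \<Rightarrow> 'g \<Rightarrow> complex) \<Rightarrow> bool"
  where "cocycle2 G p \<upsilon> \<longleftrightarrow>
    (\<forall>g\<in>carrier G. \<forall>h\<in>carrier G. cmod (\<upsilon> g h) = 1) \<and>
    (\<forall>f\<in>carrier G. \<forall>g\<in>carrier G. \<forall>h\<in>carrier G.
      conj_pow (p f) (\<upsilon> g h) * \<upsilon> f (g \<otimes>\<^bsub>G\<^esub> h) = \<upsilon> f g * \<upsilon> (f \<otimes>\<^bsub>G\<^esub> g) h)"

text \<open>The class of \<open>\<upsilon>\<close> in \<open>H\<^sup>2(G, U(1)\<^sub>p)\<close>, as a set of cocycles.\<close>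

definition cocycle_class ::
  "('g, 'm) monoid_scheme \<Rightarrow> ('g \<Rightarrow> bit) \<Rightarrow> ('g \<Rightarrow> 'g \<Rightarrow> complex) \<Rightarrow> ('g \<Rightarrow> 'g \<Rightarrow> complex) set"
  where "cocycle_class G p \<upsilon> = {\<omega>. cocycle2 G p \<omega> \<and>
    (\<exists>b. (\<forall>g\<in>carrier G. cmod (b g) = 1) \<and>
      (\<forall>g\<in>carrier G. \<forall>h\<in>carrier G.
        \<omega> g h = \<upsilon> g h * (b g * conj_pow (p g) (b h) / b (g \<otimes>\<^bsub>G\<^esub> h))))}"

definition projective_rep ::
  "('g, 'm) monoid_scheme \<Rightarrow> ('g \<Rightarrow> bit) \<Rightarrow> 'a::chilbert_space set \<Rightarrow> ('g \<Rightarrow> 'a op) \<Rightarrow>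
    ('g \<Rightarrow> 'g \<Rightarrow> complex) \<Rightarrow> bool"
  where "projective_rep G p K V \<upsilon> \<longleftrightarrow>
    (\<forall>g\<in>carrier G. unitary_antiunitary (p g) K (V g)) \<and>
    (\<forall>g\<in>carrier G. \<forall>h\<in>carrier G.
      cmod (\<upsilon> g h) = 1 \<and> V g o\<^sub>L V h = scale_op (\<upsilon> g h) (V (g \<otimes>\<^bsub>G\<^esub> h))) \<and>
    (\<forall>g\<in>carrier G. \<upsilon> \<one>\<^bsub>G\<^esub> g = 1 \<and> \<upsilon> g \<one>\<^bsub>G\<^esub> = 1)"

definition graded_dynamical_system ::
  "('g, 'm) monoid_scheme \<Rightarrow> ('g \<Rightarrow> bit) \<Rightarrow> 'a::chilbert_space op set \<Rightarrow> ('a op \<Rightarrow> 'a op) \<Rightarrow>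
    ('g \<Rightarrow> 'a op \<Rightarrow> 'a op) \<Rightarrow> bool"
  where "graded_dynamical_system G p M \<theta> \<alpha> \<longleftrightarrow>
    graded_von_neumann_algebra M \<theta> \<and>
    (\<forall>g\<in>carrier G. star_iso (p g) M M (\<alpha> g)) \<and>
    (\<forall>g\<in>carrier G. \<forall>h\<in>carrier G. \<forall>x\<in>M. \<alpha> (g \<otimes>\<^bsub>G\<^esub> h) x = \<alpha> g (\<alpha> h x)) \<and>
    (\<forall>g\<in>carrier G. \<forall>x\<in>M. \<alpha> g (\<theta> x) = \<theta> (\<alpha> g x))"

definition equivalent_systems ::
  "('g, 'm) monoid_scheme \<Rightarrow>
    'a::chilbert_space op set \<Rightarrow> ('a op \<Rightarrow> 'a op) \<Rightarrow> ('g \<Rightarrow> 'a op \<Rightarrow> 'a op) \<Rightarrow>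
    'b::chilbert_space op set \<Rightarrow> ('b op \<Rightarrow> 'b op) \<Rightarrow> ('g \<Rightarrow> 'b op \<Rightarrow> 'b op) \<Rightarrow> bool"
  where "equivalent_systems G M \<theta> \<alpha> N \<eta> \<beta> \<longleftrightarrow>
    (\<exists>\<phi>. star_iso 0 M N \<phi> \<and> (\<forall>x\<in>M. \<phi> (\<theta> x) = \<eta> (\<phi> x)) \<and>
      (\<forall>g\<in>carrier G. \<forall>x\<in>M. \<phi> (\<alpha> g x) = \<beta> g (\<phi> x)))"

section \<open>The index\<close>

definition sigma_x :: "complex^2^2"
  where "sigma_x = vector [vector [0, 1], vector [1, 0]]"

definition sigma_y :: "complex^2^2"
  where "sigma_y = vector [vector [0, - \<i>], vector [\<i>, 0]]"

definition sigma_z :: "complex^2^2"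
  where "sigma_z = vector [vector [1, 0], vector [0, - 1]]"

text \<open>
  \<open>\<K> \<otimes> \<complex>\<^sup>2\<close> is realised as \<open>\<K> \<times> \<K>\<close>. For
  complex-linear \<open>a\<close>, \<open>amp a m\<close> is \<open>a \<otimes> m\<close>. The matrix acts
  first, so for anti-linear \<open>a\<close> it is \<open>a \<otimes> C m\<close> with
  \<open>C\<close> the complex conjugation on \<open>\<complex>\<^sup>2\<close>.
\<close>

definition amp :: "'a::chilbert_space op \<Rightarrow> complex^2^2 \<Rightarrow> ('a \<times> 'a) op"
  where "amp a m = Blinfun (\<lambda>(u, v).
    (a (m $ 1 $ 1 *\<^sub>C u + m $ 1 $ 2 *\<^sub>C v), a (m $ 2 $ 1 *\<^sub>C u + m $ 2 $ 2 *\<^sub>C v)))"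

lemma hilbert_tensor_C2:
  "hilbert_tensor (\<lambda>(x::'a::chilbert_space) (w::complex \<times> complex). (fst w *\<^sub>C x, snd w *\<^sub>C x))"
  (is "hilbert_tensor ?t")
proof -
  have adjl: "cinner (c *\<^sub>C x) y = cnj c * cinner x y" for c and x y :: 'a
    using cinner_commute[of "c *\<^sub>C x" y] cinner_commute[of x y] by (simp add: cinner_scaleC_right)
  have one: "1 *\<^sub>C x = x" "0 *\<^sub>C x = 0" for x :: 'a
    using scaleC_of_real[of 1 x] scaleC_of_real[of 0 x] by simp_all
  have "(x, y) \<in> span {?t u v | u v. True}" for x y
  proof -
    have "?t x (1, 0) + ?t y (0, 1) \<in> span {?t u v | u v. True}"
      by (intro span_add span_base) blast+
    then show ?thesis by (simp add: one)
  qed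
  then have "span {?t u v | u v. True} = UNIV" by auto
  then show ?thesis
    by (simp add: hilbert_tensor_def scaleC_add_right scaleC_add_left scaleC_scaleC scaleC_prod_def
        cinner_prod_def scaleC_complex_def cinner_complex_def adjl cinner_scaleC_right
        algebra_simps)
qed

lemma amp_apply:
  "amp a m (u, v) =
    (a (m $ 1 $ 1 *\<^sub>C u + m $ 1 $ 2 *\<^sub>C v), a (m $ 2 $ 1 *\<^sub>C u + m $ 2 $ 2 *\<^sub>C v))"
proof -
  have "bounded_linear (\<lambda>w. (a (m $ 1 $ 1 *\<^sub>C fst w + m $ 1 $ 2 *\<^sub>C snd w),
      a (m $ 2 $ 1 *\<^sub>C fst w + m $ 2 $ 2 *\<^sub>C snd w)))"
    by (intro bounded_linear_Pair bounded_linear_compose[OF blinfun.bounded_linear_right]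
        bounded_linear_add bounded_linear_compose[OF bounded_linear_scaleC]
        bounded_linear_fst bounded_linear_snd)
  then show ?thesis
    by (simp add: amp_def case_prod_unfold bounded_linear_Blinfun_apply)
qed

text \<open>With respect to \<open>x \<otimes> (c, d) = (c *\<^sub>C x, d *\<^sub>C x)\<close>.\<close>

lemma amp_tensor:
  assumes "a \<in> Bounded_ops"
  shows "amp a m (c *\<^sub>C x, d *\<^sub>C x) =
    ((m $ 1 $ 1 * c + m $ 1 $ 2 * d) *\<^sub>C a x, (m $ 2 $ 1 * c + m $ 2 $ 2 * d) *\<^sub>C a x)"
  using assms
  by (simp add: amp_apply Bounded_ops_def scaleC_scaleC blinfun.add_right flip: scaleC_add_left)

text \<open>The matrix factors of \<open>\<R>\<^sub>0\<close> and \<open>\<R>\<^sub>1\<close>; for the latter,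
  \<open>\<CC> = span {1, \<sigma>\<^sub>x}\<close>.\<close>

definition matrix_factor :: "bit \<Rightarrow> (complex^2^2) set"
  where "matrix_factor \<kappa> = (if \<kappa> = 0 then UNIV else {mat c + mat d ** sigma_x | c d. True})"

text \<open>The matrix factor is finite-dimensional, so the algebraic tensor product needs no closure.\<close>

definition model_algebra :: "bit \<Rightarrow> 'a::chilbert_space set \<Rightarrow> ('a \<times> 'a) op set"
  where "model_algebra \<kappa> K = span {amp a m | a m. a \<in> B K \<and> m \<in> matrix_factor \<kappa>}"

definition model_grading :: "'a::chilbert_space set \<Rightarrow> ('a \<times> 'a) op"
  where "model_grading K = amp (one_on K) sigma_z"

text \<open>\<open>K\<close>, \<open>V\<close> and \<open>q\<close> define a member of
  \<open>\<S>\<^sub>\<kappa>\<close>, where \<open>V\<close> has cocycle \<open>\<omega>\<close>.\<close>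

definition model_data ::
  "('g, 'm) monoid_scheme \<Rightarrow> ('g \<Rightarrow> bit) \<Rightarrow> bit \<Rightarrow> 'a::chilbert_space set \<Rightarrow>
    ('g \<Rightarrow> ('a \<times> 'a) op) \<Rightarrow> ('g \<Rightarrow> 'g \<Rightarrow> complex) \<Rightarrow> ('g \<Rightarrow> bit) \<Rightarrow> bool"
  where "model_data G p \<kappa> K V \<omega> q \<longleftrightarrow>
    closed_csubspace K \<and> projective_rep G p (K \<times> K) V \<omega> \<and> Z2_hom G q \<and>
    (\<forall>g\<in>carrier G. Ad (V g) (model_grading K) = scale_op (sign (q g)) (model_grading K)) \<and>
    (\<kappa> = 1 \<longrightarrow> (\<forall>g\<in>carrier G.
      Ad (V g) (amp (one_on K) sigma_x) = scale_op (sign (q g)) (amp (one_on K) sigma_x)))"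

text \<open>
  \<open>index_rel G p M \<theta> \<alpha> (\<kappa>, q, c)\<close>: the system is equivalent to a member of
  \<open>\<S>\<^sub>\<kappa>\<close> with homomorphism \<open>q\<close> and cohomology class
  \<open>c\<close>. It suffices to let \<open>K\<close> range over closed subspaces of the Hilbert
  space on which \<open>M\<close> acts: if \<open>M\<close> is isomorphic to
  \<open>\<R>\<^sub>\<kappa>\<close> over some Hilbert space \<open>\<K>\<close>, then that
  representation of \<open>\<R>\<^sub>\<kappa>\<close> contains a copy of \<open>\<K>\<close>. Elements of
  \<open>Hom(G, \<int>\<^sub>2)\<close> are functions on the carrier, hence extensional.
\<close>

definition index_rel ::
  "('g, 'm) monoid_scheme \<Rightarrow> ('g \<Rightarrow> bit) \<Rightarrow> 'a::chilbert_space op set \<Rightarrow> ('a op \<Rightarrow> 'a op) \<Rightarrow>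
    ('g \<Rightarrow> 'a op \<Rightarrow> 'a op) \<Rightarrow> bit \<times> ('g \<Rightarrow> bit) \<times> ('g \<Rightarrow> 'g \<Rightarrow> complex) set \<Rightarrow> bool"
  where "index_rel G p M \<theta> \<alpha> = (\<lambda>(\<kappa>, q, c). q \<in> extensional (carrier G) \<and>
    (\<exists>(K :: 'a set) V \<omega> \<upsilon>.
      model_data G p \<kappa> K V \<omega> q \<and>
      equivalent_systems G M \<theta> \<alpha> (model_algebra \<kappa> K) (Ad (model_grading K)) (\<lambda>g. Ad (V g)) \<and>
      (if \<kappa> = 0 then \<upsilon> = \<omega>
       else (\<exists>V0. projective_rep G p K V0 \<upsilon> \<and>
         (\<forall>g\<in>carrier G. V g = amp (V0 g) (if q g = 0 then mat 1 else sigma_y)))) \<and>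
      c = cocycle_class G p \<upsilon>))"

definition Ind ::
  "('g, 'm) monoid_scheme \<Rightarrow> ('g \<Rightarrow> bit) \<Rightarrow> 'a::chilbert_space op set \<Rightarrow> ('a op \<Rightarrow> 'a op) \<Rightarrow>
    ('g \<Rightarrow> 'a op \<Rightarrow> 'a op) \<Rightarrow> bit \<times> ('g \<Rightarrow> bit) \<times> ('g \<Rightarrow> 'g \<Rightarrow> complex) set"
  where "Ind G p M \<theta> \<alpha> = (THE i. index_rel G p M \<theta> \<alpha> i)"

section \<open>Graded tensor products\<close>

text \<open>\<open>a \<hat>\<otimes> b\<close> for \<open>b\<close> of degree \<open>s\<close>. The degree is
  an argument because \<open>b = 0\<close> has both degrees (the result is \<open>0\<close> for
  either).\<close>

definition graded_op_tensor ::
  "('a::chilbert_space \<Rightarrow> 'b::chilbert_space \<Rightarrow> 'c::chilbert_space) \<Rightarrow> 'a op \<Rightarrow> 'a op \<Rightarrow> bit \<Rightarrow>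
    'b op \<Rightarrow> 'c op"
  where "graded_op_tensor t \<Gamma>1 a s b = op_tensor t (if s = 0 then a else a o\<^sub>L \<Gamma>1) b"

definition graded_tensor ::
  "('a::chilbert_space \<Rightarrow> 'b::chilbert_space \<Rightarrow> 'c::chilbert_space) \<Rightarrow>
    'a op set \<Rightarrow> 'a op \<Rightarrow> 'b op set \<Rightarrow> 'b op \<Rightarrow> 'c op set"
  where "graded_tensor t M1 \<Gamma>1 M2 \<Gamma>2 = von_neumann_algebra hull
    {graded_op_tensor t \<Gamma>1 a s b | a r b s.
      a \<in> homogeneous_part M1 (Ad \<Gamma>1) r \<and> b \<in> homogeneous_part M2 (Ad \<Gamma>2) s}"

definition graded_tensor_action ::
  "('g \<Rightarrow> bit) \<Rightarrow> ('a::chilbert_space \<Rightarrow> 'b::chilbert_space \<Rightarrow> 'c::chilbert_space) \<Rightarrow>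
    'a op set \<Rightarrow> 'a op \<Rightarrow> ('g \<Rightarrow> 'a op \<Rightarrow> 'a op) \<Rightarrow>
    'b op set \<Rightarrow> 'b op \<Rightarrow> ('g \<Rightarrow> 'b op \<Rightarrow> 'b op) \<Rightarrow> 'g \<Rightarrow> 'c op \<Rightarrow> 'c op"
  where "graded_tensor_action p t M1 \<Gamma>1 \<alpha>1 M2 \<Gamma>2 \<alpha>2 g =
    (let M = graded_tensor t M1 \<Gamma>1 M2 \<Gamma>2 in
      (THE \<beta>. \<beta> \<in> extensional M \<and> star_iso (p g) M M \<beta> \<and>
        (\<forall>r s. \<forall>a\<in>homogeneous_part M1 (Ad \<Gamma>1) r. \<forall>b\<in>homogeneous_part M2 (Ad \<Gamma>2) s.
          \<beta> (graded_op_tensor t \<Gamma>1 a s b) = graded_op_tensor t \<Gamma>1 (\<alpha>1 g a) s (\<alpha>2 g b))))"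

definition epsilon_cocycle ::
  "('g \<Rightarrow> bit) \<Rightarrow> bit \<Rightarrow> ('g \<Rightarrow> bit) \<Rightarrow> bit \<Rightarrow> ('g \<Rightarrow> bit) \<Rightarrow> 'g \<Rightarrow> 'g \<Rightarrow> complex"
  where "epsilon_cocycle p \<kappa>1 q1 \<kappa>2 q2 g h =
    sign (q1 g * q2 h + (\<kappa>1 - \<kappa>2) * (\<kappa>1 * q2 g + \<kappa>2 * q1 g) * p h)"

end

theory Submission
  imports Defs
begin

text \<open>
  The index can be read off inside \<open>M\<close>. Let \<open>N\<close> be \<open>M\<close> or its even part,
  according to \<open>\<kappa>\<close>, and \<open>e\<close> a minimal even projection of the type I factor \<open>N\<close>.
  A self-adjoint unitary \<open>w\<close> of degree \<open>\<kappa>\<close> implements the grading (\<open>\<kappa> = 0\<close>) or is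
  central (\<open>\<kappa> = 1\<close>), and \<open>\<alpha>\<^sub>g w = (-1)\<^bsup>q(g)\<^esup> w\<close>. Partial isometries
  \<open>v\<^sub>g\<close> in \<open>N\<close> from \<open>e\<close> to \<open>\<alpha>\<^sub>g e\<close> satisfy
  \<open>\<alpha>\<^sub>g(v\<^sub>h) v\<^sub>g = \<upsilon>(g, h) v\<^sub>g\<^sub>h\<close>, and \<open>\<upsilon>\<close> is the cocycle of the index.
  For the graded tensor product \<open>w\<close> is \<open>w\<^sub>1 \<otimes> w\<^sub>2\<close> up to a factor \<open>\<i>\<close> when
  \<open>\<kappa>\<^sub>1 = \<kappa>\<^sub>2 = 1\<close> (this factor and its conjugation by anti-linear
  automorphisms produce the term \<open>\<kappa>\<^sub>1\<kappa>\<^sub>2p\<close>), and \<open>e\<close> is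
  \<open>e\<^sub>1 \<otimes> e\<^sub>2\<close>, cut down by \<open>(1 + w)/2\<close> in that case. The partial isometries are the graded tensor
  products of \<open>v\<^sub>1\<close> and \<open>v\<^sub>2\<close>, multiplied by powers of \<open>w\<^sub>1\<close> and
  \<open>w\<^sub>2\<close> to correct their parity. The resulting sign agrees with \<open>\<epsilon>\<close> up to the coboundaries of
  \<open>(-1)\<^bsup>qq'\<^esup>\<close> and \<open>\<i>\<^bsup>q\<^esup>\<close>.
\<close>

text \<open>\<open>Ind\<close> is a definite description over all models, so computing it requires
  uniqueness as well as existence; data inside \<open>M\<close> provide both, since every model
  yields them and they yield a model. No operator topology is used: vectors \<open>a (e v)\<close>
  with \<open>a\<close> in the algebra span a dense subspace, an operator prescribed on them exists
  as soon as inner products match, and algebra elements are recognised by commuting with the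
  commutant. Two obstacles shape the tensor product part. Its action, possibly anti-linear, must be
  constructed: each automorphism is implemented on the given Hilbert space by a unitary or
  anti-unitary that commutes with the grading operator up to sign, and the implementers are
  tensored. Anti-linearity comes from a conjugation of the range of \<open>e\<close> adapted to the
  grading. Secondly, star isomorphisms carry no continuity assumption, so equality on generators is
  transferred to the bicommutant by compressing with \<open>e\<close>, where only multiples of
  \<open>e\<close> and \<open>w e\<close> remain. Adjoints refer to the real inner product, so that
  linear and anti-linear operators share proofs.\<close>

section \<open>Calculus in complex Hilbert spaces\<close>

lemma scaleC_one [simp]: "1 *\<^sub>C x = x"
  using scaleC_of_real[of 1 x] by simp

lemma scaleC_zero_left [simp]: "0 *\<^sub>C x = 0"
  using scaleC_of_real[of 0 x] by simp

lemma scaleC_zero_right [simp]: "c *\<^sub>C (0::'a::chilbert_space) = 0"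
  using scaleC_add_right[of c "0::'a" 0] by simp

lemma scaleC_minus_right [simp]: "c *\<^sub>C (- x) = - (c *\<^sub>C x)" for x :: "'a::chilbert_space"
  using scaleC_add_right[of c x "- x"] by (simp add: eq_neg_iff_add_eq_0 add.commute)

lemma scaleC_minus_left [simp]: "(- c) *\<^sub>C x = - (c *\<^sub>C x)" for x :: "'a::chilbert_space"
  using scaleC_add_left[of c "- c" x] by (simp add: eq_neg_iff_add_eq_0 add.commute)

lemma scaleC_diff_right: "c *\<^sub>C (x - y) = c *\<^sub>C x - c *\<^sub>C y" for x :: "'a::chilbert_space"
  using scaleC_add_right[of c x "- y"] by simp

lemma scaleC_diff_left: "(c - d) *\<^sub>C x = c *\<^sub>C x - d *\<^sub>C x" for x :: "'a::chilbert_space"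
  using scaleC_add_left[of c "- d" x] by simp

lemma scaleC_eq_0_iff [simp]: "c *\<^sub>C x = 0 \<longleftrightarrow> c = 0 \<or> x = 0" for x :: "'a::chilbert_space"
  by (metis mult_eq_0_iff norm_eq_zero norm_scaleC)

lemma scaleC_cancel_right: "c *\<^sub>C x = d *\<^sub>C x \<longleftrightarrow> c = d \<or> x = 0" for x :: "'a::chilbert_space"
  using scaleC_eq_0_iff[of "c - d" x] by (simp add: scaleC_diff_left)

lemma scaleR_scaleC_commute: "c *\<^sub>C (r *\<^sub>R x) = r *\<^sub>R (c *\<^sub>C x)" for x :: "'a::chilbert_space"
  by (rule linear_simps(5)[OF bounded_linear_scaleC])

lemma cinner_add_left: "cinner (x + y) z = cinner x z + cinner y z"
  by (metis cinner_commute cinner_add_right complex_cnj_add)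

lemma cinner_scaleC_left: "cinner (c *\<^sub>C x) y = cnj c * cinner x y"
  by (metis cinner_commute cinner_scaleC_right complex_cnj_mult)

lemma cinner_zero_left [simp]: "cinner 0 x = 0"
  using cinner_scaleC_left[of 0 0 x] by simp

lemma cinner_zero_right [simp]: "cinner x 0 = 0"
  using cinner_scaleC_right[of x 0 0] by simp

lemma cinner_minus_left [simp]: "cinner (- x) y = - cinner x y"
  using cinner_scaleC_left[of "-1" x y] by simp

lemma cinner_minus_right [simp]: "cinner x (- y) = - cinner x y"
  using cinner_scaleC_right[of x "-1" y] by simp

lemma cinner_diff_left: "cinner (x - y) z = cinner x z - cinner y z"
  using cinner_add_left[of x "- y" z] by simp

lemma cinner_diff_right: "cinner x (y - z) = cinner x y - cinner x z"
  using cinner_add_right[of x y "- z"] by simp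

lemma cinner_scaleR_right: "cinner x (r *\<^sub>R y) = r *\<^sub>R cinner x y"
  using cinner_scaleC_right[of x "of_real r" y] by (simp add: scaleC_of_real scaleR_conv_of_real)

lemma Im_cinner: "Im (cinner x y) = (\<i> *\<^sub>C x) \<bullet> y"
  by (simp flip: Re_cinner add: cinner_scaleC_left)

lemma cinner_self: "cinner x x = of_real ((norm x)\<^sup>2)"
  using cinner_commute[of x x]
  by (simp add: complex_eq_iff Re_cinner power2_norm_eq_inner)

lemma cinner_self_eq_0 [simp]: "cinner x x = 0 \<longleftrightarrow> x = 0"
  by (simp add: cinner_self)

lemma cinner_eq_0_commute: "cinner x y = 0 \<longleftrightarrow> cinner y x = 0"
  by (metis cinner_commute complex_cnj_zero_iff)

lemma cinner_eqI: "(\<And>z. cinner z x = cinner z y) \<Longrightarrow> x = y"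
  by (metis cinner_diff_right cinner_self_eq_0 eq_iff_diff_eq_0)

lemma bounded_linear_cinner_right: "bounded_linear (\<lambda>y. cinner x y)"
proof (rule bounded_linear_intro)
  show "norm (cinner x y) \<le> norm y * (2 * norm x)" for y
  proof -
    have "norm (cinner x y) \<le> \<bar>Re (cinner x y)\<bar> + \<bar>Im (cinner x y)\<bar>"
      by (rule cmod_le)
    also have "\<dots> \<le> norm x * norm y + norm (\<i> *\<^sub>C x) * norm y"
      unfolding Im_cinner Re_cinner by (intro add_mono Cauchy_Schwarz_ineq2)
    finally show ?thesis by (simp add: norm_scaleC algebra_simps)
  qed
qed (simp_all add: cinner_add_right cinner_scaleR_right)

text \<open>Extensions and projections are built with the real inner product. On sets stable under
  complex scalars this loses nothing: testing with \<open>y\<close> and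
  \<open>\<i> *\<^sub>C y\<close> recovers both parts of \<open>cinner\<close>.\<close>

lemma orthogonal_cinnerI:
  assumes "\<And>c. x \<bullet> (c *\<^sub>C y) = 0"
  shows "cinner x y = 0"
proof -
  have "Re (cinner x y) = 0" using assms[of 1] by (simp add: Re_cinner)
  moreover have "Re (cinner x (\<i> *\<^sub>C y)) = 0" using assms[of \<i>] by (simp only: Re_cinner)
  ultimately show ?thesis by (simp add: cinner_scaleC_right complex_eq_iff)
qed

section \<open>Projections and the existence of adjoints\<close>

lemma parallelogram: "(norm (x + y))\<^sup>2 + (norm (x - y))\<^sup>2 = 2 * (norm x)\<^sup>2 + 2 * (norm y)\<^sup>2"
  for x y :: "'a::real_inner"
  by (simp add: power2_norm_eq_inner algebra_simps inner_commute)

text \<open>A minimising sequence is Cauchy by the parallelogram law, because midpoints of points of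
  \<open>K\<close> stay in \<open>K\<close>.\<close>

lemma nearest_point_exists:
  fixes K :: "'a::{real_inner, complete_space} set"
  assumes K: "closed K" "subspace K"
  shows "\<exists>y\<in>K. \<forall>z\<in>K. norm (x - y) \<le> norm (x - z)"
proof -
  define d where "d = (INF z\<in>K. norm (x - z))"
  have ne: "K \<noteq> {}" using K subspace_0 by blast
  have bdd: "bdd_below ((\<lambda>z. norm (x - z)) ` K)" by (auto intro: bdd_belowI[of _ 0])
  have d_le: "d \<le> norm (x - z)" if "z \<in> K" for z
    unfolding d_def using bdd that by (rule cINF_lower)
  have d0: "0 \<le> d" unfolding d_def using ne by (intro cINF_greatest) auto
  have "\<exists>z\<in>K. norm (x - z) < d + 1 / real (Suc n)" for n
  proof -
    have "(INF z\<in>K. norm (x - z)) < d + 1 / real (Suc n)" by (simp add: d_def)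
    then show ?thesis using ne bdd by (subst (asm) cINF_less_iff) auto
  qed
  then obtain y where y: "\<And>n. y n \<in> K" "\<And>n. norm (x - y n) < d + 1 / real (Suc n)" by metis
  have gap: "(norm (y m - y n))\<^sup>2 \<le> 4 * (2 * d + 1) / real (Suc N)" if "m \<ge> N" "n \<ge> N" for m n N
  proof -
    define e where "e = 1 / real (Suc N)"
    have e: "0 < e" "e \<le> 1" by (simp_all add: e_def)
    have le: "norm (x - y k) \<le> d + e" if "k \<ge> N" for k
    proof -
      have "1 / real (Suc k) \<le> e" using that by (simp add: e_def frac_le)
      then show ?thesis using y(2)[of k] by linarith
    qed
    have mid: "(1/2) *\<^sub>R (y m + y n) \<in> K"
      using K(2) y(1) by (simp add: subspace_add subspace_scale)
    have "(x - y m) + (x - y n) = 2 *\<^sub>R (x - (1/2) *\<^sub>R (y m + y n))"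
      by (simp add: algebra_simps scaleR_2)
    then have "norm ((x - y m) + (x - y n)) = 2 * norm (x - (1/2) *\<^sub>R (y m + y n))" by simp
    then have "2 * d \<le> norm ((x - y m) + (x - y n))" using d_le[OF mid] by simp
    then have "(2 * d)\<^sup>2 \<le> (norm ((x - y m) + (x - y n)))\<^sup>2" using d0 by (intro power_mono) auto
    moreover have "(norm (x - y m))\<^sup>2 \<le> (d + e)\<^sup>2" "(norm (x - y n))\<^sup>2 \<le> (d + e)\<^sup>2"
      using le that by (auto intro!: power_mono)
    moreover have "norm (y m - y n) = norm ((x - y m) - (x - y n))" by (simp add: norm_minus_commute)
    ultimately have "(norm (y m - y n))\<^sup>2 \<le> 4 * (d + e)\<^sup>2 - 4 * d\<^sup>2"
      using parallelogram[of "x - y m" "x - y n"] by (simp add: power_mult_distrib)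
    also have "\<dots> = 4 * (2 * d * e + e * e)" by (simp add: power2_eq_square algebra_simps)
    \<comment> \<open>\<open>e \<le> 1\<close> absorbs the quadratic term, so the bound is linear in
      \<open>1 / real (Suc N)\<close>.\<close>
    also have "\<dots> \<le> 4 * (2 * d * e + 1 * e)" using e by (intro mult_left_mono add_left_mono mult_right_mono) auto
    also have "\<dots> = 4 * (2 * d + 1) / real (Suc N)" by (simp add: e_def field_simps)
    finally show ?thesis .
  qed
  have "Cauchy y"
  proof (rule CauchyI)
    fix e :: real assume e: "0 < e"
    obtain N where N: "4 * (2 * d + 1) / e\<^sup>2 < real N" using reals_Archimedean2 by blast
    have "norm (y m - y n) < e" if "m \<ge> N" "n \<ge> N" for m n
    proof -
      have "4 * (2 * d + 1) < e\<^sup>2 * real (Suc N)"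
        using N e by (simp add: field_simps add_strict_increasing)
      then have "4 * (2 * d + 1) / real (Suc N) < e\<^sup>2" by (simp add: divide_less_eq)
      then have "(norm (y m - y n))\<^sup>2 < e\<^sup>2" using gap[OF that] by linarith
      then show ?thesis using e power_less_imp_less_base by (metis less_imp_le)
    qed
    then show "\<exists>M. \<forall>m\<ge>M. \<forall>n\<ge>M. norm (y m - y n) < e" by blast
  qed
  then obtain l where l: "y \<longlonglongrightarrow> l" using convergent_eq_Cauchy by blast
  have "l \<in> K" using closed_sequentially[OF K(1)] y(1) l by blast
  moreover have "norm (x - l) \<le> d"
  proof (rule LIMSEQ_le)
    show "(\<lambda>n. norm (x - y n)) \<longlonglongrightarrow> norm (x - l)" by (intro tendsto_intros l)
    show "(\<lambda>n. d + 1 / real (Suc n)) \<longlonglongrightarrow> d"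
      using LIMSEQ_inverse_real_of_nat_add[of d] by (simp add: inverse_eq_divide)
    show "\<exists>N. \<forall>n\<ge>N. norm (x - y n) \<le> d + 1 / real (Suc n)" using y(2) less_imp_le by blast
  qed
  ultimately show ?thesis using d_le order_trans by blast
qed

lemma orthogonal_decomposition:
  fixes K :: "'a::{real_inner, complete_space} set"
  assumes "closed K" "subspace K"
  shows "\<exists>y\<in>K. \<forall>z\<in>K. (x - y) \<bullet> z = 0"
proof -
  obtain y where y: "y \<in> K" "\<And>z. z \<in> K \<Longrightarrow> norm (x - y) \<le> norm (x - z)"
    using nearest_point_exists[OF assms] by blast
  have "(x - y) \<bullet> z = 0" if z: "z \<in> K" for z
  proof (cases "z = 0")
    case False
    \<comment> \<open>Moving \<open>y\<close> by this multiple of \<open>z\<close> would reduce the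
      distance to \<open>x\<close> unless \<open>x - y\<close> is already orthogonal to
      \<open>z\<close>.\<close>
    define r where "r = ((x - y) \<bullet> z) / (z \<bullet> z)"
    have "y + r *\<^sub>R z \<in> K" using y(1) z assms(2) by (simp add: subspace_add subspace_scale)
    then have "norm (x - y) \<le> norm (x - (y + r *\<^sub>R z))" by (rule y(2))
    then have "(norm (x - y))\<^sup>2 \<le> (norm ((x - y) - r *\<^sub>R z))\<^sup>2"
      by (intro power_mono) (auto simp: algebra_simps)
    also have "\<dots> = (norm (x - y))\<^sup>2 - 2 * r * ((x - y) \<bullet> z) + r * r * (z \<bullet> z)"
      by (simp add: power2_norm_eq_inner inner_diff_left[of "x - y"] inner_diff_right[of _ "x - y"]
          inner_commute[of z "x - y"] right_diff_distrib)
    also have "\<dots> = (norm (x - y))\<^sup>2 - ((x - y) \<bullet> z)\<^sup>2 / (z \<bullet> z)"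
      using False by (simp add: r_def power2_eq_square field_simps)
    finally have "((x - y) \<bullet> z)\<^sup>2 / (z \<bullet> z) \<le> 0" by simp
    moreover have "0 < z \<bullet> z" using False by simp
    ultimately have "((x - y) \<bullet> z)\<^sup>2 \<le> 0" by (simp add: divide_le_0_iff)
    then show ?thesis by simp
  qed simp
  then show ?thesis using y(1) by blast
qed

text \<open>Stated for real subspaces because the extension lemmas work with real spans; complex
  linearity on complex subspaces is part of \<open>proj_csubspace\<close>.\<close>

definition proj :: "'a::{real_inner, complete_space} set \<Rightarrow> 'a \<Rightarrow>\<^sub>L 'a"
  where "proj K = Blinfun (\<lambda>x. THE y. y \<in> K \<and> (\<forall>z\<in>K. (x - y) \<bullet> z = 0))"

lemma proj_apply:
  fixes K :: "'a::{real_inner, complete_space} set"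
  assumes K: "closed K" "subspace K"
  shows proj_in: "proj K x \<in> K" and proj_orth: "z \<in> K \<Longrightarrow> (x - proj K x) \<bullet> z = 0"
    and proj_unique: "y \<in> K \<Longrightarrow> (\<And>z. z \<in> K \<Longrightarrow> (x - y) \<bullet> z = 0) \<Longrightarrow> proj K x = y"
proof -
  let ?P = "\<lambda>x y. y \<in> K \<and> (\<forall>z\<in>K. (x - y) \<bullet> z = 0)"
  define P where "P = (\<lambda>x. THE y. ?P x y)"
  have uniq: "y = y'" if "?P x y" "?P x y'" for x y y'
  proof -
    have d: "y - y' \<in> K" using that K(2) by (simp add: subspace_diff)
    have "(y - y') \<bullet> (y - y') = (x - y') \<bullet> (y - y') - (x - y) \<bullet> (y - y')" by (simp add: algebra_simps)
    then show ?thesis using that d by simp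
  qed
  have ex1: "\<exists>!y. ?P x y" for x using orthogonal_decomposition[OF K] uniq by blast
  have P: "?P x (P x)" for x unfolding P_def using theI'[OF ex1] .
  have "bounded_linear P"
  proof (rule bounded_linear_intro)
    show "P (x + y) = P x + P y" for x y
      by (rule uniq[OF P])
         (use P[of x] P[of y] K(2) in \<open>auto simp: subspace_add inner_diff_left inner_add_left\<close>)
    show "P (r *\<^sub>R x) = r *\<^sub>R P x" for r x
      by (rule uniq[OF P])
         (use P[of x] K(2) in \<open>auto simp: subspace_scale inner_diff_left inner_add_left\<close>)
    show "norm (P x) \<le> norm x * 1" for x
    proof -
      have "(x - P x) \<bullet> P x = 0" using P by blast
      then have "(norm (P x))\<^sup>2 = x \<bullet> P x" by (simp add: power2_norm_eq_inner inner_diff_left)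
      also have "\<dots> \<le> norm x * norm (P x)" by (rule norm_cauchy_schwarz)
      finally show ?thesis by (cases "norm (P x) = 0") (auto simp: power2_eq_square)
    qed
  qed
  then have eq: "blinfun_apply (proj K) = P" by (simp add: proj_def P_def bounded_linear_Blinfun_apply)
  show "proj K x \<in> K" "z \<in> K \<Longrightarrow> (x - proj K x) \<bullet> z = 0" using P by (auto simp: eq)
  show "y \<in> K \<Longrightarrow> (\<And>z. z \<in> K \<Longrightarrow> (x - y) \<bullet> z = 0) \<Longrightarrow> proj K x = y"
    using uniq[OF P, of y x] by (auto simp: eq)
qed

lemma proj_id:
  assumes "closed K" "subspace K" "x \<in> K"
  shows "proj K x = x"
  using assms by (intro proj_unique) auto

lemma proj_eq_0:
  assumes "closed K" "subspace K" "\<And>z. z \<in> K \<Longrightarrow> x \<bullet> z = 0"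
  shows "proj K x = 0"
  using assms by (intro proj_unique) (auto simp: subspace_0)

text \<open>A vector outside the kernel, minus its projection onto the kernel, spans the orthogonal
  complement of the kernel; a multiple of it represents \<open>f\<close>.\<close>

lemma riesz_representation:
  fixes f :: "'a::{real_inner, complete_space} \<Rightarrow> real"
  assumes f: "bounded_linear f"
  shows "\<exists>y. \<forall>x. f x = x \<bullet> y"
proof (cases "\<forall>x. f x = 0")
  case True
  then show ?thesis by (intro exI[of _ 0]) simp
next
  case False
  interpret f: bounded_linear f by fact
  let ?K = "{x. f x = 0}"
  have K: "closed ?K" "subspace ?K"
    by (auto intro!: closed_Collect_eq f.continuous_on continuous_intros simp: subspace_def f.add f.scaleR f.zero)
  from False obtain x0 where x0: "f x0 \<noteq> 0" by blast
  define n where "n = x0 - proj ?K x0"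
  have fn: "f n = f x0" using proj_in[OF K, of x0] by (simp add: n_def f.diff)
  have orth: "n \<bullet> z = 0" if "f z = 0" for z using proj_orth[OF K, of z x0] that by (simp add: n_def)
  have nn: "n \<bullet> n \<noteq> 0" using fn x0 f.zero by auto
  have "f x = x \<bullet> ((f x0 / (n \<bullet> n)) *\<^sub>R n)" for x
  proof -
    have "f (x - (f x / f n) *\<^sub>R n) = 0" using fn x0 by (simp add: f.diff f.scaleR)
    then have "n \<bullet> (x - (f x / f n) *\<^sub>R n) = 0" by (rule orth)
    then have "n \<bullet> x = (f x / f n) * (n \<bullet> n)" by (simp add: inner_diff_right)
    then show ?thesis using nn x0 fn by (simp add: inner_commute field_simps)
  qed
  then show ?thesis by blast
qed

text \<open>\<open>adjoint\<close> is an indefinite choice; the Riesz vectors supply the witness, so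
  that \<open>inner_adj\<close> holds for every bounded operator.\<close>

lemma adjoint_exists:
  fixes A :: "'a::{real_inner, complete_space} \<Rightarrow>\<^sub>L 'b::real_inner"
  shows "\<exists>A' :: 'b \<Rightarrow>\<^sub>L 'a. \<forall>u v. A u \<bullet> v = u \<bullet> A' v"
proof -
  have "\<exists>y. \<forall>u. A u \<bullet> v = u \<bullet> y" for v
    by (rule riesz_representation)
       (intro bounded_linear_inner_left_comp blinfun.bounded_linear_right)
  then obtain g where g: "\<And>u v. A u \<bullet> v = u \<bullet> g v" by metis
  have ext: "x = y" if "\<And>u. u \<bullet> x = u \<bullet> y" for x y :: 'a
    using that[of "x - y"] by (metis inner_diff_right eq_iff_diff_eq_0 inner_eq_zero_iff)
  have "bounded_linear g"
  proof (rule bounded_linear_intro)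
    show "g (x + y) = g x + g y" for x y by (rule ext) (simp flip: g add: inner_add_right)
    show "g (r *\<^sub>R x) = r *\<^sub>R g x" for r x by (rule ext) (simp flip: g)
    show "norm (g v) \<le> norm v * norm A" for v
    proof -
      have "(norm (g v))\<^sup>2 = A (g v) \<bullet> v" by (simp add: g power2_norm_eq_inner)
      also have "\<dots> \<le> norm (A (g v)) * norm v" by (rule norm_cauchy_schwarz)
      also have "\<dots> \<le> (norm A * norm (g v)) * norm v" by (intro mult_right_mono norm_blinfun) auto
      finally show ?thesis by (cases "norm (g v) = 0") (auto simp: power2_eq_square mult_ac)
    qed
  qed
  then show ?thesis using g by (intro exI[of _ "Blinfun g"]) (simp add: bounded_linear_Blinfun_apply)
qed

lemma inner_adj: "blinfun_apply x u \<bullet> v = u \<bullet> blinfun_apply (adj x) v"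
  for x :: "'a::chilbert_space op"
proof -
  obtain y :: "'a op" where y: "\<forall>u v. x u \<bullet> v = u \<bullet> y v" using adjoint_exists by blast
  then have "adjoint (blinfun_apply x) = blinfun_apply y" by (rule adjoint_unique)
  then show ?thesis using y by (simp add: adj_def blinfun_apply_inverse)
qed

lemma inner_adj2: "u \<bullet> blinfun_apply x v = blinfun_apply (adj x) u \<bullet> v"
  by (metis inner_adj inner_commute)

lemma inner_eqI: "(\<And>u. u \<bullet> x = u \<bullet> y) \<Longrightarrow> x = y" for x y :: "'a::real_inner"
  by (metis inner_diff_right eq_iff_diff_eq_0 inner_eq_zero_iff)

lemma adj_eqI:
  assumes "\<And>u v. blinfun_apply x u \<bullet> v = u \<bullet> blinfun_apply y v"
  shows "adj x = y"
  by (rule blinfun_eqI, rule inner_eqI) (simp flip: inner_adj assms)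

section \<open>Extension of densely defined operators\<close>

lemma subspace_closure:
  fixes S :: "'a::real_normed_vector set"
  assumes "subspace S"
  shows "subspace (closure S)"
proof (rule subspaceI)
  show "0 \<in> closure S" using assms subspace_0 closure_subset by blast
  show "x + y \<in> closure S" if "x \<in> closure S" "y \<in> closure S" for x y
  proof -
    from that obtain f g where "\<And>n. f n \<in> S" "f \<longlonglongrightarrow> x" "\<And>n. g n \<in> S" "g \<longlonglongrightarrow> y"
      unfolding closure_sequential by blast
    then show ?thesis unfolding closure_sequential
      by (intro exI[of _ "\<lambda>n. f n + g n"]) (auto intro: tendsto_add subspace_add assms)
  qed
  show "c *\<^sub>R x \<in> closure S" if "x \<in> closure S" for c x
  proof -
    from that obtain f where "\<And>n. f n \<in> S" "f \<longlonglongrightarrow> x" unfolding closure_sequential by blast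
    then show ?thesis unfolding closure_sequential
      by (intro exI[of _ "\<lambda>n. c *\<^sub>R f n"]) (auto intro: tendsto_intros subspace_scale assms)
  qed
qed

abbreviation clspan :: "'a::real_normed_vector set \<Rightarrow> 'a set"
  where "clspan D \<equiv> closure (span D)"

lemma clspan [simp]: "closed (clspan D)" "subspace (clspan D)"
  by (simp_all add: subspace_closure)

lemma clspan_base: "x \<in> D \<Longrightarrow> x \<in> clspan D"
  using closure_subset span_base by blast

lemma clspan_minimal: "D \<subseteq> K \<Longrightarrow> closed K \<Longrightarrow> subspace K \<Longrightarrow> clspan D \<subseteq> K"
  by (simp add: closure_minimal span_minimal)

lemma clspan_induct:
  assumes "x \<in> clspan D" "\<And>x. x \<in> D \<Longrightarrow> P x" "subspace {x. P x}" "closed {x. P x}"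
  shows "P x"
  using clspan_minimal[of D "{x. P x}"] assms by auto

lemma clspan_eq_UNIV:
  fixes D :: "'a::{real_inner, complete_space} set"
  assumes "\<And>x. (\<And>d. d \<in> D \<Longrightarrow> x \<bullet> d = 0) \<Longrightarrow> x = 0"
  shows "clspan D = UNIV"
proof -
  have "x - proj (clspan D) x = 0" for x
    by (rule assms) (auto intro: proj_orth clspan_base)
  then have "x \<in> clspan D" for x by (metis clspan eq_iff_diff_eq_0 proj_in)
  then show ?thesis by blast
qed

lemma clspan_orth:
  assumes "\<And>d. d \<in> D \<Longrightarrow> x \<bullet> d = 0" "y \<in> clspan D"
  shows "x \<bullet> y = 0"
  using assms(2)
proof (rule clspan_induct)
  show "subspace {y. x \<bullet> y = 0}" by (simp add: subspace_def inner_add_right)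
  show "closed {y. x \<bullet> y = 0}" by (intro closed_Collect_eq continuous_intros)
qed (rule assms(1))

lemma subspace_eq_blinfun: "subspace {x. blinfun_apply A x = blinfun_apply C x}"
  by (simp add: subspace_def blinfun.add_right blinfun.scaleR_right)

lemma closed_eq_blinfun: "closed {x. blinfun_apply A x = blinfun_apply C x}"
  by (intro closed_Collect_eq continuous_intros)

text \<open>Operators produced by the extension lemmas vanish on the orthogonal complement of the
  prescribed vectors, so they are compared on those vectors and on the complement
  separately.\<close>

lemma blinfun_eqI_clspan:
  fixes A B :: "'a::{real_inner, complete_space} \<Rightarrow>\<^sub>L 'b::real_normed_vector"
  assumes "\<And>d. d \<in> D \<Longrightarrow> A d = B d" "\<And>x. (\<And>d. d \<in> D \<Longrightarrow> x \<bullet> d = 0) \<Longrightarrow> A x = B x"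
  shows "A = B"
proof (rule blinfun_eqI)
  fix x
  let ?y = "proj (clspan D) x"
  have "A ?y = B ?y"
    using proj_in[of "clspan D" x]
    by (rule clspan_induct) (auto simp: assms subspace_eq_blinfun closed_eq_blinfun)
  moreover have "A (x - ?y) = B (x - ?y)"
    by (rule assms(2)) (auto intro: proj_orth clspan_base)
  ultimately show "A x = B x" by (simp add: blinfun.diff_right)
qed

lemma blinfun_eqI_dense:
  fixes A B :: "'a::{real_inner, complete_space} \<Rightarrow>\<^sub>L 'b::real_normed_vector"
  assumes "\<And>d. d \<in> D \<Longrightarrow> A d = B d" "clspan D = UNIV"
  shows "A = B"
proof (rule blinfun_eqI_clspan[of D])
  fix x assume "\<And>d. d \<in> D \<Longrightarrow> x \<bullet> d = 0"
  then have "x \<bullet> x = 0" by (rule clspan_orth[of D x x]) (simp_all add: assms(2))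
  then show "A x = B x" by (simp add: blinfun.zero_right)
qed (rule assms(1))

text \<open>The operator is obtained as the closure of its graph.\<close>

lemma bounded_extension:
  fixes d :: "'i \<Rightarrow> 'a::{real_inner, complete_space}" and f :: "'i \<Rightarrow> 'b::{real_normed_vector, complete_space}"
  assumes bound: "\<And>x y. (x, y) \<in> span ((\<lambda>i. (d i, f i)) ` I) \<Longrightarrow> norm y \<le> C * norm x"
  obtains V :: "'a \<Rightarrow>\<^sub>L 'b" where "\<And>i. i \<in> I \<Longrightarrow> V (d i) = f i"
    and "\<And>x. (\<And>i. i \<in> I \<Longrightarrow> x \<bullet> d i = 0) \<Longrightarrow> V x = 0"
proof -
  let ?D = "(\<lambda>i. (d i, f i)) ` I"
  define G where "G = clspan ?D"
  let ?K = "clspan (d ` I)"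
  have G: "subspace G" "closed G" by (simp_all add: G_def)
  have bG: "norm y \<le> C * norm x" if "(x, y) \<in> G" for x y
  proof -
    have "closed {z :: 'a \<times> 'b. norm (snd z) \<le> C * norm (fst z)}"
      by (intro closed_Collect_le continuous_intros)
    moreover have "span ?D \<subseteq> {z. norm (snd z) \<le> C * norm (fst z)}" using bound by auto
    ultimately have "G \<subseteq> {z. norm (snd z) \<le> C * norm (fst z)}"
      unfolding G_def by (rule closure_minimal[rotated])
    then show ?thesis using that by auto
  qed
  have fst_span: "fst ` span ?D = span (d ` I)"
    by (simp add: linear_span_image[symmetric] linear_fst image_image)
  have ex: "\<exists>y. (x, y) \<in> G" if "x \<in> ?K" for x
  proof -
    from that obtain s where s: "\<And>n. s n \<in> span (d ` I)" "s \<longlonglongrightarrow> x"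
      unfolding closure_sequential by blast
    have "\<exists>y. (s n, y) \<in> span ?D" for n
    proof -
      have "s n \<in> fst ` span ?D" using s(1)[of n] fst_span by simp
      then show ?thesis by (auto simp: image_iff)
    qed
    then obtain y where y: "\<And>n. (s n, y n) \<in> span ?D" by metis
    \<comment> \<open>The norm bound carries the Cauchy property from the domain to the values, so
      the closed graph is defined on the whole closed span.\<close>
    have "Cauchy y"
    proof (rule CauchyI)
      fix e :: real assume e: "0 < e"
      have "Cauchy s" using s(2) by (rule LIMSEQ_imp_Cauchy)
      then obtain M where M: "\<And>m n. m \<ge> M \<Longrightarrow> n \<ge> M \<Longrightarrow> norm (s m - s n) < e / (\<bar>C\<bar> + 1)"
        using CauchyD[of s "e / (\<bar>C\<bar> + 1)"] e by (auto simp: add_nonneg_pos)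
      have "norm (y m - y n) < e" if "m \<ge> M" "n \<ge> M" for m n
      proof -
        have "(s m - s n, y m - y n) \<in> span ?D" using span_diff[OF y[of m] y[of n]] by simp
        then have "norm (y m - y n) \<le> C * norm (s m - s n)" by (rule bound)
        also have "\<dots> \<le> (\<bar>C\<bar> + 1) * norm (s m - s n)" by (intro mult_right_mono) auto
        also have "\<dots> < e" using M[OF that] by (simp add: pos_less_divide_eq mult.commute)
        finally show ?thesis .
      qed
      then show "\<exists>M. \<forall>m\<ge>M. \<forall>n\<ge>M. norm (y m - y n) < e" by blast
    qed
    then obtain l where l: "y \<longlonglongrightarrow> l" using convergent_eq_Cauchy by blast
    have "(\<lambda>n. (s n, y n)) \<longlonglongrightarrow> (x, l)" by (intro tendsto_Pair s l)
    then have "(x, l) \<in> G" unfolding G_def closure_sequential using y by (intro exI) auto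
    then show ?thesis by blast
  qed
  have uniq: "y = y'" if "(x, y) \<in> G" "(x, y') \<in> G" for x y y'
    using bG[of 0 "y - y'"] subspace_diff[OF G(1) that] by simp
  \<comment> \<open>Composing with the projection makes the extension vanish on the orthogonal
    complement of its domain.\<close>
  define T where "T x = (THE y. (proj ?K x, y) \<in> G)" for x
  have T: "(proj ?K x, T x) \<in> G" for x
  proof -
    have "\<exists>!y. (proj ?K x, y) \<in> G" using ex[OF proj_in] uniq by (metis clspan)
    then show ?thesis unfolding T_def by (rule theI')
  qed
  have "bounded_linear T"
  proof (rule bounded_linear_intro)
    show "T (x + y) = T x + T y" for x y
      by (rule uniq[OF T]) (use subspace_add[OF G(1) T[of x] T[of y]] in \<open>simp add: blinfun.add_right\<close>)
    show "T (r *\<^sub>R x) = r *\<^sub>R T x" for r x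
      by (rule uniq[OF T]) (use subspace_scale[OF G(1) T[of x]] in \<open>simp add: blinfun.scaleR_right\<close>)
    show "norm (T x) \<le> norm x * (\<bar>C\<bar> * norm (proj ?K))" for x
    proof -
      have "norm (T x) \<le> C * norm (proj ?K x)" by (rule bG[OF T])
      also have "\<dots> \<le> \<bar>C\<bar> * norm (proj ?K x)" by (intro mult_right_mono) auto
      also have "\<dots> \<le> \<bar>C\<bar> * (norm (proj ?K) * norm x)" by (intro mult_left_mono norm_blinfun) auto
      finally show ?thesis by (simp add: mult_ac)
    qed
  qed
  then have app: "blinfun_apply (Blinfun T) x = T x" for x by (simp add: bounded_linear_Blinfun_apply)
  show thesis
  proof (rule that[of "Blinfun T"])
    fix i assume i: "i \<in> I"
    have "proj ?K (d i) = d i" using i by (intro proj_id) (auto intro: clspan_base)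
    moreover have "(d i, f i) \<in> G" unfolding G_def using i by (auto intro: clspan_base)
    ultimately show "Blinfun T (d i) = f i" unfolding app using T[of "d i"] by (intro uniq[of "d i"]) simp_all
  next
    fix x assume x: "\<And>i. i \<in> I \<Longrightarrow> x \<bullet> d i = 0"
    have "x \<bullet> z = 0" if "z \<in> ?K" for z
      by (rule clspan_orth[OF _ that]) (use x in auto)
    then have "proj ?K x = 0" by (intro proj_eq_0) simp_all
    then have "(0, T x) \<in> G" using T[of x] by simp
    moreover have "(0, 0) \<in> G" using subspace_0[OF G(1)] by (simp add: zero_prod_def)
    ultimately show "Blinfun T x = 0" unfolding app by (rule uniq)
  qed
qed

text \<open>Equal Gram matrices extend bilinearly to the span of the graph. This gives
  well-definedness and boundedness with constant 1 at once.\<close>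

lemma isometry_extension:
  fixes d :: "'i \<Rightarrow> 'a::{real_inner, complete_space}" and f :: "'i \<Rightarrow> 'b::{real_inner, complete_space}"
  assumes iso: "\<And>i j. i \<in> I \<Longrightarrow> j \<in> I \<Longrightarrow> f i \<bullet> f j = d i \<bullet> d j"
  obtains V :: "'a \<Rightarrow>\<^sub>L 'b" where "\<And>i. i \<in> I \<Longrightarrow> V (d i) = f i"
    and "\<And>x. (\<And>i. i \<in> I \<Longrightarrow> x \<bullet> d i = 0) \<Longrightarrow> V x = 0"
    and "\<And>x y. x \<in> clspan (d ` I) \<Longrightarrow> y \<in> clspan (d ` I) \<Longrightarrow> V x \<bullet> V y = x \<bullet> y"
proof -
  let ?D = "(\<lambda>i. (d i, f i)) ` I"
  have 1: "snd w \<bullet> f j = fst w \<bullet> d j" if "w \<in> span ?D" "j \<in> I" for w j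
    using that(1)
  proof (rule span_induct)
    show "subspace {w. snd w \<bullet> f j = fst w \<bullet> d j}"
      by (simp add: subspace_def inner_add_left)
  qed (use iso that(2) in auto)
  have 2: "snd w \<bullet> snd w' = fst w \<bullet> fst w'" if w: "w \<in> span ?D" "w' \<in> span ?D" for w w'
    using w(2)
  proof (rule span_induct)
    show "subspace {w'. snd w \<bullet> snd w' = fst w \<bullet> fst w'}"
      by (simp add: subspace_def inner_add_right)
  qed (use 1[OF w(1)] in auto)
  have "norm y \<le> 1 * norm x" if "(x, y) \<in> span ?D" for x y
    using 2[OF that that] by (simp add: norm_eq_sqrt_inner)
  then obtain V :: "'a \<Rightarrow>\<^sub>L 'b" where V: "\<And>i. i \<in> I \<Longrightarrow> V (d i) = f i"
    "\<And>x. (\<And>i. i \<in> I \<Longrightarrow> x \<bullet> d i = 0) \<Longrightarrow> V x = 0"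
    using bounded_extension[of d f I 1 thesis] by blast
  have 3: "V x \<bullet> V (d j) = x \<bullet> d j" if "x \<in> clspan (d ` I)" "j \<in> I" for x j
    using that(1)
  proof (rule clspan_induct)
    show "subspace {x. V x \<bullet> V (d j) = x \<bullet> d j}"
      by (simp add: subspace_def inner_add_left blinfun.add_right blinfun.scaleR_right blinfun.zero_right)
    show "closed {x. V x \<bullet> V (d j) = x \<bullet> d j}" by (intro closed_Collect_eq continuous_intros)
  qed (use V(1) iso that(2) in auto)
  have "V x \<bullet> V y = x \<bullet> y" if xy: "x \<in> clspan (d ` I)" "y \<in> clspan (d ` I)" for x y
    using xy(2)
  proof (rule clspan_induct)
    show "subspace {y. V x \<bullet> V y = x \<bullet> y}"
      by (simp add: subspace_def inner_add_right blinfun.add_right blinfun.scaleR_right blinfun.zero_right)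
    show "closed {y. V x \<bullet> V y = x \<bullet> y}" by (intro closed_Collect_eq continuous_intros)
  qed (use 3[OF xy(1)] in auto)
  then show thesis using that V by blast
qed

text \<open>A ratio above 1 has unbounded powers. Exponents \<open>2 ^ k\<close> suffice, which is
  what repeated squaring delivers in \<open>adjointable_extension\<close>.\<close>

lemma power_bound_le:
  fixes r c K :: real
  assumes "0 \<le> r" "0 < c" "\<And>k. r ^ (2 ^ k) \<le> K * c ^ (2 ^ k)"
  shows "r \<le> c"
proof (rule ccontr)
  assume "\<not> r \<le> c"
  then have q: "1 < r / c" using assms(2) by (simp add: less_divide_eq)
  obtain n where n: "K < (r / c) ^ n" using real_arch_pow[OF q] by blast
  have "(r / c) ^ n \<le> (r / c) ^ (2 ^ n)" using q by (intro power_increasing) auto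
  also have "\<dots> \<le> K" using assms(2,3) by (simp add: power_divide divide_le_eq)
  finally show False using n by simp
qed

text \<open>
  The operator is bounded because the moments \<open>x \<bullet> (A\<^sup>* A)\<^sup>n x\<close> are
  log-convex along powers of 2, so that \<open>\<parallel>A x\<parallel>\<^sup>2 / \<parallel>x\<parallel>\<^sup>2\<close>
  cannot exceed their growth rate.
\<close>

lemma adjointable_extension:
  fixes d :: "'i \<Rightarrow> 'a::{real_inner, complete_space}"
  assumes F: "\<And>i. i \<in> I \<Longrightarrow> F i \<in> I" "\<And>i. i \<in> I \<Longrightarrow> F' i \<in> I"
    and adj: "\<And>i j. i \<in> I \<Longrightarrow> j \<in> I \<Longrightarrow> d (F i) \<bullet> d j = d i \<bullet> d (F' j)"
    and c: "0 < c"
    and growth: "\<And>i. i \<in> I \<Longrightarrow> \<exists>B. \<forall>n. norm (d (((F' \<circ> F) ^^ n) i)) \<le> B * c ^ n"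
  obtains A :: "'a \<Rightarrow>\<^sub>L 'a" where "\<And>i. i \<in> I \<Longrightarrow> A (d i) = d (F i)"
    and "\<And>x. (\<And>i. i \<in> I \<Longrightarrow> x \<bullet> d i = 0) \<Longrightarrow> A x = 0"
proof -
  let ?P = "\<lambda>n i. ((F' \<circ> F) ^^ n) i"
  have P_in: "?P n i \<in> I" if "i \<in> I" for n i using that F by (induction n) auto
  have P1: "d (F' (F i)) \<bullet> d j = d i \<bullet> d (F' (F j))" if "i \<in> I" "j \<in> I" for i j
  proof -
    have "d (F' (F i)) \<bullet> d j = d j \<bullet> d (F' (F i))" by (rule inner_commute)
    also have "\<dots> = d (F j) \<bullet> d (F i)" using adj[of j "F i"] that F by simp
    also have "\<dots> = d i \<bullet> d (F' (F j))" using adj[of i "F j"] that F by (simp add: inner_commute)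
    finally show ?thesis .
  qed
  \<comment> \<open>\<open>F' \<circ> F\<close> behaves like a symmetric operator: Gram entries of
    its iterates depend only on the sum of the exponents.\<close>
  have Pn: "d (?P n i) \<bullet> d (?P m j) = d i \<bullet> d (?P (n + m) j)" if "i \<in> I" "j \<in> I" for i j n m
    using that
  proof (induction n arbitrary: m)
    case (Suc n)
    have "d (?P (Suc n) i) \<bullet> d (?P m j) = d (?P n i) \<bullet> d (?P (Suc m) j)"
      using P1[of "?P n i" "?P m j"] P_in Suc.prems by simp
    also have "\<dots> = d i \<bullet> d (?P (n + Suc m) j)" using Suc by blast
    finally show ?case by (simp only: add_Suc add_Suc_right)
  qed simp
  have "norm y \<le> sqrt c * norm x" if xy: "(x, y) \<in> span ((\<lambda>i. (d i, d (F i))) ` I)" for x y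
  proof -
    from xy obtain T r where T: "finite T" "T \<subseteq> (\<lambda>i. (d i, d (F i))) ` I" "(x, y) = (\<Sum>a\<in>T. r a *\<^sub>R a)"
      unfolding span_explicit by blast
    \<comment> \<open>One index is chosen for each graph vector, so that the sum over vectors can be
      reindexed.\<close>
    obtain U where U: "U \<subseteq> I" "inj_on (\<lambda>i. (d i, d (F i))) U" "T = (\<lambda>i. (d i, d (F i))) ` U"
      using T(2) unfolding subset_image_inj by blast
    define s where "s i = r (d i, d (F i))" for i
    have "(x, y) = (\<Sum>i\<in>U. s i *\<^sub>R (d i, d (F i)))"
      unfolding T(3) U(3) sum.reindex[OF U(2)] by (simp add: s_def)
    then have "(x, y) = (\<Sum>i\<in>U. (s i *\<^sub>R d i, s i *\<^sub>R d (F i)))" by simp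
    then have x: "x = (\<Sum>i\<in>U. s i *\<^sub>R d i)" and y: "y = (\<Sum>i\<in>U. s i *\<^sub>R d (F i))"
      by (simp_all add: sum_prod)
    define X where "X n = (\<Sum>i\<in>U. s i *\<^sub>R d (?P n i))" for n
    have X0: "X 0 = x" by (simp add: X_def x)
    have XX: "X n \<bullet> X m = x \<bullet> X (n + m)" for n m
    proof -
      have "X n \<bullet> X m = (\<Sum>i\<in>U. \<Sum>j\<in>U. s i * s j * (d (?P n i) \<bullet> d (?P m j)))"
        unfolding X_def inner_sum_left
          by (simp add: inner_sum_right mult_ac sum_distrib_left)
      also have "\<dots> = (\<Sum>i\<in>U. \<Sum>j\<in>U. s i * s j * (d i \<bullet> d (?P (n + m) j)))"
        using U(1) Pn by (intro sum.cong) (auto simp: subset_iff)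
      also have "\<dots> = x \<bullet> X (n + m)"
        unfolding X_def x inner_sum_left
          by (simp add: inner_sum_right mult_ac sum_distrib_left)
      finally show ?thesis .
    qed
    have yy: "y \<bullet> y = x \<bullet> X 1"
    proof -
      have "y \<bullet> y = (\<Sum>i\<in>U. \<Sum>j\<in>U. s i * s j * (d (F i) \<bullet> d (F j)))"
        unfolding y inner_sum_left
          by (simp add: inner_sum_right mult_ac sum_distrib_left)
      also have "\<dots> = (\<Sum>i\<in>U. \<Sum>j\<in>U. s i * s j * (d i \<bullet> d (?P 1 j)))"
        using U(1) adj F by (intro sum.cong) (auto simp: subset_iff)
      also have "\<dots> = x \<bullet> X 1"
        unfolding X_def x inner_sum_left
          by (simp add: inner_sum_right mult_ac sum_distrib_left)
      finally show ?thesis .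
    qed
    have "\<forall>i\<in>U. \<exists>B. \<forall>n. norm (d (?P n i)) \<le> B * c ^ n" using growth U(1) by blast
    then obtain B where B: "\<And>i n. i \<in> U \<Longrightarrow> norm (d (?P n i)) \<le> B i * c ^ n" by metis
    define K where "K = (\<Sum>i\<in>U. \<bar>s i\<bar> * B i)"
    have XK: "norm (X n) \<le> K * c ^ n" for n
    proof -
      have "norm (X n) \<le> (\<Sum>i\<in>U. norm (s i *\<^sub>R d (?P n i)))" unfolding X_def by (rule norm_sum)
      also have "\<dots> \<le> (\<Sum>i\<in>U. \<bar>s i\<bar> * (B i * c ^ n))"
        using B by (intro sum_mono) (auto intro: mult_left_mono)
      also have "\<dots> = K * c ^ n" unfolding K_def sum_distrib_right by (simp add: mult.assoc)
      finally show ?thesis .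
    qed
    define a where "a n = x \<bullet> X n" for n
    show ?thesis
    proof (cases "x = 0")
      case True
      then show ?thesis using yy by simp
    next
      case False
      have a0: "a 0 > 0" using False by (simp add: a_def X0)
      \<comment> \<open>Cauchy-Schwarz between \<open>x\<close> and \<open>X n\<close>. Iterated
        along powers of two it compares \<open>a 1 / a 0\<close> with
        \<open>a (2 ^ k) / a 0\<close>, whose growth is bounded by hypothesis.\<close>
      have sq: "(a n)\<^sup>2 \<le> a 0 * a (2 * n)" for n
      proof -
        have "(a n)\<^sup>2 \<le> (x \<bullet> x) * (X n \<bullet> X n)" unfolding a_def by (rule Cauchy_Schwarz_ineq)
        then show ?thesis using XX[of n n] by (simp add: a_def X0 mult_2)
      qed
      have pos: "0 \<le> a 1" unfolding a_def yy[symmetric] by simp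
      have step: "(a 1 / a 0) ^ (2 ^ k) \<le> a (2 ^ k) / a 0" for k
      proof (induction k)
        case (Suc k)
        have "(a 1 / a 0) ^ (2 ^ Suc k) = ((a 1 / a 0) ^ (2 ^ k))\<^sup>2"
          by (simp add: power_mult[symmetric] mult.commute)
        also have "\<dots> \<le> (a (2 ^ k) / a 0)\<^sup>2" using Suc pos a0 by (intro power_mono) auto
        also have "\<dots> \<le> (a 0 * a (2 * 2 ^ k)) / (a 0)\<^sup>2"
          unfolding power_divide by (intro divide_right_mono sq) auto
        also have "\<dots> = a (2 ^ Suc k) / a 0" using a0 by (simp add: power2_eq_square)
        finally show ?case .
      qed simp
      have "a 1 / a 0 \<le> c"
      proof (rule power_bound_le[OF _ c])
        show "0 \<le> a 1 / a 0" using pos a0 by simp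
        show "(a 1 / a 0) ^ (2 ^ k) \<le> (norm x * K / a 0) * c ^ (2 ^ k)" for k
        proof -
          have "a (2 ^ k) \<le> norm x * norm (X (2 ^ k))" unfolding a_def by (rule norm_cauchy_schwarz)
          also have "\<dots> \<le> norm x * (K * c ^ (2 ^ k))" by (intro mult_left_mono XK) auto
          finally have "a (2 ^ k) / a 0 \<le> (norm x * (K * c ^ (2 ^ k))) / a 0"
            using a0 by (intro divide_right_mono) auto
          then show ?thesis using step[of k] by (simp add: mult_ac)
        qed
      qed
      then have "a 1 \<le> c * a 0" using a0 by (simp add: divide_le_eq)
      then have "(norm y)\<^sup>2 \<le> c * (norm x)\<^sup>2" by (simp add: a_def X0 power2_norm_eq_inner yy)
      then have "sqrt ((norm y)\<^sup>2) \<le> sqrt (c * (norm x)\<^sup>2)" by (rule real_sqrt_le_mono)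
      then show ?thesis by (simp add: real_sqrt_mult)
    qed
  qed
  then show thesis by (rule bounded_extension) (use that in auto)
qed

text \<open>Bits serve as exponents in the field with two elements, so sums and products are kept
  rather than rewritten to bitwise operations.\<close>

declare add_bit_eq_xor [simp del] mult_bit_eq_and [simp del]

section \<open>Signs and conjugations\<close>

lemma bit_add_self [simp]: "s + s = 0" for s :: bit
  by (cases s) simp_all

lemma conj_pow_0 [simp]: "conj_pow 0 z = z"
  and conj_pow_1 [simp]: "conj_pow 1 z = cnj z"
  by (simp_all add: conj_pow_def)

lemma conj_pow_add: "conj_pow (r + s) z = conj_pow r (conj_pow s z)"
  by (cases r; cases s) simp_all

lemma conj_pow_arith [simp]:
  "conj_pow s (z + w) = conj_pow s z + conj_pow s w"
  "conj_pow s (z * w) = conj_pow s z * conj_pow s w"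
  "conj_pow s (z / w) = conj_pow s z / conj_pow s w"
  "conj_pow s (- z) = - conj_pow s z"
  "conj_pow s 1 = 1" "conj_pow s 0 = 0"
  "conj_pow s (of_real r) = of_real r"
  "conj_pow s (conj_pow s z) = z"
  "cmod (conj_pow s z) = cmod z"
  "conj_pow s z = 0 \<longleftrightarrow> z = 0"
  "Re (conj_pow s z) = Re z"
  "conj_pow s (cnj z) = cnj (conj_pow s z)"
  by (cases s; simp)+

lemma sign_0 [simp]: "sign 0 = 1"
  and sign_1 [simp]: "sign 1 = - 1"
  by (simp_all add: sign_def)

lemma sign_add: "sign (r + s) = sign r * sign s"
  by (cases r; cases s) simp_all

lemma sign_simps [simp]:
  "sign s * sign s = 1" "cmod (sign s) = 1" "sign s \<noteq> 0" "conj_pow r (sign s) = sign s"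
  "cnj (sign s) = sign s" "sign s * (sign s * z) = z" "inverse (sign s) = sign s"
  by (cases s; cases r; simp)+

lemma sign_eq_iff: "sign r = sign s \<longleftrightarrow> r = s"
  by (cases r; cases s) simp_all

section \<open>Algebra of operators\<close>

text \<open>The bit records linear or anti-linear; under composition the bits add, so one statement
  covers both kinds of group element.\<close>

definition semilinear :: "bit \<Rightarrow> ('a::chilbert_space \<Rightarrow>\<^sub>L 'b::chilbert_space) \<Rightarrow> bool"
  where "semilinear s x \<longleftrightarrow> (\<forall>c v. x (c *\<^sub>C v) = conj_pow s c *\<^sub>C x v)"

lemma semilinearD: "semilinear s x \<Longrightarrow> x (c *\<^sub>C v) = conj_pow s c *\<^sub>C x v"
  by (simp add: semilinear_def)

lemma semilinear_compose: "semilinear r x \<Longrightarrow> semilinear s y \<Longrightarrow> semilinear (r + s) (x o\<^sub>L y)"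
  by (simp add: semilinear_def conj_pow_add)

lemma Bounded_ops_iff: "x \<in> Bounded_ops \<longleftrightarrow> semilinear 0 x"
  by (simp add: Bounded_ops_def semilinear_def)

lemma Bounded_opsD: "x \<in> Bounded_ops \<Longrightarrow> blinfun_apply x (c *\<^sub>C v) = c *\<^sub>C x v"
  by (simp add: Bounded_ops_def)

lemma scale_op_apply [simp]: "scale_op c x v = c *\<^sub>C x v"
proof -
  have "bounded_linear (\<lambda>v. c *\<^sub>C x v)"
    by (intro bounded_linear_compose[OF bounded_linear_scaleC] blinfun.bounded_linear_right)
  then show ?thesis by (simp add: scale_op_def bounded_linear_Blinfun_apply)
qed

text \<open>The imaginary part of \<open>cinner\<close> is a real inner product with
  \<open>\<i> *\<^sub>C u\<close>; semilinearity decides its sign.\<close>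

lemma cinner_adj_semilinear:
  fixes x :: "'a::chilbert_space op"
  assumes "semilinear s x"
  shows "cinner (x u) v = conj_pow s (cinner u (adj x v))"
proof (cases "s = 0")
  case True
  then show ?thesis using assms semilinearD[OF assms, of \<i> u]
    by (simp add: complex_eq_iff Re_cinner Im_cinner inner_adj flip: inner_adj[of x "\<i> *\<^sub>C u"])
next
  case False
  then have "s = 1" by simp
  then show ?thesis using assms semilinearD[OF assms, of \<i> u] inner_adj[of x "\<i> *\<^sub>C u" v]
    by (simp add: complex_eq_iff Re_cinner Im_cinner inner_adj)
qed

lemma cinner_adj: "x \<in> Bounded_ops \<Longrightarrow> cinner (blinfun_apply x u) v = cinner u (adj x v)"
  using cinner_adj_semilinear[of 0 x u v] by (simp add: Bounded_ops_iff)

lemma adj_adj [simp]: "adj (adj x) = x"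
  by (rule adj_eqI) (metis inner_adj inner_commute)

lemma adj_compose [simp]: "adj (x o\<^sub>L y) = adj y o\<^sub>L adj x"
  by (rule adj_eqI) (simp add: inner_adj)

lemma adj_add [simp]: "adj (x + y) = adj x + adj y"
  by (rule adj_eqI) (simp add: blinfun.add_left inner_add_left inner_add_right inner_adj)

lemma adj_diff [simp]: "adj (x - y) = adj x - adj y"
  by (rule adj_eqI) (simp add: blinfun.diff_left inner_diff_left inner_diff_right inner_adj)

lemma adj_minus [simp]: "adj (- x) = - adj x"
  by (rule adj_eqI) (simp add: blinfun.minus_left inner_adj)

lemma adj_scaleR [simp]: "adj (r *\<^sub>R x) = r *\<^sub>R adj x"
  by (rule adj_eqI) (simp add: blinfun.scaleR_left inner_adj)

lemma adj_zero [simp]: "adj 0 = 0"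
  by (rule adj_eqI) simp

lemma adj_id [simp]: "adj id_blinfun = id_blinfun"
  by (rule adj_eqI) simp

lemma adj_eq_0_iff [simp]: "adj x = 0 \<longleftrightarrow> x = 0"
  by (metis adj_adj adj_zero)

lemma semilinear_adj: "semilinear s x \<Longrightarrow> semilinear s (adj x)"
  unfolding semilinear_def
proof (intro allI)
  fix c v assume "\<forall>c v. x (c *\<^sub>C v) = conj_pow s c *\<^sub>C x v"
  then have s: "semilinear s x" by (simp add: semilinear_def)
  show "adj x (c *\<^sub>C v) = conj_pow s c *\<^sub>C adj x v"
  proof (rule cinner_eqI)
    fix z
    have "conj_pow s (cinner z (adj x (c *\<^sub>C v))) = conj_pow s (cinner z (conj_pow s c *\<^sub>C adj x v))"
      by (simp flip: cinner_adj_semilinear[OF s] add: cinner_scaleC_right)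
    then show "cinner z (adj x (c *\<^sub>C v)) = cinner z (conj_pow s c *\<^sub>C adj x v)"
      by (metis conj_pow_arith(8))
  qed
qed

lemma adj_scale_op [simp]: "x \<in> Bounded_ops \<Longrightarrow> adj (scale_op c x) = scale_op (cnj c) (adj x)"
  by (rule adj_eqI_linear) (simp add: cinner_scaleC_left cinner_scaleC_right cinner_adj)

lemma Bounded_ops_intros [simp, intro]:
  "id_blinfun \<in> Bounded_ops" "0 \<in> Bounded_ops"
  "x \<in> Bounded_ops \<Longrightarrow> y \<in> Bounded_ops \<Longrightarrow> x o\<^sub>L y \<in> Bounded_ops"
  "x \<in> Bounded_ops \<Longrightarrow> y \<in> Bounded_ops \<Longrightarrow> x + y \<in> Bounded_ops"
  "x \<in> Bounded_ops \<Longrightarrow> y \<in> Bounded_ops \<Longrightarrow> x - y \<in> Bounded_ops"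
  "x \<in> Bounded_ops \<Longrightarrow> - x \<in> Bounded_ops"
  "x \<in> Bounded_ops \<Longrightarrow> scale_op c x \<in> Bounded_ops"
  "x \<in> Bounded_ops \<Longrightarrow> r *\<^sub>R x \<in> Bounded_ops"
  "x \<in> Bounded_ops \<Longrightarrow> adj x \<in> Bounded_ops"
  using semilinear_adj[of 0 x]
  by (auto simp: Bounded_ops_def semilinear_def blinfun.add_left blinfun.diff_left blinfun.minus_left
      blinfun.scaleR_left scaleC_add_right scaleC_diff_right scaleC_scaleC mult.commute scaleR_scaleC_commute)

lemma scale_op_simps [simp]:
  "scale_op 1 x = x" "scale_op 0 x = 0" "scale_op c 0 = 0" "scale_op (- 1) x = - x"
  "scale_op c (scale_op d x) = scale_op (c * d) x"
  "scale_op c x o\<^sub>L y = scale_op c (x o\<^sub>L y)"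
  "scale_op (- c) x = - scale_op c x" "scale_op c (- x) = - scale_op c x"
  by (rule blinfun_eqI, simp add: scaleC_scaleC blinfun.minus_left)+

lemma compose_scale_op:
  "semilinear s x \<Longrightarrow> x o\<^sub>L scale_op c y = scale_op (conj_pow s c) (x o\<^sub>L y)"
  by (rule blinfun_eqI) (simp add: semilinearD)

lemma compose_scale_op_linear [simp]:
  "x \<in> Bounded_ops \<Longrightarrow> x o\<^sub>L scale_op c y = scale_op c (x o\<^sub>L y)"
  using compose_scale_op[of 0 x c y] by (simp add: Bounded_ops_iff)

lemma scale_op_add_right: "scale_op c (x + y) = scale_op c x + scale_op c y"
  by (rule blinfun_eqI) (simp add: blinfun.add_left scaleC_add_right)

lemma scale_op_diff_right: "scale_op c (x - y) = scale_op c x - scale_op c y"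
  by (rule blinfun_eqI) (simp add: blinfun.diff_left scaleC_diff_right)

lemma scale_op_add_left: "scale_op (c + d) x = scale_op c x + scale_op d x"
  by (rule blinfun_eqI) (simp add: blinfun.add_left scaleC_add_left)

lemma scale_op_of_real: "scale_op (of_real r) x = r *\<^sub>R x"
  by (rule blinfun_eqI) (simp add: blinfun.scaleR_left scaleC_of_real)

lemma scale_op_eq_0_iff [simp]: "scale_op c x = 0 \<longleftrightarrow> c = 0 \<or> x = 0"
proof
  assume "scale_op c x = 0"
  then have "c *\<^sub>C x v = 0" for v by (metis scale_op_apply blinfun.zero_left)
  then have "c = 0 \<or> x v = 0" for v by simp
  then show "c = 0 \<or> x = 0" by (metis blinfun_eqI blinfun.zero_left)
qed auto

lemma scale_op_cancel: "scale_op c x = scale_op d x \<longleftrightarrow> c = d \<or> x = 0"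
proof -
  have "scale_op c x = scale_op d x \<longleftrightarrow> scale_op (c - d) x = 0"
    using scale_op_add_left[of "c - d" d x] by auto
  then show ?thesis by simp
qed

lemma compose_simps [simp]:
  "id_blinfun o\<^sub>L x = x" "x o\<^sub>L id_blinfun = x"
  "(0 :: 'a::chilbert_space op) o\<^sub>L y = 0" "y o\<^sub>L (0 :: 'a op) = 0"
  "(- u) o\<^sub>L v = - (u o\<^sub>L v)" "u o\<^sub>L (- v) = - (u o\<^sub>L v)"
  for y u v :: "'a::chilbert_space op"
  by (rule blinfun_eqI, simp add: blinfun.minus_left blinfun.minus_right)+

lemma compose_distribs:
  "(x + y) o\<^sub>L z = (x o\<^sub>L z) + (y o\<^sub>L z)" "z o\<^sub>L (x + y) = (z o\<^sub>L x) + (z o\<^sub>L y)"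
  "(x - y) o\<^sub>L z = (x o\<^sub>L z) - (y o\<^sub>L z)" "z o\<^sub>L (x - y) = (z o\<^sub>L x) - (z o\<^sub>L y)"
  "(r *\<^sub>R x) o\<^sub>L z = r *\<^sub>R (x o\<^sub>L z)" "z o\<^sub>L (r *\<^sub>R x) = r *\<^sub>R (z o\<^sub>L x)"
  for x y z :: "'a::chilbert_space op"
  by (rule blinfun_eqI, simp add: blinfun.add_left blinfun.add_right blinfun.diff_left
      blinfun.diff_right blinfun.scaleR_left blinfun.scaleR_right)+

lemma compose_assoc: "(x o\<^sub>L y) o\<^sub>L z = x o\<^sub>L (y o\<^sub>L z)"
  by (rule blinfun_eqI) simp

lemma compose_eqD: "x o\<^sub>L y = z \<Longrightarrow> x (y v) = z v"
  by (metis blinfun_apply_blinfun_compose)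

lemma norm_adj_compose: "(norm (blinfun_apply x v))\<^sup>2 = v \<bullet> (adj x o\<^sub>L x) v"
  by (simp add: power2_norm_eq_inner inner_adj)

lemma adj_compose_eq_0_iff: "adj x o\<^sub>L x = 0 \<longleftrightarrow> x = 0"
proof
  assume "adj x o\<^sub>L x = 0"
  then have "norm (x v) = 0" for v using norm_adj_compose[of x v] by simp
  then show "x = 0" by (intro blinfun_eqI) simp
qed simp

lemma id_blinfun_neq_0 [simp]: "(id_blinfun :: 'a::chilbert_space op) \<noteq> 0"
  by (metis blinfun.zero_left id_blinfun.rep_eq nonzero_space)

section \<open>Closed subspaces\<close>

lemma closed_csubspaceD:
  assumes "closed_csubspace K"
  shows "closed K" "subspace K" "\<And>c x. x \<in> K \<Longrightarrow> c *\<^sub>C x \<in> K"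
proof -
  show c: "\<And>c x. x \<in> K \<Longrightarrow> c *\<^sub>C x \<in> K" and "closed K"
    using assms by (auto simp: closed_csubspace_def)
  obtain x where "x \<in> K" using assms by (auto simp: closed_csubspace_def)
  then have "0 \<in> K" using c[of x 0] by simp
  then show "subspace K"
    using assms by (auto simp: closed_csubspace_def subspace_def simp flip: scaleC_of_real)
qed

lemma closed_csubspaceI:
  "closed K \<Longrightarrow> subspace K \<Longrightarrow> (\<And>c x. x \<in> K \<Longrightarrow> c *\<^sub>C x \<in> K) \<Longrightarrow> closed_csubspace K"
  by (auto simp: closed_csubspace_def subspace_def)

lemma closed_csubspace_clspan:
  assumes "\<And>c d. d \<in> D \<Longrightarrow> c *\<^sub>C d \<in> D"
  shows "closed_csubspace (clspan D)"
proof (rule closed_csubspaceI)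
  fix c and x :: 'a assume "x \<in> clspan D"
  then show "c *\<^sub>C x \<in> clspan D"
  proof (rule clspan_induct)
    show "subspace {x. c *\<^sub>C x \<in> clspan D}"
      using clspan(2)[of D] by (auto simp: subspace_def scaleC_add_right scaleR_scaleC_commute)
    have "continuous_on UNIV ((*\<^sub>C) c :: 'a \<Rightarrow> 'a)"
      by (rule bounded_linear.continuous_on[OF bounded_linear_scaleC]) (rule continuous_on_id)
    then show "closed {x. c *\<^sub>C x \<in> clspan D}"
      using continuous_closed_vimage[OF closed_closure[of "span D"], of "(*\<^sub>C) c"]
      by (simp add: vimage_def continuous_on_eq_continuous_at)
  qed (auto intro: clspan_base assms)
qed simp_all

lemma closed_csubspace_Collect:
  assumes "x \<in> Bounded_ops" "y \<in> Bounded_ops"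
  shows "closed_csubspace {v. blinfun_apply x v = blinfun_apply y v}"
  using assms by (intro closed_csubspaceI subspace_eq_blinfun closed_eq_blinfun) (simp add: Bounded_opsD)

text \<open>Orthogonality to a complex subspace is orthogonality for \<open>cinner\<close>, which is
  stable under complex scalars; uniqueness of the real projection then makes it
  complex-linear.\<close>

lemma proj_csubspace:
  assumes K: "closed_csubspace K"
  shows proj_cinner: "z \<in> K \<Longrightarrow> cinner z (x - proj K x) = 0"
    and projection_proj: "projection_op (proj K)"
    and proj_range: "proj K x \<in> K"
    and proj_fix: "x \<in> K \<Longrightarrow> proj K x = x"
    and proj_zero: "(\<And>z. z \<in> K \<Longrightarrow> cinner z x = 0) \<Longrightarrow> proj K x = 0"
proof -
  note K' = closed_csubspaceD[OF K]
  show rng: "\<And>x. proj K x \<in> K" and fx: "\<And>x. x \<in> K \<Longrightarrow> proj K x = x"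
    by (auto intro: proj_in proj_id K')
  have orth: "\<And>z x. z \<in> K \<Longrightarrow> cinner z (x - proj K x) = 0"
    by (subst cinner_eq_0_commute, rule orthogonal_cinnerI) (auto intro: proj_orth K')
  then show "z \<in> K \<Longrightarrow> cinner z (x - proj K x) = 0" .
  have "proj K \<in> Bounded_ops"
  proof -
    have "proj K (c *\<^sub>C v) = c *\<^sub>C proj K v" for c v
    proof (rule proj_unique)
      fix z assume "z \<in> K"
      then have "cinner z (c *\<^sub>C (v - proj K v)) = 0" by (simp add: cinner_scaleC_right orth)
      then show "(c *\<^sub>C v - c *\<^sub>C proj K v) \<bullet> z = 0"
        by (metis Re_cinner inner_commute scaleC_diff_right zero_complex.simps(1))
    qed (use K' rng in auto)
    then show ?thesis by (simp add: Bounded_ops_def)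
  qed
  moreover have "adj (proj K) = proj K"
  proof (rule adj_eqI)
    fix u v
    have "(u - proj K u) \<bullet> proj K v = 0" "(v - proj K v) \<bullet> proj K u = 0"
      by (auto intro: proj_orth K' rng)
    then show "proj K u \<bullet> v = u \<bullet> proj K v"
      by (simp add: inner_diff_left inner_diff_right inner_commute)
  qed
  moreover have "proj K o\<^sub>L proj K = proj K"
    by (rule blinfun_eqI) (simp add: rng fx)
  ultimately show "projection_op (proj K)" by (simp add: projection_op_def)
  show "proj K x = 0" if "\<And>z. z \<in> K \<Longrightarrow> cinner z x = 0"
    using that by (intro proj_eq_0 K') (metis Re_cinner inner_commute zero_complex.simps(1))
qed

text \<open>Invariance under the adjoint makes the orthogonal complement invariant as well, so
  \<open>K\<close> reduces \<open>x\<close>. Linearity of \<open>x\<close> over the complex numbers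
  is not assumed.\<close>

lemma proj_commute:
  fixes x :: "'a::chilbert_space op"
  assumes K: "closed_csubspace K" and inv: "\<And>v. v \<in> K \<Longrightarrow> x v \<in> K" "\<And>v. v \<in> K \<Longrightarrow> adj x v \<in> K"
  shows "proj K o\<^sub>L x = x o\<^sub>L proj K"
proof (rule blinfun_eqI)
  fix v
  note K' = closed_csubspaceD[OF K]
  have "proj K (x v) = x (proj K v)"
  proof (rule proj_unique[OF K'(1,2)])
    fix z assume "z \<in> K"
    then have "(v - proj K v) \<bullet> adj x z = 0" using inv by (intro proj_orth K') auto
    then show "(x v - x (proj K v)) \<bullet> z = 0" by (simp add: inner_adj flip: blinfun.diff_right)
  qed (use inv proj_range[OF K] in auto)
  then show "(proj K o\<^sub>L x) v = (x o\<^sub>L proj K) v" by simp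
qed

text \<open>Semilinearity is an equation between two operators for each scalar. It is checked on
  \<open>D\<close> and on the orthogonal complement, which is stable under scalars because
  \<open>D\<close> is.\<close>

lemma semilinear_extension:
  fixes A :: "'a::chilbert_space \<Rightarrow>\<^sub>L 'b::chilbert_space"
  assumes "\<And>c d. d \<in> D \<Longrightarrow> c *\<^sub>C d \<in> D" "\<And>c d. d \<in> D \<Longrightarrow> A (c *\<^sub>C d) = conj_pow s c *\<^sub>C A d"
    and "\<And>x. (\<And>d. d \<in> D \<Longrightarrow> x \<bullet> d = 0) \<Longrightarrow> A x = 0"
  shows "semilinear s A"
proof -
  have "A o\<^sub>L scale_op c id_blinfun = scale_op (conj_pow s c) id_blinfun o\<^sub>L A" for c
  proof (rule blinfun_eqI_clspan[of D])
    fix x assume x: "\<And>d. d \<in> D \<Longrightarrow> x \<bullet> d = 0"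
    have "(c *\<^sub>C x) \<bullet> d = 0" if "d \<in> D" for d
    proof -
      have "cinner d x = 0"
        by (subst cinner_eq_0_commute, rule orthogonal_cinnerI) (auto intro: x assms(1) that)
      then have "cinner d (c *\<^sub>C x) = 0" by (simp add: cinner_scaleC_right)
      then show ?thesis by (metis Re_cinner inner_commute zero_complex.simps(1))
    qed
    then show "(A o\<^sub>L scale_op c id_blinfun) x = (scale_op (conj_pow s c) id_blinfun o\<^sub>L A) x"
      using assms(3) x by simp
  qed (simp add: assms(2))
  then have "(A o\<^sub>L scale_op c id_blinfun) v = (scale_op (conj_pow s c) id_blinfun o\<^sub>L A) v" for c v
    by simp
  then show ?thesis by (simp add: semilinear_def)
qed

section \<open>Commutants and von Neumann algebras\<close>

text \<open>No unit is demanded, so that \<open>B K\<close> is included: its unit is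
  \<open>proj K\<close>, which differs from \<open>id_blinfun\<close> for a proper subspace.\<close>

definition star_algebra :: "'a::chilbert_space op set \<Rightarrow> bool"
  where "star_algebra N \<longleftrightarrow> N \<subseteq> Bounded_ops \<and> 0 \<in> N \<and>
    (\<forall>x\<in>N. \<forall>y\<in>N. x + y \<in> N \<and> x o\<^sub>L y \<in> N) \<and> (\<forall>x\<in>N. adj x \<in> N \<and> (\<forall>c. scale_op c x \<in> N))"

lemma star_algebraD:
  assumes "star_algebra N"
  shows "x \<in> N \<Longrightarrow> x \<in> Bounded_ops" "0 \<in> N"
    "x \<in> N \<Longrightarrow> y \<in> N \<Longrightarrow> x + y \<in> N" "x \<in> N \<Longrightarrow> y \<in> N \<Longrightarrow> x o\<^sub>L y \<in> N"
    "x \<in> N \<Longrightarrow> adj x \<in> N" "x \<in> N \<Longrightarrow> scale_op c x \<in> N" "x \<in> N \<Longrightarrow> - x \<in> N"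
    "x \<in> N \<Longrightarrow> y \<in> N \<Longrightarrow> x - y \<in> N" "x \<in> N \<Longrightarrow> r *\<^sub>R x \<in> N"
proof -
  show a: "x \<in> N \<Longrightarrow> x \<in> Bounded_ops" "0 \<in> N"
    "x \<in> N \<Longrightarrow> y \<in> N \<Longrightarrow> x + y \<in> N" "x \<in> N \<Longrightarrow> y \<in> N \<Longrightarrow> x o\<^sub>L y \<in> N"
    "x \<in> N \<Longrightarrow> adj x \<in> N" "x \<in> N \<Longrightarrow> scale_op c x \<in> N" for x y c
    using assms by (auto simp: star_algebra_def)
  show m: "x \<in> N \<Longrightarrow> - x \<in> N" for x using a(6)[of x "-1"] by simp
  show "x \<in> N \<Longrightarrow> y \<in> N \<Longrightarrow> x - y \<in> N" using a(3)[of x "- y"] m by simp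
  show "x \<in> N \<Longrightarrow> r *\<^sub>R x \<in> N" using a(6)[of x "of_real r"] by (simp add: scale_op_of_real)
qed

lemma commutant_iff: "x \<in> commutant S \<longleftrightarrow> x \<in> Bounded_ops \<and> (\<forall>y\<in>S. x o\<^sub>L y = y o\<^sub>L x)"
  by (simp add: commutant_def)

lemma commutantD:
  fixes x y :: "'a::chilbert_space op"
  assumes "x \<in> commutant S"
  shows "x \<in> Bounded_ops" "y \<in> S \<Longrightarrow> x o\<^sub>L y = y o\<^sub>L x" "y \<in> S \<Longrightarrow> x (y v) = y (x v)"
proof -
  show "x \<in> Bounded_ops" and c: "y \<in> S \<Longrightarrow> x o\<^sub>L y = y o\<^sub>L x"
    using assms by (auto simp: commutant_def)
  show "y \<in> S \<Longrightarrow> x (y v) = y (x v)" using c by (metis blinfun_apply_blinfun_compose)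
qed

lemma commutantI:
  "x \<in> Bounded_ops \<Longrightarrow> (\<And>y v. y \<in> S \<Longrightarrow> x (blinfun_apply y v) = y (x v)) \<Longrightarrow> x \<in> commutant S"
  for x :: "'a::chilbert_space op"
  by (auto simp: commutant_def intro!: blinfun_eqI)

lemma commutant_mono: "S \<subseteq> T \<Longrightarrow> commutant T \<subseteq> commutant S"
  by (auto simp: commutant_def)

lemma commutant_subset_Bounded: "commutant S \<subseteq> Bounded_ops"
  by (auto simp: commutant_def)

lemma subset_bicommutant: "S \<subseteq> Bounded_ops \<Longrightarrow> S \<subseteq> commutant (commutant S)"
  by (auto simp: commutant_def)

lemma tricommutant: "S \<subseteq> Bounded_ops \<Longrightarrow> commutant (commutant (commutant S)) = commutant S"
  by (simp add: commutant_mono commutant_subset_Bounded subset_antisym subset_bicommutant)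

lemma commutant_adj:
  assumes "\<And>y. y \<in> S \<Longrightarrow> adj y \<in> S" "x \<in> commutant S"
  shows "adj x \<in> commutant S"
proof -
  have "adj x o\<^sub>L y = y o\<^sub>L adj x" if "y \<in> S" for y
  proof -
    have "adj (x o\<^sub>L adj y) = adj (adj y o\<^sub>L x)" using assms that by (simp add: commutant_def)
    then show ?thesis by simp
  qed
  then show ?thesis using assms(2) by (simp add: commutant_def)
qed

lemma star_algebra_commutant:
  assumes "S \<subseteq> Bounded_ops" "\<And>y. y \<in> S \<Longrightarrow> adj y \<in> S"
  shows "star_algebra (commutant S)"
proof -
  have "x o\<^sub>L y \<in> commutant S" if "x \<in> commutant S" "y \<in> commutant S" for x y
    using that by (intro commutantI) (auto simp: commutantD)
  moreover have "x + y \<in> commutant S" if "x \<in> commutant S" "y \<in> commutant S" for x y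
    using that by (auto simp: commutant_iff compose_distribs)
  moreover have "scale_op c x \<in> commutant S" if "x \<in> commutant S" for c x
    using that assms(1) by (auto simp: commutant_iff subset_iff)
  ultimately show ?thesis
    using assms commutant_adj[of S] by (auto simp: star_algebra_def commutant_iff[of 0] commutantD)
qed

lemma id_commutant [simp]: "id_blinfun \<in> commutant S"
  by (simp add: commutant_iff)

lemma von_neumann_algebra_commutant:
  assumes "S \<subseteq> Bounded_ops" "\<And>y. y \<in> S \<Longrightarrow> adj y \<in> S"
  shows "von_neumann_algebra (commutant S)"
  using assms commutant_adj[of S] tricommutant[of S]
  by (auto simp: von_neumann_algebra_def commutant_subset_Bounded)

lemma von_neumann_algebraD:
  assumes "von_neumann_algebra N"
  shows "star_algebra N" "id_blinfun \<in> N" "commutant (commutant N) = N" "star_algebra (commutant N)"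
proof -
  have N: "N \<subseteq> Bounded_ops" "\<And>x. x \<in> N \<Longrightarrow> adj x \<in> N" "commutant (commutant N) = N"
    using assms by (auto simp: von_neumann_algebra_def)
  show "commutant (commutant N) = N" by fact
  show "star_algebra (commutant N)" using N by (intro star_algebra_commutant)
  then have "star_algebra (commutant (commutant N))"
    by (intro star_algebra_commutant) (auto simp: star_algebraD)
  then show "star_algebra N" using N by simp
  have "id_blinfun \<in> commutant (commutant N)" by simp
  then show "id_blinfun \<in> N" using N by simp
qed

section \<open>Star isomorphisms\<close>

lemma star_isoD:
  assumes "star_iso s M N \<phi>"
  shows "bij_betw \<phi> M N" "inj_on \<phi> M" "\<phi> ` M = N" "x \<in> M \<Longrightarrow> \<phi> x \<in> N"
    "x \<in> M \<Longrightarrow> y \<in> M \<Longrightarrow> \<phi> (x + y) = \<phi> x + \<phi> y"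
    "x \<in> M \<Longrightarrow> y \<in> M \<Longrightarrow> \<phi> (x o\<^sub>L y) = \<phi> x o\<^sub>L \<phi> y"
    "x \<in> M \<Longrightarrow> \<phi> (adj x) = adj (\<phi> x)"
    "x \<in> M \<Longrightarrow> \<phi> (scale_op c x) = scale_op (conj_pow s c) (\<phi> x)"
  using assms by (auto simp: star_iso_def bij_betw_def)

lemma star_iso_more:
  assumes "star_iso s M N \<phi>" "star_algebra M"
  shows "\<phi> 0 = 0" "x \<in> M \<Longrightarrow> \<phi> (- x) = - \<phi> x" "x \<in> M \<Longrightarrow> y \<in> M \<Longrightarrow> \<phi> (x - y) = \<phi> x - \<phi> y"
    "x \<in> M \<Longrightarrow> \<phi> x = 0 \<longleftrightarrow> x = 0"
proof -
  note iso = star_isoD[OF assms(1)] and alg = star_algebraD[OF assms(2)]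
  show z: "\<phi> 0 = 0" using iso(8)[OF alg(2), of 0] by simp
  show m: "\<phi> (- x) = - \<phi> x" if "x \<in> M" for x using iso(8)[OF that, of "-1"] by simp
  show "\<phi> (x - y) = \<phi> x - \<phi> y" if "x \<in> M" "y \<in> M"
    using iso(5)[of x "- y"] that m alg by simp
  show "x \<in> M \<Longrightarrow> \<phi> x = 0 \<longleftrightarrow> x = 0" using inj_onD[OF iso(2), of x 0] z alg by auto
qed

lemma star_iso_id_blinfun:
  assumes "star_iso s M N \<phi>" "id_blinfun \<in> M" "id_blinfun \<in> N" 
  shows "\<phi> id_blinfun = id_blinfun"
proof -
  note iso = star_isoD[OF assms(1)]
  obtain x where x: "x \<in> M" "\<phi> x = id_blinfun" using iso(3) assms(3) by force
  have "\<phi> id_blinfun = \<phi> id_blinfun o\<^sub>L \<phi> x" by (simp add: x)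
  also have "\<dots> = \<phi> (id_blinfun o\<^sub>L x)" using iso(6)[OF assms(2) x(1)] by (simp only:)
  finally show ?thesis by (simp add: x)
qed

lemma star_iso_compose:
  assumes "star_iso s M N \<phi>" "star_iso r N P \<psi>"
  shows "star_iso (r + s) M P (\<psi> \<circ> \<phi>)"
  using assms star_isoD(4)[OF assms(1)]
  by (auto simp: star_iso_def conj_pow_add intro: bij_betw_trans)

lemma star_iso_cong:
  assumes "star_iso s M N \<phi>" "star_algebra M" "\<And>x. x \<in> M \<Longrightarrow> \<psi> x = \<phi> x"
  shows "star_iso s M N \<psi>"
proof -
  have "bij_betw \<psi> M N" using star_isoD(1)[OF assms(1)] assms(3) by (simp cong: bij_betw_cong)
  then show ?thesis using assms star_algebraD[OF assms(2)] by (simp add: star_iso_def)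
qed

lemma star_iso_inv:
  assumes "star_iso s M N \<phi>" "star_algebra M"
  shows "star_iso s N M (inv_into M \<phi>)"
proof -
  note iso = star_isoD[OF assms(1)] and alg = star_algebraD[OF assms(2)]
  have inv: "inv_into M \<phi> y = x" if "x \<in> M" "\<phi> x = y" for x y
    using that iso(2) by auto
  have "bij_betw (inv_into M \<phi>) N M" using iso(1) by (rule bij_betw_inv_into)
  moreover have "inv_into M \<phi> (x + y) = inv_into M \<phi> x + inv_into M \<phi> y \<and>
      inv_into M \<phi> (x o\<^sub>L y) = inv_into M \<phi> x o\<^sub>L inv_into M \<phi> y" if xy: "x \<in> N" "y \<in> N" for x y
  proof -
    obtain a b where ab: "a \<in> M" "\<phi> a = x" "b \<in> M" "\<phi> b = y" using iso(3) xy by auto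
    then have "inv_into M \<phi> (x + y) = a + b" "inv_into M \<phi> (x o\<^sub>L y) = a o\<^sub>L b"
      by (auto intro!: inv simp: iso alg)
    then show ?thesis by (simp add: inv[OF ab(1,2)] inv[OF ab(3,4)])
  qed
  moreover have "inv_into M \<phi> (adj x) = adj (inv_into M \<phi> x) \<and>
      inv_into M \<phi> (scale_op c x) = scale_op (conj_pow s c) (inv_into M \<phi> x)" if x: "x \<in> N" for x c
  proof -
    obtain a where a: "a \<in> M" "\<phi> a = x" using iso(3) x by auto
    then have "inv_into M \<phi> (adj x) = adj a"
        "inv_into M \<phi> (scale_op c x) = scale_op (conj_pow s c) a"
      by (auto intro!: inv simp: iso alg)
    then show ?thesis by (simp add: inv[OF a])
  qed
  ultimately show ?thesis by (simp add: star_iso_def)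
qed

lemma star_algebra_image:
  assumes "star_iso s M N \<phi>" "star_algebra M" "N \<subseteq> Bounded_ops"
  shows "star_algebra N"
proof -
  note iso = star_isoD[OF assms(1)] and alg = star_algebraD[OF assms(2)]
  have N: "N = \<phi> ` M" using iso by simp
  have "scale_op c (\<phi> x) \<in> \<phi> ` M" if "x \<in> M" for c x
    using that iso(8)[of x "conj_pow s c"] alg by (metis conj_pow_arith(8) imageI)
  moreover have "\<phi> x + \<phi> y \<in> \<phi> ` M" "\<phi> x o\<^sub>L \<phi> y \<in> \<phi> ` M" if "x \<in> M" "y \<in> M" for x y
    using that imageI[of "x + y" M \<phi>] imageI[of "x o\<^sub>L y" M \<phi>] by (simp_all add: iso alg)
  moreover have "adj (\<phi> x) \<in> \<phi> ` M" if "x \<in> M" for x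
    using that imageI[of "adj x" M \<phi>] by (simp add: iso alg)
  moreover have "0 \<in> \<phi> ` M" using star_iso_more(1)[OF assms(1,2)] alg(2) by force
  ultimately show ?thesis using assms(3) unfolding star_algebra_def N by blast
qed

definition unitary_op :: "bit \<Rightarrow> 'a::chilbert_space op \<Rightarrow> bool"
  where "unitary_op s V \<longleftrightarrow> semilinear s V \<and> adj V o\<^sub>L V = id_blinfun \<and> V o\<^sub>L adj V = id_blinfun"

lemma unitary_opD:
  assumes "unitary_op s V"
  shows "semilinear s V" "adj V o\<^sub>L V = id_blinfun" "V o\<^sub>L adj V = id_blinfun"
    "adj V (V v) = v" "V (adj V v) = v"
proof -
  show a: "semilinear s V" "adj V o\<^sub>L V = id_blinfun" "V o\<^sub>L adj V = id_blinfun"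
    using assms by (auto simp: unitary_op_def)
  show "adj V (V v) = v" "V (adj V v) = v"
    using compose_eqD[OF a(2), of v] compose_eqD[OF a(3), of v] by simp_all
qed

text \<open>The last hypothesis expresses density of the range. It suffices because the fixed points
  of \<open>V\<close> after \<open>adj V\<close> form a closed subspace containing the
  range.\<close>

lemma unitary_opI:
  fixes V :: "'a::chilbert_space op"
  assumes "semilinear s V" "\<And>x y. V x \<bullet> V y = x \<bullet> y" "\<And>D. \<lbrakk>closed D; subspace D; range V \<subseteq> D\<rbrakk> \<Longrightarrow> D = UNIV"
  shows "unitary_op s V"
proof -
  have 1: "adj V o\<^sub>L V = id_blinfun"
    by (rule blinfun_eqI, rule inner_eqI) (simp flip: inner_adj add: assms(2))
  have fx: "adj V (V v) = v" for v using compose_eqD[OF 1, of v] by simp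
  have "{y. V (adj V y) = y} = UNIV"
  proof (rule assms(3))
    show "closed {y. V (adj V y) = y}" by (intro closed_Collect_eq continuous_intros)
    show "subspace {y. V (adj V y) = y}"
      by (simp add: subspace_def blinfun.add_right blinfun.scaleR_right)
  qed (auto simp: fx)
  then have "V (adj V y) = y" for y by blast
  then have "V o\<^sub>L adj V = id_blinfun" by (intro blinfun_eqI) simp
  then show ?thesis using assms(1) 1 by (simp add: unitary_op_def)
qed

lemma Ad_apply [simp]: "Ad V x v = V (x (adj V v))"
  by (simp add: Ad_def)

lemma Ad_Bounded: "semilinear s V \<Longrightarrow> x \<in> Bounded_ops \<Longrightarrow> Ad V x \<in> Bounded_ops"
  using semilinear_adj[of s V] by (simp add: Bounded_ops_def semilinear_def)

lemma Ad_intertwine: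
  assumes V: "unitary_op s V"
  shows "Ad V x = y \<longleftrightarrow> V o\<^sub>L x = y o\<^sub>L V"
proof
  show "V o\<^sub>L x = y o\<^sub>L V" if "Ad V x = y"
    by (rule blinfun_eqI) (simp flip: that add: unitary_opD[OF V])
  show "Ad V x = y" if "V o\<^sub>L x = y o\<^sub>L V"
    by (simp add: Ad_def that compose_assoc unitary_opD(3)[OF V])
qed

lemma Ad_adj: "Ad V (adj x) = adj (Ad V x)"
  by (simp add: Ad_def compose_assoc)

lemma Ad_add: "Ad V (x + y) = Ad V x + Ad V y"
  by (simp add: Ad_def compose_distribs)

lemma Ad_compose: "adj V o\<^sub>L V = id_blinfun \<Longrightarrow> Ad V (x o\<^sub>L y) = Ad V x o\<^sub>L Ad V y"
  by (rule blinfun_eqI) (simp add: compose_eqD[of "adj V" V id_blinfun])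

lemma Ad_scale: "semilinear s V \<Longrightarrow> Ad V (scale_op c x) = scale_op (conj_pow s c) (Ad V x)"
  by (rule blinfun_eqI) (simp add: semilinearD)

lemma unitary_op_adj: "unitary_op s V \<Longrightarrow> unitary_op s (adj V)"
  by (simp add: unitary_op_def semilinear_adj)

lemma unitary_op_compose:
  assumes "unitary_op r V" "unitary_op s W"
  shows "unitary_op (r + s) (V o\<^sub>L W)"
proof -
  note V = unitary_opD[OF assms(1)] and W = unitary_opD[OF assms(2)]
  have "adj (V o\<^sub>L W) o\<^sub>L (V o\<^sub>L W) = id_blinfun" "(V o\<^sub>L W) o\<^sub>L adj (V o\<^sub>L W) = id_blinfun"
    by (auto intro!: blinfun_eqI simp: V W)
  then show ?thesis using semilinear_compose V W by (auto simp: unitary_op_def)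
qed

lemma star_iso_Ad:
  assumes V: "unitary_op s V" and "M \<subseteq> Bounded_ops" "Ad V ` M \<subseteq> M" "Ad (adj V) ` M \<subseteq> M"
  shows "star_iso s M M (Ad V)"
proof -
  note V' = unitary_opD[OF V]
  have 1: "Ad (adj V) (Ad V x) = x" "Ad V (Ad (adj V) x) = x" for x
    by (rule blinfun_eqI, simp add: V')+
  have "bij_betw (Ad V) M M"
    using assms(3,4) 1 by (intro bij_betw_byWitness[of _ "Ad (adj V)"]) auto
  then show ?thesis
    by (auto simp: star_iso_def Ad_add Ad_adj Ad_compose[OF V'(2)] Ad_scale[OF V'(1)])
qed

lemma sa_unitaryD:
  assumes "sa_unitary u"
  shows "u \<in> Bounded_ops" "adj u = u" "u o\<^sub>L u = id_blinfun" "u (u v) = v" "unitary_op 0 u"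
proof -
  show a: "u \<in> Bounded_ops" "adj u = u" "u o\<^sub>L u = id_blinfun"
    using assms by (auto simp: sa_unitary_def)
  show "u (u v) = v" using compose_eqD[OF a(3), of v] by simp
  show "unitary_op 0 u" using a by (simp add: unitary_op_def Bounded_ops_iff)
qed

lemma projection_opD:
  assumes "projection_op e"
  shows "e \<in> Bounded_ops" "adj e = e" "e o\<^sub>L e = e" "e (e v) = e v"
proof -
  show a: "e \<in> Bounded_ops" "adj e = e" "e o\<^sub>L e = e"
    using assms by (auto simp: projection_op_def)
  show "e (e v) = e v" using compose_eqD[OF a(3)] .
qed

section \<open>Conjugations\<close>

text \<open>
  A maximal set of vectors with real inner products is the real subspace fixed by the conjugation.
\<close>

lemma conjugation_exists:
  fixes L :: "'a::chilbert_space set"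
  assumes L: "closed_csubspace L"
  obtains J :: "'a op" where "semilinear 1 J" "\<And>x. x \<in> L \<Longrightarrow> J x \<in> L" "\<And>x. x \<in> L \<Longrightarrow> J (J x) = x"
    "\<And>x y. x \<in> L \<Longrightarrow> y \<in> L \<Longrightarrow> cinner (J x) (J y) = cnj (cinner x y)"
proof -
  note L' = closed_csubspaceD[OF L]
  let ?A = "{S. S \<subseteq> L \<and> (\<forall>u\<in>S. \<forall>v\<in>S. Im (cinner u v) = 0)}"
  have "\<exists>S\<in>?A. \<forall>X\<in>?A. S \<subseteq> X \<longrightarrow> X = S"
  proof (rule subset_Zorn')
    fix C assume C: "subset.chain ?A C"
    have "Im (cinner u v) = 0" if uv: "u \<in> X" "v \<in> Y" "X \<in> C" "Y \<in> C" for u v X Y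
    proof -
      have "X \<subseteq> Y \<or> Y \<subseteq> X" using C uv by (simp add: subset_chain_def)
      then obtain Z where "Z \<in> C" "u \<in> Z" "v \<in> Z" using uv by blast
      moreover from this have "Z \<in> ?A" using C by (auto simp: subset_chain_def)
      ultimately show ?thesis by blast
    qed
    moreover have "\<Union> C \<subseteq> L" using C by (auto simp: subset_chain_def)
    ultimately show "\<Union> C \<in> ?A" by blast
  qed
  then obtain S where S0: "S \<in> ?A" and max0: "\<forall>X\<in>?A. S \<subseteq> X \<longrightarrow> X = S" by (rule bexE)
  then have S: "S \<subseteq> L" "\<And>u v. u \<in> S \<Longrightarrow> v \<in> S \<Longrightarrow> Im (cinner u v) = 0" by auto
  \<comment> \<open>Complex multiples of vectors of \<open>S\<close>; the conjugation is to
    conjugate the coefficient and keep the vector.\<close>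
  define I where "I = (UNIV :: complex set) \<times> S"
  define d where "d = (\<lambda>(c, s :: 'a). c *\<^sub>C s)"
  define f where "f = (\<lambda>(c, s :: 'a). cnj c *\<^sub>C s)"
  have "f i \<bullet> f j = d i \<bullet> d j" if "i \<in> I" "j \<in> I" for i j
  proof -
    obtain c s c' s' where ij: "i = (c, s)" "j = (c', s')" by (cases i; cases j)
    then have "Im (cinner s s') = 0" using that S by (simp add: I_def)
    then show ?thesis
      by (simp flip: Re_cinner add: ij d_def f_def cinner_scaleC_left cinner_scaleC_right)
  qed
  then obtain J :: "'a op" where J: "\<And>i. i \<in> I \<Longrightarrow> J (d i) = f i"
    "\<And>x. (\<And>i. i \<in> I \<Longrightarrow> x \<bullet> d i = 0) \<Longrightarrow> J x = 0"
    "\<And>x y. x \<in> clspan (d ` I) \<Longrightarrow> y \<in> clspan (d ` I) \<Longrightarrow> J x \<bullet> J y = x \<bullet> y"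
    using isometry_extension[of I f d] by blast
  have dI: "c *\<^sub>C x \<in> d ` I" if "x \<in> d ` I" for c x
    using that by (force simp: d_def I_def scaleC_scaleC image_iff)
  have dL: "d ` I \<subseteq> L" using S(1) L'(3) by (auto simp: d_def I_def)
  have sl: "semilinear 1 J"
  proof (rule semilinear_extension[of "d ` I"])
    fix c x assume "x \<in> d ` I"
    then obtain b s where x: "(b, s) \<in> I" "x = b *\<^sub>C s" by (auto simp: d_def)
    then have "J (d (c * b, s)) = f (c * b, s)" "J (d (b, s)) = f (b, s)"
      by (intro J(1), simp add: I_def)+
    then show "J (c *\<^sub>C x) = conj_pow 1 c *\<^sub>C J x"
      by (simp add: x d_def f_def scaleC_scaleC)
  qed (auto intro: dI J(2))
  have eq: "clspan (d ` I) = L"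
  proof (rule antisym)
    show "clspan (d ` I) \<subseteq> L" using dL L' by (intro clspan_minimal)
    show "L \<subseteq> clspan (d ` I)"
    proof
      fix x assume x: "x \<in> L"
      define v where "v = x - proj (clspan (d ` I)) x"
      have vL: "v \<in> L" unfolding v_def
        using x proj_in[of "clspan (d ` I)" x] \<open>clspan (d ` I) \<subseteq> L\<close> L'(2)
        by (auto intro: subspace_diff)
      have "cinner s v = 0" if "s \<in> S" for s
      proof -
        have "s \<in> clspan (d ` I)" using that
          by (intro clspan_base) (force simp: d_def I_def image_iff intro: exI[of _ 1])
        then show ?thesis unfolding v_def
          by (rule proj_cinner[OF closed_csubspace_clspan, rotated]) (rule dI)
      qed
      then have "cinner s v = 0" "cinner v s = 0" if "s \<in> S" for s
        using that cinner_eq_0_commute by blast+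
      \<comment> \<open>The component of \<open>x\<close> orthogonal to the span has inner product 0
        with \<open>S\<close> and a real one with itself, so maximality puts it into
        \<open>S\<close> and it vanishes.\<close>
      then have "insert v S \<in> ?A" using S vL by (auto simp: cinner_self)
      then have "insert v S = S" using bspec[OF max0, of "insert v S"] by (simp only: subset_insertI)
      then have "v \<in> S" by blast
      then have "v = 0" using \<open>\<And>s. s \<in> S \<Longrightarrow> cinner s v = 0\<close> cinner_self_eq_0 by blast
      then have "proj (clspan (d ` I)) x = x" by (simp add: v_def)
      moreover have "proj (clspan (d ` I)) x \<in> clspan (d ` I)" by (rule proj_in) simp_all
      ultimately show "x \<in> clspan (d ` I)" by simp
    qed
  qed
  have JL: "J x \<in> L \<and> J (J x) = x" if "x \<in> L" for x
    using that[folded eq]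
  proof (rule clspan_induct)
    fix y assume "y \<in> d ` I"
    then obtain c s where y: "s \<in> S" "y = c *\<^sub>C s" by (auto simp: d_def I_def)
    then have "J (d (c, s)) = f (c, s)" "J (d (cnj c, s)) = f (cnj c, s)"
      by (intro J(1), simp add: I_def)+
    then show "J y \<in> L \<and> J (J y) = y" using S(1) L' y by (auto simp: d_def f_def)
  next
    \<comment> \<open>Membership in \<open>L\<close> is rewritten as an equation between operators,
      so that the solution set is visibly a closed subspace.\<close>
    have "J -` L = {x. proj L (J x) = J x}"
      using proj_range[OF L] proj_fix[OF L] by auto (metis proj_range[OF L])
    then have "{x. J x \<in> L \<and> J (J x) = x} = {x. (proj L o\<^sub>L J) x = J x} \<inter> {x. (J o\<^sub>L J) x = id_blinfun x}"
      by auto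
    then show "subspace {x. J x \<in> L \<and> J (J x) = x}" "closed {x. J x \<in> L \<and> J (J x) = x}"
      using subspace_eq_blinfun[of "proj L o\<^sub>L J" J] subspace_eq_blinfun[of "J o\<^sub>L J" id_blinfun]
        closed_eq_blinfun[of "proj L o\<^sub>L J" J] closed_eq_blinfun[of "J o\<^sub>L J" id_blinfun]
      by (simp_all add: subspace_inter closed_Int del: blinfun_apply_blinfun_compose id_blinfun.rep_eq)
  qed
  have "cinner (J x) (J y) = cnj (cinner x y)" if xy: "x \<in> L" "y \<in> L" for x y
  proof -
    have re: "J u \<bullet> J v = u \<bullet> v" if "u \<in> L" "v \<in> L" for u v using J(3) that unfolding eq by blast
    have "(\<i> *\<^sub>C J x) \<bullet> J y = J ((- \<i>) *\<^sub>C x) \<bullet> J y" by (simp only: semilinearD[OF sl]) simp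
    also have "\<dots> = ((- \<i>) *\<^sub>C x) \<bullet> y" by (intro re L'(3) xy)
    finally show ?thesis using re[OF xy]
      by (simp add: complex_eq_iff Re_cinner Im_cinner)
  qed
  then show thesis using that sl JL by blast
qed

section \<open>Minimal projections\<close>

text \<open>The last clause says that \<open>e\<close> has central support 1. Together with the
  scalar corner it forces a trivial center (\<open>commuting_scalar\<close>), so that unital
  \<open>N\<close> is a factor with minimal projection \<open>e\<close>.\<close>

definition minimal_full :: "'a::chilbert_space op set \<Rightarrow> 'a op \<Rightarrow> bool"
  where "minimal_full N e \<longleftrightarrow> e \<in> N \<and> projection_op e \<and> e \<noteq> 0 \<and>
    (\<forall>x\<in>N. \<exists>c. e o\<^sub>L (x o\<^sub>L e) = scale_op c e) \<and>
    (\<forall>x\<in>N. (\<forall>a\<in>N. x o\<^sub>L (a o\<^sub>L e) = 0) \<longrightarrow> x = 0)"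

locale corner =
  fixes N :: "'a::chilbert_space op set" and e :: "'a op"
  assumes alg: "star_algebra N" and mf: "minimal_full N e"
begin

lemmas algD = star_algebraD[OF alg]

lemma eD: "e \<in> N" "e \<in> Bounded_ops" "adj e = e" "e o\<^sub>L e = e" "e \<noteq> 0" "e (e v) = e v"
  using mf projection_opD[of e] by (auto simp: minimal_full_def)

lemma scalar: "x \<in> N \<Longrightarrow> \<exists>c. e o\<^sub>L (x o\<^sub>L e) = scale_op c e"
  using mf by (auto simp: minimal_full_def)

lemma full: "x \<in> N \<Longrightarrow> (\<And>a. a \<in> N \<Longrightarrow> x o\<^sub>L (a o\<^sub>L e) = 0) \<Longrightarrow> x = 0"
  using mf by (auto simp: minimal_full_def)

lemma ex_unit: "\<exists>u. e u = u \<and> norm u = 1"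
proof -
  obtain v where v: "e v \<noteq> 0" using eD(5) blinfun_eqI[of e 0] by force
  then show ?thesis
    by (intro exI[of _ "(1 / norm (e v)) *\<^sub>R e v"]) (simp add: blinfun.scaleR_right eD)
qed

text \<open>\<open>adj y o\<^sub>L y\<close> lies in the corner of \<open>e\<close>; its scalar is
  read off at a unit vector of the range, where it is a squared norm.\<close>

lemma scalar_adj_self:
  assumes "y \<in> N" "y o\<^sub>L e = y"
  shows "\<exists>k\<ge>0. adj y o\<^sub>L y = k *\<^sub>R e \<and> (k = 0 \<longrightarrow> y = 0)"
proof -
  have ye: "y (e v) = y v" "e (adj y v) = adj y v" for v
    using compose_eqD[OF assms(2)] compose_eqD[of e "adj y" "adj y"] assms(2)
    by (metis adj_compose eD(3))+
  obtain c where c: "e o\<^sub>L ((adj y o\<^sub>L y) o\<^sub>L e) = scale_op c e"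
    using scalar[of "adj y o\<^sub>L y"] assms algD by auto
  have "e o\<^sub>L ((adj y o\<^sub>L y) o\<^sub>L e) = adj y o\<^sub>L y" by (rule blinfun_eqI) (simp add: ye)
  with c have yy: "adj y o\<^sub>L y = scale_op c e" by simp
  obtain u where u: "e u = u" "norm u = 1" using ex_unit by blast
  have "cinner (y u) (y u) = cinner u ((adj y o\<^sub>L y) u)"
    using assms algD by (simp add: cinner_adj)
  also have "\<dots> = c" by (simp add: yy u cinner_scaleC_right cinner_self)
  finally have c': "c = of_real ((norm (y u))\<^sup>2)" by (simp add: cinner_self)
  show ?thesis
  proof (intro exI[of _ "(norm (y u))\<^sup>2"] conjI impI)
    show "adj y o\<^sub>L y = (norm (y u))\<^sup>2 *\<^sub>R e" by (simp only: yy c' scale_op_of_real)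
    show "y = 0" if "(norm (y u))\<^sup>2 = 0"
      using yy that by (simp add: c' adj_compose_eq_0_iff)
  qed simp
qed

lemma normalise:
  assumes "y \<in> N" "y o\<^sub>L e = y" "y \<noteq> 0"
  shows "\<exists>r>0. adj (r *\<^sub>R y) o\<^sub>L (r *\<^sub>R y) = e"
proof -
  obtain k where k: "k \<ge> 0" "adj y o\<^sub>L y = k *\<^sub>R e" "k = 0 \<longrightarrow> y = 0"
    using scalar_adj_self assms by blast
  then have "k > 0" using assms(3) by force
  then show ?thesis using k(2)
    by (intro exI[of _ "1 / sqrt k"]) (simp add: compose_distribs)
qed

lemma isometry_e:
  assumes "w \<in> N" "adj w o\<^sub>L w = e"
  shows "w o\<^sub>L e = w" "e o\<^sub>L adj w = adj w" "w (e v) = w v" "e (adj w v) = adj w v" "adj w (w v) = e v"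
proof -
  \<comment> \<open>The difference between \<open>w\<close> and \<open>w o\<^sub>L e\<close> has
    zero square in the sense of \<open>adj_compose_eq_0_iff\<close>.\<close>
  have "adj (w - (w o\<^sub>L e)) o\<^sub>L (w - (w o\<^sub>L e)) = 0"
    using compose_eqD[OF assms(2)]
    by (intro blinfun_eqI) (simp add: blinfun.diff_left blinfun.diff_right eD)
  then have "w - (w o\<^sub>L e) = 0" by (simp only: adj_compose_eq_0_iff)
  then show 1: "w o\<^sub>L e = w" by simp
  then have "adj (w o\<^sub>L e) = adj w" by simp
  then show 2: "e o\<^sub>L adj w = adj w" by (simp add: eD)
  show "w (e v) = w v" "e (adj w v) = adj w v" "adj w (w v) = e v"
    using compose_eqD[OF 1] compose_eqD[OF 2] compose_eqD[OF assms(2)] by auto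
qed

text \<open>Conjugation by \<open>w\<close> carries the corner of \<open>e\<close> to the corner of
  its final projection, and fullness is transferred by multiplying with
  \<open>adj w\<close>.\<close>

lemma isometry_minimal_full:
  assumes w: "w \<in> N" "adj w o\<^sub>L w = e"
  shows "minimal_full N (w o\<^sub>L adj w)"
proof -
  note we = isometry_e[OF w]
  have pr: "projection_op (w o\<^sub>L adj w)"
  proof -
    have "(w o\<^sub>L adj w) o\<^sub>L (w o\<^sub>L adj w) = w o\<^sub>L adj w" by (rule blinfun_eqI) (simp add: we)
    then show ?thesis using w(1) by (simp add: projection_op_def algD)
  qed
  have nz: "w o\<^sub>L adj w \<noteq> 0"
  proof
    assume "w o\<^sub>L adj w = 0"
    then have "adj w = 0" using adj_compose_eq_0_iff[of "adj w"] by simp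
    then show False using w eD by simp
  qed
  have sc: "\<exists>c. (w o\<^sub>L adj w) o\<^sub>L (x o\<^sub>L (w o\<^sub>L adj w)) = scale_op c (w o\<^sub>L adj w)" if "x \<in> N" for x
  proof -
    obtain c where c: "e o\<^sub>L ((adj w o\<^sub>L (x o\<^sub>L w)) o\<^sub>L e) = scale_op c e"
      using scalar[of "adj w o\<^sub>L (x o\<^sub>L w)"] w \<open>x \<in> N\<close> algD by auto
    have c': "adj w (x (w v)) = c *\<^sub>C e v" for v using compose_eqD[OF c, of v] by (simp add: we)
    show ?thesis using w algD
      by (intro exI[of _ c] blinfun_eqI) (simp add: c' we Bounded_opsD)
  qed
  have fl: "x = 0" if x: "x \<in> N" "\<And>a. a \<in> N \<Longrightarrow> x o\<^sub>L (a o\<^sub>L (w o\<^sub>L adj w)) = 0" for x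
  proof (rule full[OF x(1)])
    fix a assume "a \<in> N"
    then have "x o\<^sub>L ((a o\<^sub>L adj w) o\<^sub>L (w o\<^sub>L adj w)) = 0" using x w algD by auto
    then have "x (a (adj w (w (adj w v)))) = 0" for v
      using compose_eqD[of x "(a o\<^sub>L adj w) o\<^sub>L (w o\<^sub>L adj w)" 0 v] by simp
    from this[of "w v" for v] show "x o\<^sub>L (a o\<^sub>L e) = 0"
      by (intro blinfun_eqI) (simp add: we)
  qed
  show ?thesis unfolding minimal_full_def using pr nz sc fl w algD by auto
qed

text \<open>Fullness of \<open>e\<close> gives a nonzero element \<open>f a e\<close>. Normalised,
  it is a partial isometry starting at \<open>e\<close>; minimality of \<open>f\<close> makes its
  final projection a multiple of \<open>f\<close>, and idempotence leaves only the multiple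
  1.\<close>

lemma equivalent_minimal:
  assumes "minimal_full N f"
  shows "\<exists>w\<in>N. adj w o\<^sub>L w = e \<and> w o\<^sub>L adj w = f"
proof -
  interpret f: corner N f using alg assms by unfold_locales
  obtain a where a: "a \<in> N" "f o\<^sub>L (a o\<^sub>L e) \<noteq> 0" using full[OF f.eD(1)] f.eD(5) by blast
  define y where "y = f o\<^sub>L (a o\<^sub>L e)"
  have y: "y \<in> N" "y o\<^sub>L e = y" "y \<noteq> 0"
    using a algD eD f.eD by (auto simp: y_def compose_assoc)
  then obtain r :: real where r: "r > 0" "adj (r *\<^sub>R y) o\<^sub>L (r *\<^sub>R y) = e" using normalise by blast
  define w where "w = r *\<^sub>R y"
  have w: "w \<in> N" "adj w o\<^sub>L w = e" using r y algD by (simp_all add: w_def)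
  note we = isometry_e[OF w]
  have "f o\<^sub>L y = y" by (simp add: y_def f.eD flip: compose_assoc)
  then have "f o\<^sub>L w = w" by (simp add: w_def compose_distribs)
  then have fw: "f (w v) = w v" "adj w (f v) = adj w v" for v
    using compose_eqD[of f w w] compose_eqD[of "adj w" f "adj w"] by (metis adj_compose f.eD(3))+
  obtain c where "f o\<^sub>L ((w o\<^sub>L adj w) o\<^sub>L f) = scale_op c f"
    using f.scalar[of "w o\<^sub>L adj w"] w algD by auto
  moreover have "f o\<^sub>L ((w o\<^sub>L adj w) o\<^sub>L f) = w o\<^sub>L adj w" by (rule blinfun_eqI) (simp add: fw)
  ultimately have c: "w o\<^sub>L adj w = scale_op c f" by simp
  have "(w o\<^sub>L adj w) o\<^sub>L (w o\<^sub>L adj w) = w o\<^sub>L adj w" by (rule blinfun_eqI) (simp add: we)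
  then have "scale_op (c * c) f = scale_op c f" using f.eD by (simp add: c)
  then have "c * c = c" using f.eD by (simp add: scale_op_cancel)
  moreover have "c \<noteq> 0"
  proof
    assume "c = 0"
    then have "adj w = 0" using c adj_compose_eq_0_iff[of "adj w"] by simp
    then show False using w eD by simp
  qed
  ultimately have "c = 1" by simp
  then show ?thesis using c w by auto
qed

text \<open>On the range of \<open>e\<close> the element acts as the scalar of the corner; commuting
  with \<open>N\<close>, the difference from that scalar annihilates \<open>N e\<close>, and
  fullness applies.\<close>

lemma commuting_scalar:
  assumes "x \<in> Bounded_ops" "x \<in> N" "\<And>a. a \<in> N \<Longrightarrow> x o\<^sub>L a = a o\<^sub>L x" "id_blinfun \<in> N"
  shows "\<exists>c. x = scale_op c id_blinfun"
proof -
  obtain c where c: "e o\<^sub>L (x o\<^sub>L e) = scale_op c e" using scalar assms by blast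
  have xa: "x (a v) = a (x v)" if "a \<in> N" for a v using assms(3)[OF that] by (metis blinfun_apply_blinfun_compose)
  have xe: "x (e v) = c *\<^sub>C e v" for v using compose_eqD[OF c, of v] xa[OF eD(1)] by (simp add: eD)
  have "x - scale_op c id_blinfun = 0"
  proof (rule full)
    show "(x - scale_op c id_blinfun) o\<^sub>L (a o\<^sub>L e) = 0" if "a \<in> N" for a
      using that algD by (intro blinfun_eqI) (simp add: blinfun.diff_left xa xe Bounded_opsD)
  qed (use assms algD in auto)
  then show ?thesis by (intro exI[of _ c]) simp
qed

end

lemma minimal_full_iso:
  assumes \<phi>: "star_iso s N N' \<phi>" and N: "star_algebra N" "N' \<subseteq> Bounded_ops" and e: "minimal_full N e"
  shows "minimal_full N' (\<phi> e)"
proof -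
  interpret corner N e using N e by unfold_locales
  note iso = star_isoD[OF \<phi>] and iso' = star_iso_more[OF \<phi> N(1)]
  have eN: "\<phi> e \<in> N'" using iso e by (simp add: minimal_full_def)
  have "projection_op (\<phi> e)"
    using N eN iso(7)[OF eD(1)] iso(6)[OF eD(1,1)] eD by (auto simp: projection_op_def)
  moreover have "\<exists>c. \<phi> e o\<^sub>L (y o\<^sub>L \<phi> e) = scale_op c (\<phi> e)" if y: "y \<in> N'" for y
  proof -
    obtain x where x: "x \<in> N" "y = \<phi> x" using iso(3) y by auto
    obtain c where "e o\<^sub>L (x o\<^sub>L e) = scale_op c e" using scalar x by blast
    then have "\<phi> (e o\<^sub>L (x o\<^sub>L e)) = scale_op (conj_pow s c) (\<phi> e)" using iso eD by simp
    then show ?thesis using x eD algD iso by auto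
  qed
  moreover have "y = 0" if y: "y \<in> N'" "\<forall>a\<in>N'. y o\<^sub>L (a o\<^sub>L \<phi> e) = 0" for y
  proof -
    obtain x where x: "x \<in> N" "y = \<phi> x" using iso(3) y by auto
    have "x o\<^sub>L (a o\<^sub>L e) = 0" if a: "a \<in> N" for a
    proof -
      have "\<phi> (x o\<^sub>L (a o\<^sub>L e)) = \<phi> x o\<^sub>L (\<phi> a o\<^sub>L \<phi> e)" using x a eD algD iso by simp
      also have "\<dots> = 0" using y x a iso by simp
      finally show ?thesis using iso'(4) x a eD algD by simp
    qed
    then have "x = 0" using full x by blast
    then show ?thesis using x iso' by simp
  qed
  moreover have "\<phi> e \<noteq> 0" using iso'(4)[OF eD(1)] eD by simp
  ultimately show ?thesis using eN by (simp add: minimal_full_def)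
qed

lemma bicommutant_cyclic_proj:
  assumes S: "\<And>x. x \<in> S \<Longrightarrow> adj x \<in> S"
    and "\<And>c d. d \<in> D \<Longrightarrow> c *\<^sub>C d \<in> D" "\<And>x d. x \<in> S \<Longrightarrow> d \<in> D \<Longrightarrow> blinfun_apply x d \<in> clspan D"
  shows "proj (clspan D) \<in> commutant S"
proof -
  have K: "closed_csubspace (clspan D)" using assms(2) by (rule closed_csubspace_clspan)
  have inv: "x v \<in> clspan D" if "x \<in> S" "v \<in> clspan D" for x v
    using that(2)
  proof (rule clspan_induct)
    have *: "{v. x v \<in> clspan D} = {v. (proj (clspan D) o\<^sub>L x) v = x v}"
      using proj_range[OF K] proj_fix[OF K] by auto (metis proj_range[OF K])
    show "subspace {v. x v \<in> clspan D}" "closed {v. x v \<in> clspan D}"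
      unfolding * by (rule subspace_eq_blinfun closed_eq_blinfun)+
  qed (use assms(3) that in auto)
  have "proj (clspan D) o\<^sub>L x = x o\<^sub>L proj (clspan D)" if "x \<in> S" for x
    using that S by (intro proj_commute K) (auto intro: inv)
  moreover have "proj (clspan D) \<in> Bounded_ops"
    using projection_proj[OF K] by (simp add: projection_op_def)
  ultimately show ?thesis by (simp add: commutant_def)
qed

text \<open>This projection is the central support of \<open>e\<close>: the span is invariant under
  \<open>N\<close> by multiplication and under the commutant because \<open>a\<close> and
  \<open>e\<close> commute with it.\<close>

lemma cyclic_proj_central:
  fixes e :: "'a::chilbert_space op"
  assumes N: "von_neumann_algebra N" and e: "e \<in> N"
  shows "proj (clspan {blinfun_apply a (e v) | a v. a \<in> N}) \<in> center N"
proof -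
  let ?D = "{blinfun_apply a (e v) | a v. a \<in> N}"
  note N' = von_neumann_algebraD[OF N]
  note alg = star_algebraD[OF N'(1)]
  have c: "c *\<^sub>C d \<in> ?D" if d: "d \<in> ?D" for c d
  proof -
    obtain a v where "d = blinfun_apply a (e v)" "a \<in> N" using d by auto
    then show ?thesis using alg by (intro CollectI exI[of _ "scale_op c a"] exI[of _ v]) simp
  qed
  have "proj (clspan ?D) \<in> commutant N"
  proof (rule bicommutant_cyclic_proj)
    show "x d \<in> clspan ?D" if d: "x \<in> N" "d \<in> ?D" for x d
    proof -
      obtain a v where "d = blinfun_apply a (e v)" "a \<in> N" using d by auto
      then show ?thesis using alg d
        by (intro clspan_base CollectI exI[of _ "x o\<^sub>L a"] exI[of _ v]) simp
    qed
  qed (use alg c in auto)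
  moreover have "proj (clspan ?D) \<in> commutant (commutant N)"
  proof (rule bicommutant_cyclic_proj)
    show "x d \<in> clspan ?D" if d: "x \<in> commutant N" "d \<in> ?D" for x d
    proof -
      obtain a v where "d = blinfun_apply a (e v)" "a \<in> N" using d by auto
      then show ?thesis using commutantD(3)[OF d(1)] e
        by (intro clspan_base CollectI exI[of _ a] exI[of _ "x v"]) simp
    qed
  qed (use N'(4) c star_algebraD in auto)
  ultimately show ?thesis using N' by (simp add: center_def)
qed

text \<open>The complement of the central support annihilates every \<open>a o\<^sub>L e\<close>, so
  fullness makes it zero.\<close>

lemma cyclic_dense:
  fixes e :: "'a::chilbert_space op"
  assumes N: "von_neumann_algebra N" and e: "minimal_full N e"
  shows "clspan {blinfun_apply a (e v) | a v. a \<in> N} = UNIV"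
proof -
  note N' = von_neumann_algebraD[OF N]
  interpret corner N e using N' e by unfold_locales
  let ?P = "proj (clspan {blinfun_apply a (e v) | a v. a \<in> N})"
  have P: "?P \<in> N" using cyclic_proj_central[OF N eD(1)] by (simp add: center_def)
  have "id_blinfun - ?P = 0"
  proof (rule full)
    fix a assume "a \<in> N"
    then have "?P (a (e v)) = a (e v)" for v
      by (intro proj_id) (auto intro!: clspan_base)
    then show "(id_blinfun - ?P) o\<^sub>L (a o\<^sub>L e) = 0"
      by (intro blinfun_eqI) (simp add: blinfun.diff_left)
  qed (use N' P algD in auto)
  then have "?P = id_blinfun" by simp
  moreover have "?P v \<in> clspan {blinfun_apply a (e v) | a v. a \<in> N}" for v
    by (rule proj_in) simp_all
  ultimately show ?thesis by auto
qed

section \<open>Cocycles from partial isometries\<close>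

locale algebra_action = group G for G :: "('g, 'm) monoid_scheme" (structure) +
  fixes p :: "'g \<Rightarrow> bit" and N :: "'a::chilbert_space op set" and \<alpha> :: "'g \<Rightarrow> 'a op \<Rightarrow> 'a op"
  assumes p_hom: "Z2_hom G p" and N: "star_algebra N"
    and iso: "g \<in> carrier G \<Longrightarrow> star_iso (p g) N N (\<alpha> g)"
    and act: "g \<in> carrier G \<Longrightarrow> h \<in> carrier G \<Longrightarrow> x \<in> N \<Longrightarrow> \<alpha> (g \<otimes> h) x = \<alpha> g (\<alpha> h x)"
begin

lemmas NalgD = star_algebraD[OF N]
lemmas isoD = star_isoD[OF iso]
lemma act_one: "x \<in> N \<Longrightarrow> \<alpha> \<one> x = x"
  using act[of \<one> \<one> x] inj_onD[OF isoD(2)[of \<one>], of "\<alpha> \<one> x" x] isoD(4)[of \<one> x] by simp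

end

text \<open>
  For \<open>N = B(K)\<close>, \<open>\<alpha>\<^sub>g = Ad V\<^sub>g\<close> and \<open>e\<close> the projection
  onto \<open>\<complex>\<xi>\<close>, the rank one operators \<open>v\<^sub>g : \<xi> \<mapsto> V\<^sub>g \<xi>\<close>
  satisfy the following with the cocycle of \<open>V\<close>. This describes the class of
  \<open>V\<close> without reference to a representation.
\<close>

definition corner_cocycle ::
  "('g, 'm) monoid_scheme \<Rightarrow> 'a::chilbert_space op set \<Rightarrow> ('g \<Rightarrow> 'a op \<Rightarrow> 'a op) \<Rightarrow> 'a op \<Rightarrow>
    ('g \<Rightarrow> 'a op) \<Rightarrow> ('g \<Rightarrow> 'g \<Rightarrow> complex) \<Rightarrow> bool"
  where "corner_cocycle G N \<alpha> e v \<upsilon> \<longleftrightarrow>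
    (\<forall>g\<in>carrier G. v g \<in> N \<and> adj (v g) o\<^sub>L v g = e \<and> v g o\<^sub>L adj (v g) = \<alpha> g e) \<and>
    (\<forall>g\<in>carrier G. \<forall>h\<in>carrier G. \<alpha> g (v h) o\<^sub>L v g = scale_op (\<upsilon> g h) (v (g \<otimes>\<^bsub>G\<^esub> h)))"

text \<open>The cochain \<open>b\<close> is kept explicit because rescaling partial isometries by
  \<open>b\<close> realises the change of cocycle (\<open>corner_rescale\<close>).\<close>

definition cohomologous ::
  "('g, 'm) monoid_scheme \<Rightarrow> ('g \<Rightarrow> bit) \<Rightarrow> ('g \<Rightarrow> complex) \<Rightarrow> ('g \<Rightarrow> 'g \<Rightarrow> complex) \<Rightarrow>
    ('g \<Rightarrow> 'g \<Rightarrow> complex) \<Rightarrow> bool"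
  where "cohomologous G p b \<upsilon> \<omega> \<longleftrightarrow> (\<forall>g\<in>carrier G. cmod (b g) = 1) \<and>
    (\<forall>g\<in>carrier G. \<forall>h\<in>carrier G.
      \<omega> g h = \<upsilon> g h * (b g * conj_pow (p g) (b h) / b (g \<otimes>\<^bsub>G\<^esub> h)))"

lemma cocycle_class_iff:
  "\<omega> \<in> cocycle_class G p \<upsilon> \<longleftrightarrow> cocycle2 G p \<omega> \<and> (\<exists>b. cohomologous G p b \<upsilon> \<omega>)"
  by (simp add: cocycle_class_def cohomologous_def)

lemma cohomologous_trans:
  "cohomologous G p b \<upsilon> \<omega> \<Longrightarrow> cohomologous G p b' \<omega> \<rho> \<Longrightarrow> cohomologous G p (\<lambda>g. b g * b' g) \<upsilon> \<rho>"
  by (simp add: cohomologous_def norm_mult)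

lemma cohomologous_refl: "cohomologous G p (\<lambda>_. 1) \<upsilon> \<upsilon>"
  by (simp add: cohomologous_def)

lemma cohomologous_sym:
  assumes "group G" "cohomologous G p b \<upsilon> \<omega>"
  shows "cohomologous G p (\<lambda>g. inverse (b g)) \<omega> \<upsilon>"
proof -
  interpret group G by fact
  have nz: "b g \<noteq> 0" if "g \<in> carrier G" for g
    using assms(2) that by (auto simp: cohomologous_def)
  have cp: "conj_pow s (inverse z) = inverse (conj_pow s z)" for s z by (cases s) simp_all
  show ?thesis using assms(2) nz by (simp add: cohomologous_def norm_divide cp field_simps)
qed

lemma cocycle_class_cong:
  assumes "group G" "cohomologous G p b \<upsilon> \<omega>"
  shows "cocycle_class G p \<upsilon> = cocycle_class G p \<omega>"
proof -
  have "\<exists>b. cohomologous G p b \<upsilon> \<rho>" if "cohomologous G p b' \<omega> \<rho>" for \<rho> b'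
    using cohomologous_trans[OF assms(2) that] by blast
  moreover have "\<exists>b. cohomologous G p b \<omega> \<rho>" if "cohomologous G p b' \<upsilon> \<rho>" for \<rho> b'
    using cohomologous_trans[OF cohomologous_sym[OF assms] that] by blast
  ultimately show ?thesis by (auto simp: cocycle_class_iff)
qed

context algebra_action
begin

lemma corner_cocycleD:
  assumes "corner_cocycle G N \<alpha> e v \<upsilon>" "g \<in> carrier G"
  shows "v g \<in> N" "adj (v g) o\<^sub>L v g = e" "v g o\<^sub>L adj (v g) = \<alpha> g e"
    "h \<in> carrier G \<Longrightarrow> \<alpha> g (v h) o\<^sub>L v g = scale_op (\<upsilon> g h) (v (g \<otimes> h))"
  using assms by (auto simp: corner_cocycle_def)

text \<open>\<open>\<alpha> g e\<close> is again minimal and full, hence equivalent to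
  \<open>e\<close>. Both \<open>\<alpha> g (v h) o\<^sub>L v g\<close> and
  \<open>v (g \<otimes> h)\<close> lead from \<open>e\<close> to the image of \<open>e\<close> under
  \<open>g \<otimes> h\<close>, so they differ by an element of the corner, a scalar.\<close>

lemma corner_exists:
  assumes e: "minimal_full N e"
  shows "\<exists>v \<upsilon>. corner_cocycle G N \<alpha> e v \<upsilon>"
proof -
  interpret corner N e using N e by unfold_locales
  have "\<exists>w\<in>N. adj w o\<^sub>L w = e \<and> w o\<^sub>L adj w = \<alpha> g e" if "g \<in> carrier G" for g
    using equivalent_minimal[OF minimal_full_iso[OF iso N _ e]] that algD by auto
  then obtain v where v: "\<And>g. g \<in> carrier G \<Longrightarrow> v g \<in> N"
    "\<And>g. g \<in> carrier G \<Longrightarrow> adj (v g) o\<^sub>L v g = e" "\<And>g. g \<in> carrier G \<Longrightarrow> v g o\<^sub>L adj (v g) = \<alpha> g e"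
    by metis
  have "\<exists>c. \<alpha> g (v h) o\<^sub>L v g = scale_op c (v (g \<otimes> h))" if g: "g \<in> carrier G" "h \<in> carrier G" for g h
  proof -
    let ?y = "\<alpha> g (v h) o\<^sub>L v g" and ?u = "v (g \<otimes> h)"
    have y: "?y \<in> N" using g v isoD algD by simp
    have u: "?u \<in> N" "adj ?u o\<^sub>L ?u = e" "?u o\<^sub>L adj ?u = \<alpha> g (\<alpha> h e)" using v g act e by (simp_all add: minimal_full_def)
    have vh: "\<alpha> h e o\<^sub>L v h = v h" 
      by (rule blinfun_eqI)
         (simp flip: v(3)[OF g(2)] add: isometry_e[OF v(1)[OF g(2)] v(2)[OF g(2)]])
    have "\<alpha> g (\<alpha> h e) o\<^sub>L ?y = \<alpha> g (\<alpha> h e o\<^sub>L v h) o\<^sub>L v g"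
      using g v isoD eD by (simp add: compose_assoc)
    then have uy: "?u (adj ?u (?y x)) = ?y x" for x
      using u(3) vh by (metis blinfun_apply_blinfun_compose)
    obtain c where "e o\<^sub>L ((adj ?u o\<^sub>L ?y) o\<^sub>L e) = scale_op c e"
      using scalar[of "adj ?u o\<^sub>L ?y"] y u algD by auto
    then have c: "adj ?u (?y x) = c *\<^sub>C e x" for x
      using compose_eqD[of e "(adj ?u o\<^sub>L ?y) o\<^sub>L e" "scale_op c e" x] isometry_e[OF u(1,2)]
        isometry_e[OF v(1)[OF g(1)] v(2)[OF g(1)]] by simp
    have "?y = scale_op c ?u"
    proof (rule blinfun_eqI)
      fix x
      have "?y x = ?u (c *\<^sub>C e x)" using uy[of x] c[of x] by simp
      then show "?y x = scale_op c ?u x" using isometry_e[OF u(1,2)] u algD by (simp add: Bounded_opsD)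
    qed
    then show ?thesis by blast
  qed
  then obtain \<upsilon> where "\<And>g h. g \<in> carrier G \<Longrightarrow> h \<in> carrier G \<Longrightarrow>
      \<alpha> g (v h) o\<^sub>L v g = scale_op (\<upsilon> g h) (v (g \<otimes> h))" by metis
  then show ?thesis using v unfolding corner_cocycle_def by blast
qed

text \<open>Both sides of the cocycle relation are partial isometries with initial projection
  \<open>e\<close>.\<close>

lemma corner_cocycle_modulus:
  assumes e: "minimal_full N e" and c: "corner_cocycle G N \<alpha> e v \<upsilon>" and g: "g \<in> carrier G" "h \<in> carrier G"
  shows "cmod (\<upsilon> g h) = 1"
proof -
  interpret corner N e using N e by unfold_locales
  note v = corner_cocycleD[OF c]
  let ?y = "\<alpha> g (v h) o\<^sub>L v g"
  have vB: "v g \<in> Bounded_ops" if "g \<in> carrier G" for g using that by (simp add: algD(1) v(1))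
  have "adj (\<alpha> g (v h)) o\<^sub>L \<alpha> g (v h) = \<alpha> g e"
    using isoD(6)[OF g(1) algD(5)[OF v(1)[OF g(2)]] v(1)[OF g(2)]] isoD(7)[OF g(1) v(1)[OF g(2)]]
      v(2)[OF g(2)] by simp
  then have a: "adj (\<alpha> g (v h)) (\<alpha> g (v h) x) = \<alpha> g e x" for x
    by (rule compose_eqD)
  have b: "\<alpha> g e (v g x) = v g x" for x
    using isometry_e[OF v(1)[OF g(1)] v(2)[OF g(1)]] v(3)[OF g(1)] by (metis blinfun_apply_blinfun_compose)
  have "adj ?y o\<^sub>L ?y = e"
    by (rule blinfun_eqI) (simp add: a b isometry_e[OF v(1)[OF g(1)] v(2)[OF g(1)]])
  moreover have "adj ?y o\<^sub>L ?y = scale_op (\<upsilon> g h * cnj (\<upsilon> g h)) e"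
    using v(4)[OF g(1) g(2)] v(2)[of "g \<otimes> h"] g vB by (simp add: mult.commute)
  ultimately have "scale_op (\<upsilon> g h * cnj (\<upsilon> g h)) e = scale_op 1 e" by simp
  then have "\<upsilon> g h * cnj (\<upsilon> g h) = 1" using eD by (simp only: scale_op_cancel) simp
  then have "(cmod (\<upsilon> g h))\<^sup>2 = 1" by (metis complex_norm_square of_real_eq_1_iff)
  then show ?thesis by (simp add: power2_eq_1_iff)
      (metis norm_ge_zero not_one_le_zero neg_0_le_iff_le)
qed

text \<open>An anti-linear \<open>\<alpha> g\<close> conjugates the factor \<open>b h\<close>; this
  is the twist in the coboundary.\<close>

lemma corner_rescale:
  assumes c: "corner_cocycle G N \<alpha> e v \<upsilon>" and b: "cohomologous G p b \<upsilon> \<omega>"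
  shows "corner_cocycle G N \<alpha> e (\<lambda>g. scale_op (b g) (v g)) \<omega>"
proof -
  note v = corner_cocycleD[OF c]
  have vB: "v g \<in> Bounded_ops" if "g \<in> carrier G" for g using that by (simp add: NalgD(1) v(1))
  have b1: "cmod (b g) = 1" "b g \<noteq> 0" "b g * cnj (b g) = 1" "cnj (b g) * b g = 1" if "g \<in> carrier G" for g
  proof -
    show 1: "cmod (b g) = 1" using b that by (simp add: cohomologous_def)
    then show "b g \<noteq> 0" by auto
    show "b g * cnj (b g) = 1" "cnj (b g) * b g = 1"
      using complex_norm_square[of "b g"] 1 by (simp_all add: mult.commute)
  qed
  show ?thesis unfolding corner_cocycle_def
  proof (intro conjI ballI)
    fix g assume g: "g \<in> carrier G"
    show "scale_op (b g) (v g) \<in> N" using v g NalgD by simp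
    show "adj (scale_op (b g) (v g)) o\<^sub>L scale_op (b g) (v g) = e"
      "scale_op (b g) (v g) o\<^sub>L adj (scale_op (b g) (v g)) = \<alpha> g e"
      using v g vB b1 by simp_all
    fix h assume h: "h \<in> carrier G"
    have "\<omega> g h * b (g \<otimes> h) = \<upsilon> g h * (b g * conj_pow (p g) (b h))"
      using b g h b1 by (simp add: cohomologous_def)
    moreover have "\<alpha> g (v h) \<in> Bounded_ops" using g h by (simp add: NalgD(1) isoD(4) v(1))
    ultimately show "\<alpha> g (scale_op (b h) (v h)) o\<^sub>L scale_op (b g) (v g) =
        scale_op (\<omega> g h) (scale_op (b (g \<otimes> h)) (v (g \<otimes> h)))"
      using g h v by (simp add: isoD mult_ac)
  qed
qed

text \<open>A partial isometry \<open>w\<close> from \<open>e\<close> to \<open>e'\<close>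
  transports \<open>v'\<close> to a family based at \<open>e\<close>. It has the same initial and
  final projections as \<open>v\<close>, so the two differ by scalars \<open>b g\<close>; inserting
  this into the cocycle relation gives the coboundary of \<open>b\<close>.\<close>

lemma corner_unique:
  assumes e: "minimal_full N e" "corner_cocycle G N \<alpha> e v \<upsilon>"
    and e': "minimal_full N e'" "corner_cocycle G N \<alpha> e' v' \<omega>"
  shows "\<exists>b. cohomologous G p b \<upsilon> \<omega>"
proof -
  interpret corner N e using N e by unfold_locales
  interpret C: corner N e' using N e' by unfold_locales
  note v = corner_cocycleD[OF e(2)] and v' = corner_cocycleD[OF e'(2)]
  obtain w where w: "w \<in> N" "adj w o\<^sub>L w = e" "w o\<^sub>L adj w = e'"
    using equivalent_minimal e'(1) by blast
  note we = isometry_e[OF w(1,2)]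
  note ve = isometry_e[OF v(1) v(2)] and ve' = C.isometry_e[OF v'(1) v'(2)]
  have wadj: "adj w \<in> N" using w algD by simp
  have ww': "w (adj w x) = e' x" for x using compose_eqD[OF w(3)] .
  have aw: "\<alpha> g w (\<alpha> g (adj w) x) = \<alpha> g e' x" "\<alpha> g (adj w) (\<alpha> g w x) = \<alpha> g e x" if "g \<in> carrier G" for g x
    using isoD(6)[OF that w(1) wadj] isoD(6)[OF that wadj w(1)] w by (metis blinfun_apply_blinfun_compose)+
  have vv: "v g (adj (v g) x) = \<alpha> g e x" "v' g (adj (v' g) x) = \<alpha> g e' x" if "g \<in> carrier G" for g x
    using v(3) v'(3) that by (metis blinfun_apply_blinfun_compose)+
  have "e o\<^sub>L adj w = adj w" by (rule we)
  then have ae: "\<alpha> g e (\<alpha> g (adj w) x) = \<alpha> g (adj w) x" if "g \<in> carrier G" for g x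
    using isoD(6)[OF that eD(1) wadj] by (metis blinfun_apply_blinfun_compose)
  have av: "\<alpha> g e' (v' g x) = v' g x" "\<alpha> g e (v g x) = v g x" if "g \<in> carrier G" for g x
    using vv[OF that] ve'(5)[OF that that] ve(5)[OF that that] ve(3)[OF that that] ve'(3)[OF that that] by metis+
  have "\<exists>c. adj (v g) o\<^sub>L (\<alpha> g (adj w) o\<^sub>L (v' g o\<^sub>L w)) = scale_op c e" if g: "g \<in> carrier G" for g
  proof -
    let ?y = "adj (v g) o\<^sub>L (\<alpha> g (adj w) o\<^sub>L (v' g o\<^sub>L w))"
    have "?y \<in> N" using g v v' w wadj algD isoD by simp
    moreover have "e o\<^sub>L (?y o\<^sub>L e) = ?y" by (rule blinfun_eqI) (simp add: we ve[OF g g])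
    ultimately show ?thesis using scalar by metis
  qed
  then obtain b where b: "\<And>g. g \<in> carrier G \<Longrightarrow>
      adj (v g) o\<^sub>L (\<alpha> g (adj w) o\<^sub>L (v' g o\<^sub>L w)) = scale_op (b g) e" by metis
  have v'_eq: "v' g x = b g *\<^sub>C \<alpha> g w (v g (adj w x))" if g: "g \<in> carrier G" for g x
  proof -
    have B: "v g \<in> Bounded_ops" "\<alpha> g w \<in> Bounded_ops" using g by (simp_all add: algD(1) isoD(4) v(1) w(1))
    have "\<alpha> g w (v g (adj (v g) (\<alpha> g (adj w) (v' g (w (adj w x)))))) = v' g x"
      using g by (simp add: vv ae aw av ww' ve')
    moreover have "adj (v g) (\<alpha> g (adj w) (v' g (w (adj w x)))) = b g *\<^sub>C e (adj w x)"
      using compose_eqD[OF b[OF g], of "adj w x"] by simp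
    ultimately show ?thesis using B by (simp add: we Bounded_opsD)
  qed
  have v'_eq': "v' g = scale_op (b g) (\<alpha> g w o\<^sub>L (v g o\<^sub>L adj w))" if "g \<in> carrier G" for g
    by (rule blinfun_eqI) (simp add: v'_eq that)
  have bmod: "cmod (b g) = 1" if g: "g \<in> carrier G" for g
  proof -
    have B: "v g \<in> Bounded_ops" "\<alpha> g w \<in> Bounded_ops" "w \<in> Bounded_ops" using g by (simp_all add: algD(1) isoD(4) v(1) w(1))
    have adjaw: "adj (\<alpha> g w) = \<alpha> g (adj w)" using isoD(7)[OF g w(1)] by simp
    let ?z = "\<alpha> g w o\<^sub>L (v g o\<^sub>L adj w)"
    have "adj ?z o\<^sub>L ?z = e'" 
      by (rule blinfun_eqI) (simp add: adjaw aw av ve[OF g g] we g ww')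
    then have "scale_op (b g * cnj (b g)) e' = adj (v' g) o\<^sub>L v' g"
      using B by (simp add: v'_eq'[OF g] mult.commute)
    then have "scale_op (b g * cnj (b g)) e' = scale_op 1 e'" using v'(2)[OF g] by simp
    then have "b g * cnj (b g) = 1" using C.eD by (simp only: scale_op_cancel) simp
    then have "(cmod (b g))\<^sup>2 = 1" by (metis complex_norm_square of_real_eq_1_iff)
    then show ?thesis by (simp add: power2_eq_1_iff)
        (metis norm_ge_zero not_one_le_zero neg_0_le_iff_le)
  qed
  have "\<omega> g h = \<upsilon> g h * (b g * conj_pow (p g) (b h) / b (g \<otimes> h))"
    if g: "g \<in> carrier G" "h \<in> carrier G" for g h
  proof -
    have B: "v k \<in> Bounded_ops" "\<alpha> k w \<in> Bounded_ops" "\<alpha> k x \<in> Bounded_ops"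
      if "k \<in> carrier G" "x \<in> N" for k x using that by (simp_all add: algD(1) isoD(4) v(1) w(1))
    have gh: "g \<otimes> h \<in> carrier G" using g by simp
    have N3: "\<alpha> h w \<in> N" "v h \<in> N" "v h o\<^sub>L adj w \<in> N" "\<alpha> h w o\<^sub>L (v h o\<^sub>L adj w) \<in> N"
      using g v w wadj isoD algD by simp_all
    have "\<alpha> g (v' h) = scale_op (conj_pow (p g) (b h)) (\<alpha> g (\<alpha> h w) o\<^sub>L (\<alpha> g (v h) o\<^sub>L \<alpha> g (adj w)))"
      unfolding v'_eq'[OF g(2)] using g N3 wadj by (simp add: isoD)
    then have avh: "\<alpha> g (v' h) x = conj_pow (p g) (b h) *\<^sub>C \<alpha> (g \<otimes> h) w (\<alpha> g (v h) (\<alpha> g (adj w) x))" for x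
      using act[OF g w(1)] by simp
    have vh: "\<alpha> g (v h) (v g x) = \<upsilon> g h *\<^sub>C v (g \<otimes> h) x" for x
      using compose_eqD[OF v(4)[OF g], of x] by simp
    have B': "\<alpha> g (v h) \<in> Bounded_ops" "\<alpha> g (adj w) \<in> Bounded_ops" "v g \<in> Bounded_ops"
      "\<alpha> (g \<otimes> h) w \<in> Bounded_ops" "v (g \<otimes> h) \<in> Bounded_ops" "\<alpha> g w \<in> Bounded_ops"
      using g gh N3 wadj w by (simp_all add: B algD(1) isoD(4) v(1))
    have bgh: "b (g \<otimes> h) \<noteq> 0" using bmod[OF gh] by auto
    let ?c = "conj_pow (p g) (b h) * b g * \<upsilon> g h"
    let ?z = "\<alpha> (g \<otimes> h) w o\<^sub>L (v (g \<otimes> h) o\<^sub>L adj w)"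
    have "\<alpha> g (v' h) o\<^sub>L v' g = scale_op ?c ?z"
      by (rule blinfun_eqI)
         (simp add: avh v'_eq[OF g(1)] B' Bounded_opsD aw av vh g scaleC_scaleC mult_ac)
    moreover have "\<alpha> g (v' h) o\<^sub>L v' g = scale_op (\<omega> g h * b (g \<otimes> h)) ?z"
      using v'(4)[OF g] v'_eq'[OF gh] by simp
    ultimately have "scale_op (\<omega> g h * b (g \<otimes> h)) ?z = scale_op ?c ?z" by simp
    moreover have "?z \<noteq> 0" using v'_eq'[OF gh] v'(2)[OF gh] C.eD by auto
    ultimately have "\<omega> g h * b (g \<otimes> h) = ?c" by (simp add: scale_op_cancel)
    then show ?thesis using bgh by (simp add: field_simps)
  qed
  then show ?thesis using bmod by (intro exI[of _ b]) (simp add: cohomologous_def)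
qed

end

section \<open>Covariant extension\<close>

text \<open>The operator is prescribed by \<open>a u \<mapsto> \<beta> a (Y u)\<close>. The
  hypothesis on \<open>Y\<close> says that matrix coefficients agree, which after moving
  \<open>a\<close> across the inner product is exactly preservation of inner products on
  \<open>D\<close>. Used with \<open>L\<close> the range of a projection or a single vector.\<close>

lemma covariant_extension:
  fixes L :: "'a::chilbert_space set" and Y :: "'a \<Rightarrow> 'b::chilbert_space"
  assumes N: "star_algebra N" and \<beta>: "star_iso s N N' \<beta>" "N' \<subseteq> Bounded_ops"
    and Y: "\<And>x u u'. x \<in> N \<Longrightarrow> u \<in> L \<Longrightarrow> u' \<in> L \<Longrightarrow>
      cinner (Y u) (\<beta> x (Y u')) = conj_pow s (cinner u (x u'))"
  defines "D \<equiv> {blinfun_apply a u | a u. a \<in> N \<and> u \<in> L}"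
  obtains V :: "'a \<Rightarrow>\<^sub>L 'b" where "semilinear s V"
    "\<And>a u. a \<in> N \<Longrightarrow> u \<in> L \<Longrightarrow> V (a u) = \<beta> a (Y u)" "\<And>b x. b \<in> N \<Longrightarrow> V (b x) = \<beta> b (V x)"
    "\<And>x y. x \<in> clspan D \<Longrightarrow> y \<in> clspan D \<Longrightarrow> V x \<bullet> V y = x \<bullet> y"
    "\<And>x. (\<And>d. d \<in> D \<Longrightarrow> x \<bullet> d = 0) \<Longrightarrow> V x = 0"
proof -
  note alg = star_algebraD[OF N] and iso = star_isoD[OF \<beta>(1)]
  have \<beta>B: "\<beta> x \<in> Bounded_ops" if "x \<in> N" for x using iso(4)[OF that] \<beta>(2) by blast
  define I where "I = N \<times> L"
  define d where "d = (\<lambda>(a :: 'a op, u). a u)"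
  define f where "f = (\<lambda>(a, u). \<beta> a (Y u))"
  have D: "D = d ` I" by (auto simp: D_def d_def I_def)
  have "f i \<bullet> f j = d i \<bullet> d j" if "i \<in> I" "j \<in> I" for i j
  proof -
    obtain a u b u' where ij: "i = (a, u)" "j = (b, u')" by (cases i; cases j)
    then have ab: "a \<in> N" "b \<in> N" "u \<in> L" "u' \<in> L" using that by (auto simp: I_def)
    have "cinner (\<beta> a (Y u)) (\<beta> b (Y u')) = cinner (Y u) (adj (\<beta> a) (\<beta> b (Y u')))"
      using ab \<beta>B by (simp add: cinner_adj)
    also have "\<dots> = cinner (Y u) (\<beta> (adj a o\<^sub>L b) (Y u'))"
      using ab alg by (simp add: iso)
    also have "\<dots> = conj_pow s (cinner u ((adj a o\<^sub>L b) u'))" using ab alg Y by simp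
    also have "\<dots> = conj_pow s (cinner (a u) (b u'))" using ab alg by (simp add: cinner_adj)
    finally show ?thesis by (simp add: ij f_def d_def flip: Re_cinner)
  qed
  then obtain V :: "'a \<Rightarrow>\<^sub>L 'b" where V: "\<And>i. i \<in> I \<Longrightarrow> V (d i) = f i"
    "\<And>x. (\<And>i. i \<in> I \<Longrightarrow> x \<bullet> d i = 0) \<Longrightarrow> V x = 0"
    "\<And>x y. x \<in> clspan D \<Longrightarrow> y \<in> clspan D \<Longrightarrow> V x \<bullet> V y = x \<bullet> y"
    unfolding D using isometry_extension[of I f d] by blast
  have V0: "V x = 0" if "\<And>d. d \<in> D \<Longrightarrow> x \<bullet> d = 0" for x
    using that by (intro V(2)) (auto simp: D)
  have Va: "V (a u) = \<beta> a (Y u)" if "a \<in> N" "u \<in> L" for a u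
    using V(1)[of "(a, u)"] that by (simp add: I_def d_def f_def)
  have sl: "semilinear s V"
  proof (rule semilinear_extension[of D])
    fix c x assume "x \<in> D"
    then obtain a :: "'a op" and u where au: "x = a u" "a \<in> N" "u \<in> L" by (auto simp: D_def)
    then have c: "c *\<^sub>C x = scale_op c a u" "scale_op c a \<in> N" using alg by simp_all
    then show "c *\<^sub>C x \<in> D" using au(3) unfolding D_def by blast
    show "V (c *\<^sub>C x) = conj_pow s c *\<^sub>C V x"
      unfolding c(1) Va[OF c(2) au(3)] using au by (simp add: Va iso)
  qed (rule V0)
  have cov: "V (b x) = \<beta> b (V x)" if b: "b \<in> N" for b x
  proof -
    have "V o\<^sub>L b = \<beta> b o\<^sub>L V"
    proof (rule blinfun_eqI_clspan[of D])
      fix x assume "x \<in> D"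
      then obtain a :: "'a op" and u where au: "x = a u" "a \<in> N" "u \<in> L" by (auto simp: D_def)
      have "V ((b o\<^sub>L a) u) = \<beta> (b o\<^sub>L a) (Y u)" using au b alg by (intro Va) auto
      then show "(V o\<^sub>L b) x = (\<beta> b o\<^sub>L V) x" using au b by (simp add: iso Va)
    next
      fix x assume x: "\<And>d. d \<in> D \<Longrightarrow> x \<bullet> d = 0"
      have "b x \<bullet> d = 0" if "d \<in> D" for d
      proof -
        obtain a :: "'a op" and u where au: "d = a u" "a \<in> N" "u \<in> L" using \<open>d \<in> D\<close> by (auto simp: D_def)
        then have "adj b o\<^sub>L a \<in> N" using b alg by simp
        then have "(adj b o\<^sub>L a) u \<in> D" unfolding D_def using au(3) by blast
        then show ?thesis using x au by (simp add: inner_adj)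
      qed
      then have "V (b x) = 0" "V x = 0" using x V0 by blast+
      then show "(V o\<^sub>L b) x = (\<beta> b o\<^sub>L V) x" by (simp add: blinfun.zero_right)
    qed
    then show ?thesis by (metis blinfun_apply_blinfun_compose)
  qed
  show thesis using that[OF sl Va cov V(3) V0] by simp
qed

lemma star_iso_id: "star_iso 0 N N (\<lambda>x. x)"
  by (simp add: star_iso_def bij_betw_def)

section \<open>Abelian projections in factors are minimal\<close>

text \<open>\<open>1 + \<i> h\<close> and its adjoint are bounded below, so the inverse is defined
  on a dense range and extends. The last clause puts \<open>R\<close> into every bicommutant that
  contains \<open>h\<close>, without functional calculus.\<close>

lemma resolvent:
  fixes h :: "'a::chilbert_space op"
  assumes h: "h \<in> Bounded_ops" "adj h = h"
  obtains R where "R \<in> Bounded_ops" "\<And>v. R (v + \<i> *\<^sub>C h v) = v" "\<And>v. R v + \<i> *\<^sub>C h (R v) = v"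
    "\<And>b. b \<in> Bounded_ops \<Longrightarrow> b o\<^sub>L h = h o\<^sub>L b \<Longrightarrow> b o\<^sub>L R = R o\<^sub>L b"
proof -
  define A where "A = id_blinfun + scale_op \<i> h"
  have A: "A v = v + \<i> *\<^sub>C h v" for v by (simp add: A_def blinfun.add_left)
  have AB: "A \<in> Bounded_ops" using h by (simp add: A_def)
  have orth: "v \<bullet> (\<i> *\<^sub>C h v) = 0" for v
  proof -
    have "cinner v (h v) = cinner (h v) v" using cinner_adj[OF h(1)] h(2) by metis
    then have "Im (cinner v (h v)) = 0" using cinner_commute[of v "h v"] by (metis cnj.simps(2) equal_neg_zero)
    then show ?thesis by (simp flip: Re_cinner add: cinner_scaleC_right)
  qed
  \<comment> \<open>\<open>v\<close> and \<open>\<i> *\<^sub>C h v\<close> are orthogonal for the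
    real inner product, so Pythagoras gives the lower bound.\<close>
  have sq: "(norm (v + \<i> *\<^sub>C h v))\<^sup>2 = (norm v)\<^sup>2 + (norm (h v))\<^sup>2" for v
    using orth[of v] by (simp add: dot_norm norm_scaleC)
  have sq': "(norm (v - \<i> *\<^sub>C h v))\<^sup>2 = (norm v)\<^sup>2 + (norm (h v))\<^sup>2" for v
    using orth[of v] by (simp add: dot_norm_neg norm_scaleC)
  have le: "norm v \<le> norm (A v)" for v
  proof -
    have "(norm v)\<^sup>2 \<le> (norm (A v))\<^sup>2" by (simp add: A sq)
    then show ?thesis by (rule power2_le_imp_le) simp
  qed
  have bd: "norm y \<le> 1 * norm x" if "(x, y) \<in> span ((\<lambda>v. (A v, v)) ` UNIV)" for x y
  proof -
    have "subspace (range (\<lambda>v. (A v, v)))"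
      by (rule subspaceI)
         (auto simp: image_iff zero_prod_def blinfun.zero_right blinfun.add_right blinfun.scaleR_right)
    then have "span (range (\<lambda>v. (A v, v))) = range (\<lambda>v. (A v, v))" by (rule span_eq_iff[THEN iffD2])
    with that have "(x, y) \<in> range (\<lambda>v. (A v, v))" by (simp only:)
    then show ?thesis using le by auto
  qed
  obtain R :: "'a op" where R': "\<And>v. v \<in> UNIV \<Longrightarrow> R (A v) = v"
    "\<And>x. (\<And>v. v \<in> UNIV \<Longrightarrow> x \<bullet> A v = 0) \<Longrightarrow> R x = 0"
    using bounded_extension[of A "\<lambda>v. v" UNIV 1, OF bd] by blast
  have R: "R (A v) = v" "(\<And>v. x \<bullet> A v = 0) \<Longrightarrow> R x = 0" for v x using R' by simp_all
  have perp: "x = 0" if "\<And>v. x \<bullet> A v = 0" for x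
  proof -
    have "cinner x (A v) = 0" for v
      using that by (intro orthogonal_cinnerI) (metis AB Bounded_opsD)
    then have "cinner (A v) x = 0" for v using cinner_eq_0_commute by blast
    then have "cinner v (adj A x) = 0" for v using cinner_adj[OF AB] by simp
    then have "adj A x = 0" using cinner_self_eq_0 by blast
    moreover have "adj A x = x - \<i> *\<^sub>C h x" using h by (simp add: A_def blinfun.diff_left)
    ultimately show ?thesis using sq'[of x] by simp
  qed
  have dense: "clspan (range A) = UNIV" by (rule clspan_eq_UNIV) (use perp in blast)
  have "A o\<^sub>L R = id_blinfun"
    by (rule blinfun_eqI_dense[OF _ dense]) (auto simp: R)
  then have AR: "A (R v) = v" for v using compose_eqD by fastforce
  have RB: "semilinear 0 R"
  proof (rule semilinear_extension[of "range A"])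
    fix c d assume "d \<in> range A"
    then obtain v where v: "d = A v" by blast
    then have c: "c *\<^sub>C d = A (c *\<^sub>C v)" using AB by (simp add: Bounded_opsD)
    then show "c *\<^sub>C d \<in> range A" by blast
    show "R (c *\<^sub>C d) = conj_pow 0 c *\<^sub>C R d" unfolding c by (simp add: R v)
  qed (use perp R in auto)
  have "b o\<^sub>L R = R o\<^sub>L b" if b: "b \<in> Bounded_ops" "b o\<^sub>L h = h o\<^sub>L b" for b
  proof (rule blinfun_eqI)
    fix v
    have "b (A u) = A (b u)" for u
      using compose_eqD[OF b(2)] b(1) by (simp add: A blinfun.add_right Bounded_opsD)
    then have "b (R v) = R (A (b (R v)))" "A (b (R v)) = b (A (R v))" by (simp_all add: R)
    then show "(b o\<^sub>L R) v = (R o\<^sub>L b) v" by (simp add: AR)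
  qed
  then show thesis using that[of R] RB R AR unfolding Bounded_ops_iff A by blast
qed

text \<open>
  Unitaries in the abelian algebra \<open>e N e\<close> extend to unitaries in the center. This is
  applied to the Cayley transform of a self-adjoint element.
\<close>

lemma abelian_minimal:
  fixes e :: "'a::chilbert_space op"
  assumes N: "von_neumann_algebra N" and e: "e \<in> N" "projection_op e" "e \<noteq> 0"
    and center: "center N \<subseteq> range (\<lambda>c. scale_op c id_blinfun)"
    and ab: "\<And>x y. x \<in> N \<Longrightarrow> y \<in> N \<Longrightarrow>
      (e o\<^sub>L x o\<^sub>L e) o\<^sub>L (e o\<^sub>L y o\<^sub>L e) = (e o\<^sub>L y o\<^sub>L e) o\<^sub>L (e o\<^sub>L x o\<^sub>L e)"
  shows "minimal_full N e"
proof -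
  note N' = von_neumann_algebraD[OF N]
  note alg = star_algebraD[OF N'(1)]
  note pe = projection_opD[OF e(2)]
  let ?D = "{blinfun_apply a (e v) | a v. a \<in> N}"
  define P where "P = proj (clspan ?D)"
  obtain v0 where v0: "e v0 \<noteq> 0" using e(3) blinfun_eqI[of e 0] by force
  \<comment> \<open>The central support of \<open>e\<close> is a scalar by assumption and fixes the
    nonzero vector \<open>e v0\<close>, so it is 1.\<close>
  obtain c0 where c0: "P = scale_op c0 id_blinfun"
    using cyclic_proj_central[OF N e(1)] center unfolding P_def by blast
  have "e v0 \<in> clspan ?D"
    using N'(2) by (intro clspan_base CollectI exI[of _ id_blinfun] exI[of _ v0]) simp
  then have "P (e v0) = e v0" unfolding P_def by (intro proj_id) simp_all
  then have "c0 *\<^sub>C e v0 = 1 *\<^sub>C e v0" by (simp add: c0)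
  then have c1: "c0 = 1" using v0 by (simp only: scaleC_cancel_right) simp
  have "P v \<in> clspan ?D" for v unfolding P_def by (rule proj_in) simp_all
  then have dense: "clspan ?D = UNIV" unfolding c0 c1 by auto
  have full: "x = 0" if x: "x \<in> N" "\<forall>a\<in>N. x o\<^sub>L (a o\<^sub>L e) = 0" for x
  proof (rule blinfun_eqI_dense[OF _ dense])
    fix d assume "d \<in> ?D"
    then obtain a :: "'a op" and v where "d = a (e v)" "a \<in> N" by blast
    then show "x d = blinfun_apply 0 d" using compose_eqD[OF bspec[OF x(2)], of a v] by simp
  qed
  have comm: "e (x (e (e (y (e v))))) = e (y (e (e (x (e v)))))" if "x \<in> N" "y \<in> N" for x y v
    using arg_cong[OF ab[OF that], of "\<lambda>z. blinfun_apply z v"] by simp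
  have sa: "\<exists>c. h = scale_op c e" if h: "h \<in> N" "adj h = h" "e o\<^sub>L h = h" "h o\<^sub>L e = h" for h
  proof -
    have hB: "h \<in> Bounded_ops" using h(1) by (rule alg(1))
    have eh: "e (h v) = h v" "h (e v) = h v" for v using compose_eqD h(3,4) by blast+
    obtain R where R: "R \<in> Bounded_ops" "\<And>v. R (v + \<i> *\<^sub>C h v) = v" "\<And>v. R v + \<i> *\<^sub>C h (R v) = v"
      "\<And>b. b \<in> Bounded_ops \<Longrightarrow> b o\<^sub>L h = h o\<^sub>L b \<Longrightarrow> b o\<^sub>L R = R o\<^sub>L b"
      using resolvent[OF hB h(2)] by blast
    \<comment> \<open>The Cayley transform of \<open>h\<close>, that is \<open>1 - \<i> h\<close>
      composed with the inverse of \<open>1 + \<i> h\<close>.\<close>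
    define U where "U = R - scale_op \<i> (h o\<^sub>L R)"
    have U: "U v = R v - \<i> *\<^sub>C h (R v)" for v by (simp add: U_def blinfun.diff_left)
    have "R \<in> commutant (commutant N)"
    proof -
      have "R o\<^sub>L b = b o\<^sub>L R" if "b \<in> commutant N" for b
        using R(4)[of b] commutantD[OF that] h(1) by simp
      then show ?thesis using R(1) by (simp add: commutant_iff)
    qed
    then have "R \<in> N" using N' by simp
    then have UN: "U \<in> N" unfolding U_def using h alg by simp
    have eR: "e (R v) = R (e v)" for v using R(4)[OF pe(1)] h(3,4) compose_eqD[of e R "R o\<^sub>L e"] by simp
    have eU: "e (U v) = U (e v)" for v
      using pe by (simp add: U eh blinfun.diff_right Bounded_opsD flip: eR)
    have UU: "cinner (U x) (U y) = cinner x y" for x y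
    proof -
      have hs: "cinner (h a) b = cinner a (h b)" for a b using cinner_adj[OF hB] h(2) by simp
      have "cinner (U x) (U y) = cinner (R x + \<i> *\<^sub>C h (R x)) (R y + \<i> *\<^sub>C h (R y))"
        by (simp add: U cinner_diff_left cinner_diff_right cinner_add_left cinner_add_right
            cinner_scaleC_left cinner_scaleC_right hs algebra_simps)
      then show ?thesis by (simp only: R(3))
    qed
    \<comment> \<open>Commutativity of the corner lets \<open>U\<close> pass through the compression
      of \<open>x\<close>; then \<open>U\<close> cancels because it preserves inner
      products.\<close>
    have Y: "cinner (U u) (x (U u')) = conj_pow 0 (cinner u (x u'))"
      if x: "x \<in> N" and u: "u \<in> range e" "u' \<in> range e" for x u u'
    proof -
      have e1: "e u = u" "e u' = u'" "e (U u) = U u" "e (U u') = U u'"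
        using u pe by (auto simp: eU)
      have es: "cinner (e a) b = cinner a (e b)" for a b using cinner_adj[OF pe(1)] pe(2) by simp
      have "cinner (U u) (x (U u')) = cinner (U u) (e (x (U u')))" using e1 es by metis
      also have "e (x (U u')) = U (e (x u'))"
        using comm[OF x UN, of u'] e1 by (simp add: eU pe)
      also have "cinner (U u) (U (e (x u'))) = cinner u (e (x u'))" by (rule UU)
      also have "\<dots> = cinner u (x u')" using e1 es by metis
      finally show ?thesis by simp
    qed
    have D: "{blinfun_apply a u | a u. a \<in> N \<and> u \<in> range e} = ?D" by blast
    obtain T where T: "semilinear 0 T" "\<And>a u. a \<in> N \<Longrightarrow> u \<in> range e \<Longrightarrow> T (a u) = a (U u)"
      "\<And>b x. b \<in> N \<Longrightarrow> T (b x) = b (T x)"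
      by (rule covariant_extension[OF N'(1) star_iso_id _ Y]) (auto simp: alg(1))
    have "T \<in> commutant N" using T by (intro commutantI) (auto simp: Bounded_ops_iff)
    moreover have "T \<in> commutant (commutant N)"
    proof -
      have "T o\<^sub>L m = m o\<^sub>L T" if m: "m \<in> commutant N" for m
      proof (rule blinfun_eqI_dense[OF _ dense])
        fix d assume "d \<in> ?D"
        then obtain a :: "'a op" and v where d: "d = a (e v)" "a \<in> N" by blast
        have "m (a (e v)) = a (e (m v))" using commutantD(3)[OF m] d e by simp
        moreover have "m (a (U (e v))) = a (U (e (m v)))" using commutantD(3)[OF m] d e UN by simp
        ultimately show "(T o\<^sub>L m) d = (m o\<^sub>L T) d" using d T(2) by simp
      qed
      then show ?thesis using T(1) by (simp add: commutant_iff Bounded_ops_iff)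
    qed
    ultimately have "T \<in> center N" using N' by (simp add: center_def)
    then obtain c where c: "T = scale_op c id_blinfun" using center by blast
    have Ue: "U (e v) = c *\<^sub>C e v" for v using T(2)[of id_blinfun "e v"] N' by (simp add: c)
    \<comment> \<open>\<open>U\<close> acts on the range of \<open>e\<close> as the scalar
      \<open>c\<close> of the central extension \<open>T\<close>. Evaluating it at
      \<open>(1 + \<i> h) e v\<close> gives a linear relation between \<open>e\<close> and
      \<open>h\<close>, to be solved for \<open>h\<close>.\<close>
    have key: "(1 - c) *\<^sub>C e v = (\<i> * (1 + c)) *\<^sub>C h v" for v
    proof -
      define x where "x = e v + \<i> *\<^sub>C h (e v)"
      have "e x = x" using pe by (simp add: x_def blinfun.add_right Bounded_opsD eh)
      then have "U x = c *\<^sub>C x" using Ue[of x] by simp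
      moreover have "R x = e v" unfolding x_def by (rule R(2))
      ultimately have "e v - \<i> *\<^sub>C h v = c *\<^sub>C (e v + \<i> *\<^sub>C h v)" by (simp add: U x_def eh)
      then show ?thesis
        by (simp add: scaleC_diff_left scaleC_add_left scaleC_add_right scaleC_scaleC algebra_simps)
    qed
    have "c \<noteq> - 1"
    proof
      assume "c = - 1"
      then show False using key[of v0] v0 by simp
    qed
    then have nz: "\<i> * (1 + c) \<noteq> 0" by (metis add_eq_0_iff complex_i_not_zero mult_eq_0_iff)
    show ?thesis
    proof (intro exI[of _ "(1 - c) / (\<i> * (1 + c))"] blinfun_eqI)
      fix v
      have "(1 / (\<i> * (1 + c))) *\<^sub>C ((1 - c) *\<^sub>C e v) = (1 / (\<i> * (1 + c))) *\<^sub>C ((\<i> * (1 + c)) *\<^sub>C h v)"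
        by (simp only: key)
      also have "\<dots> = ((1 / (\<i> * (1 + c))) * (\<i> * (1 + c))) *\<^sub>C h v" by (simp only: scaleC_scaleC)
      also have "(1 / (\<i> * (1 + c))) * (\<i> * (1 + c)) = 1" using nonzero_eq_divide_eq[OF nz, of "1 / (\<i> * (1 + c))" 1] by blast
      finally show "h v = scale_op ((1 - c) / (\<i> * (1 + c))) e v" by (simp add: scaleC_scaleC)
    qed
  qed
  have scalar: "\<exists>c. e o\<^sub>L (x o\<^sub>L e) = scale_op c e" if x: "x \<in> N" for x
  proof -
    define y where "y = e o\<^sub>L (x o\<^sub>L e)"
    have y: "y \<in> N" "y \<in> Bounded_ops" "e o\<^sub>L y = y" "y o\<^sub>L e = y" using x e alg pe
      by (simp_all add: y_def compose_assoc flip: compose_assoc[of e e])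
    then have y': "e o\<^sub>L adj y = adj y" "adj y o\<^sub>L e = adj y"
      by (metis adj_compose pe(2) y(4), metis adj_compose pe(2) y(3))
    \<comment> \<open>The corner element is split into self-adjoint parts, to which
      \<open>sa\<close> applies.\<close>
    have "\<exists>c. y + adj y = scale_op c e"
      using y y' alg by (intro sa) (simp_all add: compose_distribs add.commute)
    moreover have "\<exists>c. scale_op \<i> (y - adj y) = scale_op c e"
      using y y' alg pe by (intro sa) (simp_all add: compose_distribs scale_op_diff_right)
    ultimately obtain c d where cd: "y + adj y = scale_op c e" "scale_op \<i> (y - adj y) = scale_op d e" by blast
    have "y = scale_op (1/2) (y + adj y) + scale_op (- \<i>/2) (scale_op \<i> (y - adj y))"
      by (rule blinfun_eqI)
         (simp add: blinfun.add_left blinfun.diff_left scaleC_add_right scaleC_diff_right scaleC_scaleC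
           flip: scaleC_add_left)
    also have "\<dots> = scale_op (c / 2 - \<i> * d / 2) e"
      unfolding cd
      by (rule blinfun_eqI) (simp add: blinfun.add_left blinfun.diff_left scaleC_diff_left scaleC_scaleC)
    finally show ?thesis unfolding y_def by blast
  qed
  show ?thesis unfolding minimal_full_def using e scalar full by blast
qed

section \<open>Spatially graded von Neumann algebras\<close>

text \<open>For \<open>\<kappa> = 1\<close> the odd central unitary prevents \<open>M\<close> from
  having a minimal full projection, whereas the even part is a type I factor.\<close>

definition corner_algebra :: "'a::chilbert_space op set \<Rightarrow> ('a op \<Rightarrow> 'a op) \<Rightarrow> bit \<Rightarrow> 'a op set"
  where "corner_algebra M \<theta> \<kappa> = (if \<kappa> = 0 then M else homogeneous_part M \<theta> 0)"

locale graded_algebra =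
  fixes M :: "'a::chilbert_space op set" and \<Gamma> :: "'a op"
  assumes spatial: "spatially_graded M (Ad \<Gamma>) \<Gamma>"
begin

abbreviation H :: "bit \<Rightarrow> 'a op set" where "H \<equiv> homogeneous_part M (Ad \<Gamma>)"
abbreviation N :: "bit \<Rightarrow> 'a op set" where "N \<equiv> corner_algebra M (Ad \<Gamma>)"

lemma vN: "von_neumann_algebra M"
  using spatial by (simp add: spatially_graded_def graded_von_neumann_algebra_def)

lemmas M_star = von_neumann_algebraD(1)[OF vN]
lemmas M_id = von_neumann_algebraD(2)[OF vN]
lemmas M_bicomm = von_neumann_algebraD(3)[OF vN]
lemmas algD = star_algebraD[OF M_star]

lemma \<Gamma>: "sa_unitary \<Gamma>"
  using spatial by (simp add: spatially_graded_def)

lemmas \<Gamma>D = sa_unitaryD[OF \<Gamma>]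

lemma theta_iso: "star_iso 0 M M (Ad \<Gamma>)"
  using spatial by (simp add: spatially_graded_def graded_von_neumann_algebra_def)

lemmas thetaD = star_isoD[OF theta_iso]

lemma theta_theta [simp]: "Ad \<Gamma> (Ad \<Gamma> x) = x"
  by (rule blinfun_eqI) (simp add: \<Gamma>D)

lemma Hom_iff: "x \<in> H s \<longleftrightarrow> x \<in> M \<and> (\<forall>v. \<Gamma> (x v) = sign s *\<^sub>C x (\<Gamma> v))"
proof -
  have "Ad \<Gamma> x = scale_op (sign s) x \<longleftrightarrow> \<Gamma> o\<^sub>L x = scale_op (sign s) x o\<^sub>L \<Gamma>"
    by (rule Ad_intertwine[OF \<Gamma>D(5)])
  also have "\<dots> \<longleftrightarrow> (\<forall>v. (\<Gamma> o\<^sub>L x) v = (scale_op (sign s) x o\<^sub>L \<Gamma>) v)"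
    using blinfun_eqI by metis
  finally show ?thesis by (simp add: homogeneous_part_def)
qed

lemma HomD:
  assumes "x \<in> H s"
  shows "x \<in> M" "x \<in> Bounded_ops" "\<Gamma> (x v) = sign s *\<^sub>C x (\<Gamma> v)" "Ad \<Gamma> x = scale_op (sign s) x"
    "x (\<Gamma> v) = sign s *\<^sub>C \<Gamma> (x v)"
proof -
  show "x \<in> M" "\<Gamma> (x v) = sign s *\<^sub>C x (\<Gamma> v)" using assms unfolding Hom_iff by blast+
  then show "x (\<Gamma> v) = sign s *\<^sub>C \<Gamma> (x v)" by (simp add: scaleC_scaleC)
  show "x \<in> Bounded_ops" using \<open>x \<in> M\<close> by (rule algD)
  show "Ad \<Gamma> x = scale_op (sign s) x" using assms by (simp add: homogeneous_part_def)
qed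

lemma Hom_compose: "x \<in> H r \<Longrightarrow> y \<in> H s \<Longrightarrow> x o\<^sub>L y \<in> H (r + s)"
  unfolding Hom_iff[of "x o\<^sub>L y"]
  by (simp add: HomD(1-3) algD Bounded_opsD scaleC_scaleC sign_add mult.commute)

lemma Hom_adj: "x \<in> H s \<Longrightarrow> adj x \<in> H s"
  using Ad_adj[of \<Gamma> x] by (auto simp: homogeneous_part_def algD)

lemma Hom_scale: "x \<in> H s \<Longrightarrow> scale_op c x \<in> H s"
  unfolding Hom_iff[of "scale_op c x"]
  by (simp add: HomD(1-3) algD \<Gamma>D Bounded_opsD scaleC_scaleC mult.commute)

lemma Hom_add: "x \<in> H s \<Longrightarrow> y \<in> H s \<Longrightarrow> x + y \<in> H s"
  unfolding Hom_iff[of "x + y"]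
  by (simp add: HomD(1-3) algD blinfun.add_left blinfun.add_right scaleC_add_right)

lemma Hom_id: "id_blinfun \<in> H 0"
  by (simp add: Hom_iff M_id)

lemma Hom_decompose:
  assumes "x \<in> M"
  shows "\<exists>x0\<in>H 0. \<exists>x1\<in>H 1. x = x0 + x1"
proof (intro bexI)
  let ?y = "Ad \<Gamma> x"
  have y: "?y \<in> M" using assms by (rule thetaD)
  have "\<Gamma> (?y v) = x (\<Gamma> v)" "?y (\<Gamma> v) = \<Gamma> (x v)" for v by (simp_all add: \<Gamma>D)
  then show "(1/2) *\<^sub>R (x + ?y) \<in> H 0" "(1/2) *\<^sub>R (x - ?y) \<in> H 1"
    using y assms unfolding Hom_iff
    by (auto simp: algD blinfun.add_left blinfun.add_right blinfun.diff_left blinfun.diff_right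
        blinfun.scaleR_left blinfun.scaleR_right algebra_simps simp del: Ad_apply)
  show "x = (1/2) *\<^sub>R (x + ?y) + (1/2) *\<^sub>R (x - ?y)"
    by (simp add: scaleR_add_right scaleR_diff_right flip: scaleR_add_left)
qed

lemma Hom_sum_zero:
  assumes "x \<in> H 0" "y \<in> H 1" "x + y = 0"
  shows "x = 0" "y = 0"
proof -
  have "Ad \<Gamma> (x + y) = 0" using assms(3) by (simp add: Ad_def)
  then have "x - y = 0" using HomD(4)[OF assms(1)] HomD(4)[OF assms(2)] by (simp add: Ad_add)
  then have "x = y" by simp
  with assms(3) have "2 *\<^sub>R x = 0" by (simp add: scaleR_2)
  then show "x = 0" "y = 0" using \<open>x = y\<close> by simp_all
qed

text \<open>Writing the even part as a commutant makes it a von Neumann algebra.\<close>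

lemma even_commutant: "H 0 = commutant (commutant M \<union> {\<Gamma>})"
proof (rule equalityI; rule subsetI)
  fix x assume x: "x \<in> H 0"
  show "x \<in> commutant (commutant M \<union> {\<Gamma>})"
  proof (rule commutantI)
    fix y v assume "y \<in> commutant M \<union> {\<Gamma>}"
    then consider "y \<in> commutant M" | "y = \<Gamma>" by blast
    then show "x (y v) = y (x v)"
      using commutantD(3)[OF _ HomD(1)[OF x], of y v] HomD(3)[OF x] by cases simp_all
  qed (rule HomD(2)[OF x])
next
  fix x assume x: "x \<in> commutant (commutant M \<union> {\<Gamma>})"
  then have "x \<in> commutant (commutant M)" using commutant_mono by blast
  then have "x \<in> M" by (simp add: M_bicomm)
  then show "x \<in> H 0" using commutantD(3)[OF x, of \<Gamma>] by (simp add: Hom_iff)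
qed

lemma even_vN: "von_neumann_algebra (H 0)"
  unfolding even_commutant using \<Gamma>D von_neumann_algebraD(4)[OF vN]
  by (intro von_neumann_algebra_commutant) (auto simp: star_algebraD)

lemma corner_vN: "von_neumann_algebra (N \<kappa>)"
  using vN even_vN by (simp add: corner_algebra_def)

lemma corner_subset: "N \<kappa> \<subseteq> M"
  using HomD(1)[of _ 0] by (auto simp: corner_algebra_def)

lemma even_subset_corner: "H 0 \<subseteq> N \<kappa>"
  using HomD(1)[of _ 0] by (auto simp: corner_algebra_def)

lemma theta_center: "x \<in> center M \<Longrightarrow> Ad \<Gamma> x \<in> center M"
proof -
  assume x: "x \<in> center M"
  then have xM: "x \<in> M" by (simp add: center_def)
  have "Ad \<Gamma> x o\<^sub>L y = y o\<^sub>L Ad \<Gamma> x" if y: "y \<in> M" for y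
  proof -
    have "x o\<^sub>L Ad \<Gamma> y = Ad \<Gamma> y o\<^sub>L x"
      using x thetaD(4)[OF y] by (simp add: center_def commutant_iff)
    then have "Ad \<Gamma> (x o\<^sub>L Ad \<Gamma> y) = Ad \<Gamma> (Ad \<Gamma> y o\<^sub>L x)" by simp
    then show ?thesis by (simp add: thetaD(6) xM y thetaD(4))
  qed
  then show ?thesis using thetaD(4)[OF xM] algD(1) by (simp add: center_def commutant_iff)
qed

text \<open>
  For \<open>\<kappa> = 0\<close> the operator \<open>w\<close> is the inner implementation of the grading and
  corresponds to \<open>1 \<otimes> \<sigma>\<^sub>z\<close>, for \<open>\<kappa> = 1\<close> it is central and
  corresponds to \<open>1 \<otimes> \<sigma>\<^sub>x\<close>.
\<close>

definition frame :: "bit \<Rightarrow> 'a op \<Rightarrow> 'a op \<Rightarrow> bool"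
  where "frame \<kappa> e w \<longleftrightarrow> minimal_full (N \<kappa>) e \<and> e \<in> H 0 \<and>
    w \<in> H \<kappa> \<and> adj w = w \<and> w o\<^sub>L w = id_blinfun \<and>
    (\<forall>r. \<forall>x\<in>H r. w o\<^sub>L x = scale_op (sign ((1 + \<kappa>) * r)) (x o\<^sub>L w)) \<and> (\<kappa> = 0 \<longrightarrow> w o\<^sub>L e = e)"

lemma frameD:
  assumes "frame \<kappa> e w"
  shows "minimal_full (N \<kappa>) e" "e \<in> H 0" "w \<in> H \<kappa>" "adj w = w"
    "w o\<^sub>L w = id_blinfun" "w (w v) = v"
    "x \<in> H r \<Longrightarrow> w o\<^sub>L x = scale_op (sign ((1 + \<kappa>) * r)) (x o\<^sub>L w)"
    "x \<in> H r \<Longrightarrow> w (x v) = sign ((1 + \<kappa>) * r) *\<^sub>C x (w v)"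
    "\<kappa> = 0 \<Longrightarrow> w o\<^sub>L e = e" "w \<in> M" "w \<in> Bounded_ops" "corner (N \<kappa>) e"
proof -
  show a: "minimal_full (N \<kappa>) e" "e \<in> H 0" "w \<in> H \<kappa>" "adj w = w"
    "w o\<^sub>L w = id_blinfun" "x \<in> H r \<Longrightarrow> w o\<^sub>L x = scale_op (sign ((1 + \<kappa>) * r)) (x o\<^sub>L w)" for x r
    using assms unfolding frame_def by blast+
  show "w (w v) = v" using compose_eqD[OF a(5)] by simp
  show "x \<in> H r \<Longrightarrow> w (x v) = sign ((1 + \<kappa>) * r) *\<^sub>C x (w v)"
    using compose_eqD[OF a(6)] by simp
  show "\<kappa> = 0 \<Longrightarrow> w o\<^sub>L e = e" using assms by (simp add: frame_def)
  show "w \<in> M" "w \<in> Bounded_ops" using HomD[OF a(3)] by blast+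
  show "corner (N \<kappa>) e"
    using a(1) von_neumann_algebraD(1)[OF corner_vN] by unfold_locales
qed

end


context graded_algebra
begin

section \<open>Existence of frames\<close>

text \<open>The minimal projections \<open>e\<close> and \<open>Ad \<Gamma> e\<close> are equivalent
  in \<open>M\<close>; the connecting partial isometry extends to an operator that implements the
  grading and commutes with the commutant, hence lies in \<open>M\<close>.\<close>

lemma inner_grading:
  fixes e :: "'a op"
  assumes e: "minimal_full M e"
  obtains w where "w \<in> H 0" "adj w = w" "w o\<^sub>L w = id_blinfun" "\<And>x. x \<in> M \<Longrightarrow> w o\<^sub>L x = Ad \<Gamma> x o\<^sub>L w"
proof -
  interpret corner M e using M_star e by unfold_locales
  have \<theta>e: "minimal_full M (Ad \<Gamma> e)"
    by (rule minimal_full_iso[OF theta_iso M_star _ e]) (use algD in blast)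
  obtain v where v: "v \<in> M" "adj v o\<^sub>L v = e" "v o\<^sub>L adj v = Ad \<Gamma> e"
    using equivalent_minimal[OF \<theta>e] by blast
  note ve = isometry_e[OF v(1,2)]
  have \<theta>v: "Ad \<Gamma> e (v u) = v u" for u
    using compose_eqD[OF v(3), of "v u"] by (simp add: ve del: Ad_apply)
  have vB: "v \<in> Bounded_ops" using v algD by blast
  let ?L = "range e"
  let ?D = "{blinfun_apply a u | a u. a \<in> M \<and> u \<in> ?L}"
  have D: "?D = {blinfun_apply a (e v) | a v. a \<in> M}" by blast
  have dense: "clspan ?D = UNIV" unfolding D by (rule cyclic_dense[OF vN e])
  \<comment> \<open>Both sides are the same multiple of the inner product of \<open>u\<close> and
    \<open>u'\<close>: the grading carries the scalar corner of \<open>e\<close> to that of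
    \<open>Ad \<Gamma> e\<close>.\<close>
  have Y: "cinner (v u) (Ad \<Gamma> x (v u')) = conj_pow 0 (cinner u (x u'))"
    if x: "x \<in> M" and u: "u \<in> ?L" "u' \<in> ?L" for x u u'
  proof -
    have e1: "e u = u" "e u' = u'" using u eD by auto
    have es: "cinner (e a) b = cinner a (e b)" for a b using cinner_adj[OF eD(2)] eD(3) by simp
    obtain c where c: "e o\<^sub>L (x o\<^sub>L e) = scale_op c e" using scalar x by blast
    have "cinner u (x u') = cinner u (e (x (e u')))" using e1 es by metis
    also have "\<dots> = c * cinner u u'" using compose_eqD[OF c, of u'] e1 by (simp add: cinner_scaleC_right)
    finally have 1: "cinner u (x u') = c * cinner u u'" .
    have "Ad \<Gamma> (e o\<^sub>L (x o\<^sub>L e)) = scale_op c (Ad \<Gamma> e)" using eD by (simp add: c thetaD)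
    then have "Ad \<Gamma> e o\<^sub>L (Ad \<Gamma> x o\<^sub>L Ad \<Gamma> e) = scale_op c (Ad \<Gamma> e)"
      using x eD algD(4)[OF x eD(1)] by (simp add: thetaD)
    then have 2: "Ad \<Gamma> e (Ad \<Gamma> x (v u')) = c *\<^sub>C v u'"
      using \<theta>v by (metis blinfun_apply_blinfun_compose scale_op_apply)
    have \<theta>es: "cinner (Ad \<Gamma> e a) b = cinner a (Ad \<Gamma> e b)" for a b
    proof -
      have "Ad \<Gamma> e \<in> Bounded_ops" using thetaD(4)[OF eD(1)] by (rule algD)
      moreover have "adj (Ad \<Gamma> e) = Ad \<Gamma> e" using thetaD(7)[OF eD(1)] eD(3) by simp
      ultimately show ?thesis using cinner_adj by metis
    qed
    have "cinner (v u) (Ad \<Gamma> x (v u')) = cinner (Ad \<Gamma> e (v u)) (Ad \<Gamma> x (v u'))" by (simp only: \<theta>v)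
    also have "\<dots> = cinner (v u) (c *\<^sub>C v u')" by (simp only: \<theta>es 2)
    also have "\<dots> = c * cinner u u'"
      using compose_eqD[OF v(2), of u'] e1 vB by (simp add: cinner_scaleC_right cinner_adj)
    finally show ?thesis using 1 by simp
  qed
  obtain V where V: "semilinear 0 V" "\<And>a u. a \<in> M \<Longrightarrow> u \<in> ?L \<Longrightarrow> V (a u) = Ad \<Gamma> a (v u)"
    "\<And>b x. b \<in> M \<Longrightarrow> V (b x) = Ad \<Gamma> b (V x)"
    "\<And>x y. x \<in> clspan ?D \<Longrightarrow> y \<in> clspan ?D \<Longrightarrow> V x \<bullet> V y = x \<bullet> y"
    by (rule covariant_extension[OF M_star theta_iso _ Y]) (use algD in auto)
  have iso: "V x \<bullet> V y = x \<bullet> y" for x y using V(4) unfolding dense by blast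
  have "V \<in> commutant (commutant M)"
  proof -
    have "V o\<^sub>L m = m o\<^sub>L V" if m: "m \<in> commutant M" for m
    proof (rule blinfun_eqI_dense[OF _ dense])
      fix d assume "d \<in> ?D"
      then obtain a :: "'a op" and u where d: "d = a (e u)" "a \<in> M" by blast
      have 1: "m (a (e u)) = a (e (m u))" using commutantD(3)[OF m] d eD by simp
      have 2: "V (a (e x)) = Ad \<Gamma> a (v x)" for x using V(2)[OF d(2), of "e x"] ve(3) by simp
      have 3: "m (Ad \<Gamma> a (v u)) = Ad \<Gamma> a (v (m u))"
        using commutantD(3)[OF m thetaD(4)[OF d(2)]] commutantD(3)[OF m v(1)] by metis
      show "(V o\<^sub>L m) d = (m o\<^sub>L V) d" unfolding d(1) blinfun_apply_blinfun_compose 1 2 3 ..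
    qed
    then show ?thesis using V(1) by (simp add: commutant_iff Bounded_ops_iff)
  qed
  then have VM: "V \<in> M" by (simp add: M_bicomm)
  \<comment> \<open>The grading is an involution, so the square of \<open>V\<close> commutes with
    \<open>M\<close> and is a scalar.\<close>
  have VV: "(V o\<^sub>L V) o\<^sub>L b = b o\<^sub>L (V o\<^sub>L V)" if "b \<in> M" for b
    using V(3)[OF that] V(3)[OF thetaD(4)[OF that]] theta_theta by (intro blinfun_eqI) (simp del: Ad_apply)
  have "\<exists>c. V o\<^sub>L V = scale_op c id_blinfun"
    by (rule commuting_scalar) (use VM VV algD M_id in auto)
  then obtain c where c: "V o\<^sub>L V = scale_op c id_blinfun" ..
  obtain x0 :: 'a where x0: "x0 \<noteq> 0" using nonzero_space by blast
  have "norm (V (V x0)) = norm x0" using iso by (simp add: norm_eq_sqrt_inner)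
  then have "cmod c = 1" using compose_eqD[OF c, of x0] x0 by (simp add: norm_scaleC)
  \<comment> \<open>Dividing by a square root of that scalar turns \<open>V\<close> into an
    isometric involution, which is therefore self-adjoint.\<close>
  define d where "d = csqrt c"
  have d: "d * d = c" by (simp add: d_def flip: power2_eq_square)
  then have "cmod d * cmod d = 1" using \<open>cmod c = 1\<close> by (metis norm_mult)
  then have d1: "cmod d = 1" by (metis norm_ge_zero abs_of_nonneg mult_eq_1_iff real_sqrt_abs2 real_sqrt_one)
  then have dnz: "d \<noteq> 0" by auto
  define w where "w = scale_op (1 / d) V"
  have wM: "w \<in> M" "w \<in> Bounded_ops" using VM algD by (simp_all add: w_def)
  have "V (V v) = c *\<^sub>C v" for v using compose_eqD[OF c, of v] by simp
  then have ww: "w o\<^sub>L w = id_blinfun"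
    using dnz by (intro blinfun_eqI) (simp add: w_def semilinearD[OF V(1)] scaleC_scaleC flip: d)
  have "cinner (w x) (w y) = cinner x y" for x y
  proof -
    have "w x \<bullet> w y = x \<bullet> y" for x y
    proof -
      have "w x \<bullet> w y = Re (cnj (1 / d) * (1 / d) * cinner (V x) (V y))"
        by (simp flip: Re_cinner add: w_def cinner_scaleC_left cinner_scaleC_right mult.commute)
      also have "cnj (1 / d) * (1 / d) = 1"
        using d1 complex_norm_square[of d] by (simp add: mult.commute)
      finally show ?thesis using iso by (simp add: Re_cinner)
    qed
    then have "w x \<bullet> w y = x \<bullet> y" "w (\<i> *\<^sub>C x) \<bullet> w y = (\<i> *\<^sub>C x) \<bullet> y" by blast+
    then show ?thesis using wM by (simp add: complex_eq_iff Re_cinner Im_cinner Bounded_opsD)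
  qed
  then have "cinner x (adj w (w y)) = cinner x y" for x y using cinner_adj[OF wM(2)] by metis
  then have aw: "adj w (w y) = y" for y by (rule cinner_eqI)
  have wsa: "adj w = w"
    by (rule blinfun_eqI) (use aw compose_eqD[OF ww] in \<open>metis id_blinfun.rep_eq id_apply\<close>)
  have wx: "w o\<^sub>L x = Ad \<Gamma> x o\<^sub>L w" if "x \<in> M" for x
    using V(3)[OF that] algD(1)[OF thetaD(4)[OF that]]
    by (intro blinfun_eqI) (simp add: w_def Bounded_opsD del: Ad_apply)
  have "Ad \<Gamma> w = Ad \<Gamma> w o\<^sub>L (w o\<^sub>L w)" by (simp add: ww)
  also have "\<dots> = w" 
    by (simp only: wx[OF wM(1), symmetric] compose_assoc[symmetric]) (simp add: ww)
  finally have "w \<in> H 0" using wM by (simp add: homogeneous_part_def)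
  then show thesis using that wsa ww wx by blast
qed

text \<open>The projection has to be moved into the range of \<open>1 + w\<close>. This is nonzero
  because an odd unitary, supplied by balancedness, cannot commute with the implementer
  \<open>w\<close>. Being fixed by \<open>w\<close> on both sides, the new projection is
  even.\<close>

lemma frame_0_exists:
  assumes e: "minimal_full M e" and bal: "balanced M (Ad \<Gamma>)"
  shows "\<exists>e w. frame 0 e w"
proof -
  interpret corner M e using M_star e by unfold_locales
  obtain w where w: "w \<in> H 0" "adj w = w" "w o\<^sub>L w = id_blinfun" "\<And>x. x \<in> M \<Longrightarrow> w o\<^sub>L x = Ad \<Gamma> x o\<^sub>L w"
    using inner_grading[OF e] by blast
  note wM = HomD(1,2)[OF w(1)]
  obtain u where u: "u \<in> H 1" "sa_unitary u" using bal by (auto simp: balanced_def)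
  have "id_blinfun + w \<noteq> 0"
  proof
    assume "id_blinfun + w = 0"
    then have "w = - id_blinfun" by (simp add: eq_neg_iff_add_eq_0 add.commute)
    then have "u = Ad \<Gamma> u" using w(4)[OF HomD(1)[OF u(1)]] by simp
    then have "2 *\<^sub>R u = 0" using HomD(4)[OF u(1)] by (simp add: scaleR_2 eq_neg_iff_add_eq_0)
    then have "u = 0" by simp
    then show False using sa_unitaryD(3)[OF u(2)] by simp
  qed
  then obtain a where a: "a \<in> M" "(id_blinfun + w) o\<^sub>L (a o\<^sub>L e) \<noteq> 0"
    using full[of "id_blinfun + w"] M_id wM algD by blast
  define y where "y = (id_blinfun + w) o\<^sub>L (a o\<^sub>L e)"
  have "w o\<^sub>L (id_blinfun + w) = id_blinfun + w" by (simp add: compose_distribs w(3) add.commute)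
  then have "w o\<^sub>L y = y" unfolding y_def by (metis compose_assoc)
  moreover have "y \<in> M" using a(1) eD(1) M_id wM(1) by (simp add: y_def algD)
  moreover have "y o\<^sub>L e = y" by (simp add: y_def compose_assoc eD)
  ultimately have y: "y \<in> M" "y o\<^sub>L e = y" "y \<noteq> 0" "w o\<^sub>L y = y" using a(2) y_def by simp_all
  then obtain r :: real where r: "adj (r *\<^sub>R y) o\<^sub>L (r *\<^sub>R y) = e" using normalise by blast
  define v where "v = r *\<^sub>R y"
  have v: "v \<in> M" "adj v o\<^sub>L v = e" "w o\<^sub>L v = v" using y r algD by (simp_all add: v_def compose_distribs)
  define f where "f = v o\<^sub>L adj v"
  have f: "minimal_full M f" unfolding f_def by (rule isometry_minimal_full[OF v(1,2)])
  interpret f: corner M f using M_star f by unfold_locales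
  have wf: "w o\<^sub>L f = f" using v(3) by (simp add: f_def flip: compose_assoc)
  then have fw: "f o\<^sub>L w = f" using w(2) f.eD(3) by (metis adj_compose)
  have "f = Ad \<Gamma> f o\<^sub>L w" using w(4)[OF f.eD(1)] wf by simp
  then have "f o\<^sub>L w = Ad \<Gamma> f" using w(3) by (metis compose_assoc compose_simps(2))
  then have fH: "f \<in> H 0" using fw f.eD(1) by (simp add: homogeneous_part_def)
  have comm: "w o\<^sub>L x = scale_op (sign ((1 + 0) * r)) (x o\<^sub>L w)" if "x \<in> H r" for x r
    using w(4)[OF HomD(1)[OF that]] HomD(4)[OF that] by simp
  have "minimal_full (N 0) f" using f by (simp add: corner_algebra_def)
  then have "frame 0 f w" unfolding frame_def using fH w(1-3) comm wf by blast
  then show ?thesis by blast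
qed

text \<open>Even central elements are scalars, so a nonscalar central element has a nonzero odd
  part. A self-adjoint odd central element has an even central square, a positive scalar, and can be
  normalised.\<close>

lemma odd_central_unitary:
  assumes cen: "central M (Ad \<Gamma>)" and x: "x \<in> center M" "x \<notin> range (\<lambda>c. scale_op c id_blinfun)"
  obtains z where "z \<in> center M" "z \<in> H 1" "adj z = z" "z o\<^sub>L z = id_blinfun"
proof -
  have comm: "star_algebra (commutant M)" by (rule von_neumann_algebraD(4)[OF vN])
  have Z: "star_algebra (center M)"
    using star_algebraD[OF M_star] star_algebraD[OF comm] unfolding star_algebra_def center_def by auto
  note ZD = star_algebraD[OF Z]
  have Z0: "y \<in> range (\<lambda>c. scale_op c id_blinfun)" if "y \<in> center M" "y \<in> H 0" for y
    using cen that by (auto simp: central_def)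
  let ?y = "Ad \<Gamma> x"
  have xM: "x \<in> M" using x by (simp add: center_def)
  have y: "?y \<in> center M" using x by (rule_tac theta_center)
  have "x + ?y \<in> H 0" "x - ?y \<in> H 1"
    using xM thetaD(4)[OF xM] thetaD(5)[OF xM thetaD(4)[OF xM]] star_iso_more(3)[OF theta_iso M_star xM thetaD(4)[OF xM]]
    by (auto simp: homogeneous_part_def algD add.commute)
  define s where "s = x - ?y"
  have s: "s \<in> center M" "s \<in> H 1" using x y ZD \<open>x - ?y \<in> H 1\<close> by (auto simp: s_def)
  have "s \<noteq> 0"
  proof
    assume "s = 0"
    then have "x + ?y = 2 *\<^sub>R x" by (simp add: s_def scaleR_2)
    then have "2 *\<^sub>R x \<in> range (\<lambda>c. scale_op c id_blinfun)"
      using Z0[of "x + ?y"] \<open>x + ?y \<in> H 0\<close> x y ZD by metis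
    then obtain c where "2 *\<^sub>R x = scale_op c id_blinfun" by blast
    then have "scale_op (1/2) (2 *\<^sub>R x) = scale_op (c/2) id_blinfun" by simp
    then have "x = scale_op (c/2) id_blinfun" by (simp flip: scale_op_of_real)
    then show False using x by blast
  qed
  have "\<exists>t. t \<in> center M \<and> t \<in> H 1 \<and> adj t = t \<and> t \<noteq> 0"
  proof (cases "s + adj s = 0")
    case False
    then show ?thesis using s ZD Hom_add Hom_adj by (intro exI[of _ "s + adj s"]) (simp add: add.commute)
  next
    case True
    then have "adj s = - s" by (simp add: eq_neg_iff_add_eq_0 add.commute)
    then show ?thesis using s ZD Hom_scale \<open>s \<noteq> 0\<close> HomD(2)[OF s(2)]
      by (intro exI[of _ "scale_op \<i> s"]) simp
  qed
  then obtain t where t: "t \<in> center M" "t \<in> H 1" "adj t = t" "t \<noteq> 0" by blast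
  have "t o\<^sub>L t \<in> center M" "t o\<^sub>L t \<in> H 0" using t ZD Hom_compose[of t 1 t 1] by auto
  then obtain c where c: "t o\<^sub>L t = scale_op c id_blinfun" using Z0 by blast
  have tt: "t (t u) = c *\<^sub>C u" for u using compose_eqD[OF c, of u] by simp
  obtain u0 where u0: "t u0 \<noteq> 0" using t(4) blinfun_eqI[of t 0] by force
  then have u0': "u0 \<noteq> 0" by (auto simp: blinfun.zero_right)
  have "cinner (t u0) (t u0) = c * cinner u0 u0"
    using cinner_adj[OF HomD(2)[OF t(2)]] t(3) by (simp add: tt cinner_scaleC_right)
  then have "c = of_real ((norm (t u0))\<^sup>2 / (norm u0)\<^sup>2)" using u0' by (simp add: cinner_self field_simps)
  moreover define k where "k = (norm (t u0))\<^sup>2 / (norm u0)\<^sup>2"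
  ultimately have k: "c = of_real k" "k > 0" using u0 u0' by simp_all
  define z where "z = (1 / sqrt k) *\<^sub>R t"
  have "z o\<^sub>L z = (1 / k) *\<^sub>R (t o\<^sub>L t)" using k by (simp add: z_def compose_distribs)
  also have "\<dots> = id_blinfun" using k c by (simp add: scale_op_of_real)
  finally have zz: "z o\<^sub>L z = id_blinfun" .
  have "z \<in> H 1" using Hom_scale[OF t(2), of "of_real (1 / sqrt k)"] by (simp only: z_def scale_op_of_real)
  moreover have "z \<in> center M" "adj z = z" using t ZD(9) by (simp_all add: z_def)
  ultimately show thesis using that zz by blast
qed

text \<open>Type I is applied below the central projection \<open>(1 + z) / 2\<close>. The abelian
  projection found there is not even; adding its image under the grading makes it even, and it stays
  abelian in the even part.\<close>

lemma frame_1_exists: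
  assumes cen: "central M (Ad \<Gamma>)" and tI: "type_I M"
    and z: "z \<in> center M" "z \<in> H 1" "adj z = z" "z o\<^sub>L z = id_blinfun"
  shows "\<exists>e. frame 1 e z"
proof -
  note zM = HomD(1,2)[OF z(2)]
  have zx: "z o\<^sub>L x = x o\<^sub>L z" if "x \<in> M" for x using z(1) that by (simp add: center_def commutant_iff)
  have zx': "z (x v) = x (z v)" if "x \<in> M" for x v using zx[OF that] by (metis blinfun_apply_blinfun_compose)
  have zz: "z (z v) = v" for v using compose_eqD[OF z(4), of v] by simp
  define f where "f = (1/2) *\<^sub>R (id_blinfun + z)"
  have f: "f v = (1/2) *\<^sub>R (v + z v)" for v by (simp add: f_def blinfun.scaleR_left blinfun.add_left)
  have fM: "f \<in> M" using M_id zM algD by (simp add: f_def)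
  have "z (f v) = f v" for v
    by (simp add: f blinfun.add_right blinfun.scaleR_right zz add.commute)
  then have ff: "f (f v) = f v" for v using f[of "f v"] by simp
  have fx: "f (x v) = x (f v)" if "x \<in> M" for x v
    by (simp add: f blinfun.add_right blinfun.scaleR_right zx'[OF that])
  have pf: "projection_op f"
    using fM algD z(3) by (auto simp: projection_op_def f_def[symmetric] ff intro!: blinfun_eqI)
      (simp add: f_def z)
  have fc: "f \<in> center M" using fM algD fx by (auto simp: center_def intro!: commutantI)
  have "f \<noteq> 0"
  proof
    assume f0: "f = 0"
    have "(id_blinfun :: 'a op) = 0"
    proof (rule Hom_sum_zero(1)[OF Hom_id z(2)])
      have "2 *\<^sub>R f = id_blinfun + z" by (simp add: f_def)
      then show "id_blinfun + z = 0" by (simp add: f0)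
    qed
    then show False by simp
  qed
  then obtain e where e: "e \<in> M" "projection_op e" "e \<noteq> 0" "e o\<^sub>L f = e"
    and ab: "\<And>x y. x \<in> M \<Longrightarrow> y \<in> M \<Longrightarrow>
      (e o\<^sub>L x o\<^sub>L e) o\<^sub>L (e o\<^sub>L y o\<^sub>L e) = (e o\<^sub>L y o\<^sub>L e) o\<^sub>L (e o\<^sub>L x o\<^sub>L e)"
    using tI fc pf unfolding type_I_def by blast
  note pe = projection_opD[OF e(2)]
  define e' where "e' = Ad \<Gamma> e"
  have e'M: "e' \<in> M" unfolding e'_def by (rule thetaD(4)[OF e(1)])
  have ef: "e (f v) = e v" "f (e v) = e v" for v using compose_eqD[OF e(4)] fx[OF e(1)] by simp_all
  have \<theta>z: "\<Gamma> (z v) = - z (\<Gamma> v)" for v using HomD(3)[OF z(2)] by simp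
  \<comment> \<open>\<open>z\<close> is odd, so the grading exchanges \<open>f\<close> with its
    complement; hence \<open>e'\<close> lies below that complement.\<close>
  have e'f: "f (e' v) = 0" for v
  proof -
    have "f (\<Gamma> u) = \<Gamma> (u - f u)" for u
      using \<theta>z[of u] by (simp add: f blinfun.diff_right blinfun.add_right blinfun.scaleR_right algebra_simps)
        (simp flip: scaleR_add_left)
    then show ?thesis by (simp add: e'_def ef blinfun.zero_right)
  qed
  \<comment> \<open>As \<open>f\<close> is central, nothing in \<open>M\<close> connects the part
    below \<open>f\<close> with the part below its complement.\<close>
  have cross: "e (x (e' v)) = 0" "e' (x (e v)) = 0" if "x \<in> M" for x v
  proof -
    have "e (x (e' v)) = e (f (x (e' v)))" by (simp add: ef)
    then show "e (x (e' v)) = 0" by (simp add: fx[OF that] e'f blinfun.zero_right)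
    have "e' (x (e v)) = e' (x (f (e v)))" by (simp add: ef)
    also have "\<dots> = f (e' (x (e v)))" by (simp add: fx[OF that] fx[OF e'M])
    finally show "e' (x (e v)) = 0" by (simp add: e'f)
  qed
  define e0 where "e0 = e + e'"
  have e0: "e0 v = e v + e' v" for v by (simp add: e0_def blinfun.add_left)
  have "Ad \<Gamma> e0 = e0" unfolding e0_def e'_def by (simp add: Ad_add add.commute)
  then have e0H: "e0 \<in> H 0" using e e'M algD by (simp add: homogeneous_part_def e0_def)
  have "adj e' = e'" using thetaD(7)[OF e(1)] pe by (simp add: e'_def)
  moreover have "e' (e' v) = e' v" for v by (simp add: e'_def \<Gamma>D pe)
  moreover have "e (e' v) = 0" "e' (e v) = 0" for v using cross[OF M_id] by simp_all
  ultimately have pe0: "projection_op e0"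
    using HomD(2)[OF e0H] pe unfolding projection_op_def e0_def
    by (auto simp: blinfun.add_right blinfun.add_left intro!: blinfun_eqI)
  have "e0 \<noteq> 0"
  proof
    assume "e0 = 0"
    then have "e (e0 v) = 0" for v by (simp add: blinfun.zero_right)
    then have "e v = 0" for v using cross(1)[OF M_id] by (simp add: e0 blinfun.add_right pe)
    then show False using e(3) blinfun_eqI[of e 0] by force
  qed
  \<comment> \<open>The compression of an even element by \<open>e0\<close> is its compression by
    \<open>e\<close> plus the image of that under the grading, so commutativity is inherited from
    the corner of \<open>e\<close>.\<close>
  have key: "e0 (x (e0 v)) = e (x (e v)) + \<Gamma> (e (x (e (\<Gamma> v))))" if "x \<in> H 0" for x v
    using cross[OF HomD(1)[OF that]] HomD(3)[OF that]
    by (simp add: e0 blinfun.add_right) (simp add: e'_def \<Gamma>D)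
  have ab0: "(e0 o\<^sub>L x o\<^sub>L e0) o\<^sub>L (e0 o\<^sub>L y o\<^sub>L e0) = (e0 o\<^sub>L y o\<^sub>L e0) o\<^sub>L (e0 o\<^sub>L x o\<^sub>L e0)"
    if xy: "x \<in> H 0" "y \<in> H 0" for x y
  proof (rule blinfun_eqI)
    fix v
    have ex: "e (x (e (e (y (e u))))) = e (y (e (e (x (e u)))))" for u
      using arg_cong[OF ab[OF HomD(1)[OF xy(1)] HomD(1)[OF xy(2)]], of "\<lambda>z. blinfun_apply z u"] by simp
    have e\<Gamma>: "e (\<Gamma> (e u)) = 0" for u
      using cross(1)[OF M_id, of "\<Gamma> u"] by (simp add: e'_def \<Gamma>D)
    have "e0 (x (e0 (e0 (y (e0 v))))) = e (x (e (e (y (e v))))) + \<Gamma> (e (x (e (e (y (e (\<Gamma> v)))))))"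
      if "x \<in> H 0" "y \<in> H 0" for x y
    proof -
      have k: "e0 (y (e0 v)) = e (y (e v)) + \<Gamma> (e (y (e (\<Gamma> v))))" by (rule key[OF \<open>y \<in> H 0\<close>])
      have "e0 (x (e0 (e0 (y (e0 v))))) = e (x (e (e0 (y (e0 v))))) + \<Gamma> (e (x (e (\<Gamma> (e0 (y (e0 v)))))))"
        by (rule key[OF \<open>x \<in> H 0\<close>])
      also have "e (e0 (y (e0 v))) = e (e (y (e v)))"
        by (simp add: k blinfun.add_right e\<Gamma> pe)
      also have "e (\<Gamma> (e0 (y (e0 v)))) = e (e (y (e (\<Gamma> v))))"
        by (simp add: k blinfun.add_right e\<Gamma> pe \<Gamma>D)
      finally show ?thesis .
    qed
    then show "((e0 o\<^sub>L x o\<^sub>L e0) o\<^sub>L (e0 o\<^sub>L y o\<^sub>L e0)) v = ((e0 o\<^sub>L y o\<^sub>L e0) o\<^sub>L (e0 o\<^sub>L x o\<^sub>L e0)) v"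
      using xy ex by simp
  qed
  \<comment> \<open>An odd \<open>x1\<close> is \<open>z\<close> times the even element
    \<open>z o\<^sub>L x1\<close>, so what is central in the even part is central in
    \<open>M\<close>, and scalar because \<open>M\<close> is central.\<close>
  have "center (H 0) \<subseteq> range (\<lambda>c. scale_op c id_blinfun)"
  proof
    fix y assume "y \<in> center (H 0)"
    then have y: "y \<in> H 0" "\<And>x. x \<in> H 0 \<Longrightarrow> y o\<^sub>L x = x o\<^sub>L y" by (auto simp: center_def commutant_iff)
    have yx: "y (x v) = x (y v)" if "x \<in> H 0" for x v using y(2)[OF that] by (metis blinfun_apply_blinfun_compose)
    have "y (x v) = x (y v)" if xM: "x \<in> M" for x v
    proof -
      obtain x0 x1 where x: "x0 \<in> H 0" "x1 \<in> H 1" "x = x0 + x1" using Hom_decompose[OF xM] by blast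
      have zx1: "z o\<^sub>L x1 \<in> H 0" using Hom_compose[OF z(2) x(2)] by simp
      have "y (x1 v) = y (z ((z o\<^sub>L x1) v))" by (simp add: zz)
      also have "\<dots> = x1 (y v)" using yx[OF zx1, of v] zx'[OF HomD(1)[OF y(1)]] by (metis blinfun_apply_blinfun_compose zz)
      finally show ?thesis using yx[OF x(1)] x(3) by (simp add: blinfun.add_left blinfun.add_right)
    qed
    then have "y \<in> center M" using HomD(1,2)[OF y(1)] by (auto simp: center_def intro!: commutantI)
    then show "y \<in> range (\<lambda>c. scale_op c id_blinfun)" using cen y(1) by (auto simp: central_def)
  qed
  then have "minimal_full (H 0) e0"
    by (rule abelian_minimal[OF even_vN e0H pe0 \<open>e0 \<noteq> 0\<close> _ ab0])
  then have "minimal_full (N 1) e0" by (simp add: corner_algebra_def)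
  moreover have "z o\<^sub>L x = scale_op (sign ((1 + 1) * r)) (x o\<^sub>L z)" if "x \<in> H r" for x r
    using zx[OF HomD(1)[OF that]] by simp
  ultimately have "frame 1 e0 z" unfolding frame_def
    using e0H z(2-4) one_neq_zero[where 'a = bit] by blast
  then show ?thesis by blast
qed

text \<open>Whether \<open>M\<close> has trivial center decides between \<open>\<kappa> = 0\<close>
  and \<open>\<kappa> = 1\<close>.\<close>

theorem frame_exists:
  assumes bal: "balanced M (Ad \<Gamma>)" and cen: "central M (Ad \<Gamma>)" and tI: "type_I M"
  shows "\<exists>\<kappa> e w. frame \<kappa> e w"
proof (cases "center M \<subseteq> range (\<lambda>c. scale_op c id_blinfun)")
  case True
  have "id_blinfun \<in> center M" by (simp add: center_def M_id)
  moreover have "projection_op (id_blinfun :: 'a op)" by (simp add: projection_op_def)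
  ultimately obtain e where e: "e \<in> M" "projection_op e" "e \<noteq> 0"
    and ab: "\<And>x y. x \<in> M \<Longrightarrow> y \<in> M \<Longrightarrow>
      (e o\<^sub>L x o\<^sub>L e) o\<^sub>L (e o\<^sub>L y o\<^sub>L e) = (e o\<^sub>L y o\<^sub>L e) o\<^sub>L (e o\<^sub>L x o\<^sub>L e)"
    using tI id_blinfun_neq_0 unfolding type_I_def by blast
  then have "minimal_full M e" using True by (intro abelian_minimal[OF vN])
  then show ?thesis using frame_0_exists bal by blast
next
  case False
  then obtain x where "x \<in> center M" "x \<notin> range (\<lambda>c. scale_op c id_blinfun)" by blast
  then obtain z where "z \<in> center M" "z \<in> H 1" "adj z = z" "z o\<^sub>L z = id_blinfun"
    using odd_central_unitary[OF cen] by blast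
  then show ?thesis using frame_1_exists[OF cen tI] by blast
qed

text \<open>In the product of \<open>w'\<close> and \<open>w\<close> the commutation signs cancel,
  so it is central, hence a scalar; since both square to 1, the scalar is a sign.\<close>

lemma frame_unique_sign:
  assumes fr: "frame \<kappa> e w" and w': "w' \<in> H \<kappa>" "w' o\<^sub>L w' = id_blinfun"
    "\<And>r x. x \<in> H r \<Longrightarrow> w' o\<^sub>L x = scale_op (sign ((1 + \<kappa>) * r)) (x o\<^sub>L w')"
  shows "\<exists>s. w' = scale_op (sign s) w"
proof -
  note w = frameD[OF fr]
  interpret corner "N \<kappa>" e by (rule w)
  let ?x = "w' o\<^sub>L w"
  have x0: "?x \<in> H 0" using Hom_compose[OF w'(1) w(3)] by simp
  have w'a: "w' (a v) = sign ((1 + \<kappa>) * r) *\<^sub>C a (w' v)" if "a \<in> H r" for a r v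
    using compose_eqD[OF w'(3)[OF that], of v] by simp
  have w'B: "w' \<in> Bounded_ops" by (rule HomD(2)[OF w'(1)])
  have comm: "?x (a v) = a (?x v)" if "a \<in> H r" for a r v
    using w'B by (simp add: w(8)[OF that] w'a[OF that] Bounded_opsD scaleC_scaleC)
  have "?x o\<^sub>L a = a o\<^sub>L ?x" if a: "a \<in> M" for a
  proof -
    obtain a0 a1 where "a0 \<in> H 0" "a1 \<in> H 1" "a = a0 + a1" using Hom_decompose[OF a] by blast
    then show ?thesis using comm[of a0 0] comm[of a1 1]
      by (intro blinfun_eqI) (simp add: blinfun.add_left blinfun.add_right)
  qed
  then have "\<exists>c. ?x = scale_op c id_blinfun"
    using x0 even_subset_corner[of \<kappa>] corner_subset[of \<kappa>] HomD(2)[OF x0] von_neumann_algebraD(2)[OF corner_vN]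
    by (intro commuting_scalar) auto
  then obtain c where c: "?x = scale_op c id_blinfun" ..
  have w'c: "w' = scale_op c w"
  proof (rule blinfun_eqI)
    fix v show "w' v = scale_op c w v" using compose_eqD[OF c, of "w v"] by (simp add: w(6))
  qed
  then have "scale_op (c * c) id_blinfun = scale_op 1 (id_blinfun :: 'a op)" using w'(2) w(5,11) by simp
  then have "c * c = 1" by (simp only: scale_op_cancel) simp
  then have "c = 1 \<or> c = - 1" by (simp add: square_eq_1_iff)
  then show ?thesis using w'c by (metis sign_0 sign_1)
qed

end

section \<open>The index of a graded dynamical system\<close>

locale graded_system = graded_algebra M \<Gamma> + group G
  for M :: "'a::chilbert_space op set" and \<Gamma> and G :: "('g, 'm) monoid_scheme" (structure) +
  fixes p :: "'g \<Rightarrow> bit" and \<alpha> :: "'g \<Rightarrow> 'a op \<Rightarrow> 'a op"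
  assumes dyn: "graded_dynamical_system G p M (Ad \<Gamma>) \<alpha>" and p_hom: "Z2_hom G p"
begin

sublocale act: algebra_action G p M \<alpha>
  using dyn p_hom M_star by unfold_locales (auto simp: graded_dynamical_system_def)

lemma Hom_act: "g \<in> carrier G \<Longrightarrow> x \<in> H s \<Longrightarrow> \<alpha> g x \<in> H s"
proof -
  assume a: "g \<in> carrier G" "x \<in> H s"
  then have "\<alpha> g (Ad \<Gamma> x) = Ad \<Gamma> (\<alpha> g x)"
    using dyn HomD(1)[OF a(2)] by (simp add: graded_dynamical_system_def)
  then show ?thesis using a HomD(1,4)[OF a(2)] by (simp add: homogeneous_part_def act.isoD)
qed

lemma Hom_act_surj: "g \<in> carrier G \<Longrightarrow> y \<in> H s \<Longrightarrow> \<exists>x\<in>H s. y = \<alpha> g x"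
proof -
  assume a: "g \<in> carrier G" "y \<in> H s"
  then obtain x where x: "x \<in> M" "y = \<alpha> g x" using act.isoD(3)[OF a(1)] HomD(1)[OF a(2)] by blast
  have "\<alpha> g (Ad \<Gamma> x) = \<alpha> g (scale_op (sign s) x)"
    using dyn a x HomD(4)[OF a(2)] by (simp add: graded_dynamical_system_def act.isoD)
  then have "Ad \<Gamma> x = scale_op (sign s) x"
    by (rule inj_onD[OF act.isoD(2)[OF a(1)] _ thetaD(4)[OF x(1)] algD(6)[OF x(1)]])
  then show ?thesis using x by (auto simp: homogeneous_part_def)
qed

lemma even_iso: "g \<in> carrier G \<Longrightarrow> star_iso (p g) (H 0) (H 0) (\<alpha> g)"
proof -
  assume g: "g \<in> carrier G"
  have "\<alpha> g ` H 0 = H 0" using Hom_act[OF g, of _ 0] Hom_act_surj[OF g, of _ 0] by blast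
  moreover have "inj_on (\<alpha> g) (H 0)"
    using act.isoD(2)[OF g] by (rule inj_on_subset) (use HomD(1) in blast)
  ultimately show ?thesis using act.isoD[OF g] HomD(1)[of _ 0] by (simp add: star_iso_def bij_betw_def)
qed

lemma corner_action: "algebra_action G p (N \<kappa>) \<alpha>"
proof
  show "star_algebra (N \<kappa>)" by (rule von_neumann_algebraD(1)[OF corner_vN])
  show "star_iso (p g) (N \<kappa>) (N \<kappa>) (\<alpha> g)"
    if "g \<in> carrier G" for g
    using even_iso[OF that] act.iso[OF that] by (simp add: corner_algebra_def)
  show "\<alpha> (g \<otimes> h) x = \<alpha> g (\<alpha> h x)"
    if "g \<in> carrier G" "h \<in> carrier G" "x \<in> N \<kappa>" for g h x
    using that corner_subset act.act by blast
qed (rule p_hom)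

text \<open>The choices are harmless: the sign of \<open>w\<close> cancels in the equation for
  \<open>q\<close>, and a change of \<open>e\<close> or \<open>v\<close> alters
  \<open>\<upsilon>\<close> by a coboundary (\<open>index_data_unique\<close>).\<close>

definition index_data :: "bit \<Rightarrow> ('g \<Rightarrow> bit) \<Rightarrow> 'a op \<Rightarrow> 'a op \<Rightarrow> ('g \<Rightarrow> 'a op) \<Rightarrow> ('g \<Rightarrow> 'g \<Rightarrow> complex) \<Rightarrow> bool"
  where "index_data \<kappa> q e w v \<upsilon> \<longleftrightarrow> frame \<kappa> e w \<and>
    (\<forall>g\<in>carrier G. \<alpha> g w = scale_op (sign (q g)) w) \<and>
    corner_cocycle G (N \<kappa>) \<alpha> e v \<upsilon>"

text \<open>\<open>\<alpha> g w\<close> satisfies the defining relations of \<open>w\<close>, so it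
  equals \<open>w\<close> up to a sign, which is \<open>q g\<close>.\<close>

lemma index_data_exists:
  assumes fr: "frame \<kappa> e w"
  shows "\<exists>q\<in>extensional (carrier G). \<exists>v \<upsilon>. index_data \<kappa> q e w v \<upsilon>"
proof -
  note w = frameD[OF fr]
  have "\<exists>s. \<alpha> g w = scale_op (sign s) w" if g: "g \<in> carrier G" for g
  proof (rule frame_unique_sign[OF fr])
    show "\<alpha> g w \<in> H \<kappa>" by (rule Hom_act[OF g w(3)])
    have "\<alpha> g w o\<^sub>L \<alpha> g w = \<alpha> g (w o\<^sub>L w)" using act.isoD(6)[OF g w(10) w(10)] by simp
    then show "\<alpha> g w o\<^sub>L \<alpha> g w = id_blinfun"
      using w(5) star_iso_id_blinfun[OF act.iso[OF g] M_id M_id] by simp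
    show "\<alpha> g w o\<^sub>L x = scale_op (sign ((1 + \<kappa>) * r)) (x o\<^sub>L \<alpha> g w)" if x: "x \<in> H r" for r x
    proof -
      obtain y where y: "y \<in> H r" "x = \<alpha> g y" using Hom_act_surj[OF g x] by blast
      have yM: "y \<in> M" by (rule HomD(1)[OF y(1)])
      have "\<alpha> g (w o\<^sub>L y) = \<alpha> g (scale_op (sign ((1 + \<kappa>) * r)) (y o\<^sub>L w))" by (simp only: w(7)[OF y(1)])
      then show ?thesis using act.isoD[OF g] y(2) yM w(10) algD(4)[OF yM w(10)] by simp
    qed
  qed
  then obtain q where q: "\<And>g. g \<in> carrier G \<Longrightarrow> \<alpha> g w = scale_op (sign (q g)) w" by metis
  interpret C: algebra_action G p "N \<kappa>" \<alpha> by (rule corner_action)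
  obtain v \<upsilon> where "corner_cocycle G (N \<kappa>) \<alpha> e v \<upsilon>"
    using C.corner_exists[OF w(1)] by blast
  then have "index_data \<kappa> (restrict q (carrier G)) e w v \<upsilon>" using fr q by (simp add: index_data_def)
  then show ?thesis using restrict_extensional by blast
qed

lemma index_data_hom:
  assumes "index_data \<kappa> q e w v \<upsilon>"
  shows "Z2_hom G q"
  unfolding Z2_hom_def
proof (intro ballI)
  fix g h assume g: "g \<in> carrier G" "h \<in> carrier G"
  have fr: "frame \<kappa> e w" and q: "\<And>g. g \<in> carrier G \<Longrightarrow> \<alpha> g w = scale_op (sign (q g)) w"
    using assms by (auto simp: index_data_def)
  note w = frameD[OF fr]
  have "w \<noteq> 0" using w(5) by auto
  have "\<alpha> (g \<otimes> h) w = \<alpha> g (\<alpha> h w)" using act.act g w(10) by blast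
  then have "scale_op (sign (q (g \<otimes> h))) w = scale_op (sign (q g + q h)) w"
    using q g w(10) act.isoD(8)[OF g(1) w(10)] by (simp add: sign_add mult.commute)
  then show "q (g \<otimes> h) = q g + q h" using \<open>w \<noteq> 0\<close> by (simp add: scale_op_cancel sign_eq_iff)
qed

theorem index_data_unique:
  assumes 1: "index_data \<kappa> q e w v \<upsilon>" and 2: "index_data \<kappa>' q' e' w' v' \<upsilon>'"
  shows "\<kappa> = \<kappa>'" "g \<in> carrier G \<Longrightarrow> q g = q' g" "\<exists>b. cohomologous G p b \<upsilon> \<upsilon>'"
proof -
  have fr: "frame \<kappa> e w" "frame \<kappa>' e' w'" using assms by (auto simp: index_data_def)
  note w = frameD[OF fr(1)] and w' = frameD[OF fr(2)]
  \<comment> \<open>With a frame for \<open>\<kappa> = 0\<close> every central element is a scalar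
    and thus even, while a frame for \<open>\<kappa> = 1\<close> contains a nonzero odd central
    element.\<close>
  have mixed: False if fr0: "frame 0 e w" and fr1: "frame 1 e' w'" for e w e' w'
  proof -
    note w = frameD[OF fr0] and w' = frameD[OF fr1]
    interpret corner M e using w(12) by (simp add: corner_algebra_def)
    have comm: "w' o\<^sub>L a = a o\<^sub>L w'" if a: "a \<in> M" for a
    proof -
      obtain a0 a1 where "a0 \<in> H 0" "a1 \<in> H 1" "a = a0 + a1" using Hom_decompose[OF a] by blast
      then show ?thesis using w'(7)[of a0 0] w'(7)[of a1 1] by (simp add: compose_distribs)
    qed
    obtain c where c: "w' = scale_op c id_blinfun"
      using commuting_scalar[OF w'(11) w'(10) comm M_id] by blast
    then have "w' \<in> H 0" using Hom_scale[OF Hom_id] by simp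
    then have "w' = - w'" using HomD(4)[OF w'(3)] HomD(4)[of w' 0] by simp
    then have "2 *\<^sub>R w' = 0" by (simp add: scaleR_2 eq_neg_iff_add_eq_0)
    then show False using w'(5) by simp
  qed
  show \<kappa>: "\<kappa> = \<kappa>'"
  proof (rule ccontr)
    assume "\<kappa> \<noteq> \<kappa>'"
    then show False using fr mixed by (cases \<kappa>; cases \<kappa>') auto
  qed
  obtain s where s: "w' = scale_op (sign s) w"
    using frame_unique_sign[OF fr(1), of w'] w'(3,5,7) unfolding \<kappa> by blast
  show "q g = q' g" if g: "g \<in> carrier G"
  proof -
    have "\<alpha> g w = scale_op (sign (q g)) w" "\<alpha> g w' = scale_op (sign (q' g)) w'"
      using assms g by (auto simp: index_data_def)
    then have "scale_op (sign s * sign (q g)) w = scale_op (sign (q' g) * sign s) w"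
      using s act.isoD(8)[OF g w(10)] by simp
    moreover have "w \<noteq> 0" using w(5) by auto
    ultimately have "sign s * sign (q g) = sign (q' g) * sign s" by (simp add: scale_op_cancel)
    then show ?thesis by (simp add: sign_eq_iff mult.commute)
  qed
  interpret C: algebra_action G p "N \<kappa>" \<alpha> by (rule corner_action)
  show "\<exists>b. cohomologous G p b \<upsilon> \<upsilon>'"
    using assms w'(1) C.corner_unique[OF w(1), of v \<upsilon> e' v' \<upsilon>'] unfolding index_data_def \<kappa>[symmetric]
    by blast
qed

lemma index_data_rescale:
  "index_data \<kappa> q e w v \<upsilon> \<Longrightarrow> cohomologous G p b \<upsilon> \<omega> \<Longrightarrow>
    index_data \<kappa> q e w (\<lambda>g. scale_op (b g) (v g)) \<omega>"
  using algebra_action.corner_rescale[OF corner_action] unfolding index_data_def by blast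

end

text \<open>Makes operator spaces complete; norm limits of operators occur in the proof that the
  cyclic subspace is closed.\<close>

instance chilbert_space \<subseteq> banach ..

section \<open>The irreducible representation\<close>

text \<open>\<open>\<beta>\<close> carries the scalar corner of \<open>e\<close> to that of
  \<open>\<beta> e\<close>, conjugating the scalar if it is anti-linear, and \<open>v\<close> pulls
  it back to \<open>e\<close>.\<close>

lemma corner_transport:
  fixes e :: "'a::chilbert_space op"
  assumes N: "star_algebra N" "minimal_full N e" and \<beta>: "star_iso s N N \<beta>"
    and v: "v \<in> N" "adj v o\<^sub>L v = e" "v o\<^sub>L adj v = \<beta> e"
    and x: "x \<in> N" "e o\<^sub>L (x o\<^sub>L e) = scale_op c e"
  shows "adj v o\<^sub>L (\<beta> x o\<^sub>L v) = scale_op (conj_pow s c) e"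
proof -
  interpret corner N e using N by unfold_locales
  note iso = star_isoD[OF \<beta>] and ve = isometry_e[OF v(1,2)]
  have \<beta>v: "\<beta> e (v u) = v u" for u using compose_eqD[OF v(3), of "v u"] by (simp add: ve)
  have \<beta>v': "adj v (\<beta> e u) = adj v u" for u using compose_eqD[OF v(3), of u] by (simp add: ve flip: v(3))
  have "\<beta> (e o\<^sub>L (x o\<^sub>L e)) = \<beta> e o\<^sub>L (\<beta> x o\<^sub>L \<beta> e)" 
    using iso(6)[OF eD(1) algD(4)[OF x(1) eD(1)]] iso(6)[OF x(1) eD(1)] by simp
  then have "\<beta> e o\<^sub>L (\<beta> x o\<^sub>L \<beta> e) = scale_op (conj_pow s c) (\<beta> e)" using x(2) eD by (simp add: iso)
  then have "\<beta> e (\<beta> x (\<beta> e (v u))) = conj_pow s c *\<^sub>C \<beta> e (v u)" for u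
    by (metis blinfun_apply_blinfun_compose scale_op_apply)
  then have "adj v (\<beta> x (v u)) = adj v (conj_pow s c *\<^sub>C v u)" for u
    using \<beta>v \<beta>v' by metis
  then show ?thesis
    using algD(1)[OF algD(5)[OF v(1)]] by (intro blinfun_eqI) (simp add: Bounded_opsD ve)
qed

text \<open>Restricted to the cyclic subspace of a unit vector \<open>u\<close> in the range of
  \<open>e\<close>, the algebra becomes all bounded operators (\<open>compress_iso\<close>): the
  irreducible representation of a type I factor.\<close>

locale cyclic_rep = corner N e for N :: "'a::chilbert_space op set" and e +
  fixes u :: 'a
  assumes vN: "von_neumann_algebra N" and u: "e u = u" "norm u = 1"
begin

text \<open>No closure is taken: elements of \<open>N e\<close> attain their norm at
  \<open>u\<close>, which makes the set closed already.\<close>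

definition K :: "'a set" where "K = {blinfun_apply x u | x. x \<in> N}"

definition Q :: "'a op" where "Q = proj K"

lemma id_N: "id_blinfun \<in> N" using von_neumann_algebraD(2)[OF vN] .

text \<open>\<open>adj y o\<^sub>L y\<close> is a multiple of the minimal projection
  \<open>e\<close>, and the multiple is the squared norm of \<open>y u\<close>.\<close>

lemma norm_eq:
  assumes "y \<in> N" "y o\<^sub>L e = y"
  shows "norm y \<le> norm (y u)"
proof -
  obtain k where k: "k \<ge> 0" "adj y o\<^sub>L y = k *\<^sub>R e" using scalar_adj_self assms by blast
  have "(norm (y u))\<^sup>2 = k"
    unfolding norm_adj_compose k(2) using u by (simp add: blinfun.scaleR_left dot_square_norm)
  moreover have "(norm (y v))\<^sup>2 \<le> k * (norm v)\<^sup>2" for v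
  proof -
    have "(norm (e v))\<^sup>2 = v \<bullet> e v" using norm_adj_compose[of e v] eD by simp
    also have "\<dots> \<le> norm v * norm (e v)" by (rule norm_cauchy_schwarz)
    finally have "norm (e v) \<le> norm v" by (cases "norm (e v) = 0") (auto simp: power2_eq_square)
    then have "(norm (e v))\<^sup>2 \<le> (norm v)\<^sup>2" by (intro power_mono) auto
    then have "v \<bullet> e v \<le> (norm v)\<^sup>2" using \<open>(norm (e v))\<^sup>2 = v \<bullet> e v\<close> by simp
    then show ?thesis unfolding norm_adj_compose k(2)
      using k(1) by (simp add: blinfun.scaleR_left mult_left_mono)
  qed
  ultimately have "(norm (y v))\<^sup>2 \<le> (norm (y u) * norm v)\<^sup>2" for v by (simp add: power_mult_distrib)
  then have "norm (y v) \<le> norm (y u) * norm v" for v by (rule power2_le_imp_le) simp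
  then show ?thesis by (intro norm_blinfun_bound) auto
qed

lemma zero_if:
  assumes "y \<in> N" "y o\<^sub>L e = y" "y u = 0"
  shows "y = 0"
  using norm_eq[OF assms(1,2)] assms(3) by simp

lemma K_rep: "k \<in> K \<Longrightarrow> \<exists>a\<in>N. a o\<^sub>L e = a \<and> a u = k"
proof -
  assume "k \<in> K"
  then obtain x where "x \<in> N" "k = x u" by (auto simp: K_def)
  then show ?thesis using algD(4)[OF _ eD(1)] u by (intro bexI[of _ "x o\<^sub>L e"]) (auto simp: compose_assoc eD)
qed

lemma K_inv: "x \<in> N \<Longrightarrow> k \<in> K \<Longrightarrow> x k \<in> K"
proof -
  assume x: "x \<in> N" "k \<in> K"
  then obtain a where "a \<in> N" "k = a u" by (auto simp: K_def)
  then have "x k = (x o\<^sub>L a) u" "x o\<^sub>L a \<in> N" using x algD by simp_all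
  then show ?thesis unfolding K_def by blast
qed

lemma u_K: "u \<in> K"
proof -
  have "u = id_blinfun u" by simp
  then show ?thesis using id_N unfolding K_def by blast
qed

lemma K: "closed_csubspace K"
proof (rule closed_csubspaceI)
  show "c *\<^sub>C x \<in> K" if "x \<in> K" for c x
    using K_inv[of "scale_op c id_blinfun" x] that id_N algD by simp
  show "subspace K"
  proof (rule subspaceI)
    show "0 \<in> K" using K_inv[OF algD(2) u_K] by simp
    show "x + y \<in> K" if xy: "x \<in> K" "y \<in> K" for x y
    proof -
      obtain a b where "a \<in> N" "b \<in> N" "x = a u" "y = b u" using xy unfolding K_def by blast
      then have "x + y = (a + b) u" "a + b \<in> N" using algD by (simp_all add: blinfun.add_left)
      then show ?thesis unfolding K_def by blast
    qed
    show "r *\<^sub>R x \<in> K" if "x \<in> K" for r x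
      using K_inv[of "r *\<^sub>R id_blinfun" x] that id_N algD by (simp add: blinfun.scaleR_left)
  qed
  show "closed K"
    unfolding closed_sequential_limits
  proof (intro allI impI)
    fix f l assume fl: "(\<forall>n. f n \<in> K) \<and> f \<longlonglongrightarrow> l"
    then have "\<forall>n. \<exists>a\<in>N. a o\<^sub>L e = a \<and> a u = f n" using K_rep by blast
    then obtain a where a: "\<And>n. a n \<in> N" "\<And>n. a n o\<^sub>L e = a n" "\<And>n. a n u = f n" by metis
    \<comment> \<open>By \<open>norm_eq\<close> the representing elements converge in norm as soon
      as their values at \<open>u\<close> do; the limit still commutes with the commutant.\<close>
    have "Cauchy a"
    proof (rule CauchyI)
      fix r :: real assume "0 < r"
      have "Cauchy f" using fl by (intro LIMSEQ_imp_Cauchy) blast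
      then obtain M where M: "\<And>m n. m \<ge> M \<Longrightarrow> n \<ge> M \<Longrightarrow> norm (f m - f n) < r"
        using CauchyD \<open>0 < r\<close> by blast
      have "norm (a m - a n) \<le> norm (f m - f n)" for m n
      proof -
        have "norm (a m - a n) \<le> norm ((a m - a n) u)"
          using a(1) algD(8) by (intro norm_eq) (simp_all add: compose_distribs a(2))
        then show ?thesis by (simp add: blinfun.diff_left a(3))
      qed
      then show "\<exists>M. \<forall>m\<ge>M. \<forall>n\<ge>M. norm (a m - a n) < r" using M le_less_trans by blast
    qed
    then obtain b where b: "a \<longlonglongrightarrow> b" using convergent_eq_Cauchy by blast
    then have lim: "(\<lambda>n. a n x) \<longlonglongrightarrow> b x" for x by (intro tendsto_intros)
    have "b \<in> commutant (commutant N)"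
    proof (rule commutantI)
      have aB: "a n \<in> Bounded_ops" for n using algD(1)[OF a(1)] .
      have "b (c *\<^sub>C x) = c *\<^sub>C b x" for c x
      proof (rule LIMSEQ_unique[OF lim])
        have "(\<lambda>n. c *\<^sub>C a n x) \<longlonglongrightarrow> c *\<^sub>C b x"
          by (rule bounded_linear.tendsto[OF bounded_linear_scaleC lim])
        then show "(\<lambda>n. a n (c *\<^sub>C x)) \<longlonglongrightarrow> c *\<^sub>C b x" by (simp add: Bounded_opsD[OF aB])
      qed
      then show "b \<in> Bounded_ops" by (simp add: Bounded_ops_def)
      fix m x assume m: "m \<in> commutant N"
      show "b (m x) = m (b x)"
      proof (rule LIMSEQ_unique[OF lim])
        have "(\<lambda>n. m (a n x)) \<longlonglongrightarrow> m (b x)" by (intro tendsto_intros lim)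
        then show "(\<lambda>n. a n (m x)) \<longlonglongrightarrow> m (b x)" by (simp add: commutantD(3)[OF m a(1)])
      qed
    qed
    then have "b \<in> N" using von_neumann_algebraD(3)[OF vN] by simp
    moreover have "l = b u"
      by (rule LIMSEQ_unique[OF _ lim]) (use fl in \<open>simp add: a(3)\<close>)
    ultimately show "l \<in> K" unfolding K_def by blast
  qed
qed

lemma clspan_K: "clspan {blinfun_apply a x | a x. a \<in> N \<and> x \<in> {u}} = K"
proof -
  have eq: "{blinfun_apply a x | a x. a \<in> N \<and> x \<in> {u}} = K" by (auto simp: K_def)
  show ?thesis unfolding eq using closed_csubspaceD(1,2)[OF K] by (metis closure_closed span_eq_iff)
qed

lemma Q: "Q \<in> Bounded_ops" "adj Q = Q" "Q (Q x) = Q x" "Q x \<in> K" "k \<in> K \<Longrightarrow> Q k = k"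
  unfolding Q_def using projection_opD[OF projection_proj[OF K]] proj_range[OF K] proj_fix[OF K] by auto

lemma Q_commute: "x \<in> N \<Longrightarrow> Q (x v) = x (Q v)"
  using compose_eqD[OF proj_commute[OF K], of x v] K_inv algD by (simp add: Q_def)

lemma compress_zero: "x \<in> N \<Longrightarrow> (\<And>k. k \<in> K \<Longrightarrow> x k = 0) \<Longrightarrow> x = 0"
proof (rule full)
  fix a assume x: "x \<in> N" "\<And>k. k \<in> K \<Longrightarrow> x k = 0" and a: "a \<in> N"
  show "x o\<^sub>L (a o\<^sub>L e) = 0"
    using x(1) a algD eD(1) x(2)[OF K_inv[OF a u_K]] by (intro zero_if) (simp_all add: compose_assoc eD u)
qed

text \<open>An element of \<open>N e\<close> is determined by its value at \<open>u\<close>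
  (\<open>zero_if\<close>), so \<open>N e\<close> is a copy of \<open>K\<close>.\<close>

definition coord :: "'a \<Rightarrow> 'a op" where "coord k = (SOME a. a \<in> N \<and> a o\<^sub>L e = a \<and> a u = k)"

lemma coord: "k \<in> K \<Longrightarrow> coord k \<in> N" "k \<in> K \<Longrightarrow> coord k o\<^sub>L e = coord k" "k \<in> K \<Longrightarrow> coord k u = k"
proof -
  have "coord k \<in> N \<and> coord k o\<^sub>L e = coord k \<and> coord k u = k" if "k \<in> K" for k
  proof -
    have "\<exists>a. a \<in> N \<and> a o\<^sub>L e = a \<and> a u = k" using K_rep[OF that] by blast
    then show ?thesis unfolding coord_def by (rule someI_ex)
  qed
  then show "k \<in> K \<Longrightarrow> coord k \<in> N" "k \<in> K \<Longrightarrow> coord k o\<^sub>L e = coord k" "k \<in> K \<Longrightarrow> coord k u = k" by blast+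
qed

lemma coord_apply: "a \<in> N \<Longrightarrow> coord (a u) (e v) = a (e v)"
proof -
  assume a: "a \<in> N"
  have k: "a u \<in> K" using K_inv[OF a u_K] .
  have "coord (a u) - (a o\<^sub>L e) = 0"
    using a algD eD(1) coord[OF k]
    by (intro zero_if) (simp_all add: compose_distribs compose_assoc eD blinfun.diff_left u)
  then have "coord (a u) = a o\<^sub>L e" by simp
  then show ?thesis by (simp add: eD)
qed

text \<open>This identifies the Hilbert space with the tensor product of \<open>K\<close> and the
  range of \<open>e\<close>, where \<open>coord k \<eta>\<close> is the elementary tensor of
  \<open>k\<close> and \<open>\<eta>\<close>.\<close>

lemma coord_cinner:
  assumes "k \<in> K" "l \<in> K" "e \<eta> = \<eta>" "e \<zeta> = \<zeta>"
  shows "cinner (coord k \<eta>) (coord l \<zeta>) = cinner k l * cinner \<eta> \<zeta>"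
proof -
  note k = coord[OF assms(1)] and l = coord[OF assms(2)]
  have kB: "coord k \<in> Bounded_ops" "coord l \<in> Bounded_ops" using k(1) l(1) algD(1) by blast+
  obtain c where c: "e o\<^sub>L ((adj (coord k) o\<^sub>L coord l) o\<^sub>L e) = scale_op c e"
    using scalar[of "adj (coord k) o\<^sub>L coord l"] k(1) l(1) algD(4,5) by blast
  have "e (adj (coord k) v) = adj (coord k) v" for v
    using k(2) eD(3) by (metis adj_compose blinfun_apply_blinfun_compose)
  then have c': "adj (coord k) (coord l (e v)) = c *\<^sub>C e v" for v
    using compose_eqD[OF c, of v] by simp
  have "cinner k l = cinner u (adj (coord k) (coord l (e u)))"
    using k(3) l(3) cinner_adj[OF kB(1), of u "coord l u"] u by simp
  also have "\<dots> = c" unfolding c' using u by (simp add: cinner_scaleC_right cinner_self)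
  finally have "c = cinner k l" by simp
  moreover have "cinner (coord k \<eta>) (coord l \<zeta>) = cinner \<eta> (adj (coord k) (coord l (e \<zeta>)))"
    using cinner_adj[OF kB(1)] assms(4) by simp
  ultimately show ?thesis unfolding c' using assms(4) by (simp add: cinner_scaleC_right)
qed

text \<open>The preimage of \<open>X\<close> is \<open>X\<close> tensored with the identity in the
  coordinates of \<open>coord_cinner\<close>; \<open>adjointable_extension\<close> supplies its
  boundedness.\<close>

lemma compress_surj:
  assumes X: "X \<in> B K"
  shows "\<exists>x\<in>N. \<forall>v. x (Q v) = X v"
proof -
  have XB: "X \<in> Bounded_ops" and Xrange: "X v \<in> K" and Xzero: "(\<And>w. w \<in> K \<Longrightarrow> cinner w v = 0) \<Longrightarrow> X v = 0" for v
    using X by (auto simp: B_def lives_on_def)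
  have XQ: "X (Q v) = X v" for v
  proof -
    have "X (v - Q v) = 0" using proj_cinner[OF K] by (intro Xzero) (simp add: Q_def)
    then show ?thesis by (simp add: blinfun.diff_right)
  qed
  have adjX: "adj X v \<in> K" for v
  proof -
    have "Q (adj X v) = adj X v"
    proof (rule inner_eqI)
      fix y show "y \<bullet> Q (adj X v) = y \<bullet> adj X v"
        using inner_adj[of Q y "adj X v"] inner_adj[of X "Q y" v] inner_adj[of X y v] Q(2) XQ by simp
    qed
    then show ?thesis using Q(4) by metis
  qed
  let ?I = "K \<times> range e"
  define d where "d = (\<lambda>(k, \<eta>). coord k \<eta>)"
  define F where "F = (\<lambda>(k, \<eta> :: 'a). (X k, \<eta>))"
  define F' where "F' = (\<lambda>(k, \<eta> :: 'a). (adj X k, \<eta>))"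
  have FI: "F i \<in> ?I" "F' i \<in> ?I" if "i \<in> ?I" for i using that Xrange adjX by (auto simp: F_def F'_def)
  have dd: "d i \<bullet> d j = Re (cinner (fst i) (fst j) * cinner (snd i) (snd j))" if "i \<in> ?I" "j \<in> ?I" for i j
  proof -
    have "cinner (d i) (d j) = cinner (fst i) (fst j) * cinner (snd i) (snd j)"
      using that unfolding d_def case_prod_unfold by (intro coord_cinner) (auto simp: eD)
    then show ?thesis by (metis Re_cinner)
  qed
  have adj: "d (F i) \<bullet> d j = d i \<bullet> d (F' j)" if "i \<in> ?I" "j \<in> ?I" for i j
    using cinner_adj[OF XB]
    by (simp add: dd[OF FI(1)[OF that(1)] that(2)] dd[OF that(1) FI(2)[OF that(2)]])
       (simp add: F_def F'_def case_prod_unfold)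
  \<comment> \<open>Growth rate of the iterates of \<open>adj X\<close> after \<open>X\<close>; the
    summand 1 keeps it positive when \<open>X\<close> is 0.\<close>
  define C where "C = norm (adj X) * norm X + 1"
  have C: "0 < C" unfolding C_def by (intro add_nonneg_pos mult_nonneg_nonneg) auto
  have growth: "\<exists>b. \<forall>n. norm (d (((F' \<circ> F) ^^ n) i)) \<le> b * C ^ n" if i: "i \<in> ?I" for i
  proof (intro exI allI)
    fix n
    have P: "((F' \<circ> F) ^^ n) i \<in> ?I \<and> snd (((F' \<circ> F) ^^ n) i) = snd i \<and>
        norm (fst (((F' \<circ> F) ^^ n) i)) \<le> C ^ n * norm (fst i)"
    proof (induction n)
      case (Suc n)
      define j where "j = ((F' \<circ> F) ^^ n) i"
      have step: "((F' \<circ> F) ^^ Suc n) i = F' (F j)" by (simp add: j_def)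
      have j: "j \<in> ?I" "snd j = snd i" "norm (fst j) \<le> C ^ n * norm (fst i)"
        using Suc unfolding j_def by blast+
      have "norm (adj X (X (fst j))) \<le> norm (adj X) * (norm X * norm (fst j))"
        by (rule order_trans[OF norm_blinfun mult_left_mono[OF norm_blinfun]]) simp
      also have "\<dots> \<le> C * norm (fst j)" by (simp add: C_def algebra_simps)
      also have "\<dots> \<le> C * (C ^ n * norm (fst i))" by (rule mult_left_mono[OF j(3) less_imp_le[OF C]])
      finally have "norm (fst (F' (F j))) \<le> C ^ Suc n * norm (fst i)"
        by (simp add: F_def F'_def case_prod_unfold mult.assoc)
      moreover have "snd (F' (F j)) = snd i" using j(2) by (simp add: F_def F'_def case_prod_unfold)
      ultimately show ?case unfolding step using FI(2)[OF FI(1)[OF j(1)]] by blast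
    qed (use i in auto)
    let ?j = "((F' \<circ> F) ^^ n) i"
    have "(norm (d ?j))\<^sup>2 = (norm (fst ?j) * norm (snd i))\<^sup>2"
      using dd[of ?j ?j] P by (simp add: cinner_self power_mult_distrib power2_norm_eq_inner)
    then have "norm (d ?j) = norm (fst ?j) * norm (snd i)" by (simp add: power2_eq_iff_nonneg)
    also have "\<dots> \<le> (C ^ n * norm (fst i)) * norm (snd i)" using P by (intro mult_right_mono) auto
    finally show "norm (d ?j) \<le> (norm (fst i) * norm (snd i)) * C ^ n" by (simp add: mult_ac)
  qed
  obtain x :: "'a op" where x: "\<And>i. i \<in> ?I \<Longrightarrow> x (d i) = d (F i)" "\<And>v. (\<And>i. i \<in> ?I \<Longrightarrow> v \<bullet> d i = 0) \<Longrightarrow> x v = 0"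
    using adjointable_extension[of ?I F F' d C, OF FI adj C growth] by blast
  have xd: "x (coord k (e v)) = coord (X k) (e v)" if "k \<in> K" for k v
    using x(1)[of "(k, e v)"] that by (simp add: d_def F_def)
  have D: "{blinfun_apply a (e v) | a v. a \<in> N} \<subseteq> d ` ?I"
  proof
    fix y assume "y \<in> {blinfun_apply a (e v) | a v. a \<in> N}"
    then obtain a :: "'a op" and v where y: "y = a (e v)" "a \<in> N" by blast
    then have "y = d (a u, e v)" "(a u, e v) \<in> ?I"
      using K_inv[OF y(2) u_K] by (simp_all add: d_def coord_apply)
    then show "y \<in> d ` ?I" by (rule image_eqI)
  qed
  have dense: "clspan (d ` ?I) = UNIV"
    using cyclic_dense[OF vN mf] closure_mono[OF span_mono[OF D]] by auto
  have coordB: "coord k \<in> Bounded_ops" if "k \<in> K" for k using coord(1)[OF that] algD(1) by blast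
  \<comment> \<open>On \<open>coord k (e v)\<close> an element of the commutant changes only
    \<open>v\<close>, while \<open>x\<close> changes only \<open>k\<close>.\<close>
  have "x \<in> commutant (commutant N)"
  proof -
    have "semilinear 0 x"
    proof (rule semilinear_extension[of "d ` ?I"])
      fix c y assume "y \<in> d ` ?I"
      then obtain k v where y: "k \<in> K" "y = coord k (e v)" by (auto simp: d_def)
      have cv: "c *\<^sub>C coord l (e v) = coord l (e (c *\<^sub>C v))" if "l \<in> K" for l
        using coordB[OF that] eD by (simp add: Bounded_opsD)
      have "c *\<^sub>C y = d (k, e (c *\<^sub>C v))" using cv[OF y(1)] by (simp add: y(2) d_def)
      then show "c *\<^sub>C y \<in> d ` ?I" using y(1) by (intro image_eqI) auto
      show "x (c *\<^sub>C y) = conj_pow 0 c *\<^sub>C x y" using y xd cv Xrange by simp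
    qed (use x(2) in auto)
    moreover have "x o\<^sub>L m = m o\<^sub>L x" if m: "m \<in> commutant N" for m
    proof (rule blinfun_eqI_dense[OF _ dense])
      fix y assume "y \<in> d ` ?I"
      then obtain k v where y: "k \<in> K" "y = coord k (e v)" by (auto simp: d_def)
      have "m (coord l (e v)) = coord l (e (m v))" if "l \<in> K" for l
        using commutantD(3)[OF m coord(1)[OF that]] commutantD(3)[OF m eD(1)] by simp
      then show "(x o\<^sub>L m) y = (m o\<^sub>L x) y" using y xd Xrange by simp
    qed
    ultimately show ?thesis by (simp add: commutant_iff Bounded_ops_iff)
  qed
  then have "x \<in> N" using von_neumann_algebraD(3)[OF vN] by simp
  moreover have "x (Q v) = X v" for v
  proof -
    have "x (Q v) = x (coord (Q v) (e u))" using coord(3)[OF Q(4)] u by simp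
    also have "\<dots> = X (Q v)" using xd[OF Q(4)[of v], of u] coord(3)[OF Xrange] u by simp
    finally show ?thesis by (simp add: XQ)
  qed
  ultimately show ?thesis by blast
qed

lemma compress_in: "x \<in> N \<Longrightarrow> x o\<^sub>L Q \<in> B K"
  unfolding B_def lives_on_def using algD(1) Q K_inv proj_zero[OF K] by (auto simp: Q_def)

theorem compress_iso: "star_iso 0 N (B K) (\<lambda>x. x o\<^sub>L Q)"
proof -
  have mult: "(x o\<^sub>L y) o\<^sub>L Q = (x o\<^sub>L Q) o\<^sub>L (y o\<^sub>L Q)" if "x \<in> N" "y \<in> N" for x y
    by (rule blinfun_eqI) (simp add: Q_commute[OF that(2)] Q)
  have adj: "adj x o\<^sub>L Q = adj (x o\<^sub>L Q)" if "x \<in> N" for x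
    by (rule blinfun_eqI) (simp add: Q Q_commute[OF algD(5)[OF that]])
  have inj: "inj_on (\<lambda>x. x o\<^sub>L Q) N"
  proof (rule inj_onI)
    fix x y assume xy: "x \<in> N" "y \<in> N" "x o\<^sub>L Q = y o\<^sub>L Q"
    have "x - y = 0"
    proof (rule compress_zero)
      fix k assume "k \<in> K"
      then have "(x o\<^sub>L Q) k = x k" "(y o\<^sub>L Q) k = y k" by (simp_all add: Q)
      then show "(x - y) k = 0" using xy(3) by (simp add: blinfun.diff_left)
    qed (use xy algD in auto)
    then show "x = y" by simp
  qed
  have "(\<lambda>x. x o\<^sub>L Q) ` N = B K"
  proof
    show "(\<lambda>x. x o\<^sub>L Q) ` N \<subseteq> B K" using compress_in by blast
    show "B K \<subseteq> (\<lambda>x. x o\<^sub>L Q) ` N"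
    proof
      fix X assume "X \<in> B K"
      then obtain x where "x \<in> N" "\<forall>v. x (Q v) = X v" using compress_surj by blast
      then show "X \<in> (\<lambda>x. x o\<^sub>L Q) ` N" by (intro image_eqI[of _ _ x] blinfun_eqI) simp_all
    qed
  qed
  then show ?thesis using mult adj inj by (auto simp: star_iso_def bij_betw_def compose_distribs)
qed

text \<open>The vector \<open>v u\<close> has under \<open>\<beta>\<close> the same matrix
  coefficients as \<open>u\<close>, up to conjugation in the anti-linear case, so
  \<open>x u \<mapsto> \<beta> x (v u)\<close> extends isometrically.\<close>

lemma implement:
  assumes \<beta>: "star_iso s N N \<beta>" and v: "v \<in> N" "adj v o\<^sub>L v = e" "v o\<^sub>L adj v = \<beta> e"
  obtains W where "unitary_antiunitary s K W" "\<And>x y. x \<in> N \<Longrightarrow> W (x y) = \<beta> x (W y)"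
    "\<And>x. x \<in> N \<Longrightarrow> W (x u) = \<beta> x (v u)"
proof -
  note iso = star_isoD[OF \<beta>]
  have Y: "cinner (v a) (\<beta> x (v b)) = conj_pow s (cinner a (x b))" if x: "x \<in> N" and ab: "a \<in> {u}" "b \<in> {u}" for x a b
  proof -
    have ab: "a = u" "b = u" using ab by auto
    obtain c where c: "e o\<^sub>L (x o\<^sub>L e) = scale_op c e" using scalar x by blast
    have vB: "v \<in> Bounded_ops" using v(1) algD(1) by blast
    have "cinner u (x u) = cinner u (e (x (e u)))" using u cinner_adj[OF eD(2), of u "x u"] eD(3) by simp
    also have "\<dots> = c" using compose_eqD[OF c, of u] u by (simp add: cinner_scaleC_right cinner_self)
    finally have "cinner u (x u) = c" .
    moreover have "cinner (v u) (\<beta> x (v u)) = cinner u (adj v (\<beta> x (v u)))" by (rule cinner_adj[OF vB])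
    moreover have "adj v (\<beta> x (v u)) = conj_pow s c *\<^sub>C u"
      using compose_eqD[OF corner_transport[OF alg mf \<beta> v x c], of u] u by simp
    ultimately show ?thesis using u by (simp add: ab cinner_scaleC_right cinner_self)
  qed
  obtain W :: "'a op" where W: "semilinear s W" "\<And>a b. a \<in> N \<Longrightarrow> b \<in> {u} \<Longrightarrow> W (a b) = \<beta> a (v b)"
    "\<And>b x. b \<in> N \<Longrightarrow> W (b x) = \<beta> b (W x)"
    "\<And>x y. x \<in> clspan {blinfun_apply a b | a b. a \<in> N \<and> b \<in> {u}} \<Longrightarrow>
      y \<in> clspan {blinfun_apply a b | a b. a \<in> N \<and> b \<in> {u}} \<Longrightarrow> W x \<bullet> W y = x \<bullet> y"
    "\<And>x. (\<And>d. d \<in> {blinfun_apply a b | a b. a \<in> N \<and> b \<in> {u}} \<Longrightarrow> x \<bullet> d = 0) \<Longrightarrow> W x = 0"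
    using covariant_extension[OF alg \<beta> _ Y] algD(1) by blast
  note W4 = W(4)[unfolded clspan_K]
  have Wu: "W (x u) = \<beta> x (v u)" if "x \<in> N" for x using W(2)[OF that] by simp
  have W0: "W x = 0" if "\<And>w. w \<in> K \<Longrightarrow> cinner w x = 0" for x
  proof (rule W(5))
    fix d assume "d \<in> {blinfun_apply a b | a b. a \<in> N \<and> b \<in> {u}}"
    then have "d \<in> K" by (auto simp: K_def)
    then have "cinner d x = 0" by (rule that)
    then show "x \<bullet> d = 0" by (metis Re_cinner inner_commute zero_complex.simps(1))
  qed
  have WK: "W k \<in> K" if "k \<in> K" for k
  proof -
    obtain a where a: "a \<in> N" "k = a u" using \<open>k \<in> K\<close> by (auto simp: K_def)
    then have "W k = (\<beta> a o\<^sub>L v) u" "\<beta> a o\<^sub>L v \<in> N" using Wu iso(4) v(1) algD(4) by auto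
    then show ?thesis unfolding K_def by blast
  qed
  have WQ: "W (Q x) = W x" for x
  proof -
    have "W (x - Q x) = 0" using proj_cinner[OF K] by (intro W0) (simp add: Q_def)
    then show ?thesis by (simp add: blinfun.diff_right)
  qed
  have "range W \<subseteq> K" using WK Q(4) WQ by (metis image_subsetI)
  moreover have "W ` K = K"
  proof
    show "W ` K \<subseteq> K" using WK by blast
    show "K \<subseteq> W ` K"
    proof
      fix k assume "k \<in> K"
      then obtain a where a: "a \<in> N" "k = a u" by (auto simp: K_def)
      \<comment> \<open>Since \<open>adj v (v u) = u\<close>, an element with image
        \<open>a o\<^sub>L adj v\<close> under \<open>\<beta>\<close> leads to a preimage of
        \<open>a u\<close>.\<close>
      then have "a o\<^sub>L adj v \<in> N" using v algD by simp
      then have "a o\<^sub>L adj v \<in> \<beta> ` N" by (simp only: iso(3))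
      then obtain b where b: "\<beta> b = a o\<^sub>L adj v" "b \<in> N" by (metis imageE)
      have "W (b u) = a (adj v (v u))" using Wu[OF b(2)] b(1) by simp
      also have "\<dots> = k" using compose_eqD[OF v(2), of u] u a by simp
      finally show "k \<in> W ` K" using K_inv[OF b(2) u_K] by (metis imageI)
    qed
  qed
  moreover have "cinner (W x) (W y) = conj_pow s (cinner x y)" if xy: "x \<in> K" "y \<in> K" for x y
  proof -
    have ix: "\<i> *\<^sub>C x \<in> K" using closed_csubspaceD(3)[OF K xy(1)] .
    have "W (\<i> *\<^sub>C x) \<bullet> W y = (\<i> *\<^sub>C x) \<bullet> y" by (rule W4[OF ix xy(2)])
    then show ?thesis using W4[OF xy] semilinearD[OF W(1), of \<i> x]
      by (cases s) (simp_all add: complex_eq_iff Re_cinner Im_cinner)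
  qed
  ultimately have "unitary_antiunitary s K W"
    unfolding unitary_antiunitary_def lives_on_def using W0 W(1) by (auto simp: semilinear_def)
  then show thesis using that W(3) Wu by blast
qed

end

section \<open>Operators on a closed subspace\<close>

lemma B_D:
  assumes "closed_csubspace K" "x \<in> B K"
  shows "x \<in> Bounded_ops" "x v \<in> K" "x (proj K v) = x v" "proj K (x v) = x v" "x o\<^sub>L proj K = x"
    "proj K o\<^sub>L x = x"
proof -
  show b: "x \<in> Bounded_ops" "x v \<in> K" for v using assms(2) by (auto simp: B_def lives_on_def)
  show 1: "proj K (x v) = x v" for v by (rule proj_fix[OF assms(1) b(2)])
  show 2: "x (proj K v) = x v" for v
  proof -
    have "x (v - proj K v) = 0"
      using assms(2) proj_cinner[OF assms(1)] by (auto simp: B_def lives_on_def)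
    then show ?thesis by (simp add: blinfun.diff_right)
  qed
  show "x o\<^sub>L proj K = x" "proj K o\<^sub>L x = x" by (rule blinfun_eqI, simp add: 1 2)+
qed

lemma B_I:
  assumes "closed_csubspace K" "x \<in> Bounded_ops" "\<And>v. x v \<in> K" "\<And>v. x (proj K v) = x v"
  shows "x \<in> B K"
proof -
  have "x v = 0" if "\<forall>w\<in>K. cinner w v = 0" for v
    using assms(4)[of v] proj_zero[OF assms(1), of v] that by (simp add: blinfun.zero_right)
  then show ?thesis using assms by (auto simp: B_def lives_on_def)
qed

lemma B_star_algebra:
  assumes K: "closed_csubspace K"
  shows "star_algebra (B K)"
proof -
  note K' = closed_csubspaceD[OF K] and BD = B_D[OF K]
  note P = projection_opD[OF projection_proj[OF K]]
  have "adj x \<in> B K" if x: "x \<in> B K" for x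
  proof (rule B_I[OF K])
    show "adj x \<in> Bounded_ops" using BD(1)[OF x] by simp
    have "adj (x o\<^sub>L proj K) = adj x" "adj (proj K o\<^sub>L x) = adj x" using BD(5,6)[OF x] by simp_all
    then have e: "proj K o\<^sub>L adj x = adj x" "adj x o\<^sub>L proj K = adj x" using P(2) by simp_all
    show "adj x v \<in> K" "adj x (proj K v) = adj x v" for v
      using compose_eqD[OF e(1), of v] compose_eqD[OF e(2), of v] proj_range[OF K] by metis+
  qed
  moreover have "x + y \<in> B K" "x o\<^sub>L y \<in> B K" if "x \<in> B K" "y \<in> B K" for x y
    using that BD K'(2) by (auto intro!: B_I[OF K] simp: blinfun.add_left subspace_add)
  moreover have "scale_op c x \<in> B K" if "x \<in> B K" for c x
    using that BD K'(3) by (auto intro!: B_I[OF K])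
  moreover have "0 \<in> B K" using K'(2) by (auto intro!: B_I[OF K] simp: subspace_0)
  ultimately show ?thesis using BD(1) by (auto simp: star_algebra_def)
qed

lemma proj_in_B: "closed_csubspace K \<Longrightarrow> proj K \<in> B K"
  using projection_opD[OF projection_proj] proj_range proj_fix by (intro B_I) auto

lemma one_on_eq:
  assumes K: "closed_csubspace K"
  shows "one_on K = proj K"
  unfolding one_on_def
proof (rule the_equality)
  show "proj K \<in> B K \<and> (\<forall>v\<in>K. proj K v = v)" using proj_in_B[OF K] proj_fix[OF K] by blast
  fix x assume x: "x \<in> B K \<and> (\<forall>v\<in>K. x v = v)"
  show "x = proj K"
  proof (rule blinfun_eqI)
    fix v show "x v = proj K v" using B_D(3)[OF K, of x v] x proj_range[OF K, of v] by auto
  qed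
qed

lemma unitary_antiunitaryD:
  assumes "unitary_antiunitary s K V" and K: "closed_csubspace K"
  shows "semilinear s V" "V v \<in> K" "V (proj K v) = V v" "V ` K = K"
    "k \<in> K \<Longrightarrow> l \<in> K \<Longrightarrow> cinner (V k) (V l) = conj_pow s (cinner k l)"
    "adj V o\<^sub>L V = proj K" "V o\<^sub>L adj V = proj K"
proof -
  show sl: "semilinear s V" and VK: "V v \<in> K" and im: "V ` K = K"
    and ci: "k \<in> K \<Longrightarrow> l \<in> K \<Longrightarrow> cinner (V k) (V l) = conj_pow s (cinner k l)" for v k l
    using assms(1) by (auto simp: unitary_antiunitary_def lives_on_def semilinear_def)
  show VP: "V (proj K v) = V v" for v
  proof -
    have "V (v - proj K v) = 0"
      using assms(1) proj_cinner[OF K] by (auto simp: unitary_antiunitary_def lives_on_def)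
    then show ?thesis by (simp add: blinfun.diff_right)
  qed
  note P = projection_opD[OF projection_proj[OF K]] and rng = proj_range[OF K] and fx = proj_fix[OF K]
  have inn: "V k \<bullet> V l = k \<bullet> l" if "k \<in> K" "l \<in> K" for k l
    using ci[OF that] by (simp flip: Re_cinner)
  show AV: "adj V o\<^sub>L V = proj K"
  proof (rule blinfun_eqI, rule inner_eqI)
    fix v z
    have "z \<bullet> (adj V o\<^sub>L V) v = V (proj K z) \<bullet> V (proj K v)" by (simp add: VP flip: inner_adj)
    also have "\<dots> = proj K z \<bullet> proj K v" by (intro inn rng)
    also have "\<dots> = z \<bullet> proj K v" using inner_adj[of "proj K" z "proj K v"] P by simp
    finally show "z \<bullet> (adj V o\<^sub>L V) v = z \<bullet> proj K v" .
  qed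
  have "V (adj V (proj K v)) = proj K v" for v
  proof -
    obtain k where k: "k \<in> K" "proj K v = V k" using im rng by (metis imageE)
    then show ?thesis using compose_eqD[OF AV, of k] fx by simp
  qed
  moreover have "adj V (proj K v) = adj V v" for v
  proof (rule inner_eqI)
    fix z
    have "z \<bullet> adj V (proj K v) = proj K (V z) \<bullet> v"
      using inner_adj[of V z "proj K v"] inner_adj[of "proj K" "V z" v] P by simp
    then show "z \<bullet> adj V (proj K v) = z \<bullet> adj V v" using fx[OF VK] by (simp add: inner_adj)
  qed
  ultimately show "V o\<^sub>L adj V = proj K" by (intro blinfun_eqI) simp
qed

lemma unitary_antiunitary_Ad:
  assumes "unitary_antiunitary s K V" "closed_csubspace K" "V o\<^sub>L y = y' o\<^sub>L V" "y' o\<^sub>L proj K = y'"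
  shows "Ad V y = y'"
  using unitary_antiunitaryD(7)[OF assms(1,2)] assms(3,4) by (simp add: Ad_def compose_assoc)

lemma Ad_B:
  assumes V: "unitary_antiunitary s K V" and K: "closed_csubspace K" and x: "x \<in> B K"
  shows "Ad V x \<in> B K"
proof (rule B_I[OF K])
  note VD = unitary_antiunitaryD[OF V K]
  show "Ad V x \<in> Bounded_ops" using VD(1) B_D(1)[OF K x] by (rule Ad_Bounded)
  show "Ad V x v \<in> K" for v by (simp add: VD)
  have "adj V (proj K v) = adj V v" for v
  proof -
    have "V o\<^sub>L adj V o\<^sub>L V = V" using VD(3) by (intro blinfun_eqI) (simp add: VD(7)[THEN compose_eqD] proj_fix[OF K] VD(2))
    then have "proj K o\<^sub>L V = V" by (simp add: VD)
    then have "adj V o\<^sub>L proj K = adj V"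
      using projection_opD(2)[OF projection_proj[OF K]] by (metis adj_compose)
    then show ?thesis by (rule compose_eqD)
  qed
  then show "Ad V x (proj K v) = Ad V x v" for v by simp
qed

section \<open>Rank one operators\<close>

definition rank_one :: "'a::chilbert_space \<Rightarrow> 'a \<Rightarrow> 'a op"
  where "rank_one k l = Blinfun (\<lambda>x. cinner l x *\<^sub>C k)"

lemma rank_one_apply [simp]: "rank_one k l x = cinner l x *\<^sub>C k"
proof -
  have "bounded_linear (\<lambda>c. c *\<^sub>C k)"
    by (rule bounded_linear_intro[of _ "norm k"])
       (simp_all add: scaleC_add_left scaleC_scaleC norm_scaleC scaleR_conv_of_real flip: scaleC_of_real)
  then have "bounded_linear (\<lambda>x. cinner l x *\<^sub>C k)"
    by (rule bounded_linear_compose[OF _ bounded_linear_cinner_right])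
  then show ?thesis by (simp add: rank_one_def bounded_linear_Blinfun_apply)
qed

lemma rank_one_Bounded [simp]: "rank_one k l \<in> Bounded_ops"
  by (simp add: Bounded_ops_def cinner_scaleC_right scaleC_scaleC)

lemma rank_one_adj [simp]: "adj (rank_one k l) = rank_one l k"
  by (rule adj_eqI_linear) (simp add: cinner_scaleC_left cinner_scaleC_right flip: cinner_commute mult.commute)

lemma rank_one_scale: "rank_one (c *\<^sub>C k) l = scale_op c (rank_one k l)"
  by (rule blinfun_eqI) (simp add: scaleC_scaleC mult.commute)

lemma rank_one_compose: "rank_one k l o\<^sub>L rank_one k' l' = scale_op (cinner l k') (rank_one k l')"
  by (rule blinfun_eqI) (simp add: cinner_scaleC_right scaleC_scaleC mult.commute)

lemma Ad_rank_one: "semilinear s V \<Longrightarrow> Ad V (rank_one k l) = rank_one (V k) (V l)"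
  by (rule blinfun_eqI) (simp add: semilinearD cinner_adj_semilinear)

lemma rank_one_B: "closed_csubspace K \<Longrightarrow> k \<in> K \<Longrightarrow> l \<in> K \<Longrightarrow> rank_one k l \<in> B K"
  by (auto simp: B_def lives_on_def closed_csubspaceD)

lemma rank_one_minimal_full:
  assumes K: "closed_csubspace K" and \<xi>: "\<xi> \<in> K" "norm \<xi> = 1"
  shows "minimal_full (B K) (rank_one \<xi> \<xi>)"
proof -
  have \<xi>1: "cinner \<xi> \<xi> = 1" using \<xi> by (simp add: cinner_self)
  then have nz: "rank_one \<xi> \<xi> \<noteq> 0" using \<xi>(2) by (metis blinfun.zero_left norm_zero rank_one_apply scaleC_one zero_neq_one)
  have p: "projection_op (rank_one \<xi> \<xi>)" by (simp add: projection_op_def rank_one_compose \<xi>1)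
  have s: "rank_one \<xi> \<xi> o\<^sub>L (x o\<^sub>L rank_one \<xi> \<xi>) = scale_op (cinner \<xi> (x \<xi>)) (rank_one \<xi> \<xi>)"
    if "x \<in> B K" for x
    using B_D(1)[OF K that]
    by (intro blinfun_eqI) (simp add: Bounded_opsD cinner_scaleC_right scaleC_scaleC mult.commute)
  have f: "x = 0" if x: "x \<in> B K" "\<forall>a\<in>B K. x o\<^sub>L (a o\<^sub>L rank_one \<xi> \<xi>) = 0" for x
  proof (rule blinfun_eqI)
    fix v
    have "rank_one (proj K v) \<xi> \<in> B K" by (rule rank_one_B[OF K proj_range[OF K] \<xi>(1)])
    then have "x o\<^sub>L (rank_one (proj K v) \<xi> o\<^sub>L rank_one \<xi> \<xi>) = 0" using x(2) by blast
    then have "x (proj K v) = 0"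
      using compose_eqD[of x "rank_one (proj K v) \<xi> o\<^sub>L rank_one \<xi> \<xi>" 0 \<xi>] by (simp add: \<xi>1)
    then show "x v = blinfun_apply 0 v" using B_D(3)[OF K x(1)] by simp
  qed
  show ?thesis unfolding minimal_full_def using rank_one_B[OF K \<xi>(1,1)] nz p s f by blast
qed

lemma rank_one_corner_cocycle:
  assumes G: "group G" and K: "closed_csubspace K" and V: "projective_rep G p K V \<omega>"
    and \<xi>: "\<xi> \<in> K" "norm \<xi> = 1"
  shows "corner_cocycle G (B K) (\<lambda>g. Ad (V g)) (rank_one \<xi> \<xi>) (\<lambda>g. rank_one (V g \<xi>) \<xi>) \<omega>"
proof -
  interpret group G by fact
  have ua: "unitary_antiunitary (p g) K (V g)" if "g \<in> carrier G" for g
    using V that by (simp add: projective_rep_def)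
  note D = unitary_antiunitaryD[OF ua K]
  have \<xi>1: "cinner \<xi> \<xi> = 1" using \<xi> by (simp add: cinner_self)
  have V1: "cinner (V g \<xi>) (V g \<xi>) = 1" if "g \<in> carrier G" for g using D(5)[OF that \<xi>(1,1)] \<xi>1 by simp
  show ?thesis unfolding corner_cocycle_def
  proof (intro conjI ballI)
    fix g assume g: "g \<in> carrier G"
    show "rank_one (V g \<xi>) \<xi> \<in> B K" by (rule rank_one_B[OF K D(2)[OF g] \<xi>(1)])
    show "adj (rank_one (V g \<xi>) \<xi>) o\<^sub>L rank_one (V g \<xi>) \<xi> = rank_one \<xi> \<xi>"
      "rank_one (V g \<xi>) \<xi> o\<^sub>L adj (rank_one (V g \<xi>) \<xi>) = Ad (V g) (rank_one \<xi> \<xi>)"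
      by (simp_all add: rank_one_compose V1[OF g] \<xi>1 Ad_rank_one[OF D(1)[OF g]])
    fix h assume h: "h \<in> carrier G"
    have "V g o\<^sub>L V h = scale_op (\<omega> g h) (V (g \<otimes>\<^bsub>G\<^esub> h))" using V g h by (simp add: projective_rep_def)
    then have "V g (V h \<xi>) = \<omega> g h *\<^sub>C V (g \<otimes>\<^bsub>G\<^esub> h) \<xi>" using compose_eqD by fastforce
    then show "Ad (V g) (rank_one (V h \<xi>) \<xi>) o\<^sub>L rank_one (V g \<xi>) \<xi> =
        scale_op (\<omega> g h) (rank_one (V (g \<otimes>\<^bsub>G\<^esub> h) \<xi>) \<xi>)"
      by (simp add: Ad_rank_one[OF D(1)[OF g]] rank_one_compose V1[OF g] rank_one_scale)
  qed
qed

lemma corner_cocycle_iso: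
  assumes G: "group G" and c: "corner_cocycle G N \<alpha> e v \<upsilon>" and \<psi>: "star_iso 0 N N' \<psi>" and N: "star_algebra N"
    and e: "e \<in> N" and \<alpha>: "\<And>g x. g \<in> carrier G \<Longrightarrow> x \<in> N \<Longrightarrow> \<alpha> g x \<in> N"
    and eq: "\<And>g x. g \<in> carrier G \<Longrightarrow> x \<in> N \<Longrightarrow> \<psi> (\<alpha> g x) = \<beta> g (\<psi> x)"
  shows "corner_cocycle G N' \<beta> (\<psi> e) (\<lambda>g. \<psi> (v g)) \<upsilon>"
proof -
  interpret group G by fact
  note iso = star_isoD[OF \<psi>] and alg = star_algebraD[OF N]
  have v: "v g \<in> N" "adj (v g) o\<^sub>L v g = e" "v g o\<^sub>L adj (v g) = \<alpha> g e" if "g \<in> carrier G" for g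
    using c that by (auto simp: corner_cocycle_def)
  have c': "\<alpha> g (v h) o\<^sub>L v g = scale_op (\<upsilon> g h) (v (g \<otimes>\<^bsub>G\<^esub> h))" if "g \<in> carrier G" "h \<in> carrier G" for g h
    using c that by (auto simp: corner_cocycle_def)
  show ?thesis unfolding corner_cocycle_def
  proof (intro conjI ballI)
    fix g assume g: "g \<in> carrier G"
    show "\<psi> (v g) \<in> N'" using iso(4) v g by blast
    have av: "adj (v g) \<in> N" using alg(5)[OF v(1)[OF g]] .
    show "adj (\<psi> (v g)) o\<^sub>L \<psi> (v g) = \<psi> e"
      using iso(6)[OF av v(1)[OF g]] iso(7)[OF v(1)[OF g]] v(2)[OF g] by simp
    show "\<psi> (v g) o\<^sub>L adj (\<psi> (v g)) = \<beta> g (\<psi> e)"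
      using iso(6)[OF v(1)[OF g] av] iso(7)[OF v(1)[OF g]] v(3)[OF g] eq[OF g e] by simp
    fix h assume h: "h \<in> carrier G"
    have "\<psi> (\<alpha> g (v h) o\<^sub>L v g) = \<beta> g (\<psi> (v h)) o\<^sub>L \<psi> (v g)"
      using iso(6)[OF \<alpha>[OF g v(1)[OF h]] v(1)[OF g]] eq[OF g v(1)[OF h]] by simp
    moreover have "\<psi> (scale_op (\<upsilon> g h) (v (g \<otimes>\<^bsub>G\<^esub> h))) = scale_op (\<upsilon> g h) (\<psi> (v (g \<otimes>\<^bsub>G\<^esub> h)))"
      using iso(8)[OF v(1)[of "g \<otimes>\<^bsub>G\<^esub> h"]] g h by simp
    ultimately show "\<beta> g (\<psi> (v h)) o\<^sub>L \<psi> (v g) = scale_op (\<upsilon> g h) (\<psi> (v (g \<otimes>\<^bsub>G\<^esub> h)))"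
      using c'[OF g h] by simp
  qed
qed

section \<open>The model systems\<close>

lemma amp_simps [simp]:
  "amp a (mat 1) (x, y) = (a x, a y)"
  "amp a sigma_x (x, y) = (a y, a x)"
  "amp a sigma_y (x, y) = (- a (\<i> *\<^sub>C y), a (\<i> *\<^sub>C x))"
  "amp a sigma_z (x, y) = (a x, - a y)"
  by (simp_all add: amp_apply mat_def sigma_x_def sigma_y_def sigma_z_def vector_2 blinfun.minus_right)

lemma closed_csubspace_Times:
  assumes "closed_csubspace K" "closed_csubspace L"
  shows "closed_csubspace (K \<times> L)"
  using closed_csubspaceD[OF assms(1)] closed_csubspaceD[OF assms(2)]
  by (intro closed_csubspaceI) (auto simp: closed_Times subspace_Times scaleC_prod_def)

lemma proj_Times:
  assumes K: "closed_csubspace K" and L: "closed_csubspace L"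
  shows "proj (K \<times> L) (x, y) = (proj K x, proj L y)"
proof (rule proj_unique)
  show "closed (K \<times> L)" "subspace (K \<times> L)"
    using closed_csubspaceD[OF closed_csubspace_Times[OF K L]] by blast+
  show "(proj K x, proj L y) \<in> K \<times> L" by (simp add: proj_range K L)
  fix z assume z: "z \<in> K \<times> L"
  then show "((x, y) - (proj K x, proj L y)) \<bullet> z = 0"
    using proj_orth[OF closed_csubspaceD(1,2)[OF K], of "fst z" x]
      proj_orth[OF closed_csubspaceD(1,2)[OF L], of "snd z" y]
    by (cases z) (simp add: inner_Pair)
qed

lemma amp_B:
  assumes K: "closed_csubspace K" and a: "a \<in> B K"
  shows "amp a m \<in> B (K \<times> K)"
proof (rule B_I[OF closed_csubspace_Times[OF K K]])
  note aD = B_D[OF K a]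
  show "amp a m \<in> Bounded_ops"
  proof -
    have "amp a m (c *\<^sub>C (x, y)) = c *\<^sub>C amp a m (x, y)" for c x y
      by (simp add: amp_apply scaleC_prod_def scaleC_scaleC Bounded_opsD[OF aD(1)] blinfun.add_right
          scaleC_add_right mult.commute)
    then show ?thesis by (auto simp: Bounded_ops_def)
  qed
  show "amp a m v \<in> K \<times> K" for v by (cases v) (simp add: amp_apply aD)
  show "amp a m (proj (K \<times> K) v) = amp a m v" for v
    by (cases v) (simp add: proj_Times[OF K K] amp_apply blinfun.add_right Bounded_opsD[OF aD(1)] aD)
qed

lemma subspace_B: "closed_csubspace K \<Longrightarrow> subspace (B K)"
  using star_algebraD[OF B_star_algebra] by (intro subspaceI) auto

text \<open>A matrix block of \<open>X\<close>, with \<open>\<iota>\<close> one of the two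
  embeddings and \<open>\<pi>\<close> one of the two coordinates.\<close>

definition blk :: "('a::chilbert_space \<times> 'a \<Rightarrow> 'a) \<Rightarrow> ('a \<Rightarrow> 'a \<times> 'a) \<Rightarrow> ('a \<times> 'a) op \<Rightarrow> 'a op"
  where "blk \<pi> \<iota> X = Blinfun (\<lambda>k. \<pi> (X (\<iota> k)))"

lemma blk_apply:
  "bounded_linear \<pi> \<Longrightarrow> bounded_linear \<iota> \<Longrightarrow> blk \<pi> \<iota> X k = \<pi> (X (\<iota> k))"
  unfolding blk_def
  by (subst bounded_linear_Blinfun_apply)
     (auto intro: bounded_linear_compose[of \<pi>] bounded_linear_compose[OF blinfun.bounded_linear_right])

text \<open>Every operator on \<open>K \<times> K\<close> is the sum of its four blocks tensored
  with matrix units.\<close>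

lemma model_algebra_0:
  fixes K :: "'a::chilbert_space set"
  assumes K: "closed_csubspace K"
  shows "model_algebra 0 K = B (K \<times> K)"
proof
  note K2 = closed_csubspace_Times[OF K K]
  show "model_algebra 0 K \<subseteq> B (K \<times> K)"
    unfolding model_algebra_def using amp_B[OF K] by (intro span_minimal subspace_B[OF K2]) auto
  show "B (K \<times> K) \<subseteq> model_algebra 0 K"
  proof
    fix X assume X: "X \<in> B (K \<times> K)"
    note XD = B_D[OF K2 X]
    have bl: "bounded_linear (\<lambda>k::'a. (k, 0::'a))" "bounded_linear (\<lambda>k::'a. (0::'a, k))"
      by (intro bounded_linear_Pair bounded_linear_ident bounded_linear_zero)+
    note app = blk_apply[OF bounded_linear_fst bl(1)] blk_apply[OF bounded_linear_fst bl(2)]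
      blk_apply[OF bounded_linear_snd bl(1)] blk_apply[OF bounded_linear_snd bl(2)]
    have sc: "c *\<^sub>C (k :: 'a, 0 :: 'a) = (c *\<^sub>C k, 0)" "c *\<^sub>C (0 :: 'a, k :: 'a) = (0, c *\<^sub>C k)" for c k
      by (simp_all add: scaleC_prod_def)
    have p0: "proj K 0 = 0" by (simp add: blinfun.zero_right)
    have pr: "X (proj K k, 0) = X (k, 0)" "X (0, proj K k) = X (0, k)" for k
      using XD(3)[of "(k, 0)"] XD(3)[of "(0, k)"] by (simp_all add: proj_Times[OF K K] p0)
    have XK: "fst (X v) \<in> K" "snd (X v) \<in> K" for v using XD(2)[of v] by (auto simp: mem_Times_iff)
    have BX: "blk fst (\<lambda>k. (k, 0)) X \<in> B K" "blk fst (\<lambda>k. (0, k)) X \<in> B K"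
      "blk snd (\<lambda>k. (k, 0)) X \<in> B K" "blk snd (\<lambda>k. (0, k)) X \<in> B K"
      by (auto intro!: B_I[OF K] simp: Bounded_ops_def app XK pr Bounded_opsD[OF XD(1)] simp flip: sc)
         (simp_all add: scaleC_prod_def)
    define E :: "complex \<Rightarrow> complex \<Rightarrow> complex \<Rightarrow> complex \<Rightarrow> complex^2^2"
      where "E a b c d = vector [vector [a, b], vector [c, d]]" for a b c d
    have Xeq: "X = amp (blk fst (\<lambda>k. (k, 0)) X) (E 1 0 0 0) + amp (blk fst (\<lambda>k. (0, k)) X) (E 0 1 0 0) +
        amp (blk snd (\<lambda>k. (k, 0)) X) (E 0 0 1 0) + amp (blk snd (\<lambda>k. (0, k)) X) (E 0 0 0 1)"
    proof (rule blinfun_eqI)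
      fix v :: "'a \<times> 'a"
      obtain x y where v: "v = (x, y)" by (cases v)
      have "X v = X ((x, 0) + (0, y))" by (simp add: v)
      also have "\<dots> = X (x, 0) + X (0, y)" by (rule blinfun.add_right)
      finally show "X v = (amp (blk fst (\<lambda>k. (k, 0)) X) (E 1 0 0 0) + amp (blk fst (\<lambda>k. (0, k)) X) (E 0 1 0 0) +
        amp (blk snd (\<lambda>k. (k, 0)) X) (E 0 0 1 0) + amp (blk snd (\<lambda>k. (0, k)) X) (E 0 0 0 1)) v"
        by (simp add: v blinfun.add_left amp_apply E_def app prod_eq_iff)
    qed
    have m: "amp a m \<in> model_algebra 0 K" if "a \<in> B K" for a m
      unfolding model_algebra_def using that by (auto intro!: span_base simp: matrix_factor_def)
    have "subspace (model_algebra 0 K)" by (simp add: model_algebra_def)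
    then show "X \<in> model_algebra 0 K"
      by (subst Xeq) (intro subspace_add m BX)
  qed
qed

lemma model_algebra_1:
  assumes K: "closed_csubspace K"
  shows "model_algebra 1 K = {amp a (mat 1) + amp b sigma_x | a b. a \<in> B K \<and> b \<in> B K}" (is "_ = ?R")
proof
  note alg = star_algebraD[OF B_star_algebra[OF K]]
  have R: "subspace ?R"
  proof (rule subspaceI)
    have "0 = amp 0 (mat 1) + amp 0 sigma_x"
      by (rule blinfun_eqI) (auto simp: blinfun.add_left zero_prod_def)
    then show "0 \<in> ?R" using alg(2) by blast
    fix x y r assume "x \<in> ?R"
    then obtain a b where x: "x = amp a (mat 1) + amp b sigma_x" "a \<in> B K" "b \<in> B K" by blast
    have "r *\<^sub>R x = amp (r *\<^sub>R a) (mat 1) + amp (r *\<^sub>R b) sigma_x"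
      by (rule blinfun_eqI) (auto simp: x blinfun.add_left blinfun.scaleR_left scaleR_add_right)
    then show "r *\<^sub>R x \<in> ?R" using x alg(9) by blast
    assume "y \<in> ?R"
    then obtain c d where y: "y = amp c (mat 1) + amp d sigma_x" "c \<in> B K" "d \<in> B K" by blast
    have "x + y = amp (a + c) (mat 1) + amp (b + d) sigma_x"
      by (rule blinfun_eqI) (auto simp: x y blinfun.add_left)
    then show "x + y \<in> ?R" using x y alg(3) by blast
  qed
  have "amp a (mat c + mat d ** sigma_x) \<in> ?R" if a: "a \<in> B K" for a c d
  proof -
    define m where "m = mat c + mat d ** sigma_x"
    have m: "m $ 1 $ 1 = c" "m $ 1 $ 2 = d" "m $ 2 $ 1 = d" "m $ 2 $ 2 = c"
      by (simp_all add: m_def mat_def sigma_x_def matrix_matrix_mult_def sum_2)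
    have "amp a m = amp (scale_op c a) (mat 1) + amp (scale_op d a) sigma_x"
    proof (rule blinfun_eqI)
      fix v :: "'a \<times> 'a"
      show "amp a m v = (amp (scale_op c a) (mat 1) + amp (scale_op d a) sigma_x) v"
        by (cases v) (simp add: amp_apply[of a m] m blinfun.add_left blinfun.add_right
            Bounded_opsD[OF alg(1)[OF a]] add.commute)
    qed
    then show ?thesis unfolding m_def using a alg(6) by blast
  qed
  then show "model_algebra 1 K \<subseteq> ?R"
    unfolding model_algebra_def using R by (intro span_minimal) (auto simp: matrix_factor_def)
  have "amp a (mat 1) \<in> model_algebra 1 K" "amp a sigma_x \<in> model_algebra 1 K" if "a \<in> B K" for a
  proof -
    have "mat 1 = mat 1 + mat 0 ** sigma_x" "sigma_x = mat 0 + mat 1 ** sigma_x" by (simp_all add: mat_0)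
    moreover have "matrix_factor 1 = {mat c + mat d ** sigma_x | c d. True}"
      by (simp add: matrix_factor_def)
    ultimately have "mat 1 \<in> matrix_factor 1" "sigma_x \<in> matrix_factor 1" by blast+
    then show "amp a (mat 1) \<in> model_algebra 1 K" "amp a sigma_x \<in> model_algebra 1 K"
      unfolding model_algebra_def using that by (auto intro!: span_base)
  qed
  then show "?R \<subseteq> model_algebra 1 K" unfolding model_algebra_def using span_add by fastforce
qed

lemma adj_amp:
  "adj (amp a (mat 1)) = amp (adj a) (mat 1)"
  "adj (amp a sigma_x) = amp (adj a) sigma_x"
  "adj (amp a sigma_z) = amp (adj a) sigma_z"
  by (rule adj_eqI; clarsimp simp: inner_adj[of a])+

lemma amp_mat_1_iso:
  assumes K: "closed_csubspace K"
  shows "star_iso 0 (B K) ((\<lambda>a. amp a (mat 1)) ` B K) (\<lambda>a. amp a (mat 1))"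
proof -
  have "inj_on (\<lambda>a. amp a (mat 1)) (B K)"
  proof (rule inj_onI)
    fix a b assume "amp a (mat 1) = amp b (mat 1)"
    then have "amp a (mat 1) (x, 0) = amp b (mat 1) (x, 0)" for x by simp
    then show "a = b" by (intro blinfun_eqI) simp
  qed
  moreover have "amp (a + b) (mat 1) = amp a (mat 1) + amp b (mat 1)"
    "amp (a o\<^sub>L b) (mat 1) = amp a (mat 1) o\<^sub>L amp b (mat 1)"
    "amp (scale_op c a) (mat 1) = scale_op c (amp a (mat 1))" for a b c
    by (rule blinfun_eqI; clarsimp simp: blinfun.add_left scaleC_prod_def)+
  ultimately show ?thesis by (auto simp: star_iso_def bij_betw_def adj_amp)
qed

lemma star_iso_restrict:
  assumes "star_iso s M N \<phi>" "M' \<subseteq> M"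
  shows "star_iso s M' (\<phi> ` M') \<phi>"
  using assms inj_on_subset[of \<phi> M M'] by (auto simp: star_iso_def bij_betw_def subset_iff)

lemma intertwine_inv:
  assumes \<phi>: "star_iso s M N \<phi>" and "\<And>x. x \<in> M \<Longrightarrow> f x \<in> M" "\<And>x. x \<in> M \<Longrightarrow> \<phi> (f x) = g (\<phi> x)" "y \<in> N"
  shows "inv_into M \<phi> (g y) = f (inv_into M \<phi> y)"
proof -
  note iso = star_isoD[OF \<phi>]
  have "y \<in> \<phi> ` M" using iso(3) assms(4) by simp
  then have x: "inv_into M \<phi> y \<in> M" "\<phi> (inv_into M \<phi> y) = y" by (auto intro: inv_into_into f_inv_into_f)
  have "inv_into M \<phi> (\<phi> (f (inv_into M \<phi> y))) = f (inv_into M \<phi> y)"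
    using iso(2) assms(2)[OF x(1)] by (rule inv_into_f_f)
  then show ?thesis using assms(3)[OF x(1)] x(2) by simp
qed

context graded_algebra
begin

lemma frame_0_theta:
  assumes "frame 0 e w" "x \<in> M"
  shows "w o\<^sub>L x = Ad \<Gamma> x o\<^sub>L w" "w (x v) = Ad \<Gamma> x (w v)"
proof -
  note w = frameD[OF assms(1)]
  obtain x0 x1 where x: "x0 \<in> H 0" "x1 \<in> H 1" "x = x0 + x1" using Hom_decompose[OF assms(2)] by blast
  show 1: "w o\<^sub>L x = Ad \<Gamma> x o\<^sub>L w"
    using w(7)[OF x(1)] w(7)[OF x(2)] HomD(4)[OF x(1)] HomD(4)[OF x(2)]
    by (simp add: x(3) Ad_add compose_distribs)
  show "w (x v) = Ad \<Gamma> x (w v)" using compose_eqD[OF 1, of v] by simp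
qed

end

context graded_system
begin

section \<open>Models give index data\<close>

text \<open>The inverse of the equivalence carries a rank one projection, together with the image of
  \<open>sigma_z\<close> for \<open>\<kappa> = 0\<close> or of \<open>sigma_x\<close> for
  \<open>\<kappa> = 1\<close>, to a frame of \<open>M\<close>.\<close>

lemma index_rel_imp_data:
  assumes rel: "index_rel G p M (Ad \<Gamma>) \<alpha> (\<kappa>, q, c)"
  shows "q \<in> extensional (carrier G)" "\<exists>e w v \<upsilon>. index_data \<kappa> q e w v \<upsilon> \<and> c = cocycle_class G p \<upsilon>"
proof -
  show "q \<in> extensional (carrier G)" using rel by (simp add: index_rel_def)
  obtain K :: "'a set" and V \<omega> \<upsilon> where md: "model_data G p \<kappa> K V \<omega> q"
    and eq: "equivalent_systems G M (Ad \<Gamma>) \<alpha> (model_algebra \<kappa> K) (Ad (model_grading K)) (\<lambda>g. Ad (V g))"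
    and cl: "if \<kappa> = 0 then \<upsilon> = \<omega> else (\<exists>V0. projective_rep G p K V0 \<upsilon> \<and>
      (\<forall>g\<in>carrier G. V g = amp (V0 g) (if q g = 0 then mat 1 else sigma_y)))"
    and c: "c = cocycle_class G p \<upsilon>"
    using rel unfolding index_rel_def by auto
  have K: "closed_csubspace K" and pr: "projective_rep G p (K \<times> K) V \<omega>"
    and VZ: "\<And>g. g \<in> carrier G \<Longrightarrow> Ad (V g) (model_grading K) = scale_op (sign (q g)) (model_grading K)"
    and VX: "\<And>g. \<kappa> = 1 \<Longrightarrow> g \<in> carrier G \<Longrightarrow>
      Ad (V g) (amp (one_on K) sigma_x) = scale_op (sign (q g)) (amp (one_on K) sigma_x)"
    using md by (auto simp: model_data_def)
  note one = one_on_eq[OF K]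
  note K2 = closed_csubspace_Times[OF K K]
  obtain \<phi> where \<phi>: "star_iso 0 M (model_algebra \<kappa> K) \<phi>"
    and \<phi>\<theta>: "\<And>x. x \<in> M \<Longrightarrow> \<phi> (Ad \<Gamma> x) = Ad (model_grading K) (\<phi> x)"
    and \<phi>\<alpha>: "\<And>g x. g \<in> carrier G \<Longrightarrow> x \<in> M \<Longrightarrow> \<phi> (\<alpha> g x) = Ad (V g) (\<phi> x)"
    using eq unfolding equivalent_systems_def by blast
  define N where "N = model_algebra \<kappa> K"
  have NB: "N \<subseteq> B (K \<times> K)"
  proof (cases "\<kappa> = 0")
    case True
    then show ?thesis by (simp add: N_def model_algebra_0[OF K])
  next
    case False
    then have "\<kappa> = 1" by simp
    then show ?thesis using amp_B[OF K] star_algebraD(3)[OF B_star_algebra[OF K2]]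
      by (auto simp: N_def model_algebra_1[OF K])
  qed
  have PB: "proj K \<in> B K" by (rule proj_in_B[OF K])
  have P2: "proj (K \<times> K) = amp (proj K) (mat 1)"
    by (rule blinfun_eqI) (auto simp: proj_Times[OF K K])
  have amp_N: "amp a (mat 1) \<in> N" if "a \<in> B K" for a
  proof (cases "\<kappa> = 0")
    case True
    then show ?thesis using amp_B[OF K that] by (simp add: N_def model_algebra_0[OF K])
  next
    case False
    then have 1: "\<kappa> = 1" by simp
    have "amp a (mat 1) = amp a (mat 1) + amp 0 sigma_x"
      by (rule blinfun_eqI) (auto simp: blinfun.add_left zero_prod_def)
    then show ?thesis unfolding N_def 1 model_algebra_1[OF K]
      using that star_algebraD(2)[OF B_star_algebra[OF K]] by blast
  qed
  define \<psi> where "\<psi> = inv_into M \<phi>"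
  have \<psi>: "star_iso 0 N M \<psi>" unfolding \<psi>_def N_def by (rule star_iso_inv[OF \<phi> M_star])
  have Nalg: "star_algebra N" unfolding N_def
    by (rule star_algebra_image[OF \<phi> M_star]) (use NB B_D(1)[OF K2] in \<open>auto simp: N_def\<close>)
  note iso = star_isoD[OF \<psi>] and iso' = star_iso_more[OF \<psi> Nalg] and nalg = star_algebraD[OF Nalg]
  have \<psi>\<theta>: "\<psi> (Ad (model_grading K) y) = Ad \<Gamma> (\<psi> y)" if "y \<in> N" for y
    unfolding \<psi>_def
    by (rule intertwine_inv[where f = "Ad \<Gamma>" and g = "Ad (model_grading K)", OF \<phi> thetaD(4) \<phi>\<theta>])
       (use that in \<open>auto simp: N_def\<close>)
  have \<psi>\<alpha>: "\<psi> (Ad (V g) y) = \<alpha> g (\<psi> y)" if "g \<in> carrier G" "y \<in> N" for g y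
    unfolding \<psi>_def
    by (rule intertwine_inv[where f = "\<alpha> g" and g = "Ad (V g)",
          OF \<phi> act.isoD(4)[OF that(1)] \<phi>\<alpha>[OF that(1)]])
       (use that in \<open>auto simp: N_def\<close>)
  have P2N: "proj (K \<times> K) \<in> N" unfolding P2 by (rule amp_N[OF PB])
  \<comment> \<open>The unit of the model is the projection onto \<open>K \<times> K\<close>;
    surjectivity of \<open>\<psi>\<close> forces it to go to the identity.\<close>
  have \<psi>1: "\<psi> (proj (K \<times> K)) = id_blinfun"
  proof -
    obtain y where y: "y \<in> N" "\<psi> y = id_blinfun" using iso(3) M_id by (metis imageE)
    have "\<psi> (proj (K \<times> K)) = \<psi> y o\<^sub>L \<psi> (proj (K \<times> K))" by (simp add: y)
    also have "\<dots> = \<psi> (y o\<^sub>L proj (K \<times> K))" using iso(6)[OF y(1) P2N] by simp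
    also have "y o\<^sub>L proj (K \<times> K) = y" using NB y(1) B_D(5)[OF K2] by blast
    finally show ?thesis by (simp add: y)
  qed
  obtain \<xi> where \<xi>: "\<xi> \<in> K" "norm \<xi> = 1"
  proof -
    have "proj (K \<times> K) \<noteq> 0" using \<psi>1 iso'(1) by (metis id_blinfun_neq_0)
    then obtain v where "proj (K \<times> K) v \<noteq> 0" using blinfun_eqI[of "proj (K \<times> K)" 0] by force
    then obtain k where k: "k \<in> K" "k \<noteq> 0"
      using proj_range[OF K] by (cases v) (auto simp: P2 zero_prod_def)
    then have "(1 / norm k) *\<^sub>R k \<in> K" using closed_csubspaceD(2)[OF K] by (simp add: subspace_scale)
    then show thesis using that[of "(1 / norm k) *\<^sub>R k"] k by simp
  qed
  define Z where "Z = model_grading K"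
  have Z: "Z (x, y) = (proj K x, - proj K y)" for x y by (simp add: Z_def model_grading_def one)
  note pK = projection_opD[OF projection_proj[OF K]]
  have ZB: "Z \<in> B (K \<times> K)" unfolding Z_def model_grading_def one by (rule amp_B[OF K PB])
  have adjZ: "adj Z = Z" by (simp add: Z_def model_grading_def one adj_amp pK)
  have ZZ: "Z o\<^sub>L Z = proj (K \<times> K)"
    by (rule blinfun_eqI) (auto simp: Z P2 pK blinfun.minus_right)
  have AdZ: "Ad Z (amp a (mat 1)) = amp a (mat 1)" "Ad Z (amp a sigma_x) = - amp a sigma_x" if "a \<in> B K" for a
    using B_D(3,4)[OF K that]
    by (auto intro!: blinfun_eqI simp: adjZ Z blinfun.minus_right blinfun.minus_left)
  have bicomm: "\<psi> (amp (proj K) sigma_x) o\<^sub>L x = x o\<^sub>L \<psi> (amp (proj K) sigma_x)"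
    if 1: "\<kappa> = 1" and x: "x \<in> M" and XN: "amp (proj K) sigma_x \<in> N" for x
  proof -
    obtain y where y: "y \<in> N" "x = \<psi> y" using iso(3) x by blast
    then obtain a b where ab: "y = amp a (mat 1) + amp b sigma_x" "a \<in> B K" "b \<in> B K"
      unfolding N_def 1 model_algebra_1[OF K] by blast
    have "amp (proj K) sigma_x o\<^sub>L y = y o\<^sub>L amp (proj K) sigma_x"
      using B_D(3,4)[OF K ab(2)] B_D(3,4)[OF K ab(3)]
      by (auto intro!: blinfun_eqI simp: ab(1) blinfun.add_left blinfun.add_right)
    then show ?thesis using iso(6)[OF y(1) XN] iso(6)[OF XN y(1)] y(2) by simp
  qed
  show "\<exists>e w v \<upsilon>. index_data \<kappa> q e w v \<upsilon> \<and> c = cocycle_class G p \<upsilon>"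
  proof (cases "\<kappa> = 0")
    case True
    then have N0: "N = B (K \<times> K)" by (simp add: N_def model_algebra_0[OF K])
    \<comment> \<open>The first component is where \<open>sigma_z\<close> acts as 1; this yields the
      normalisation \<open>w o\<^sub>L e = e\<close> of a frame with
      \<open>\<kappa> = 0\<close>.\<close>
    let ?\<xi> = "(\<xi>, 0 :: 'a)"
    have \<xi>2: "?\<xi> \<in> K \<times> K" "norm ?\<xi> = 1" "Z ?\<xi> = ?\<xi>"
      using \<xi> closed_csubspaceD(2)[OF K] proj_fix[OF K \<xi>(1)]
      by (auto simp: subspace_0 norm_Pair Z blinfun.zero_right)
    let ?e = "rank_one ?\<xi> ?\<xi>"
    have eN: "?e \<in> N" unfolding N0 by (rule rank_one_B[OF K2 \<xi>2(1,1)])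
    have "M \<subseteq> Bounded_ops" using algD(1) by blast
    then have mf: "minimal_full M (\<psi> ?e)"
      using minimal_full_iso[OF \<psi> Nalg _ rank_one_minimal_full[OF K2 \<xi>2(1,2), folded N0]] by blast
    have ZN: "Z \<in> N" using ZB N0 by simp
    have "Ad Z ?e = ?e" using \<xi>2(3) B_D(1)[OF K2 ZB] by (subst Ad_rank_one[of 0]) (auto simp: Bounded_ops_iff)
    then have eH: "\<psi> ?e \<in> H 0"
      using iso(4)[OF eN] \<psi>\<theta>[OF eN] by (simp add: homogeneous_part_def Z_def)
    have "Ad Z Z = Z" using B_D(6)[OF K2 ZB] by (simp add: Ad_def adjZ ZZ)
    then have wH: "\<psi> Z \<in> H 0"
      using iso(4)[OF ZN] \<psi>\<theta>[OF ZN] by (simp add: homogeneous_part_def Z_def)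
    have wsa: "adj (\<psi> Z) = \<psi> Z" using iso(7)[OF ZN] adjZ by simp
    have ww: "\<psi> Z o\<^sub>L \<psi> Z = id_blinfun" using iso(6)[OF ZN ZN] by (simp add: ZZ \<psi>1)
    have wx: "\<psi> Z o\<^sub>L x = scale_op (sign ((1 + 0) * r)) (x o\<^sub>L \<psi> Z)" if x: "x \<in> H r" for x r
    proof -
      obtain y where y: "y \<in> N" "x = \<psi> y" using iso(3) HomD(1)[OF x] by blast
      have AN: "Ad Z y \<in> N" using y ZN nalg adjZ by (simp add: Ad_def)
      have "y o\<^sub>L proj (K \<times> K) = y" using B_D(5)[OF K2] NB y(1) by blast
      then have "Z o\<^sub>L y = Ad Z y o\<^sub>L Z" by (simp add: Ad_def adjZ compose_assoc ZZ)
      then have "\<psi> Z o\<^sub>L \<psi> y = \<psi> (Ad Z y) o\<^sub>L \<psi> Z" using iso(6)[OF ZN y(1)] iso(6)[OF AN ZN] by simp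
      also have "\<psi> (Ad Z y) = scale_op (sign r) x" using \<psi>\<theta>[OF y(1)] HomD(4)[OF x] y(2) by (simp add: Z_def)
      finally show ?thesis using y(2) by simp
    qed
    have "Z o\<^sub>L ?e = ?e"
      using \<xi>2(3) B_D(1)[OF K2 ZB] by (intro blinfun_eqI) (simp add: Bounded_opsD)
    then have we: "\<psi> Z o\<^sub>L \<psi> ?e = \<psi> ?e" using iso(6)[OF ZN eN] by simp
    have "minimal_full (corner_algebra M (Ad \<Gamma>) 0) (\<psi> ?e)" using mf by (simp add: corner_algebra_def)
    then have fr: "frame 0 (\<psi> ?e) (\<psi> Z)"
      unfolding frame_def using eH wH wsa ww wx we by blast
    have aw: "\<alpha> g (\<psi> Z) = scale_op (sign (q g)) (\<psi> Z)" if g: "g \<in> carrier G" for g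
      using \<psi>\<alpha>[OF g ZN] VZ[OF g] iso(8)[OF ZN] by (simp add: Z_def)
    have "corner_cocycle G M \<alpha> (\<psi> ?e) (\<lambda>g. \<psi> (rank_one (V g ?\<xi>) ?\<xi>)) \<omega>"
    proof (rule corner_cocycle_iso[OF is_group _ \<psi> Nalg eN])
      show "corner_cocycle G N (\<lambda>g. Ad (V g)) ?e (\<lambda>g. rank_one (V g ?\<xi>) ?\<xi>) \<omega>"
        unfolding N0 by (rule rank_one_corner_cocycle[OF is_group K2 pr \<xi>2(1,2)])
      show "Ad (V g) x \<in> N" if "g \<in> carrier G" "x \<in> N" for g x
        using Ad_B[OF _ K2, of "p g" "V g" x] pr that unfolding N0 projective_rep_def by blast
    qed (use \<psi>\<alpha> in blast)
    then have "index_data 0 q (\<psi> ?e) (\<psi> Z) (\<lambda>g. \<psi> (rank_one (V g ?\<xi>) ?\<xi>)) \<omega>"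
      unfolding index_data_def using fr aw by (simp add: corner_algebra_def)
    moreover have "c = cocycle_class G p \<omega>" using c cl True by simp
    ultimately show ?thesis using True by blast
  next
    case False
    then have 1: "\<kappa> = 1" by simp
    obtain V0 where V0: "projective_rep G p K V0 \<upsilon>"
      and VV0: "\<And>g. g \<in> carrier G \<Longrightarrow> V g = amp (V0 g) (if q g = 0 then mat 1 else sigma_y)"
      using cl 1 by auto
    define X where "X = amp (proj K) sigma_x"
    have XN: "X \<in> N"
    proof -
      have "X = amp 0 (mat 1) + amp (proj K) sigma_x"
        by (rule blinfun_eqI) (auto simp: blinfun.add_left X_def zero_prod_def)
      then show ?thesis unfolding N_def 1 model_algebra_1[OF K]
        using PB star_algebraD(2)[OF B_star_algebra[OF K]] by blast
    qed
    \<comment> \<open>The even part of the model consists of the operators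
      \<open>amp a (mat 1)\<close>, so the cocycle can be computed in \<open>B K\<close>.\<close>
    define \<rho> where "\<rho> = (\<lambda>a. \<psi> (amp a (mat 1)))"
    have imH: "\<psi> ` ((\<lambda>a. amp a (mat 1)) ` B K) = H 0"
    proof
      show "\<psi> ` ((\<lambda>a. amp a (mat 1)) ` B K) \<subseteq> H 0"
      proof
        fix x assume "x \<in> \<psi> ` ((\<lambda>a. amp a (mat 1)) ` B K)"
        then obtain a where a: "a \<in> B K" "x = \<psi> (amp a (mat 1))" by blast
        have "Ad \<Gamma> x = x" using \<psi>\<theta>[OF amp_N[OF a(1)]] AdZ(1)[OF a(1)] a(2) by (simp add: Z_def)
        then show "x \<in> H 0" using iso(4)[OF amp_N[OF a(1)]] a(2) by (simp add: homogeneous_part_def)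
      qed
      show "H 0 \<subseteq> \<psi> ` ((\<lambda>a. amp a (mat 1)) ` B K)"
      proof
        fix x assume x: "x \<in> H 0"
        obtain y where y: "y \<in> N" "x = \<psi> y" using iso(3) HomD(1)[OF x] by blast
        then obtain a b where ab: "y = amp a (mat 1) + amp b sigma_x" "a \<in> B K" "b \<in> B K"
          unfolding N_def 1 model_algebra_1[OF K] by blast
        have Ay: "Ad Z y = amp a (mat 1) - amp b sigma_x" using AdZ ab by (simp add: Ad_add)
        have ZBd: "Ad Z y \<in> N"
        proof -
          have "amp a (mat 1) - (y - amp a (mat 1)) \<in> N" using amp_N[OF ab(2)] y(1) nalg by simp
          moreover have "amp a (mat 1) - (y - amp a (mat 1)) = Ad Z y" unfolding Ay by (simp add: ab(1))
          ultimately show ?thesis by simp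
        qed
        have "\<psi> (Ad Z y) = \<psi> y" using \<psi>\<theta>[OF y(1)] HomD(4)[OF x] y(2) by (simp add: Z_def)
        then have "Ad Z y = y" using inj_onD[OF iso(2) _ ZBd y(1)] by blast
        then have "amp a (mat 1) + - amp b sigma_x = amp a (mat 1) + amp b sigma_x" using Ay ab(1) by simp
        then have "- amp b sigma_x = amp b sigma_x" by (simp only: add_left_cancel)
        then have "2 *\<^sub>R amp b sigma_x = 0" by (simp add: scaleR_2 neg_eq_iff_add_eq_0)
        then have "y = amp a (mat 1)" using ab(1) by simp
        then show "x \<in> \<psi> ` ((\<lambda>a. amp a (mat 1)) ` B K)" using y(2) ab(2) by blast
      qed
    qed
    have "star_iso 0 ((\<lambda>a. amp a (mat 1)) ` B K) (H 0) \<psi>"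
      using star_iso_restrict[OF \<psi>, of "(\<lambda>a. amp a (mat 1)) ` B K"] amp_N unfolding imH by blast
    then have \<rho>: "star_iso 0 (B K) (H 0) \<rho>"
      using star_iso_compose[OF amp_mat_1_iso[OF K]] unfolding \<rho>_def comp_def by force
    note BKalg = B_star_algebra[OF K]
    have ua0: "unitary_antiunitary (p g) K (V0 g)" if "g \<in> carrier G" for g
      using V0 that by (simp add: projective_rep_def)
    have ua: "unitary_antiunitary (p g) (K \<times> K) (V g)" if "g \<in> carrier G" for g
      using pr that by (simp add: projective_rep_def)
    \<comment> \<open>The Pauli factor of \<open>V g\<close> acts only on the second tensor factor
      and cancels on \<open>amp a (mat 1)\<close>, so the action on the even part is that of
      \<open>V0\<close>.\<close>
    have \<rho>\<alpha>: "\<rho> (Ad (V0 g) a) = \<alpha> g (\<rho> a)" if g: "g \<in> carrier G" and a: "a \<in> B K" for g a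
    proof -
      note W = unitary_antiunitaryD[OF ua0[OF g] K]
      have aB: "Ad (V0 g) a \<in> B K" by (rule Ad_B[OF ua0[OF g] K a])
      have aW: "Ad (V0 g) a (V0 g x) = V0 g (a x)" for x
        using compose_eqD[OF W(6), of x] B_D(3)[OF K a] by simp
      have "Ad (V g) (amp a (mat 1)) = amp (Ad (V0 g) a) (mat 1)"
      proof (rule unitary_antiunitary_Ad[OF ua[OF g] K2])
        show "V g o\<^sub>L amp a (mat 1) = amp (Ad (V0 g) a) (mat 1) o\<^sub>L V g"
          using B_D(1)[OF K a]
          by (intro blinfun_eqI) (auto simp: VV0[OF g] aW blinfun.minus_right Bounded_opsD simp del: Ad_apply)
        show "amp (Ad (V0 g) a) (mat 1) o\<^sub>L proj (K \<times> K) = amp (Ad (V0 g) a) (mat 1)"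
          by (rule B_D(5)[OF K2 amp_B[OF K aB]])
      qed
      then show ?thesis using \<psi>\<alpha>[OF g amp_N[OF a]] by (simp add: \<rho>_def)
    qed
    let ?e = "rank_one \<xi> \<xi>"
    have eB: "?e \<in> B K" by (rule rank_one_B[OF K \<xi>(1,1)])
    have "H 0 \<subseteq> Bounded_ops" using HomD(2) by blast
    then have mf: "minimal_full (H 0) (\<rho> ?e)"
      by (rule minimal_full_iso[OF \<rho> BKalg _ rank_one_minimal_full[OF K \<xi>]])
    have eH: "\<rho> ?e \<in> H 0" using star_isoD(4)[OF \<rho> eB] .
    have wH: "\<psi> X \<in> H 1"
      using iso(4)[OF XN] \<psi>\<theta>[OF XN] AdZ(2)[OF PB] iso'(2)[OF XN]
      by (simp add: homogeneous_part_def Z_def X_def)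
    have wsa: "adj (\<psi> X) = \<psi> X" using iso(7)[OF XN] by (simp add: X_def adj_amp pK)
    have "X o\<^sub>L X = proj (K \<times> K)" by (rule blinfun_eqI) (auto simp: X_def P2 pK)
    then have ww: "\<psi> X o\<^sub>L \<psi> X = id_blinfun" using iso(6)[OF XN XN] by (simp add: \<psi>1)
    have wx: "\<psi> X o\<^sub>L x = scale_op (sign ((1 + 1) * r)) (x o\<^sub>L \<psi> X)" if x: "x \<in> H r" for x r
      using bicomm[OF 1 HomD(1)[OF x] XN[unfolded X_def]] by (simp add: X_def)
    have "minimal_full (corner_algebra M (Ad \<Gamma>) 1) (\<rho> ?e)" using mf by (simp add: corner_algebra_def)
    then have fr: "frame 1 (\<rho> ?e) (\<psi> X)"
      unfolding frame_def using eH wH wsa ww wx one_neq_zero[where 'a = bit] by blast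
    have aw: "\<alpha> g (\<psi> X) = scale_op (sign (q g)) (\<psi> X)" if g: "g \<in> carrier G" for g
      using \<psi>\<alpha>[OF g XN] VX[OF 1 g] iso(8)[OF XN] by (simp add: X_def one)
    have "corner_cocycle G (H 0) \<alpha> (\<rho> ?e) (\<lambda>g. \<rho> (rank_one (V0 g \<xi>) \<xi>)) \<upsilon>"
    proof (rule corner_cocycle_iso[OF is_group _ \<rho> BKalg eB])
      show "corner_cocycle G (B K) (\<lambda>g. Ad (V0 g)) ?e (\<lambda>g. rank_one (V0 g \<xi>) \<xi>) \<upsilon>"
        by (rule rank_one_corner_cocycle[OF is_group K V0 \<xi>])
      show "Ad (V0 g) x \<in> B K" if "g \<in> carrier G" "x \<in> B K" for g x
        using Ad_B[OF ua0 K] that by blast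
    qed (use \<rho>\<alpha> in blast)
    then have "index_data 1 q (\<rho> ?e) (\<psi> X) (\<lambda>g. \<rho> (rank_one (V0 g \<xi>) \<xi>)) \<upsilon>"
      unfolding index_data_def using fr aw by (simp add: corner_algebra_def)
    then show ?thesis using 1 c by blast
  qed
qed

end

context graded_algebra
begin

lemma frame_1_central:
  assumes "frame 1 e w" "x \<in> M"
  shows "w (x v) = x (w v)"
proof -
  note w = frameD[OF assms(1)]
  obtain x0 x1 where x: "x0 \<in> H 0" "x1 \<in> H 1" "x = x0 + x1" using Hom_decompose[OF assms(2)] by blast
  show ?thesis using w(8)[OF x(1)] w(8)[OF x(2)]
    by (simp add: x(3) blinfun.add_left blinfun.add_right)
qed

text \<open>\<open>Ev\<close> and \<open>Od\<close> are the coordinates of \<open>M\<close> as the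
  sum of the even part and \<open>w\<close> times the even part, for an odd central
  \<open>w\<close>.\<close>

definition Ev :: "'a op \<Rightarrow> 'a op" where "Ev x = (1/2) *\<^sub>R (x + Ad \<Gamma> x)"

definition Od :: "'a op \<Rightarrow> 'a op \<Rightarrow> 'a op" where "Od w x = w o\<^sub>L ((1/2) *\<^sub>R (x - Ad \<Gamma> x))"

lemma EO_unique:
  assumes fr: "frame 1 e w" and ab: "a \<in> H 0" "b \<in> H 0"
  shows "Ev (a + (w o\<^sub>L b)) = a" "Od w (a + (w o\<^sub>L b)) = b"
proof -
  note w = frameD[OF fr]
  have wb: "w o\<^sub>L b \<in> H 1" using Hom_compose[OF w(3) ab(2)] by simp
  have th: "Ad \<Gamma> (a + (w o\<^sub>L b)) = a - (w o\<^sub>L b)"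
    using HomD(4)[OF ab(1)] HomD(4)[OF wb] by (simp add: Ad_add)
  show "Ev (a + (w o\<^sub>L b)) = a" unfolding Ev_def th by (simp flip: scaleR_2)
  show "Od w (a + (w o\<^sub>L b)) = b" unfolding Od_def th
    by (rule blinfun_eqI) (simp add: w blinfun.diff_left blinfun.add_left blinfun.scaleR_left
        blinfun.scaleR_right blinfun.add_right flip: scaleR_2)
qed

lemma EO:
  assumes fr: "frame 1 e w" and x: "x \<in> M"
  shows "Ev x \<in> H 0" "Od w x \<in> H 0" "x = Ev x + (w o\<^sub>L Od w x)"
proof -
  note w = frameD[OF fr]
  obtain x0 x1 where x: "x0 \<in> H 0" "x1 \<in> H 1" "x = x0 + x1" using Hom_decompose[OF x] by blast
  have wx1: "w o\<^sub>L x1 \<in> H 0" using Hom_compose[OF w(3) x(2)] by simp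
  have x': "x = x0 + (w o\<^sub>L (w o\<^sub>L x1))" using w(5) by (simp add: x(3) flip: compose_assoc)
  have "Ev x = x0" "Od w x = w o\<^sub>L x1" unfolding x' by (rule EO_unique[OF fr x(1) wx1])+
  then show "Ev x \<in> H 0" "Od w x \<in> H 0" "x = Ev x + (w o\<^sub>L Od w x)" using x(1) wx1 x' by auto
qed

end

context graded_system
begin

section \<open>Index data give models\<close>

text \<open>A projective representation needs a normalised cocycle. At the identity element
  \<open>v\<close> is a phase times \<open>e\<close>; a coboundary supported there removes the
  phase.\<close>

lemma index_data_normalise:
  assumes d: "index_data \<kappa> q e w v \<upsilon>"
  shows "\<exists>v' \<omega>. index_data \<kappa> q e w v' \<omega> \<and> v' \<one> = e \<and> cocycle_class G p \<omega> = cocycle_class G p \<upsilon>"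
proof -
  have fr: "frame \<kappa> e w" and c: "corner_cocycle G (N \<kappa>) \<alpha> e v \<upsilon>"
    using d by (auto simp: index_data_def)
  interpret C: algebra_action G p "N \<kappa>" \<alpha> by (rule corner_action)
  interpret corner "N \<kappa>" e by (rule frameD(12)[OF fr])
  note v = C.corner_cocycleD[OF c one_closed]
  note ve = isometry_e[OF v(1,2)]
  have "v \<one> o\<^sub>L adj (v \<one>) = e" using v(3) C.act_one[OF eD(1)] by simp
  then have ev: "e (v \<one> x) = v \<one> x" for x using ve(5) ve(3) by (metis blinfun_apply_blinfun_compose)
  obtain k where k: "e o\<^sub>L (v \<one> o\<^sub>L e) = scale_op k e" using scalar v(1) by blast
  have vk: "v \<one> = scale_op k e"
  proof (rule blinfun_eqI)
    fix x show "v \<one> x = scale_op k e x" using compose_eqD[OF k, of x] ev ve(3) by simp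
  qed
  have "scale_op (cnj k * k) e = scale_op 1 e" using v(2) eD by (simp add: vk)
  then have "cnj k * k = 1" using eD by (simp only: scale_op_cancel) simp
  then have "(cmod k)\<^sup>2 = 1" by (metis complex_norm_square mult.commute of_real_eq_1_iff)
  then have k2: "cmod k = 1" by (simp add: power2_eq_1_iff) (metis norm_ge_zero not_one_le_zero neg_0_le_iff_le)
  define b where "b g = (if g = \<one> then cnj k else 1)" for g
  define \<omega> where "\<omega> g h = \<upsilon> g h * (b g * conj_pow (p g) (b h) / b (g \<otimes> h))" for g h
  have coh: "cohomologous G p b \<upsilon> \<omega>" using k2 by (simp add: cohomologous_def \<omega>_def b_def)
  have "scale_op (b \<one>) (v \<one>) = e" using \<open>cnj k * k = 1\<close> by (simp add: b_def vk)
  then show ?thesis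
    using index_data_rescale[OF d coh] cocycle_class_cong[OF is_group coh] by blast
qed

lemma normalised_cocycle:
  assumes d: "index_data \<kappa> q e w v \<upsilon>" "v \<one> = e" and g: "g \<in> carrier G"
  shows "\<upsilon> \<one> g = 1" "\<upsilon> g \<one> = 1"
proof -
  have fr: "frame \<kappa> e w" and c: "corner_cocycle G (N \<kappa>) \<alpha> e v \<upsilon>"
    using d by (auto simp: index_data_def)
  interpret C: algebra_action G p "N \<kappa>" \<alpha> by (rule corner_action)
  interpret corner "N \<kappa>" e by (rule frameD(12)[OF fr])
  note v = C.corner_cocycleD[OF c]
  note ve = isometry_e[OF v(1)[OF g] v(2)[OF g]]
  have nz: "v g \<noteq> 0" using v(2)[OF g] eD by auto
  have "\<alpha> \<one> (v g) o\<^sub>L v \<one> = v g" using C.act_one[OF v(1)[OF g]] d(2) ve(1) by simp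
  then have "scale_op (\<upsilon> \<one> g) (v g) = scale_op 1 (v g)" using v(4)[OF one_closed g] g by simp
  then show "\<upsilon> \<one> g = 1" using nz by (simp only: scale_op_cancel) simp
  have "\<alpha> g (v \<one>) o\<^sub>L v g = v g"
    using v(3)[OF g] d(2) ve(5,3) by (intro blinfun_eqI) (simp flip: v(3)[OF g])
  then have "scale_op (\<upsilon> g \<one>) (v g) = scale_op 1 (v g)" using v(4)[OF g one_closed] g by simp
  then show "\<upsilon> g \<one> = 1" using nz by (simp only: scale_op_cancel) simp
qed

lemma frame_unit:
  assumes "frame \<kappa> e w"
  obtains u where "cyclic_rep (N \<kappa>) e u"
proof -
  interpret corner "N \<kappa>" e by (rule frameD(12)[OF assms])
  obtain u where "e u = u \<and> norm u = 1" using ex_unit by blast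
  then have "cyclic_rep (N \<kappa>) e u"
    using corner_vN by unfold_locales auto
  then show thesis by (rule that)
qed

text \<open>The implementers send \<open>x u\<close> to \<open>\<alpha> g x (v g u)\<close>, so
  composing two of them reproduces the corner cocycle relation.\<close>

lemma implementing_rep:
  assumes d: "index_data \<kappa> q e w v \<upsilon>" "v \<one> = e"
    and R: "cyclic_rep (N \<kappa>) e u"
  obtains W where "projective_rep G p (cyclic_rep.K (N \<kappa>) u) W \<upsilon>"
    "\<And>g x y. g \<in> carrier G \<Longrightarrow> x \<in> N \<kappa> \<Longrightarrow> W g (blinfun_apply x y) = \<alpha> g x (W g y)"
proof -
  have c: "corner_cocycle G (N \<kappa>) \<alpha> e v \<upsilon>"
    using d by (auto simp: index_data_def)
  let ?N = "N \<kappa>"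
  interpret C: algebra_action G p ?N \<alpha> by (rule corner_action)
  interpret R: cyclic_rep ?N e u by (rule R)
  note v = C.corner_cocycleD[OF c]
  have "\<exists>W. unitary_antiunitary (p g) R.K W \<and> (\<forall>x\<in>?N. \<forall>y. W (blinfun_apply x y) = \<alpha> g x (W y)) \<and>
      (\<forall>x\<in>?N. W (blinfun_apply x u) = \<alpha> g x (v g u))" if g: "g \<in> carrier G" for g
    using R.implement[OF C.iso[OF g] v(1-3)[OF g]] by metis
  then obtain W where ua: "\<And>g. g \<in> carrier G \<Longrightarrow> unitary_antiunitary (p g) R.K (W g)"
    and W: "\<And>g x y. g \<in> carrier G \<Longrightarrow> x \<in> ?N \<Longrightarrow> W g (blinfun_apply x y) = \<alpha> g x (W g y)"
    and Wu: "\<And>g x. g \<in> carrier G \<Longrightarrow> x \<in> ?N \<Longrightarrow> W g (blinfun_apply x u) = \<alpha> g x (v g u)" by metis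
  note WD = unitary_antiunitaryD[OF ua R.K]
  have "W g o\<^sub>L W h = scale_op (\<upsilon> g h) (W (g \<otimes> h))" if g: "g \<in> carrier G" "h \<in> carrier G" for g h
  proof (rule blinfun_eqI)
    fix y
    have gh: "g \<otimes> h \<in> carrier G" using g by simp
    have *: "W g (W h k) = \<upsilon> g h *\<^sub>C W (g \<otimes> h) k" if k: "k \<in> R.K" for k
    proof -
      obtain x where x: "x \<in> ?N" "k = x u" using k by (auto simp: R.K_def)
      have xN: "\<alpha> h x o\<^sub>L v h \<in> ?N" "\<alpha> h x \<in> ?N"
        using C.isoD(4)[OF g(2) x(1)] v(1)[OF g(2)] R.algD(4) by blast+
      have "W g (W h k) = W g ((\<alpha> h x o\<^sub>L v h) u)" using Wu[OF g(2) x(1)] x(2) by simp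
      also have "\<dots> = \<alpha> g (\<alpha> h x o\<^sub>L v h) (v g u)" by (rule Wu[OF g(1) xN(1)])
      also have "\<dots> = \<alpha> g (\<alpha> h x) (\<alpha> g (v h) (v g u))"
        using C.isoD(6)[OF g(1) xN(2) v(1)[OF g(2)]] by simp
      also have "\<alpha> g (v h) (v g u) = \<upsilon> g h *\<^sub>C v (g \<otimes> h) u" using compose_eqD[OF v(4)[OF g]] by simp
      also have "\<alpha> g (\<alpha> h x) = \<alpha> (g \<otimes> h) x" using C.act[OF g x(1)] by simp
      finally show ?thesis
        using Wu[OF gh x(1)] x(2) R.algD(1)[OF C.isoD(4)[OF gh x(1)]] by (simp add: Bounded_opsD)
    qed
    have "W g (W h (proj R.K y)) = \<upsilon> g h *\<^sub>C W (g \<otimes> h) (proj R.K y)" by (rule *[OF proj_range[OF R.K]])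
    then show "(W g o\<^sub>L W h) y = scale_op (\<upsilon> g h) (W (g \<otimes> h)) y" using WD(3)[OF g(2)] WD(3)[OF gh] by simp
  qed
  then have "projective_rep G p R.K W \<upsilon>"
    by (simp add: projective_rep_def ua C.corner_cocycle_modulus[OF R.mf c] normalised_cocycle[OF d])
  then show thesis using that W by blast
qed

text \<open>The even part acts irreducibly on \<open>R.K\<close> and is implemented by
  \<open>W\<close>; the model representation is \<open>W\<close> tensored with a power of
  \<open>sigma_y\<close>, which reproduces the sign of \<open>\<alpha> g w\<close> on
  \<open>sigma_x\<close>.\<close>

lemma index_data_imp_rel_1:
  assumes d: "index_data 1 q e w v \<upsilon>" "v \<one> = e" and q: "q \<in> extensional (carrier G)"
  shows "index_rel G p M (Ad \<Gamma>) \<alpha> (1, q, cocycle_class G p \<upsilon>)"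
proof -
  have fr: "frame 1 e w" using d by (simp add: index_data_def)
  have aw: "\<alpha> g w = scale_op (sign (q g)) w" if "g \<in> carrier G" for g
    using d that by (simp add: index_data_def)
  note w = frameD[OF fr]
  have CA: "N 1 = H 0" by (simp add: corner_algebra_def)
  obtain u where R0: "cyclic_rep (N 1) e u" using frame_unit[OF fr] by blast
  then interpret R: cyclic_rep "H 0" e u by (simp add: CA)
  obtain W where pr: "projective_rep G p R.K W \<upsilon>"
    and W: "\<And>g x y. g \<in> carrier G \<Longrightarrow> x \<in> H 0 \<Longrightarrow> W g (blinfun_apply x y) = \<alpha> g x (W g y)"
    using implementing_rep[OF d R0] unfolding CA by blast
  have ua: "unitary_antiunitary (p g) R.K (W g)" if "g \<in> carrier G" for g
    using pr that by (simp add: projective_rep_def)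
  have WW: "W g (W h y) = \<upsilon> g h *\<^sub>C W (g \<otimes> h) y" if "g \<in> carrier G" "h \<in> carrier G" for g h y
    using pr that compose_eqD[of "W g" "W h" "scale_op (\<upsilon> g h) (W (g \<otimes> h))" y]
    by (simp add: projective_rep_def)
  note WD = unitary_antiunitaryD[OF ua R.K]
  note K2 = closed_csubspace_Times[OF R.K R.K]
  note one = one_on_eq[OF R.K]
  have Q: "proj R.K = R.Q" by (simp add: R.Q_def)
  have WQ: "W g (R.Q y) = W g y" "R.Q (W g y) = W g y" if "g \<in> carrier G" for g y
    using WD(3)[OF that] proj_fix[OF R.K WD(2)[OF that]] by (simp_all add: R.Q_def)
  have Wi: "W g (\<i> *\<^sub>C y) = conj_pow (p g) \<i> *\<^sub>C W g y" if "g \<in> carrier G" for g y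
    by (rule semilinearD[OF WD(1)[OF that]])
  have qh: "Z2_hom G q" by (rule index_data_hom[OF d(1)])
  then have q_mult: "q (g \<otimes> h) = q g + q h" if "g \<in> carrier G" "h \<in> carrier G" for g h
    using that by (simp add: Z2_hom_def)
  have "p \<one> = p \<one> + p \<one>" using p_hom unfolding Z2_hom_def by (metis l_one one_closed)
  then have "q \<one> = 0" "p \<one> = 0" using q_mult[of \<one> \<one>] by simp_all
  define V where "V g = amp (W g) (if q g = 0 then mat 1 else sigma_y)" for g
  have V0: "V g (x, y) = (W g x, W g y)" if "q g = 0" for g x y using that by (simp add: V_def)
  have V1: "V g (x, y) = (- W g (\<i> *\<^sub>C y), W g (\<i> *\<^sub>C x))" if "q g = 1" for g x y
    using that by (simp add: V_def)
  have Vua: "unitary_antiunitary (p g) (R.K \<times> R.K) (V g)" if g: "g \<in> carrier G" for g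
  proof -
    note Wg = WD[OF g]
    have ciw: "cinner (W g x) (W g y) = conj_pow (p g) (cinner x y)" if "x \<in> R.K" "y \<in> R.K" for x y
      by (rule Wg(5)[OF that])
    have iK: "c *\<^sub>C x \<in> R.K \<longleftrightarrow> x \<in> R.K" if "c \<noteq> 0" for c x
    proof
      assume "c *\<^sub>C x \<in> R.K"
      then have "inverse c *\<^sub>C c *\<^sub>C x \<in> R.K" by (rule closed_csubspaceD(3)[OF R.K])
      then show "x \<in> R.K" using that by (simp add: scaleC_scaleC)
    qed (rule closed_csubspaceD(3)[OF R.K])
    have mK: "- x \<in> R.K \<longleftrightarrow> x \<in> R.K" for x using iK[of "-1" x] by simp
    consider (0) "q g = 0" | (1) "q g = 1" by (cases "q g") auto
    note cases = this
    have sl: "V g (c *\<^sub>C z) = conj_pow (p g) c *\<^sub>C V g z" for c z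
    proof (cases z)
      case (Pair x y)
      show ?thesis using cases by cases
        (simp_all add: Pair V0 V1 scaleC_prod_def semilinearD[OF Wg(1)] scaleC_scaleC mult.commute)
    qed
    have ci: "cinner (V g z) (V g z') = conj_pow (p g) (cinner z z')" if "z \<in> R.K \<times> R.K" "z' \<in> R.K \<times> R.K" for z z'
    proof -
      obtain x y x' y' where z: "z = (x, y)" "z' = (x', y')" by (cases z; cases z')
      then have in_K: "x \<in> R.K" "y \<in> R.K" "x' \<in> R.K" "y' \<in> R.K" using that by auto
      show ?thesis using cases by cases
        (simp_all add: z V0 V1 cinner_prod_def ciw iK in_K cinner_scaleC_left cinner_scaleC_right)
    qed
    have VK: "V g z \<in> R.K \<times> R.K" for z
      by (cases z; use cases in cases) (simp_all add: V0 V1 Wg(2) mK)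
    have surj: "R.K \<times> R.K \<subseteq> V g ` (R.K \<times> R.K)"
    proof clarify
      fix k l assume "k \<in> R.K" "l \<in> R.K"
      then have "k \<in> W g ` R.K" "l \<in> W g ` R.K" by (simp_all only: Wg(4))
      then obtain x y where xy: "x \<in> R.K" "y \<in> R.K" "k = W g x" "l = W g y" by blast
      show "(k, l) \<in> V g ` (R.K \<times> R.K)"
        using cases
      proof cases
        case 0
        then show ?thesis using xy by (intro image_eqI[of _ _ "(x, y)"]) (simp_all add: V0)
      next
        case 1
        then show ?thesis using xy
          by (intro image_eqI[of _ _ "(- \<i> *\<^sub>C y, \<i> *\<^sub>C x)"])
             (simp_all add: V1 scaleC_scaleC iK mK blinfun.minus_right)
      qed
    qed
    have zero: "V g z = 0" if z: "\<forall>v\<in>R.K \<times> R.K. cinner v z = 0" for z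
    proof -
      obtain x y where xy: "z = (x, y)" by (cases z)
      have 0: "0 \<in> R.K" using closed_csubspaceD(2)[OF R.K] by (rule subspace_0)
      have "cinner k x = 0" "cinner k y = 0" if "k \<in> R.K" for k
        using bspec[OF z, of "(k, 0)"] bspec[OF z, of "(0, k)"] that 0 by (simp_all add: xy cinner_prod_def)
      then have "R.Q x = 0" "R.Q y = 0" unfolding R.Q_def by (auto intro: proj_zero[OF R.K])
      then have W0: "W g x = 0" "W g y = 0" using WQ(1)[OF g, of x] WQ(1)[OF g, of y] by (simp_all add: blinfun.zero_right)
      show ?thesis using cases by cases (simp_all add: xy V0 V1 Wi[OF g] W0 zero_prod_def)
    qed
    show ?thesis unfolding unitary_antiunitary_def lives_on_def
      using sl ci VK surj zero by blast
  qed
  \<comment> \<open>\<open>sigma_y\<close> has imaginary entries and anticommutes with the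
    conjugation of the second factor; moving it past an anti-linear \<open>W h\<close> gives the
    sign. The index refers to the class of \<open>\<upsilon>\<close>, the cocycle of
    \<open>W\<close>.\<close>
  define \<omega> where "\<omega> g h = \<upsilon> g h * sign (q g * p h)" for g h
  have ii: "\<i> *\<^sub>C W g y = sign (p g) *\<^sub>C W g (\<i> *\<^sub>C y)" if "g \<in> carrier G" for g y
    by (cases "p g") (simp_all add: Wi[OF that])
  have VV: "V g o\<^sub>L V h = scale_op (\<omega> g h) (V (g \<otimes> h))" if gh: "g \<in> carrier G" "h \<in> carrier G" for g h
  proof (rule blinfun_eqI)
    fix z :: "'a \<times> 'a"
    obtain x y where z: "z = (x, y)" by (cases z)
    consider "q g = 0" "q h = 0" | "q g = 0" "q h = 1" | "q g = 1" "q h = 0" | "q g = 1" "q h = 1"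
      by (cases "q g"; cases "q h") auto
    then show "(V g o\<^sub>L V h) z = scale_op (\<omega> g h) (V (g \<otimes> h)) z"
      using q_mult[OF gh]
      by cases (simp_all add: z V0 V1 \<omega>_def WW[OF gh] ii[OF gh(2)] scaleC_prod_def scaleC_scaleC
          blinfun.minus_right semilinearD[OF WD(1)[OF gh(1)]] mult.commute)
  qed
  have "projective_rep G p (R.K \<times> R.K) V \<omega>"
    using Vua VV pr \<open>q \<one> = 0\<close> \<open>p \<one> = 0\<close> by (simp add: projective_rep_def \<omega>_def norm_mult)
  moreover have "Ad (V g) (model_grading R.K) = scale_op (sign (q g)) (model_grading R.K)"
    and "Ad (V g) (amp (one_on R.K) sigma_x) = scale_op (sign (q g)) (amp (one_on R.K) sigma_x)"
    if g: "g \<in> carrier G" for g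
  proof -
    have B: "amp R.Q m \<in> B (R.K \<times> R.K)" for m
      using amp_B[OF R.K proj_in_B[OF R.K]] by (simp add: R.Q_def)
    have B': "scale_op c (amp R.Q m) o\<^sub>L proj (R.K \<times> R.K) = scale_op c (amp R.Q m)" for c m
      using B_D(5)[OF K2 B] by simp
    consider "q g = 0" | "q g = 1" by (cases "q g") auto
    note cases = this
    show "Ad (V g) (model_grading R.K) = scale_op (sign (q g)) (model_grading R.K)"
      unfolding model_grading_def one Q
    proof (rule unitary_antiunitary_Ad[OF Vua[OF g] K2 _ B'])
      show "V g o\<^sub>L amp R.Q sigma_z = scale_op (sign (q g)) (amp R.Q sigma_z) o\<^sub>L V g"
        using cases by cases
          (auto intro!: blinfun_eqI simp: V0 V1 WQ[OF g] blinfun.minus_left blinfun.minus_right Wi[OF g] scaleC_prod_def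
            Bounded_opsD[OF R.Q(1)])
    qed
    show "Ad (V g) (amp (one_on R.K) sigma_x) = scale_op (sign (q g)) (amp (one_on R.K) sigma_x)"
      unfolding one Q
    proof (rule unitary_antiunitary_Ad[OF Vua[OF g] K2 _ B'])
      show "V g o\<^sub>L amp R.Q sigma_x = scale_op (sign (q g)) (amp R.Q sigma_x) o\<^sub>L V g"
        using cases by cases
          (auto intro!: blinfun_eqI simp: V0 V1 WQ[OF g] blinfun.minus_left blinfun.minus_right Wi[OF g] scaleC_prod_def
            Bounded_opsD[OF R.Q(1)])
    qed
  qed
  ultimately have md: "model_data G p 1 R.K V \<omega> q"
    unfolding model_data_def using R.K qh by blast
  \<comment> \<open>Even elements are compressed to the irreducible subspace and the central unitary
    \<open>w\<close> goes to \<open>sigma_x\<close>.\<close>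
  define \<phi> where "\<phi> x = amp (Ev x o\<^sub>L R.Q) (mat 1) + amp (Od w x o\<^sub>L R.Q) sigma_x" for x
  have \<phi>: "\<phi> x (k, l) = (Ev x (R.Q k) + Od w x (R.Q l), Ev x (R.Q l) + Od w x (R.Q k))" for x k l
    by (simp add: \<phi>_def blinfun.add_left)
  note comp = star_isoD[OF R.compress_iso]
  have EO_eq: "Ev y = a" "Od w y = b" if "y = a + (w o\<^sub>L b)" "a \<in> H 0" "b \<in> H 0" for y a b
    using EO_unique[OF fr that(2,3)] that(1) by auto
  have wc: "w (x v) = x (w v)" if "x \<in> M" for x v by (rule frame_1_central[OF fr that])
  have Hs: "star_algebra (H 0)" by (rule R.alg)
  note hD = star_algebraD[OF Hs]
  have QH: "R.Q (x y) = x (R.Q y)" if "x \<in> H 0" for x y by (rule R.Q_commute[OF that])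
  have iso: "star_iso 0 M (model_algebra 1 R.K) \<phi>"
    unfolding star_iso_def
  proof (intro conjI ballI allI)
    have inj: "inj_on \<phi> M"
    proof (rule inj_onI)
      fix x y assume xy: "x \<in> M" "y \<in> M" "\<phi> x = \<phi> y"
      have "\<phi> x (k, 0) = \<phi> y (k, 0)" for k using xy(3) by simp
      then have "Ev x o\<^sub>L R.Q = Ev y o\<^sub>L R.Q" "Od w x o\<^sub>L R.Q = Od w y o\<^sub>L R.Q"
        by (auto intro!: blinfun_eqI simp: \<phi> blinfun.zero_right)
      then have "Ev x = Ev y" "Od w x = Od w y"
        using inj_onD[OF comp(2)] EO(1,2)[OF fr xy(1)] EO(1,2)[OF fr xy(2)] by blast+
      then show "x = y" using EO(3)[OF fr xy(1)] EO(3)[OF fr xy(2)] by simp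
    qed
    have "\<phi> ` M = model_algebra 1 R.K"
    proof
      show "\<phi> ` M \<subseteq> model_algebra 1 R.K"
        unfolding model_algebra_1[OF R.K] using R.compress_in EO(1,2)[OF fr] by (force simp: \<phi>_def)
      show "model_algebra 1 R.K \<subseteq> \<phi> ` M"
      proof
        fix y assume "y \<in> model_algebra 1 R.K"
        then obtain a b where y: "y = amp a (mat 1) + amp b sigma_x" "a \<in> B R.K" "b \<in> B R.K"
          unfolding model_algebra_1[OF R.K] by blast
        have "a \<in> (\<lambda>x. x o\<^sub>L R.Q) ` H 0" "b \<in> (\<lambda>x. x o\<^sub>L R.Q) ` H 0"
          by (simp_all only: comp(3) y(2,3))
        then obtain a' b' where ab: "a' \<in> H 0" "b' \<in> H 0" "a = a' o\<^sub>L R.Q" "b = b' o\<^sub>L R.Q"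
          by blast
        have "a' + (w o\<^sub>L b') \<in> M"
          using HomD(1)[OF ab(1)] HomD(1)[OF ab(2)] w(10) algD(3,4) by simp
        moreover have "y = \<phi> (a' + (w o\<^sub>L b'))"
          unfolding \<phi>_def EO_unique[OF fr ab(1,2)] using y(1) ab(3,4) by simp
        ultimately show "y \<in> \<phi> ` M" by blast
      qed
    qed
    then show "bij_betw \<phi> M (model_algebra 1 R.K)" using inj by (simp add: bij_betw_def)
    fix x assume x: "x \<in> M"
    note xe = EO[OF fr x]
    note xM = HomD(1)[OF xe(1)] HomD(1)[OF xe(2)]
    have ax: "adj x = adj (Ev x) + (w o\<^sub>L adj (Od w x))"
    proof (rule blinfun_eqI)
      fix v
      have "adj x = adj (Ev x) + (adj (Od w x) o\<^sub>L w)" using arg_cong[OF xe(3), of adj] w(4) by simp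
      then show "adj x v = (adj (Ev x) + (w o\<^sub>L adj (Od w x))) v"
        using wc[OF algD(5)[OF xM(2)]] by (simp add: blinfun.add_left)
    qed
    have aeo: "Ev (adj x) = adj (Ev x)" "Od w (adj x) = adj (Od w x)"
      using EO_eq[OF ax] Hom_adj xe(1,2) by blast+
    show "\<phi> (adj x) = adj (\<phi> x)"
      unfolding \<phi>_def aeo
      using QH[OF Hom_adj[OF xe(1)]] QH[OF Hom_adj[OF xe(2)]] R.Q(2)
      by (auto intro!: blinfun_eqI simp: adj_amp blinfun.add_left)
    fix c :: complex
    have "scale_op c x = scale_op c (Ev x) + (w o\<^sub>L scale_op c (Od w x))"
      using arg_cong[OF xe(3), of "scale_op c"] w(11) by (simp add: scale_op_add_right)
    then have ceo: "Ev (scale_op c x) = scale_op c (Ev x)" "Od w (scale_op c x) = scale_op c (Od w x)"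
      using EO_eq Hom_scale xe(1,2) by blast+
    show "\<phi> (scale_op c x) = scale_op (conj_pow 0 c) (\<phi> x)"
      by (rule blinfun_eqI) (auto simp: \<phi> ceo scaleC_prod_def scaleC_add_right)
  next
    fix x y assume x: "x \<in> M" and y: "y \<in> M"
    note xe = EO[OF fr x] and ye = EO[OF fr y]
    note xM = HomD(1)[OF xe(1)] HomD(1)[OF xe(2)]
    have "x + y = (Ev x + Ev y) + (w o\<^sub>L (Od w x + Od w y))"
      by (subst xe(3), subst ye(3)) (simp add: compose_distribs)
    then have seo: "Ev (x + y) = Ev x + Ev y" "Od w (x + y) = Od w x + Od w y"
      using EO_eq Hom_add xe(1,2) ye(1,2) by blast+
    show "\<phi> (x + y) = \<phi> x + \<phi> y"
      by (rule blinfun_eqI) (auto simp: \<phi> seo blinfun.add_left)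
    have "x o\<^sub>L y = ((Ev x o\<^sub>L Ev y) + (Od w x o\<^sub>L Od w y)) + (w o\<^sub>L ((Ev x o\<^sub>L Od w y) + (Od w x o\<^sub>L Ev y)))"
    proof (rule blinfun_eqI)
      fix v
      have "(x o\<^sub>L y) v = (Ev x + (w o\<^sub>L Od w x)) ((Ev y + (w o\<^sub>L Od w y)) v)" using xe(3) ye(3) by simp
      then show "(x o\<^sub>L y) v = (((Ev x o\<^sub>L Ev y) + (Od w x o\<^sub>L Od w y)) + (w o\<^sub>L ((Ev x o\<^sub>L Od w y) + (Od w x o\<^sub>L Ev y)))) v"
        by (simp add: blinfun.add_left blinfun.add_right wc[OF xM(1), symmetric] wc[OF xM(2), symmetric] w(6))
    qed
    moreover have "(Ev x o\<^sub>L Ev y) + (Od w x o\<^sub>L Od w y) \<in> H 0"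
      "(Ev x o\<^sub>L Od w y) + (Od w x o\<^sub>L Ev y) \<in> H 0"
      by (intro hD(3,4) xe ye)+
    ultimately have meo: "Ev (x o\<^sub>L y) = (Ev x o\<^sub>L Ev y) + (Od w x o\<^sub>L Od w y)"
      "Od w (x o\<^sub>L y) = (Ev x o\<^sub>L Od w y) + (Od w x o\<^sub>L Ev y)"
      by (rule EO_eq)+
    show "\<phi> (x o\<^sub>L y) = \<phi> x o\<^sub>L \<phi> y"
      by (rule blinfun_eqI)
         (auto simp: \<phi> meo blinfun.add_left blinfun.add_right QH[OF ye(1)] QH[OF ye(2)] R.Q)
  qed
  have \<phi>\<theta>: "\<phi> (Ad \<Gamma> x) = Ad (model_grading R.K) (\<phi> x)" if x: "x \<in> M" for x
  proof -
    note xe = EO[OF fr x]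
    have wO: "w o\<^sub>L Od w x \<in> H 1" using Hom_compose[OF w(3) xe(2)] by simp
    have "Ad \<Gamma> x = Ad \<Gamma> (Ev x + (w o\<^sub>L Od w x))" using xe(3) by simp
    also have "\<dots> = Ev x + (w o\<^sub>L (- Od w x))"
      using HomD(4)[OF xe(1)] HomD(4)[OF wO] by (simp add: Ad_add)
    finally have t: "Ad \<Gamma> x = Ev x + (w o\<^sub>L (- Od w x))" .
    have "- Od w x \<in> H 0" using Hom_scale[OF xe(2), of "- 1"] by simp
    note teo = EO_eq[OF t xe(1) this]
    have "adj (model_grading R.K) = model_grading R.K"
      using R.Q(2) by (simp add: model_grading_def one Q adj_amp)
    then show ?thesis
      by (intro blinfun_eqI)
         (auto simp: \<phi> teo blinfun.minus_left model_grading_def one Q blinfun.minus_right blinfun.add_right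
           blinfun.diff_right QH[OF xe(1)] QH[OF xe(2)] R.Q)
  qed
  have \<phi>\<alpha>: "\<phi> (\<alpha> g x) = Ad (V g) (\<phi> x)" if g: "g \<in> carrier G" and x: "x \<in> M" for g x
  proof -
    note xe = EO[OF fr x]
    note xM = HomD(1)[OF xe(1)] HomD(1)[OF xe(2)]
    have aH: "\<alpha> g (Ev x) \<in> H 0" "\<alpha> g (Od w x) \<in> H 0" using Hom_act[OF g] xe by blast+
    have "\<alpha> g x = \<alpha> g (Ev x + (w o\<^sub>L Od w x))" using xe(3) by simp
    also have "\<dots> = \<alpha> g (Ev x) + (w o\<^sub>L scale_op (sign (q g)) (\<alpha> g (Od w x)))"
      using act.isoD(5)[OF g xM(1) algD(4)[OF w(10) xM(2)]] act.isoD(6)[OF g w(10) xM(2)] aw[OF g] w(11)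
      by simp
    finally have "\<alpha> g x = \<alpha> g (Ev x) + (w o\<^sub>L scale_op (sign (q g)) (\<alpha> g (Od w x)))" .
    note aeo = EO_eq[OF this aH(1) Hom_scale[OF aH(2)]]
    have WH: "\<alpha> g (Ev x) (W g y) = W g (Ev x y)" "\<alpha> g (Od w x) (W g y) = W g (Od w x y)" for y
      using W[OF g xe(1)] W[OF g xe(2)] by simp_all
    have Bd: "Ev x (\<i> *\<^sub>C y) = \<i> *\<^sub>C Ev x y" "Od w x (\<i> *\<^sub>C y) = \<i> *\<^sub>C Od w x y" for y
      using HomD(2)[OF xe(1)] HomD(2)[OF xe(2)] by (simp_all add: Bounded_opsD)
    consider "q g = 0" | "q g = 1" by (cases "q g") auto
    then have "V g o\<^sub>L \<phi> x = \<phi> (\<alpha> g x) o\<^sub>L V g"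
    proof cases
      case 1
      then show ?thesis
        by (auto intro!: blinfun_eqI simp: \<phi> aeo V0 WQ[OF g] WH blinfun.add_right
            simp flip: QH[OF xe(1)] QH[OF xe(2)])
    next
      case 2
      then show ?thesis
        by (auto intro!: blinfun_eqI simp: \<phi> aeo V1 WQ[OF g] WH blinfun.add_right blinfun.minus_left
            blinfun.minus_right scaleC_add_right Bd Wi[OF g]
            Bounded_opsD[OF R.Q(1)] Bounded_opsD[OF HomD(2)[OF aH(1)]] Bounded_opsD[OF HomD(2)[OF aH(2)]]
            simp flip: QH[OF xe(1)] QH[OF xe(2)])
    qed
    moreover have "\<phi> (\<alpha> g x) \<in> B (R.K \<times> R.K)"
    proof -
      have "\<alpha> g x \<in> M" by (rule act.isoD(4)[OF g x])
      then have "\<phi> (\<alpha> g x) = amp (Ev (\<alpha> g x) o\<^sub>L R.Q) (mat 1) + amp (Od w (\<alpha> g x) o\<^sub>L R.Q) sigma_x"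
        "Ev (\<alpha> g x) o\<^sub>L R.Q \<in> B R.K" "Od w (\<alpha> g x) o\<^sub>L R.Q \<in> B R.K"
        using EO(1,2)[OF fr] R.compress_in by (auto simp: \<phi>_def)
      then show ?thesis using amp_B[OF R.K] star_algebraD(3)[OF B_star_algebra[OF K2]] by simp
    qed
    ultimately show ?thesis
      using unitary_antiunitary_Ad[OF Vua[OF g] K2] B_D(5)[OF K2] by simp
  qed
  have eq: "equivalent_systems G M (Ad \<Gamma>) \<alpha> (model_algebra 1 R.K) (Ad (model_grading R.K)) (\<lambda>g. Ad (V g))"
    unfolding equivalent_systems_def using iso \<phi>\<theta> \<phi>\<alpha> by blast
  have "\<exists>V0. projective_rep G p R.K V0 \<upsilon> \<and>
      (\<forall>g\<in>carrier G. V g = amp (V0 g) (if q g = 0 then mat 1 else sigma_y))"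
    using pr V_def by blast
  then have "if (1::bit) = 0 then \<upsilon> = \<omega> else (\<exists>V0. projective_rep G p R.K V0 \<upsilon> \<and>
      (\<forall>g\<in>carrier G. V g = amp (V0 g) (if q g = 0 then mat 1 else sigma_y)))"
    by (simp only: one_neq_zero if_False)
  then show ?thesis
    unfolding index_rel_def prod.case using q md eq by blast
qed

text \<open>The irreducible space of \<open>M\<close> must be split as two copies of one space; the
  odd self-adjoint unitary from balancedness identifies the two eigenspaces of
  \<open>w\<close>.\<close>

lemma index_data_imp_rel_0:
  assumes d: "index_data 0 q e w v \<upsilon>" "v \<one> = e" and q: "q \<in> extensional (carrier G)"
    and bal: "balanced M (Ad \<Gamma>)"
  shows "index_rel G p M (Ad \<Gamma>) \<alpha> (0, q, cocycle_class G p \<upsilon>)"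
proof -
  have fr: "frame 0 e w" using d by (simp add: index_data_def)
  have aw: "\<alpha> g w = scale_op (sign (q g)) w" if "g \<in> carrier G" for g
    using d that by (simp add: index_data_def)
  note w = frameD[OF fr]
  have CA: "N 0 = M" by (simp add: corner_algebra_def)
  obtain u where R0: "cyclic_rep (N 0) e u" using frame_unit[OF fr] by blast
  then interpret R: cyclic_rep M e u by (simp add: CA)
  obtain W where pr: "projective_rep G p R.K W \<upsilon>"
    and W: "\<And>g x y. g \<in> carrier G \<Longrightarrow> x \<in> M \<Longrightarrow> W g (blinfun_apply x y) = \<alpha> g x (W g y)"
    using implementing_rep[OF d R0] unfolding CA by blast
  have ua: "unitary_antiunitary (p g) R.K (W g)" if "g \<in> carrier G" for g
    using pr that by (simp add: projective_rep_def)
  have WW: "W g (W h y) = \<upsilon> g h *\<^sub>C W (g \<otimes> h) y" if "g \<in> carrier G" "h \<in> carrier G" for g h y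
    using pr that compose_eqD[of "W g" "W h" "scale_op (\<upsilon> g h) (W (g \<otimes> h))" y]
    by (simp add: projective_rep_def)
  note WD = unitary_antiunitaryD[OF ua R.K]
  have WQ: "W g (R.Q y) = W g y" "R.Q (W g y) = W g y" if "g \<in> carrier G" for g y
    using WD(3)[OF that] proj_fix[OF R.K WD(2)[OF that]] by (simp_all add: R.Q_def)
  obtain U where U: "U \<in> H 1" "sa_unitary U" using bal by (auto simp: balanced_def)
  note UD = sa_unitaryD[OF U(2)] and UM = HomD(1)[OF U(1)]
  have wU: "w (U v) = - U (w v)" for v using w(8)[OF U(1)] by simp
  note QU = R.Q_commute[OF UM]
  \<comment> \<open>The eigenspace of \<open>w\<close> for 1. \<open>U\<close> anticommutes with
    \<open>w\<close> and exchanges it with the eigenspace for -1, so that \<open>w\<close> becomes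
    \<open>sigma_z\<close>.\<close>
  define K where "K = {k \<in> R.K. w k = k}"
  have K: "closed_csubspace K"
  proof -
    have "K = R.K \<inter> {k. w k = id_blinfun k}" by (auto simp: K_def)
    then show ?thesis
      using closed_csubspaceD[OF R.K] closed_csubspaceD[OF closed_csubspace_Collect[OF w(11), of id_blinfun]]
      by (intro closed_csubspaceI) (auto intro: closed_Int subspace_inter simp del: id_blinfun.rep_eq)
  qed
  note K2 = closed_csubspace_Times[OF K K]
  define P where "P = proj K"
  have P: "P v = (1/2) *\<^sub>R (R.Q v + w (R.Q v))" for v
    unfolding P_def
  proof (rule proj_unique[OF closed_csubspaceD(1,2)[OF K]])
    have "(1/2) *\<^sub>R (R.Q v + w (R.Q v)) \<in> R.K"
      using R.Q(4) R.K_inv[OF w(10)] closed_csubspaceD(2)[OF R.K] by (simp add: subspace_add subspace_scale)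
    then show "(1/2) *\<^sub>R (R.Q v + w (R.Q v)) \<in> K"
      by (simp add: K_def blinfun.scaleR_right blinfun.add_right w(6) add.commute)
    fix z assume "z \<in> K"
    then have z: "R.Q z = z" "w z = z" by (auto simp: K_def R.Q)
    have "R.Q v \<bullet> z = v \<bullet> z" using inner_adj[of R.Q v z] R.Q(2) z by simp
    moreover have "w (R.Q v) \<bullet> z = v \<bullet> z"
      using inner_adj[of w "R.Q v" z] w(4) z inner_adj[of R.Q v z] R.Q(2) by simp
    ultimately show "(v - (1/2) *\<^sub>R (R.Q v + w (R.Q v))) \<bullet> z = 0"
      by (simp add: inner_diff_left inner_add_left)
  qed
  note pP = projection_opD[OF projection_proj[OF K], folded P_def]
  have PK: "P v \<in> K" for v unfolding P_def by (rule proj_range[OF K])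
  have wP: "w (P v) = P v" for v using PK[of v] by (simp add: K_def)
  have QP: "R.Q (P v) = P v" for v using PK[of v] by (simp add: K_def R.Q)
  have PQ: "P (R.Q v) = P v" for v by (simp add: P R.Q)
  have PUP: "P (U (P v)) = 0" for v
    using QP[of v] wP[of v] by (simp add: P[of "U (P v)"] QU wU)
  have "U (P (U v)) = (1/2) *\<^sub>R (R.Q v - w (R.Q v))" for v
    by (simp add: P QU wU blinfun.scaleR_right blinfun.diff_right UD)
  then have PUPU: "P v + U (P (U v)) = R.Q v" for v
    by (simp add: P flip: scaleR_add_right)
  \<comment> \<open>\<open>j\<close> and the operator \<open>j'\<close> below are adjoint to each
    other and inverse between \<open>K \<times> K\<close> and \<open>R.K\<close>; all structure is
    transported along them.\<close>
  define j where "j = Blinfun (\<lambda>z. P (fst z) + U (P (snd z)))"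
  have j: "j (k, l) = P k + U (P l)" for k l
  proof -
    have "bounded_linear (\<lambda>z. P (fst z) + U (P (snd z)))"
      by (intro bounded_linear_add bounded_linear_compose[OF blinfun.bounded_linear_right]
          bounded_linear_fst bounded_linear_snd)
    then show ?thesis by (simp add: j_def bounded_linear_Blinfun_apply)
  qed
  define j' where "j' = Blinfun (\<lambda>v. (P v, P (U v)))"
  have j': "j' v = (P v, P (U v))" for v
  proof -
    have "bounded_linear (\<lambda>v. (P v, P (U v)))"
      by (intro bounded_linear_Pair blinfun.bounded_linear_right
          bounded_linear_compose[OF blinfun.bounded_linear_right blinfun.bounded_linear_right])
    then show ?thesis by (simp add: j'_def bounded_linear_Blinfun_apply)
  qed
  have j'j: "j' (j z) = proj (K \<times> K) z" for z
    by (cases z) (simp add: j j' proj_Times[OF K K] P_def[symmetric] blinfun.add_right PUP UD pP blinfun.zero_right)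
  have jj': "j (j' v) = R.Q v" for v by (simp add: j j' pP PUPU)
  have jK: "j z \<in> R.K" for z
  proof (cases z)
    case (Pair k l)
    have "P k \<in> R.K" "U (P l) \<in> R.K" using PK R.K_inv[OF UM] by (auto simp: K_def)
    then show ?thesis using closed_csubspaceD(2)[OF R.K] by (simp add: Pair j subspace_add)
  qed
  have Qj: "R.Q (j z) = j z" for z by (rule R.Q(5)[OF jK])
  have j'K: "j' v \<in> K \<times> K" for v by (simp add: j' PK)
  have j'Q: "j' (R.Q v) = j' v" for v by (simp add: j' PQ flip: QU)
  have jp: "j (proj (K \<times> K) z) = j z" for z
    by (cases z) (simp add: j proj_Times[OF K K] P_def[symmetric] pP)
  have cj: "cinner (j z) v = cinner z (j' v)" for z v
    using cinner_adj[OF pP(1)] cinner_adj[OF UD(1)] pP(2) UD(2)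
    by (cases z) (simp add: j j' cinner_prod_def cinner_add_left)
  have slj: "semilinear 0 j" "semilinear 0 j'"
    using pP(1) UD(1) by (auto simp: semilinear_def j j' scaleC_prod_def Bounded_opsD scaleC_add_right)
  have ij: "j z \<bullet> v = z \<bullet> j' v" for z v using cj[of z v] by (metis Re_cinner)
  have adjS: "adj (j' o\<^sub>L (x o\<^sub>L j)) = j' o\<^sub>L (adj x o\<^sub>L j)" for x
    by (rule adj_eqI) (metis blinfun_apply_blinfun_compose ij inner_adj inner_commute)
  define \<phi> where "\<phi> x = j' o\<^sub>L (x o\<^sub>L j)" for x :: "'a op"
  have \<phi>: "\<phi> x z = j' (x (j z))" for x z by (simp add: \<phi>_def)
  have \<phi>B: "\<phi> x \<in> B (K \<times> K)" if "x \<in> M" for x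
  proof (rule B_I[OF K2])
    show "\<phi> x \<in> Bounded_ops"
      using algD(1)[OF that] slj by (auto simp: Bounded_ops_def semilinear_def \<phi>)
  qed (simp_all add: \<phi> j'K jp)
  have \<phi>mult: "\<phi> (x o\<^sub>L y) = \<phi> x o\<^sub>L \<phi> y" if "y \<in> M" for x y
    by (rule blinfun_eqI) (simp add: \<phi> jj' R.Q_commute[OF that] Qj)
  have iso: "star_iso 0 M (model_algebra 0 K) \<phi>"
    unfolding star_iso_def model_algebra_0[OF K]
  proof (intro conjI ballI allI)
    have recover: "j (\<phi> x (j' v)) = x (R.Q v)" if "x \<in> M" for x v
      by (simp add: \<phi> jj' R.Q_commute[OF that] R.Q)
    have inj: "inj_on \<phi> M"
    proof (rule inj_onI)
      fix x y assume xy: "x \<in> M" "y \<in> M" "\<phi> x = \<phi> y"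
      have "x (R.Q v) = y (R.Q v)" for v using recover[OF xy(1), of v] recover[OF xy(2), of v] xy(3) by simp
      then have "x o\<^sub>L R.Q = y o\<^sub>L R.Q" by (intro blinfun_eqI) simp
      then show "x = y" using inj_onD[OF star_isoD(2)[OF R.compress_iso] _ xy(1,2)] by blast
    qed
    have "\<phi> ` M = B (K \<times> K)"
    proof
      show "\<phi> ` M \<subseteq> B (K \<times> K)" using \<phi>B by blast
      show "B (K \<times> K) \<subseteq> \<phi> ` M"
      proof
        fix X assume X: "X \<in> B (K \<times> K)"
        note XD = B_D[OF K2 X]
        have "j o\<^sub>L (X o\<^sub>L j') \<in> B R.K"
        proof (rule B_I[OF R.K])
          show "j o\<^sub>L (X o\<^sub>L j') \<in> Bounded_ops"
            by (simp add: Bounded_ops_def semilinearD[OF slj(1)] semilinearD[OF slj(2)] Bounded_opsD[OF XD(1)])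
        qed (simp_all add: jK j'Q flip: R.Q_def)
        then obtain x where x: "x \<in> M" "\<And>v. x (R.Q v) = (j o\<^sub>L (X o\<^sub>L j')) v" using R.compress_surj by blast
        have "\<phi> x = X"
        proof (rule blinfun_eqI)
          fix z
          have "\<phi> x z = j' (x (R.Q (j z)))" by (simp add: \<phi> Qj)
          then show "\<phi> x z = X z" by (simp add: x(2) j'j XD)
        qed
        then show "X \<in> \<phi> ` M" using x(1) by blast
      qed
    qed
    then show "bij_betw \<phi> M (B (K \<times> K))" using inj by (simp add: bij_betw_def)
    fix x assume x: "x \<in> M"
    show "\<phi> (adj x) = adj (\<phi> x)" by (simp only: \<phi>_def adjS)
    show "\<phi> (scale_op c x) = scale_op (conj_pow 0 c) (\<phi> x)" for c
      by (rule blinfun_eqI) (simp add: \<phi> semilinearD[OF slj(2)])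
  next
    fix x y assume "x \<in> M" "y \<in> M"
    then show "\<phi> (x o\<^sub>L y) = \<phi> x o\<^sub>L \<phi> y" by (intro \<phi>mult)
    show "\<phi> (x + y) = \<phi> x + \<phi> y"
      by (rule blinfun_eqI) (simp add: \<phi> blinfun.add_left blinfun.add_right)
  qed
  have Z: "model_grading K = \<phi> w"
  proof (rule blinfun_eqI)
    fix z :: "'a \<times> 'a"
    show "model_grading K z = \<phi> w z"
      by (cases z) (simp add: model_grading_def one_on_eq[OF K] P_def[symmetric] \<phi> j j' blinfun.add_right
          wU wP PUP pP UD blinfun.minus_right blinfun.diff_right blinfun.zero_right)
  qed
  define V where "V g = j' o\<^sub>L (W g o\<^sub>L j)" for g
  have V: "V g z = j' (W g (j z))" for g z by (simp add: V_def)
  have Vua: "unitary_antiunitary (p g) (K \<times> K) (V g)" if g: "g \<in> carrier G" for g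
  proof -
    have "K \<times> K \<subseteq> V g ` (K \<times> K)"
    proof
      fix z assume z: "z \<in> K \<times> K"
      have "j z \<in> W g ` R.K" using jK[of z] by (simp only: WD(4)[OF g])
      then obtain m where m: "m \<in> R.K" "j z = W g m" by blast
      have "V g (j' m) = j' (j z)" using m by (simp add: V jj' R.Q)
      also have "\<dots> = z" unfolding j'j by (rule proj_fix[OF K2 z])
      finally show "z \<in> V g ` (K \<times> K)" using j'K[of m] by (metis imageI)
    qed
    moreover have "cinner (V g y) (V g z) = conj_pow (p g) (cinner y z)" if yz: "y \<in> K \<times> K" "z \<in> K \<times> K" for y z
    proof -
      have "cinner (V g y) (V g z) = cinner (j (j' (W g (j y)))) (W g (j z))" unfolding V cj ..
      also have "\<dots> = cinner (W g (j y)) (W g (j z))" by (simp add: jj' WQ[OF g])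
      also have "\<dots> = conj_pow (p g) (cinner (j y) (j z))" by (rule WD(5)[OF g jK jK])
      also have "cinner (j y) (j z) = cinner y z" unfolding cj j'j using proj_fix[OF K2 yz(2)] by simp
      finally show ?thesis .
    qed
    moreover have "V g z = 0" if z: "\<forall>v\<in>K \<times> K. cinner v z = 0" for z
    proof -
      have "proj (K \<times> K) z = 0" using z by (intro proj_zero[OF K2]) blast
      then have "j z = 0" using jp[of z] by (simp add: blinfun.zero_right)
      then show ?thesis by (simp add: V blinfun.zero_right)
    qed
    moreover have "V g (c *\<^sub>C z) = conj_pow (p g) c *\<^sub>C V g z" for c z
      by (simp add: V semilinearD[OF slj(1)] semilinearD[OF slj(2)] semilinearD[OF WD(1)[OF g]])
    moreover have "V g z \<in> K \<times> K" for z by (simp only: V j'K)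
    ultimately show ?thesis unfolding unitary_antiunitary_def lives_on_def by blast
  qed
  have "V g o\<^sub>L V h = scale_op (\<upsilon> g h) (V (g \<otimes> h))" if "g \<in> carrier G" "h \<in> carrier G" for g h
    by (rule blinfun_eqI) (simp add: V jj' WQ[OF that(2)] WW[OF that] semilinearD[OF slj(2)])
  then have pr2: "projective_rep G p (K \<times> K) V \<upsilon>"
    using Vua pr by (simp add: projective_rep_def)
  have \<phi>\<alpha>: "\<phi> (\<alpha> g x) = Ad (V g) (\<phi> x)" if g: "g \<in> carrier G" and x: "x \<in> M" for g x
  proof -
    have ax: "\<alpha> g x \<in> M" by (rule act.isoD(4)[OF g x])
    have "V g o\<^sub>L \<phi> x = \<phi> (\<alpha> g x) o\<^sub>L V g"
      by (rule blinfun_eqI) (simp add: V \<phi> jj' WQ[OF g] W[OF g x])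
    then show ?thesis using unitary_antiunitary_Ad[OF Vua[OF g] K2 _ B_D(5)[OF K2 \<phi>B[OF ax]]] by simp
  qed
  have VZ: "Ad (V g) (model_grading K) = scale_op (sign (q g)) (model_grading K)" if g: "g \<in> carrier G" for g
    using \<phi>\<alpha>[OF g w(10)] aw[OF g] star_isoD(8)[OF iso w(10)] by (simp add: Z)
  have \<phi>\<theta>: "\<phi> (Ad \<Gamma> x) = Ad (model_grading K) (\<phi> x)" if x: "x \<in> M" for x
  proof -
    have "Ad \<Gamma> x = Ad \<Gamma> x o\<^sub>L (w o\<^sub>L w)" by (simp add: w(5))
    also have "\<dots> = w o\<^sub>L (x o\<^sub>L w)" using frame_0_theta(1)[OF fr x] by (simp flip: compose_assoc)
    finally have "\<phi> (Ad \<Gamma> x) = \<phi> w o\<^sub>L (\<phi> x o\<^sub>L \<phi> w)"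
      using \<phi>mult[OF algD(4)[OF x w(10)]] \<phi>mult[OF w(10)] by simp
    moreover have "adj (\<phi> w) = \<phi> w" by (simp only: \<phi>_def adjS w(4))
    ultimately show ?thesis by (simp add: Z Ad_def compose_assoc)
  qed
  have md: "model_data G p 0 K V \<upsilon> q"
    unfolding model_data_def using K pr2 VZ index_data_hom[OF d(1)] zero_neq_one[where 'a = bit] by blast
  have eq: "equivalent_systems G M (Ad \<Gamma>) \<alpha> (model_algebra 0 K) (Ad (model_grading K)) (\<lambda>g. Ad (V g))"
    unfolding equivalent_systems_def using iso \<phi>\<theta> \<phi>\<alpha> by blast
  have "if (0::bit) = 0 then \<upsilon> = \<upsilon> else (\<exists>V0. projective_rep G p K V0 \<upsilon> \<and>
      (\<forall>g\<in>carrier G. V g = amp (V0 g) (if q g = 0 then mat 1 else sigma_y)))"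
    by (simp only: if_True simp_thms)
  then show ?thesis
    unfolding index_rel_def prod.case using q md eq by blast
qed

text \<open>Normalised data build one model; any other model gives data again, and
  \<open>index_data_unique\<close> compares the two. Extensionality turns agreement of the
  homomorphisms on the carrier into equality.\<close>

theorem Ind_eq:
  assumes d: "index_data \<kappa> q e w v \<upsilon>" and q: "q \<in> extensional (carrier G)" and bal: "balanced M (Ad \<Gamma>)"
  shows "Ind G p M (Ad \<Gamma>) \<alpha> = (\<kappa>, q, cocycle_class G p \<upsilon>)"
  unfolding Ind_def
proof (rule the_equality)
  obtain v' \<omega> where d': "index_data \<kappa> q e w v' \<omega>" "v' \<one> = e" "cocycle_class G p \<omega> = cocycle_class G p \<upsilon>"
    using index_data_normalise[OF d] by blast
  have "index_rel G p M (Ad \<Gamma>) \<alpha> (\<kappa>, q, cocycle_class G p \<omega>)"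
  proof (cases "\<kappa> = 0")
    case True
    then show ?thesis using index_data_imp_rel_0[of q e w v' \<omega>] d' q bal by blast
  next
    case False
    then have "\<kappa> = 1" by simp
    then show ?thesis using index_data_imp_rel_1[of q e w v' \<omega>] d' q by blast
  qed
  then show "index_rel G p M (Ad \<Gamma>) \<alpha> (\<kappa>, q, cocycle_class G p \<upsilon>)" by (simp only: d'(3))
  fix i assume i: "index_rel G p M (Ad \<Gamma>) \<alpha> i"
  obtain \<kappa>' q' c where ieq: "i = (\<kappa>', q', c)" by (cases i)
  obtain e' w' v'' \<upsilon>' where d2: "index_data \<kappa>' q' e' w' v'' \<upsilon>'" "c = cocycle_class G p \<upsilon>'"
    using index_rel_imp_data(2)[OF i[unfolded ieq]] by blast
  have q': "q' \<in> extensional (carrier G)" by (rule index_rel_imp_data(1)[OF i[unfolded ieq]])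
  note un = index_data_unique[OF d d2(1)]
  have "q = q'" using un(2) by (rule extensionalityI[OF q q'])
  moreover obtain b where "cohomologous G p b \<upsilon> \<upsilon>'" using un(3) by blast
  ultimately show "i = (\<kappa>, q, cocycle_class G p \<upsilon>)"
    using un(1) d2(2) cocycle_class_cong[OF is_group] by (auto simp: ieq)
qed

end

section \<open>Implementing the action by unitaries and anti-unitaries\<close>

context graded_algebra
begin

lemma frame_e:
  assumes "frame \<kappa> e w"
  shows "e (e v) = e v" "adj e = e" "e \<in> Bounded_ops" "\<Gamma> (e v) = e (\<Gamma> v)" "w (e v) = e (w v)" "e \<in> M"
    "cinner (e a) b = cinner a (e b)" "e \<in> N \<kappa>"
proof -
  interpret corner "N \<kappa>" e by (rule frameD(12)[OF assms])
  show "e (e v) = e v" "adj e = e" "e \<in> Bounded_ops" "e \<in> N \<kappa>" by (rule eD)+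
  show "\<Gamma> (e v) = e (\<Gamma> v)" using HomD(3)[OF frameD(2)[OF assms]] by simp
  show "w (e v) = e (w v)" using frameD(8)[OF assms frameD(2)[OF assms]] by simp
  show "e \<in> M" by (rule HomD(1)[OF frameD(2)[OF assms]])
  show "cinner (e a) b = cinner a (e b)" using cinner_adj[OF eD(2)] eD(3) by simp
qed

lemma frame_dense:
  assumes "frame \<kappa> e w"
  shows "clspan {blinfun_apply a (e v) | a v. a \<in> N \<kappa>} = UNIV"
  by (rule cyclic_dense[OF corner_vN frameD(1)[OF assms]])

text \<open>A conjugation is chosen on each eigenspace of \<open>\<Gamma>\<close> inside the range
  of \<open>e\<close>; their sum commutes with \<open>\<Gamma>\<close>, whose eigenvalues are
  real.\<close>

lemma frame_conjugation:
  assumes fr: "frame \<kappa> e w"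
  obtains J where "semilinear 1 J" "\<And>v. J (e v) \<in> range e" "\<And>v. J (J (e v)) = e v"
    "\<And>u v. cinner (J (e u)) (J (e v)) = cnj (cinner (e u) (e v))"
    "\<And>v. J (\<Gamma> (e v)) = \<Gamma> (J (e v))" "\<And>v. \<kappa> = 1 \<Longrightarrow> J (w (e v)) = w (J (e v))"
proof -
  note w = frameD[OF fr] and e = frame_e[OF fr]
  \<comment> \<open>Projection onto the eigenspace of \<open>\<Gamma>\<close> for
    \<open>sign s\<close> inside the range of \<open>e\<close>.\<close>
  define P where "P s = (1/2) *\<^sub>R (e + scale_op (sign s) (e o\<^sub>L \<Gamma>))" for s
  have P: "P s v = (1/2) *\<^sub>R (e v + sign s *\<^sub>C e (\<Gamma> v))" for s v
    by (simp add: P_def blinfun.scaleR_left blinfun.add_left)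
  have PB: "P s \<in> Bounded_ops" for s using e(3) \<Gamma>D(1) by (simp add: P_def)
  have \<Gamma>P: "\<Gamma> (P s v) = sign s *\<^sub>C P s v" for s v
    by (simp add: P blinfun.scaleR_right blinfun.add_right e(4) \<Gamma>D Bounded_opsD[OF \<Gamma>D(1)]
        scaleR_scaleC_commute scaleC_add_right scaleC_scaleC add.commute)
  have eP: "e (P s v) = P s v" for s v
    by (simp add: P blinfun.scaleR_right blinfun.add_right e Bounded_opsD[OF e(3)])
  have P_fix: "P s v = v" if "e v = v" "\<Gamma> v = sign s *\<^sub>C v" for s v
    using that by (simp add: P Bounded_opsD[OF e(3)] scaleC_scaleC)
  have P_zero: "P s v = 0" if "e v = v" "\<Gamma> v = sign (s + 1) *\<^sub>C v" for s v
    using that by (simp add: P Bounded_opsD[OF e(3)] scaleC_scaleC sign_add blinfun.minus_right)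
  have Psum: "P 0 v + P 1 v = e v" for v
    by (simp add: P flip: scaleR_add_right)
  define L where "L s = {v. P s v = v}" for s
  have L: "closed_csubspace (L s)" for s
    using closed_csubspace_Collect[OF PB[of s] Bounded_ops_intros(1)] by (simp add: L_def)
  have LD: "e v = v" "\<Gamma> v = sign s *\<^sub>C v" if "v \<in> L s" for v s
    using eP[of s v] \<Gamma>P[of s v] that by (simp_all add: L_def)
  have LI: "v \<in> L s" if "e v = v" "\<Gamma> v = sign s *\<^sub>C v" for v s using P_fix[OF that] by (simp add: L_def)
  have PL: "P s v \<in> L s" for s v by (rule LI[OF eP \<Gamma>P])
  obtain C0 :: "'a op" where C0: "semilinear 1 C0" "\<And>x. x \<in> L 0 \<Longrightarrow> C0 x \<in> L 0" "\<And>x. x \<in> L 0 \<Longrightarrow> C0 (C0 x) = x"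
    "\<And>x y. x \<in> L 0 \<Longrightarrow> y \<in> L 0 \<Longrightarrow> cinner (C0 x) (C0 y) = cnj (cinner x y)"
    using conjugation_exists[OF L[of 0]] by blast
  \<comment> \<open>For \<open>\<kappa> = 1\<close> the odd \<open>w\<close> exchanges the
    eigenspaces, and transporting \<open>C0\<close> by \<open>w\<close> makes the sum commute with
    \<open>w\<close>. For \<open>\<kappa> = 0\<close> the second conjugation is chosen
    independently.\<close>
  have "\<exists>C1 :: 'a op. semilinear 1 C1 \<and> (\<forall>x\<in>L 1. C1 x \<in> L 1 \<and> C1 (C1 x) = x) \<and>
    (\<forall>x\<in>L 1. \<forall>y\<in>L 1. cinner (C1 x) (C1 y) = cnj (cinner x y)) \<and> (\<kappa> = 1 \<longrightarrow> (\<forall>x. C1 x = w (C0 (w x))))"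
  proof (cases "\<kappa> = 0")
    case True
    then show ?thesis using conjugation_exists[OF L[of 1]] by (metis zero_neq_one)
  next
    case False
    then have \<kappa>: "\<kappa> = 1" by simp
    have w\<Gamma>: "\<Gamma> (w v) = - w (\<Gamma> v)" for v using HomD(3)[OF w(3)] \<kappa> by simp
    have wL: "w x \<in> L (s + 1)" if "x \<in> L s" for x s
      using LD[OF that] w(11) by (intro LI) (simp_all add: w\<Gamma> Bounded_opsD sign_add flip: e(5))
    have wL0: "w x \<in> L 0" if "x \<in> L 1" for x using wL[OF that] by simp
    have wL1: "w x \<in> L 1" if "x \<in> L 0" for x using wL[OF that] by simp
    have wc: "cinner (w x) (w y) = cinner x y" for x y using cinner_adj[OF w(11)] w(4,6) by simp
    have "semilinear 1 (w o\<^sub>L (C0 o\<^sub>L w))"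
      using semilinearD[OF C0(1)] w(11) by (simp add: semilinear_def Bounded_opsD)
    then show ?thesis
      using C0 by (intro exI[of _ "w o\<^sub>L (C0 o\<^sub>L w)"]) (simp add: wL0 wL1 w(6) wc)
  qed
  then obtain C1 :: "'a op" where C1: "semilinear 1 C1" "\<And>x. x \<in> L 1 \<Longrightarrow> C1 x \<in> L 1" "\<And>x. x \<in> L 1 \<Longrightarrow> C1 (C1 x) = x"
    "\<And>x y. x \<in> L 1 \<Longrightarrow> y \<in> L 1 \<Longrightarrow> cinner (C1 x) (C1 y) = cnj (cinner x y)"
    "\<And>x. \<kappa> = 1 \<Longrightarrow> C1 x = w (C0 (w x))" by blast
  define J where "J = (C0 o\<^sub>L P 0) + (C1 o\<^sub>L P 1)"
  have J: "J v = C0 (P 0 v) + C1 (P 1 v)" for v by (simp add: J_def blinfun.add_left)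
  have orth: "cinner a b = 0" "cinner b a = 0" if "a \<in> L 0" "b \<in> L 1" for a b
  proof -
    have "cinner (\<Gamma> a) b = cinner a (\<Gamma> b)" using cinner_adj[OF \<Gamma>D(1)] \<Gamma>D(2) by simp
    then have "cinner a b = - cinner a b" using LD(2)[OF that(1)] LD(2)[OF that(2)] by simp
    then show "cinner a b = 0" by simp
    then show "cinner b a = 0" by (simp only: cinner_eq_0_commute)
  qed
  have J_sum: "J (a + b) = C0 a + C1 b" if ab: "a \<in> L 0" "b \<in> L 1" for a b
  proof -
    have "P 0 a = a" "P 1 b = b" using ab by (simp_all add: L_def)
    moreover have "P 1 a = 0" "P 0 b = 0"
      using P_zero[of a 1] P_zero[of b 0] LD[OF ab(1)] LD[OF ab(2)] by simp_all
    ultimately show ?thesis by (simp add: J blinfun.add_right blinfun.zero_right)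
  qed
  have "semilinear 1 J"
    using semilinearD[OF C0(1)] semilinearD[OF C1(1)] PB
    by (simp add: semilinear_def J Bounded_opsD scaleC_add_right)
  moreover have Je: "J (e v) = C0 (P 0 v) + C1 (P 1 v)" for v
    using J_sum[OF PL PL, of v v] by (simp add: Psum)
  moreover have "J (e v) \<in> range e" for v
  proof -
    have "e (J (e v)) = J (e v)"
      unfolding Je blinfun.add_right using LD(1)[OF C0(2)[OF PL]] LD(1)[OF C1(2)[OF PL]] by simp
    then show ?thesis by (metis rangeI)
  qed
  moreover have "J (J (e v)) = e v" for v
    unfolding Je J_sum[OF C0(2)[OF PL] C1(2)[OF PL]] C0(3)[OF PL] C1(3)[OF PL] by (rule Psum)
  moreover have "cinner (J (e u)) (J (e v)) = cnj (cinner (e u) (e v))" for u v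
  proof -
    have "cinner (J (e u)) (J (e v)) = cinner (C0 (P 0 u)) (C0 (P 0 v)) + cinner (C1 (P 1 u)) (C1 (P 1 v))"
      unfolding Je by (simp add: cinner_add_left cinner_add_right orth[OF C0(2)[OF PL] C1(2)[OF PL]])
    also have "\<dots> = cnj (cinner (P 0 u + P 1 u) (P 0 v + P 1 v))"
      by (simp add: C0(4)[OF PL PL] C1(4)[OF PL PL] cinner_add_left cinner_add_right orth[OF PL PL])
    finally show ?thesis by (simp only: Psum)
  qed
  moreover have "J (\<Gamma> (e v)) = \<Gamma> (J (e v))" for v
  proof -
    have m: "- P 1 v \<in> L 1" using closed_csubspaceD(3)[OF L PL, of "- 1"] by simp
    have "\<Gamma> (e v) = P 0 v + - P 1 v"
      unfolding Psum[of v, symmetric] blinfun.add_right \<Gamma>P by simp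
    then have "J (\<Gamma> (e v)) = C0 (P 0 v) + C1 (- P 1 v)" using J_sum[OF PL m] by simp
    also have "\<dots> = \<Gamma> (J (e v))"
      unfolding Je blinfun.add_right LD(2)[OF C0(2)[OF PL]] LD(2)[OF C1(2)[OF PL]]
      by (simp add: blinfun.minus_right)
    finally show ?thesis .
  qed
  moreover have "J (w (e v)) = w (J (e v))" if \<kappa>: "\<kappa> = 1" for v
  proof -
    have w\<Gamma>: "\<Gamma> (w v) = - w (\<Gamma> v)" for v using HomD(3)[OF w(3)] \<kappa> by simp
    have wL: "w (P s v) \<in> L (s + 1)" for s v
      using LD[OF PL[of s v]] w(11) by (intro LI) (simp_all add: w\<Gamma> Bounded_opsD sign_add flip: e(5))
    have wL0: "w (P 1 v) \<in> L 0" and wL1: "w (P 0 v) \<in> L 1" using wL[of 1 v] wL[of 0 v] by simp_all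
    have "w (e v) = w (P 1 v) + w (P 0 v)"
      unfolding Psum[of v, symmetric] blinfun.add_right by (rule add.commute)
    then have "J (w (e v)) = C0 (w (P 1 v)) + C1 (w (P 0 v))" using J_sum[OF wL0 wL1] by simp
    also have "\<dots> = w (J (e v))"
      unfolding Je blinfun.add_right by (simp add: C1(5)[OF \<kappa>] w(6) add.commute)
    finally show ?thesis .
  qed
  ultimately show thesis using that by blast
qed

end

context graded_system
begin

text \<open>For \<open>\<kappa> = 0\<close>, \<open>w\<close> acts as 1 on the range of
  \<open>e\<close> and as \<open>sign (q g)\<close> on that of \<open>\<alpha> g e\<close>; since
  \<open>w\<close> implements the grading, \<open>v g\<close> has degree \<open>q g\<close>. For
  \<open>\<kappa> = 1\<close>, \<open>v g\<close> is even by its choice in the corner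
  algebra.\<close>

lemma index_data_degree:
  assumes d: "index_data \<kappa> q e w v \<upsilon>" and g: "g \<in> carrier G"
  shows "v g \<in> H ((1 + \<kappa>) * q g)"
proof -
  have fr: "frame \<kappa> e w" and c: "corner_cocycle G (N \<kappa>) \<alpha> e v \<upsilon>"
    and aw: "\<alpha> g w = scale_op (sign (q g)) w"
    using d g by (auto simp: index_data_def)
  note w = frameD[OF fr] and e = frame_e[OF fr]
  interpret C: algebra_action G p "N \<kappa>" \<alpha> by (rule corner_action)
  interpret corner "N \<kappa>" e by (rule w)
  note v = C.corner_cocycleD[OF c g] and ve = isometry_e[OF C.corner_cocycleD(1,2)[OF c g]]
  show ?thesis
  proof (cases "\<kappa> = 0")
    case True
    have vM: "v g \<in> M" using v(1) True by (simp add: corner_algebra_def)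
    have we: "w (e x) = e x" for x using w(9)[OF True] by (rule compose_eqD)
    have "\<alpha> g (w o\<^sub>L e) = scale_op (sign (q g)) (w o\<^sub>L \<alpha> g e)"
      using act.isoD(6)[OF g w(10) e(6)] aw by simp
    then have "\<alpha> g e = scale_op (sign (q g)) (w o\<^sub>L \<alpha> g e)" using w(9)[OF True] by simp
    then have wa: "\<alpha> g e x = sign (q g) *\<^sub>C w (\<alpha> g e x)" for x
      by (metis blinfun_apply_blinfun_compose scale_op_apply)
    have av: "\<alpha> g e (v g x) = v g x" for x using v(3) ve(5,3) by (metis blinfun_apply_blinfun_compose)
    have wv: "v g x = sign (q g) *\<^sub>C w (v g x)" for x using wa[of "v g x"] av by simp
    have vw: "v g (w x) = v g x" for x
      using ve(3)[of "w x"] e(5)[of x] we[of x] ve(3)[of x] by simp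
    have "Ad \<Gamma> (v g) (w x) = w (v g x)" for x using frame_0_theta(2)[OF _ vM, of e w] fr True by simp
    then have "Ad \<Gamma> (v g) (w x) = sign (q g) *\<^sub>C v g (w x)" for x
      unfolding vw using arg_cong[OF wv, of "\<lambda>y. sign (q g) *\<^sub>C y" x] by (simp add: scaleC_scaleC)
    from this[of "w x" for x] have "Ad \<Gamma> (v g) = scale_op (sign (q g)) (v g)"
      by (intro blinfun_eqI) (simp add: w(6) del: Ad_apply)
    then show ?thesis using vM True by (simp add: homogeneous_part_def)
  next
    case False
    then show ?thesis using v(1) by (simp add: corner_algebra_def)
  qed
qed

text \<open>\<open>V\<close> maps \<open>a (e u)\<close> to
  \<open>\<alpha> g a (v g (J (e u)))\<close>. The partial isometry accounts for moving
  \<open>e\<close>, and \<open>J\<close> is a surjective isometry of the range of \<open>e\<close>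
  that carries the anti-linearity.\<close>

theorem spatial_implementation:
  assumes d: "index_data \<kappa> q e w v \<upsilon>" and g: "g \<in> carrier G"
  obtains V r where "unitary_op (p g) V" "\<And>x. x \<in> M \<Longrightarrow> V o\<^sub>L x = \<alpha> g x o\<^sub>L V"
    "V o\<^sub>L \<Gamma> = scale_op (sign r) (\<Gamma> o\<^sub>L V)"
proof -
  have fr: "frame \<kappa> e w" and c: "corner_cocycle G (N \<kappa>) \<alpha> e v \<upsilon>"
    and aw: "\<alpha> g w = scale_op (sign (q g)) w"
    using d g by (auto simp: index_data_def)
  let ?N = "N \<kappa>"
  note w = frameD[OF fr] and e = frame_e[OF fr]
  note MD = algD
  interpret C: algebra_action G p ?N \<alpha> by (rule corner_action)
  interpret corner ?N e by (rule w)
  note v = C.corner_cocycleD(1-3)[OF c g]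
  note ve = isometry_e[OF v(1,2)]
  have vdeg: "v g \<in> H ((1 + \<kappa>) * q g)" by (rule index_data_degree[OF d g])
  note vM = HomD(1,2)[OF vdeg]
  have "\<exists>J0 :: 'a op. semilinear (p g) J0 \<and> (\<forall>x. J0 (e x) \<in> range e) \<and> (\<forall>x. J0 (J0 (e x)) = e x) \<and>
    (\<forall>x y. cinner (J0 (e x)) (J0 (e y)) = conj_pow (p g) (cinner (e x) (e y))) \<and>
    (\<forall>x. J0 (\<Gamma> (e x)) = \<Gamma> (J0 (e x))) \<and> (\<kappa> = 1 \<longrightarrow> (\<forall>x. J0 (w (e x)) = w (J0 (e x))))"
  proof (cases "p g = 0")
    case True
    then show ?thesis by (intro exI[of _ id_blinfun]) (simp add: semilinear_def)
  next
    case False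
    then have "p g = 1" by simp
    then show ?thesis using frame_conjugation[OF fr] by (metis conj_pow_1)
  qed
  then obtain J0 :: "'a op" where J0: "semilinear (p g) J0" "\<And>x. J0 (e x) \<in> range e" "\<And>x. J0 (J0 (e x)) = e x"
    "\<And>x y. cinner (J0 (e x)) (J0 (e y)) = conj_pow (p g) (cinner (e x) (e y))"
    "\<And>x. J0 (\<Gamma> (e x)) = \<Gamma> (J0 (e x))" "\<And>x. \<kappa> = 1 \<Longrightarrow> J0 (w (e x)) = w (J0 (e x))" by blast
  \<comment> \<open>\<open>\<Gamma>\<close> anticommutes with the odd \<open>w\<close>; inserting it
    gives \<open>J\<close> the sign with which \<open>\<alpha> g\<close> acts on
    \<open>w\<close>.\<close>
  define T where "T = (if \<kappa> = 1 \<and> q g = 1 then \<Gamma> else id_blinfun)"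
  have T: "T \<in> Bounded_ops" "T (T x) = x" "T (e x) = e (T x)" "T (\<Gamma> x) = \<Gamma> (T x)" "cinner (T x) (T y) = cinner x y" for x y
    using \<Gamma>D e(4) cinner_adj[OF \<Gamma>D(1)] by (auto simp: T_def)
  have Tw: "T (w x) = sign (q g) *\<^sub>C w (T x)" if \<kappa>: "\<kappa> = 1" for x
    using HomD(3)[OF w(3)] \<kappa> by (cases "q g") (auto simp: T_def)
  define J where "J = J0 o\<^sub>L T"
  have J: "J (e x) = J0 (e (T x))" for x by (simp add: J_def T)
  have eJ: "e (J (e x)) = J (e x)" for x using J0(2)[of "T x"] e(1) by (auto simp: J)
  have J_sl: "J (a *\<^sub>C x) = conj_pow (p g) a *\<^sub>C J x" for a x
    by (simp add: J_def Bounded_opsD[OF T(1)] semilinearD[OF J0(1)])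
  have J_surj: "\<exists>x. J (e x) = e y" for y
  proof -
    obtain z where z: "J0 (e y) = e z" using J0(2)[of y] by blast
    have "J (e (T z)) = J0 (J0 (e y))" by (simp add: J T z)
    then show ?thesis using J0(3) by auto
  qed
  have J_cinner: "cinner (J (e x)) (J (e y)) = conj_pow (p g) (cinner (e x) (e y))" for x y
    unfolding J J0(4) by (simp flip: T(3) add: T(5))
  have J\<Gamma>: "J (\<Gamma> (e x)) = \<Gamma> (J (e x))" for x
    using J0(5)[of "T x"] by (simp add: J_def T)
  have Jw: "J (w (e x)) = sign (q g) *\<^sub>C w (J (e x))" if "\<kappa> = 1" for x
    using J0(6)[OF that, of "T x"] Tw[OF that] by (simp add: J_def T semilinearD[OF J0(1)])
  \<comment> \<open>For \<open>\<kappa> = 1\<close> the scalar corner only covers even elements; the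
    others are reached as even elements plus \<open>w\<close> times even ones, which is where
    \<open>Jw\<close> enters.\<close>
  have key: "adj (v g) (\<alpha> g x (v g (J (e u)))) = J (e (x (e u)))" if x: "x \<in> M" for x u
  proof -
    have N_key: "adj (v g) (\<alpha> g a (v g (J (e u)))) = J (e (a (e u)))" if a: "a \<in> ?N" for a
    proof -
      obtain b where b: "e o\<^sub>L (a o\<^sub>L e) = scale_op b e" using scalar a by blast
      have "adj (v g) (\<alpha> g a (v g y)) = conj_pow (p g) b *\<^sub>C e y" for y
        using compose_eqD[OF corner_transport[OF alg mf C.iso[OF g] v a b], of y] by simp
      moreover have "e (a (e u)) = b *\<^sub>C e u" using compose_eqD[OF b, of u] by simp
      ultimately show ?thesis by (simp add: eJ J_sl)
    qed
    show ?thesis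
    proof (cases "\<kappa> = 0")
      case True
      then show ?thesis using x N_key by (simp add: corner_algebra_def)
    next
      case False
      then have \<kappa>: "\<kappa> = 1" by simp
      have fr1: "frame 1 e w" using fr \<kappa> by simp
      note x0 = EO[OF fr1 x]
      have N: "Ev x \<in> ?N" "Od w x \<in> ?N" using x0 \<kappa> by (simp_all add: corner_algebra_def)
      note xM = HomD(1)[OF x0(1)] HomD(1)[OF x0(2)]
      have "\<alpha> g x = \<alpha> g (Ev x + (w o\<^sub>L Od w x))" using x0(3) by simp
      also have "\<dots> = \<alpha> g (Ev x) + scale_op (sign (q g)) (w o\<^sub>L \<alpha> g (Od w x))"
        using act.isoD(5)[OF g xM(1) MD(4)[OF w(10) xM(2)]] act.isoD(6)[OF g w(10) xM(2)] aw by simp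
      finally have ax: "\<alpha> g x y = \<alpha> g (Ev x) y + sign (q g) *\<^sub>C w (\<alpha> g (Od w x) y)" for y
        by (simp add: blinfun.add_left)
      have wv: "adj (v g) (w y) = w (adj (v g) y)" for y
        using frame_1_central[OF fr1 MD(5)[OF vM(1)]] by simp
      have xe: "x y = Ev x y + w (Od w x y)" for y
      proof -
        have "x y = (Ev x + (w o\<^sub>L Od w x)) y" using x0(3) by simp
        then show ?thesis by (simp add: blinfun.add_left)
      qed
      have "adj (v g) (\<alpha> g x (v g (J (e u)))) =
          J (e (Ev x (e u))) + sign (q g) *\<^sub>C w (J (e (Od w x (e u))))"
        using Bounded_opsD[OF MD(1)[OF MD(5)[OF vM(1)]]]
        by (simp add: ax blinfun.add_right wv N_key[OF N(1)] N_key[OF N(2)])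
      also have "\<dots> = J (e (x (e u)))"
        by (simp add: xe[of "e u"] blinfun.add_right Jw[OF \<kappa>] flip: e(5))
      finally show ?thesis .
    qed
  qed
  let ?D = "{blinfun_apply a u | a u. a \<in> M \<and> u \<in> range e}"
  have dense: "clspan ?D = UNIV"
  proof -
    have "{blinfun_apply a (e v) | a v. a \<in> ?N} \<subseteq> ?D" using corner_subset by blast
    then show ?thesis using frame_dense[OF fr] closure_mono[OF span_mono] by blast
  qed
  have Y: "cinner (v g (J a)) (\<alpha> g x (v g (J b))) = conj_pow (p g) (cinner a (x b))"
    if x: "x \<in> M" and ab: "a \<in> range e" "b \<in> range e" for x a b
  proof -
    obtain a' b' where ab': "a = e a'" "b = e b'" using ab by blast
    have "cinner (v g (J a)) (\<alpha> g x (v g (J b))) = cinner (J a) (J (e (x (e b'))))"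
      using cinner_adj[OF vM(2)] key[OF x, of b'] ab'(2) by simp
    also have "\<dots> = conj_pow (p g) (cinner (e a') (e (x (e b'))))" unfolding ab'(1) by (rule J_cinner)
    also have "cinner (e a') (e (x (e b'))) = cinner a (x b)" using e(7)[of a' "e (x (e b'))"] e(7)[of a' "x (e b')"]
      by (simp add: ab' e(1))
    finally show ?thesis .
  qed
  have MB: "M \<subseteq> Bounded_ops" using MD(1) by blast
  obtain V :: "'a op" where V: "semilinear (p g) V" "\<And>a u. a \<in> M \<Longrightarrow> u \<in> range e \<Longrightarrow> V (a u) = \<alpha> g a (v g (J u))"
    "\<And>b x. b \<in> M \<Longrightarrow> V (b x) = \<alpha> g b (V x)"
    "\<And>x y. x \<in> clspan ?D \<Longrightarrow> y \<in> clspan ?D \<Longrightarrow> V x \<bullet> V y = x \<bullet> y"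
    by (rule covariant_extension[OF M_star act.iso[OF g] _ Y]) (use MB in auto)
  have Ve: "V (a (e u)) = \<alpha> g a (v g (J (e u)))" if "a \<in> M" for a u
    using V(2)[OF that, of "e u"] by simp
  have U: "unitary_op (p g) V"
  proof (rule unitary_opI[OF V(1)])
    show "V x \<bullet> V y = x \<bullet> y" for x y using V(4) unfolding dense by blast
    fix D assume D: "closed D" "subspace D" "range V \<subseteq> D"
    have "?D \<subseteq> range V"
    proof
      fix y assume "y \<in> ?D"
      then obtain a :: "'a op" and z where y: "y = a (e z)" "a \<in> M" by blast
      have "a o\<^sub>L adj (v g) \<in> \<alpha> g ` M"
        using MD(4)[OF y(2) MD(5)[OF vM(1)]] by (simp only: act.isoD(3)[OF g])
      then obtain b where b: "b \<in> M" "\<alpha> g b = a o\<^sub>L adj (v g)" by auto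
      obtain x where x: "J (e x) = e z" using J_surj by blast
      have "V (b (e x)) = y" using Ve[OF b(1), of x] ve(5) by (simp add: b(2) x y(1) e(1))
      then show "y \<in> range V" by blast
    qed
    then have "clspan ?D \<subseteq> D" using D by (intro clspan_minimal) auto
    then show "D = UNIV" unfolding dense by blast
  qed
  \<comment> \<open>The degree of \<open>a\<close> contributes its sign twice, so only the degree of
    \<open>v g\<close> remains and the sign is the same on all generating vectors.\<close>
  have hom: "V (\<Gamma> (a (e u))) = sign ((1 + \<kappa>) * q g) *\<^sub>C \<Gamma> (V (a (e u)))" if a: "a \<in> H r" for a r u
  proof -
    note aM = HomD(1)[OF a] and aaH = Hom_act[OF g a]
    have "V (\<Gamma> (a (e u))) = sign r *\<^sub>C V (a (e (\<Gamma> u)))"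
      by (simp add: HomD(3)[OF a] e(4) semilinearD[OF V(1)])
    also have "V (a (e (\<Gamma> u))) = \<alpha> g a (v g (\<Gamma> (J (e u))))"
      using Ve[OF aM, of "\<Gamma> u"] J\<Gamma>[of u] by (simp add: e(4))
    also have "\<dots> = sign r *\<^sub>C sign ((1 + \<kappa>) * q g) *\<^sub>C \<Gamma> (\<alpha> g a (v g (J (e u))))"
      using HomD(5)[OF vdeg] HomD(5)[OF aaH] HomD(2)[OF aaH]
      by (simp add: Bounded_opsD scaleC_scaleC mult.commute)
    finally show ?thesis using Ve[OF aM, of u] by (simp add: scaleC_scaleC)
  qed
  have "V o\<^sub>L \<Gamma> = scale_op (sign ((1 + \<kappa>) * q g)) (\<Gamma> o\<^sub>L V)"
  proof (rule blinfun_eqI_dense[OF _ dense])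
    fix y assume "y \<in> ?D"
    then obtain a :: "'a op" and z where y: "y = a (e z)" "a \<in> M" by blast
    obtain a0 a1 where a: "a0 \<in> H 0" "a1 \<in> H 1" "a = a0 + a1" using Hom_decompose[OF y(2)] by blast
    show "(V o\<^sub>L \<Gamma>) y = scale_op (sign ((1 + \<kappa>) * q g)) (\<Gamma> o\<^sub>L V) y"
      using hom[OF a(1)] hom[OF a(2)]
      by (simp add: y(1) a(3) blinfun.add_left blinfun.add_right scaleC_add_right)
  qed
  moreover have "V o\<^sub>L x = \<alpha> g x o\<^sub>L V" if "x \<in> M" for x
    using V(3)[OF that] by (intro blinfun_eqI) simp
  ultimately show thesis using that U by blast
qed

end

section \<open>Tensor products of operators\<close>

locale tensor =
  fixes t :: "'a::chilbert_space \<Rightarrow> 'b::chilbert_space \<Rightarrow> 'c::chilbert_space"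
  assumes ht: "hilbert_tensor t"
begin

lemma t_add: "t (u + u') v = t u v + t u' v" "t u (v + v') = t u v + t u v'"
  and t_scale: "t (c *\<^sub>C u) v = c *\<^sub>C t u v" "t u (c *\<^sub>C v) = c *\<^sub>C t u v"
  and t_cinner: "cinner (t u v) (t u' v') = cinner u u' * cinner v v'"
  using ht by (simp_all add: hilbert_tensor_def)

lemma t_dense: "clspan (range (\<lambda>(u, v). t u v)) = UNIV"
proof -
  have "range (\<lambda>(u, v). t u v) = {t u v | u v. True}" by auto
  then show ?thesis using ht by (simp add: hilbert_tensor_def)
qed

lemma t_norm: "norm (t u v) = norm u * norm v"
proof -
  have "complex_of_real ((norm (t u v))\<^sup>2) = of_real ((norm u * norm v)\<^sup>2)"
    using t_cinner[of u v u v] by (simp add: cinner_self power_mult_distrib)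
  then have "(norm (t u v))\<^sup>2 = (norm u * norm v)\<^sup>2" by (simp only: of_real_eq_iff)
  then show ?thesis by simp
qed

lemma t_bounded_linear: "bounded_linear (t u)" "bounded_linear (\<lambda>u. t u v)"
proof -
  have R: "t (r *\<^sub>R u) v = r *\<^sub>R t u v" "t u (r *\<^sub>R v) = r *\<^sub>R t u v" for r u v
    using t_scale(1)[of "of_real r" u v] t_scale(2)[of u "of_real r" v] by (simp_all add: scaleC_of_real)
  show "bounded_linear (t u)"
    by (rule bounded_linear_intro[where K = "norm u"]) (simp_all add: t_add R t_norm)
  show "bounded_linear (\<lambda>u. t u v)"
    by (rule bounded_linear_intro[where K = "norm v"]) (simp_all add: t_add R t_norm)
qed

lemma clspan_preimage:
  assumes f: "bounded_linear f" and D: "\<And>d. d \<in> D \<Longrightarrow> f d \<in> clspan E" "clspan D = UNIV"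
  shows "f x \<in> clspan E"
proof -
  have "clspan D \<subseteq> f -` clspan E"
  proof (rule clspan_minimal)
    show "closed (f -` clspan E)"
      using f by (intro continuous_closed_vimage) (simp_all add: linear_continuous_at)
    show "subspace (f -` clspan E)"
      using f by (intro linear_subspace_vimage) (simp_all add: bounded_linear.linear)
  qed (use D(1) in auto)
  then show ?thesis using D(2) by auto
qed

lemma t_dense_product:
  assumes "clspan D1 = UNIV" "clspan D2 = UNIV"
  shows "clspan {t x y | x y. x \<in> D1 \<and> y \<in> D2} = UNIV" (is "clspan ?D = _")
proof -
  have 1: "t x y \<in> clspan ?D" if x: "x \<in> D1" for x y
  proof (rule clspan_preimage[OF t_bounded_linear(1) _ assms(2)])
    show "t x d \<in> clspan ?D" if "d \<in> D2" for d by (rule clspan_base) (use x that in blast)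
  qed
  have "t x y \<in> clspan ?D" for x y
    by (rule clspan_preimage[OF t_bounded_linear(2) _ assms(1)]) (rule 1)
  then have "clspan (range (\<lambda>(u, v). t u v)) \<subseteq> clspan ?D" by (intro clspan_minimal) auto
  then show ?thesis by (simp add: t_dense top.extremum_unique)
qed

lemma t_eqI:
  assumes "\<And>u v. blinfun_apply x (t u v) = blinfun_apply y (t u v)"
  shows "x = y"
  by (rule blinfun_eqI_dense[OF _ t_dense]) (use assms in auto)

lemma t_adjoint:
  assumes a: "semilinear s a" and b: "semilinear s b"
  shows "t (a u) (b v) \<bullet> t u' v' = t u v \<bullet> t (adj a u') (adj b v')"
proof -
  have "cinner (t (a u) (b v)) (t u' v') = conj_pow s (cinner (t u v) (t (adj a u') (adj b v')))"
    by (simp add: t_cinner cinner_adj_semilinear[OF a] cinner_adj_semilinear[OF b])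
  then show ?thesis by (metis Re_cinner conj_pow_arith(11))
qed

text \<open>Only geometric growth of the iterates on elementary tensors has to be checked for
  \<open>adjointable_extension\<close>; boundedness on sums of tensors follows, for two anti-linear
  factors as well.\<close>

lemma op_tensor_exists:
  assumes a: "semilinear s a" and b: "semilinear s b"
  shows "\<exists>z. \<forall>u v. blinfun_apply z (t u v) = t (a u) (b v)"
proof -
  let ?d = "\<lambda>(u, v). t u v" and ?F = "\<lambda>(u, v). (blinfun_apply a u, blinfun_apply b v)"
    and ?F' = "\<lambda>(u, v). (adj a u, adj b v)"
  let ?C = "\<lambda>a. norm (adj a o\<^sub>L a) + 1"
  have "((?F' \<circ> ?F) ^^ n) (u, v) =
      (((\<lambda>u. (adj a o\<^sub>L a) u) ^^ n) u, ((\<lambda>v. (adj b o\<^sub>L b) v) ^^ n) v)" for n u v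
    by (induction n) auto
  note iter = this
  have pow: "norm ((blinfun_apply x ^^ n) u) \<le> (norm x + 1) ^ n * norm u" for x :: "'d::chilbert_space op" and n u
  proof (induction n)
    case (Suc n)
    have "norm (x ((blinfun_apply x ^^ n) u)) \<le> norm x * norm ((blinfun_apply x ^^ n) u)"
      by (rule norm_blinfun)
    also have "\<dots> \<le> (norm x + 1) * ((norm x + 1) ^ n * norm u)"
      by (intro mult_mono Suc) simp_all
    finally show ?case by (simp add: mult.assoc)
  qed simp
  have bound: "norm ((blinfun_apply x ^^ n) u) * norm ((blinfun_apply y ^^ n) v) \<le>
      norm u * norm v * ((norm x + 1) * (norm y + 1)) ^ n"
    for x :: "'a op" and y :: "'b op" and n u v
    by (rule order_trans[OF mult_mono[OF pow pow]]) (simp_all add: power_mult_distrib mult_ac)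
  have growth: "\<exists>K. \<forall>n. norm (?d (((?F' \<circ> ?F) ^^ n) i)) \<le> K * (?C a * ?C b) ^ n" for i
  proof (intro exI allI)
    fix n
    obtain u v where i: "i = (u, v)" by fastforce
    show "norm (?d (((?F' \<circ> ?F) ^^ n) i)) \<le> (norm (fst i) * norm (snd i)) * (?C a * ?C b) ^ n"
      unfolding i iter by (simp add: t_norm bound)
  qed
  have "0 < ?C a * ?C b" by (intro mult_pos_pos add_nonneg_pos) simp_all
  then obtain z where z: "\<And>i. i \<in> UNIV \<Longrightarrow> blinfun_apply z (?d i) = ?d (?F i)"
    by (rule adjointable_extension[of UNIV ?F ?F' ?d, rotated 3]) (auto intro: growth simp: t_adjoint[OF a b])
  have "blinfun_apply z (t u v) = t (a u) (b v)" for u v using z[of "(u, v)"] by simp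
  then show ?thesis by (intro exI[of _ z]) auto
qed

lemma op_tensor_eqI: "(\<And>u v. blinfun_apply z (t u v) = t (blinfun_apply a u) (blinfun_apply b v)) \<Longrightarrow> op_tensor t a b = z"
  unfolding op_tensor_def by (rule the_equality) (auto intro: t_eqI)

lemma op_tensor_apply:
  assumes "semilinear s a" "semilinear s b"
  shows "op_tensor t a b (t u v) = t (a u) (b v)"
  using op_tensor_exists[OF assms] op_tensor_eqI[of _ a b] by auto

lemma op_tensor_semilinear:
  assumes ab: "semilinear s a" "semilinear s b"
  shows "semilinear s (op_tensor t a b)"
proof (rule semilinear_extension[of "range (\<lambda>(u, v). t u v)"])
  show "x \<in> range (\<lambda>(u, v). t u v) \<Longrightarrow> c *\<^sub>C x \<in> range (\<lambda>(u, v). t u v)" for c x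
    using rangeI[of "\<lambda>(u, v). t u v" "(c *\<^sub>C _, _)"] by (auto simp: t_scale(1)[symmetric])
  show "x \<in> range (\<lambda>(u, v). t u v) \<Longrightarrow> op_tensor t a b (c *\<^sub>C x) = conj_pow s c *\<^sub>C op_tensor t a b x" for c x
    by (auto simp: t_scale(1)[symmetric] op_tensor_apply[OF ab] semilinearD[OF ab(1)])
  fix x :: 'c assume "\<And>d. d \<in> range (\<lambda>(u, v). t u v) \<Longrightarrow> x \<bullet> d = 0"
  then have "x \<bullet> x = 0" by (rule clspan_orth) (auto simp: t_dense)
  then show "op_tensor t a b x = 0" by (simp add: blinfun.zero_right)
qed

lemma op_tensor_compose:
  assumes "semilinear r a" "semilinear r b" "semilinear s a'" "semilinear s b'"
  shows "op_tensor t a b o\<^sub>L op_tensor t a' b' = op_tensor t (a o\<^sub>L a') (b o\<^sub>L b')"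
  using assms semilinear_compose by (intro op_tensor_eqI[symmetric]) (simp add: op_tensor_apply)

lemma op_tensor_adj:
  assumes ab: "semilinear s a" "semilinear s b"
  shows "adj (op_tensor t a b) = op_tensor t (adj a) (adj b)"
proof (rule op_tensor_eqI[symmetric])
  fix u v
  let ?z = "adj (op_tensor t a b) (t u v) - t (adj a u) (adj b v)"
  have "?z \<bullet> d = 0" if "d \<in> range (\<lambda>(u, v). t u v)" for d
  proof -
    obtain u' v' where d: "d = t u' v'" using \<open>d \<in> range (\<lambda>(u, v). t u v)\<close> by auto
    have "d \<bullet> adj (op_tensor t a b) (t u v) = d \<bullet> t (adj a u) (adj b v)"
      by (simp add: d op_tensor_apply[OF ab] t_adjoint[OF ab] flip: inner_adj)
    then show ?thesis by (simp add: inner_diff_right inner_commute[of _ d])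
  qed
  then have "?z \<bullet> ?z = 0" by (rule clspan_orth[of "range (\<lambda>(u, v). t u v)"]) (assumption, unfold t_dense, rule UNIV_I)
  then show "adj (op_tensor t a b) (t u v) = t (adj a u) (adj b v)" by simp
qed

lemma op_tensor_id [simp]: "op_tensor t id_blinfun id_blinfun = id_blinfun"
  by (rule op_tensor_eqI) simp

lemma op_tensor_unitary:
  assumes V: "unitary_op s V" and W: "unitary_op s W"
  shows "unitary_op s (op_tensor t V W)"
  using unitary_opD(1-3)[OF V] unitary_opD(1-3)[OF W]
  by (simp add: unitary_op_def op_tensor_semilinear op_tensor_adj[of s]
      op_tensor_compose[of s _ _ s] semilinear_adj)

end

section \<open>The graded tensor product\<close>

text \<open>Stability of \<open>S\<close> under both directions of conjugation makes the commutant
  stable; the same argument once more reaches the bicommutant.\<close>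

lemma bicommutant_Ad:
  assumes V: "unitary_op s V" and S: "S \<subseteq> Bounded_ops" "\<And>x. x \<in> S \<Longrightarrow> Ad V x \<in> S" "\<And>x. x \<in> S \<Longrightarrow> Ad (adj V) x \<in> S"
  shows "x \<in> commutant (commutant S) \<Longrightarrow> Ad V x \<in> commutant (commutant S)"
proof -
  have *: "Ad W x \<in> commutant R" if W: "unitary_op s W" and R: "\<And>y. y \<in> R \<Longrightarrow> Ad (adj W) y \<in> R"
    and x: "x \<in> commutant R" for W R x
  proof (rule commutantI)
    note w = unitary_opD[OF W]
    show "Ad W x \<in> Bounded_ops" using w(1) commutantD(1)[OF x] by (rule Ad_Bounded)
    fix y v assume "y \<in> R"
    have "x (adj W (y (W u))) = adj W (y (W (x u)))" for u
      using commutantD(3)[OF x R[OF \<open>y \<in> R\<close>], of u] by simp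
    from this[of "adj W v"] show "Ad W x (y v) = y (Ad W x v)" by (simp add: w(4,5))
  qed
  have "Ad (adj V) y \<in> commutant S" if "y \<in> commutant S" for y
    by (rule *[OF unitary_op_adj[OF V] _ that]) (simp add: S(2))
  then show "x \<in> commutant (commutant S) \<Longrightarrow> Ad V x \<in> commutant (commutant S)"
    by (rule *[OF V])
qed

locale graded_pair = tensor t + A: graded_algebra M1 \<Gamma>1 + B: graded_algebra M2 \<Gamma>2
  for t :: "'a::chilbert_space \<Rightarrow> 'b::chilbert_space \<Rightarrow> 'c::chilbert_space" 
    and M1 :: "'a op set" and \<Gamma>1 and M2 :: "'b op set" and \<Gamma>2
begin

abbreviation T :: "'a op \<Rightarrow> bit \<Rightarrow> 'b op \<Rightarrow> 'c op" where "T \<equiv> graded_op_tensor t \<Gamma>1"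
abbreviation M :: "'c op set" where "M \<equiv> graded_tensor t M1 \<Gamma>1 M2 \<Gamma>2"
abbreviation \<Gamma> :: "'c op" where "\<Gamma> \<equiv> op_tensor t \<Gamma>1 \<Gamma>2"

text \<open>These generators are closed under products, adjoints and scalars, though not under sums;
  that suffices for every bicommutant argument below.\<close>

definition S :: "'c op set"
  where "S = {T a s b | a r b s. a \<in> A.H r \<and> b \<in> B.H s}"

text \<open>The power of \<open>\<Gamma>1\<close> occurring in \<open>a \<hat>\<otimes> b\<close>
  for \<open>b\<close> of degree \<open>s\<close>.\<close>

definition P :: "bit \<Rightarrow> 'a op" where "P s = (if s = 0 then id_blinfun else \<Gamma>1)"

lemma P [simp]: "P s \<in> Bounded_ops" "P s (P s v) = v" "P s (P r v) = P (r + s) v" "P 0 = id_blinfun"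
  using A.\<Gamma>D by (auto simp: P_def)

lemma P_hom: "a \<in> A.H r \<Longrightarrow> P s (a v) = sign (s * r) *\<^sub>C a (P s v)"
  using A.HomD(3) by (auto simp: P_def)

lemma T_apply: "a \<in> Bounded_ops \<Longrightarrow> b \<in> Bounded_ops \<Longrightarrow> T a s b (t u v) = t (a (P s u)) (b v)"
  using A.\<Gamma>D(1) by (auto simp: graded_op_tensor_def op_tensor_apply[of 0] P_def simp flip: Bounded_ops_iff)

lemma T_Bounded: "a \<in> Bounded_ops \<Longrightarrow> b \<in> Bounded_ops \<Longrightarrow> T a s b \<in> Bounded_ops"
  using A.\<Gamma>D(1) op_tensor_semilinear[of 0] by (auto simp: graded_op_tensor_def Bounded_ops_iff[symmetric])

lemma T_scale:
  assumes "a \<in> Bounded_ops" "b \<in> Bounded_ops"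
  shows "T (scale_op c a) s b = scale_op c (T a s b)" "T a s (scale_op c b) = scale_op c (T a s b)"
  using assms by (auto intro!: t_eqI simp: T_apply t_scale)

text \<open>The sign is the Koszul rule: it arises when the power of \<open>\<Gamma>1\<close>
  attached to \<open>b\<close> passes \<open>a'\<close>.\<close>

lemma T_compose:
  assumes "a \<in> Bounded_ops" "b \<in> Bounded_ops" and a': "a' \<in> A.H r'" and "b' \<in> Bounded_ops"
  shows "T a s b o\<^sub>L T a' s' b' = scale_op (sign (s * r')) (T (a o\<^sub>L a') (s + s') (b o\<^sub>L b'))"
  using assms A.HomD(2)[OF a']
  by (intro t_eqI) (simp add: T_apply P_hom[OF a'] t_scale Bounded_opsD add.commute)

lemma T_adj:
  assumes a: "a \<in> A.H r" and b: "b \<in> B.H s"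
  shows "adj (T a s b) = scale_op (sign (r * s)) (T (adj a) s (adj b))"
proof (rule blinfun_eqI_dense[OF _ t_dense])
  note aB = A.HomD(2)[OF a] and bB = B.HomD(2)[OF b]
  fix d :: 'c assume "d \<in> range (\<lambda>(u, v). t u v)"
  then obtain u v where d: "d = t u v" by auto
  have P: "adj (P s) = P s" using A.\<Gamma>D(2) by (simp add: P_def)
  have "adj (T a s b) = op_tensor t (adj (a o\<^sub>L P s)) (adj b)"
    using aB bB A.\<Gamma>D(1) by (simp add: graded_op_tensor_def op_tensor_adj[of 0] P_def flip: Bounded_ops_iff)
  then have "adj (T a s b) d = t (P s (adj a u)) (adj b v)"
    using aB bB P by (simp add: d op_tensor_apply[of 0] flip: Bounded_ops_iff)
  then show "adj (T a s b) d = scale_op (sign (r * s)) (T (adj a) s (adj b)) d"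
    using aB bB P_hom[OF A.Hom_adj[OF a]] by (simp add: d T_apply t_scale mult.commute)
qed

lemma T_id: "T id_blinfun 0 id_blinfun = id_blinfun" by (simp add: graded_op_tensor_def)

lemma S_iff: "x \<in> S \<longleftrightarrow> (\<exists>a r b s. a \<in> A.H r \<and> b \<in> B.H s \<and> x = T a s b)" unfolding S_def by blast

lemma S_I: "a \<in> A.H r \<Longrightarrow> b \<in> B.H s \<Longrightarrow> T a s b \<in> S" unfolding S_def by blast

lemma S_Bounded: "S \<subseteq> Bounded_ops" using T_Bounded A.HomD(2) B.HomD(2) unfolding S_def by blast

lemma S_scale: "x \<in> S \<Longrightarrow> scale_op c x \<in> S"
proof -
  assume "x \<in> S"
  then obtain a r b s where "a \<in> A.H r" "b \<in> B.H s" "x = T a s b" unfolding S_iff by blast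
  then show ?thesis
    using T_scale(1)[OF A.HomD(2) B.HomD(2), of a r b s c s] S_I[OF A.Hom_scale] by metis
qed

lemma S_compose: "x \<in> S \<Longrightarrow> y \<in> S \<Longrightarrow> x o\<^sub>L y \<in> S"
proof -
  assume "x \<in> S" "y \<in> S"
  then obtain a r b s a' r' b' s' where ab: "a \<in> A.H r" "b \<in> B.H s" "x = T a s b"
    "a' \<in> A.H r'" "b' \<in> B.H s'" "y = T a' s' b'" unfolding S_iff by blast
  show ?thesis
    unfolding ab T_compose[OF A.HomD(2)[OF ab(1)] B.HomD(2)[OF ab(2)] ab(4) B.HomD(2)[OF ab(5)]]
    by (rule S_scale[OF S_I[OF A.Hom_compose[OF ab(1,4)] B.Hom_compose[OF ab(2,5)]]])
qed

lemma S_adj: "x \<in> S \<Longrightarrow> adj x \<in> S"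
proof -
  assume "x \<in> S"
  then obtain a r b s where ab: "a \<in> A.H r" "b \<in> B.H s" "x = T a s b" unfolding S_iff by blast
  show ?thesis unfolding ab T_adj[OF ab(1,2)] by (rule S_scale[OF S_I[OF A.Hom_adj[OF ab(1)] B.Hom_adj[OF ab(2)]]])
qed

lemma S_id: "id_blinfun \<in> S" using S_I[OF A.Hom_id B.Hom_id] by (simp add: T_id)

lemma M_eq: "M = commutant (commutant S)"
proof -
  have "von_neumann_algebra (commutant (commutant S))"
    by (rule von_neumann_algebra_commutant) (use commutant_subset_Bounded commutant_adj S_adj in blast)+
  moreover have "commutant (commutant S) \<subseteq> N" if "von_neumann_algebra N" "S \<subseteq> N" for N
    using commutant_mono[OF commutant_mono[OF that(2)]] von_neumann_algebraD(3)[OF that(1)] by simp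
  ultimately show ?thesis
    unfolding graded_tensor_def S_def[symmetric]
    by (intro hull_unique subset_bicommutant S_Bounded) auto
qed

lemma S_M: "x \<in> S \<Longrightarrow> x \<in> M" using subset_bicommutant[OF S_Bounded] by (auto simp: M_eq)

lemma M_vN: "von_neumann_algebra M"
  unfolding M_eq
  by (rule von_neumann_algebra_commutant) (use commutant_subset_Bounded commutant_adj S_adj in blast)+

lemma \<Gamma>: "sa_unitary \<Gamma>"
  using op_tensor_semilinear[of 0] A.\<Gamma>D B.\<Gamma>D sa_unitaryD[OF A.\<Gamma>] sa_unitaryD[OF B.\<Gamma>]
  by (simp add: sa_unitary_def op_tensor_adj[of 0] op_tensor_compose[of 0 _ _ 0] flip: Bounded_ops_iff)

lemma \<Gamma>_apply: "\<Gamma> (t u v) = t (\<Gamma>1 u) (\<Gamma>2 v)"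
  using A.\<Gamma>D B.\<Gamma>D by (simp add: op_tensor_apply[of 0] flip: Bounded_ops_iff)

lemma \<Gamma>_T:
  assumes a: "a \<in> A.H r" and b: "b \<in> B.H s"
  shows "Ad \<Gamma> (T a s b) = scale_op (sign (r + s)) (T a s b)"
  unfolding Ad_intertwine[OF sa_unitaryD(5)[OF \<Gamma>]]
  using A.HomD(2,3)[OF a] B.HomD(2,3)[OF b] A.\<Gamma>D
  by (intro t_eqI) (auto simp: T_apply \<Gamma>_apply t_scale scaleC_scaleC sign_add P_def)

sublocale C: graded_algebra M \<Gamma>
proof
  note \<Gamma>D = sa_unitaryD[OF \<Gamma>]
  have "Ad \<Gamma> x \<in> S" if "x \<in> S" for x
    using that \<Gamma>_T S_scale unfolding S_iff by metis
  then have inv: "Ad \<Gamma> ` M \<subseteq> M"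
    using bicommutant_Ad[OF \<Gamma>D(5) S_Bounded] by (auto simp: M_eq \<Gamma>D(2))
  have "star_iso 0 M M (Ad \<Gamma>)"
    using star_algebraD(1)[OF von_neumann_algebraD(1)[OF M_vN]] inv
    by (intro star_iso_Ad[OF \<Gamma>D(5)]) (auto simp: \<Gamma>D(2))
  moreover have "Ad \<Gamma> (Ad \<Gamma> x) = x" for x by (intro blinfun_eqI) (simp add: \<Gamma>D(2,4))
  ultimately show "spatially_graded M (Ad \<Gamma>) \<Gamma>"
    using M_vN \<Gamma> by (simp add: spatially_graded_def graded_von_neumann_algebra_def)
qed

lemma T_Hom:
  assumes "a \<in> A.H r" "b \<in> B.H s"
  shows "T a s b \<in> C.H (r + s)"
  using \<Gamma>_T[OF assms] S_M[OF S_I[OF assms]] by (simp add: homogeneous_part_def)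

lemma graded_tensor_balanced:
  assumes "balanced M1 (Ad \<Gamma>1)"
  shows "balanced M (Ad \<Gamma>)"
proof -
  obtain u where u: "u \<in> A.H 1" "sa_unitary u" using assms by (auto simp: balanced_def)
  note uD = sa_unitaryD[OF u(2)]
  have "T u 0 id_blinfun o\<^sub>L T u 0 id_blinfun = id_blinfun"
    using T_compose[OF uD(1) _ u(1), of id_blinfun id_blinfun 0 0] uD(3) by (simp add: T_id)
  moreover have "adj (T u 0 id_blinfun) = T u 0 id_blinfun"
    using T_adj[OF u(1) B.Hom_id] uD(2) by simp
  ultimately have "sa_unitary (T u 0 id_blinfun)"
    using T_Bounded[OF uD(1)] by (simp add: sa_unitary_def)
  then show ?thesis using T_Hom[OF u(1) B.Hom_id] unfolding balanced_def by auto
qed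

end

section \<open>What a frame implies: corners, centrality and type I\<close>

lemma eq_neg_imp_0: "x = - x \<Longrightarrow> x = 0" for x :: "'a::real_vector"
  using scaleR_2[of x] by (simp add: eq_neg_iff_add_eq_0)

context graded_algebra
begin

text \<open>For \<open>\<kappa> = 0\<close> an odd element anticommutes with \<open>w\<close>, which
  fixes the range of \<open>e\<close>, so its compression vanishes. For \<open>\<kappa> = 1\<close>
  multiplying an odd element by \<open>w\<close> makes it even and gives a scalar corner.\<close>

lemma frame_compress:
  assumes fr: "frame \<kappa> e w" and a: "a \<in> H r"
  obtains k where "\<kappa> = 0 \<Longrightarrow> r = 1 \<Longrightarrow> k = 0"
    "\<And>v. e (a (e v)) = k *\<^sub>C (if r = 0 then e v else w (e v))"
proof -
  note w = frameD[OF fr] and e = frame_e[OF fr]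
  interpret corner "N \<kappa>" e by (rule w)
  consider "r = 1" "\<kappa> = 0" | "a \<in> N \<kappa>" "r = 0" | "r = 1" "\<kappa> = 1"
    using a HomD(1)[OF a] by (cases "r = 0"; cases "\<kappa> = 0") (auto simp: corner_algebra_def)
  then show thesis
  proof cases
    case 1
    have "e (a (e v)) = - e (a (e v))" for v
    proof -
      have we: "w (e x) = e x" for x using w(9)[OF 1(2)] by (rule compose_eqD)
      have "e (a (e v)) = w (e (a (e v)))" by (simp add: we)
      also have "\<dots> = e (w (a (e v)))" by (rule e(5))
      also have "\<dots> = - e (a (w (e v)))" using w(8)[OF a, of "e v"] 1 by (simp add: blinfun.minus_right)
      finally show ?thesis by (simp add: we)
    qed
    then have "e (a (e v)) = 0" for v by (rule eq_neg_imp_0)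
    then show thesis using that[of 0] by simp
  next
    case 2
    then obtain k where "e o\<^sub>L (a o\<^sub>L e) = scale_op k e" using scalar by blast
    then have "e (a (e v)) = k *\<^sub>C e v" for v using compose_eqD[of e "a o\<^sub>L e" _ v] by simp
    then show thesis using that[of k] 2(2) by simp
  next
    case 3
    have "w o\<^sub>L a \<in> H 0" using Hom_compose[OF w(3) a] 3 by simp
    then have "w o\<^sub>L a \<in> N \<kappa>" using 3 by (simp add: corner_algebra_def)
    then obtain k where "e o\<^sub>L ((w o\<^sub>L a) o\<^sub>L e) = scale_op k e" using scalar by blast
    then have "e (w (a (e v))) = k *\<^sub>C e v" for v using compose_eqD[of e "(w o\<^sub>L a) o\<^sub>L e" _ v] by simp
    then have "w (w (e (a (e v)))) = k *\<^sub>C w (e v)" for v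
      using Bounded_opsD[OF w(11)] by (simp only: e(5))
    then show thesis using that[of k] 3 by (simp add: w(6))
  qed
qed

lemma frame_compress_M:
  assumes fr: "frame \<kappa> e w" and a: "a \<in> M"
  obtains k l where "\<And>v. e (a (e v)) = k *\<^sub>C e v + l *\<^sub>C w (e v)"
proof -
  obtain a0 a1 where d: "a0 \<in> H 0" "a1 \<in> H 1" "a = a0 + a1" using Hom_decompose[OF a] by blast
  obtain k where k: "\<And>v. e (a0 (e v)) = k *\<^sub>C e v" using frame_compress[OF fr d(1)] by auto
  obtain l where l: "\<And>v. e (a1 (e v)) = l *\<^sub>C w (e v)" using frame_compress[OF fr d(2)] by (metis zero_neq_one)
  show thesis by (rule that[of k l]) (simp add: d(3) blinfun.add_left blinfun.add_right k l)
qed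

lemma frame_dense_hom:
  assumes fr: "frame \<kappa> e w"
  shows "clspan {blinfun_apply a (e v) | a v r. a \<in> H r} = UNIV" (is "clspan ?D = _")
proof -
  have "{blinfun_apply a (e v) | a v. a \<in> N \<kappa>} \<subseteq> clspan ?D"
  proof
    fix y assume "y \<in> {blinfun_apply a (e v) | a v. a \<in> N \<kappa>}"
    then obtain a :: "'a op" and v where y: "y = a (e v)" and "a \<in> N \<kappa>" by blast
    then have "a \<in> M" using corner_subset by blast
    then obtain a0 a1 where d: "a0 \<in> H 0" "a1 \<in> H 1" "a = a0 + a1" using Hom_decompose by blast
    have "a0 (e v) \<in> clspan ?D" "a1 (e v) \<in> clspan ?D" by (rule clspan_base; use d in blast)+
    then show "y \<in> clspan ?D" unfolding y d(3) blinfun.add_left by (rule subspace_add[OF clspan(2)])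
  qed
  then have "clspan {blinfun_apply a (e v) | a v. a \<in> N \<kappa>} \<subseteq> clspan ?D"
    by (rule clspan_minimal) simp_all
  then show ?thesis using frame_dense[OF fr] by (simp add: top.extremum_unique)
qed

lemma frame_imp_central:
  assumes fr: "frame \<kappa> e w"
  shows "central M (Ad \<Gamma>)"
  unfolding central_def
proof (intro equalityI subsetI)
  interpret corner "N \<kappa>" e by (rule frameD(12)[OF fr])
  fix x assume x: "x \<in> center M \<inter> H 0"
  then have c: "x \<in> commutant M" by (auto simp: center_def)
  have N: "x \<in> N \<kappa>" "id_blinfun \<in> N \<kappa>"
    using even_subset_corner x Hom_id by blast+
  have "\<exists>c. x = scale_op c id_blinfun"
    using commutantD(2)[OF c] corner_subset by (intro commuting_scalar[OF commutantD(1)[OF c] N(1) _ N(2)]) blast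
  then show "x \<in> range (\<lambda>c. scale_op c id_blinfun)" by blast
next
  fix x assume "x \<in> range (\<lambda>c. scale_op c (id_blinfun :: 'a op))"
  then obtain c where x: "x = scale_op c id_blinfun" by blast
  have "x \<in> H 0" unfolding x by (rule Hom_scale[OF Hom_id])
  moreover have "x \<in> commutant M" unfolding x
    by (rule star_algebraD(6)[OF von_neumann_algebraD(4)[OF vN] id_commutant])
  ultimately show "x \<in> center M \<inter> H 0" using HomD(1) by (auto simp: center_def)
qed

text \<open>Below a central projection \<open>z\<close>, the product of \<open>e\<close> and
  \<open>z\<close> is abelian: the corner of \<open>e\<close> consists of combinations of
  \<open>e\<close> and \<open>w e\<close>, which commute. It is nonzero since otherwise
  \<open>z\<close> would vanish on the dense span of \<open>N e\<close>.\<close>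

lemma frame_imp_type_I:
  assumes fr: "frame \<kappa> e w"
  shows "type_I M"
  unfolding type_I_def
proof (intro ballI impI)
  note w = frameD[OF fr] and e = frame_e[OF fr]
  fix z assume z: "z \<in> center M" "projection_op z \<and> z \<noteq> 0"
  note zp = projection_opD[OF conjunct1[OF z(2)]]
  have zM: "z \<in> M" and z': "z \<in> commutant M" using z(1) by (auto simp: center_def)
  have ze: "z (e v) = e (z v)" and zw: "z (w v) = w (z v)" for v
    using commutantD(3)[OF z'] e(6) w(10) by auto
  define f where "f = e o\<^sub>L z"
  have f: "f v = e (z v)" for v by (simp add: f_def)
  have eB: "e (c *\<^sub>C v) = c *\<^sub>C e v" for c v using Bounded_opsD[OF e(3)] .
  have wB: "w (c *\<^sub>C v) = c *\<^sub>C w v" for c v using Bounded_opsD[OF w(11)] .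
  have "f \<in> M" unfolding f_def by (rule algD(4)[OF e(6) zM])
  moreover have "projection_op f"
    using e(3) zp(1) commutantD(2)[OF z' e(6)]
    by (auto simp: projection_op_def f_def e(2) zp(2) intro!: blinfun_eqI simp: ze e(1) zp(4))
  moreover have "f \<noteq> 0"
  proof
    assume "f = 0"
    then have f0: "e (z v) = 0" for v using f[of v] by simp
    have "z = 0"
    proof (rule blinfun_eqI_dense[OF _ frame_dense[OF fr]])
      fix y assume "y \<in> {blinfun_apply a (e v) | a v. a \<in> N \<kappa>}"
      then obtain a :: "'a op" and v where y: "y = a (e v)" and "a \<in> N \<kappa>" by blast
      then have "a \<in> M" using corner_subset by blast
      then show "z y = blinfun_apply 0 y" unfolding y using commutantD(3)[OF z', of a "e v"] by (simp add: ze f0 blinfun.zero_right)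
    qed
    then show False using z(2) by simp
  qed
  moreover have "f o\<^sub>L z = f" by (intro blinfun_eqI) (simp add: f zp(4))
  moreover have "(f o\<^sub>L x o\<^sub>L f) o\<^sub>L (f o\<^sub>L y o\<^sub>L f) = (f o\<^sub>L y o\<^sub>L f) o\<^sub>L (f o\<^sub>L x o\<^sub>L f)"
    if x: "x \<in> M" and y: "y \<in> M" for x y
  proof -
    obtain k l where x': "\<And>v. e (x (e v)) = k *\<^sub>C e v + l *\<^sub>C w (e v)"
      using frame_compress_M[OF fr x] by blast
    obtain m n where y': "\<And>v. e (y (e v)) = m *\<^sub>C e v + n *\<^sub>C w (e v)"
      using frame_compress_M[OF fr y] by blast
    define X Y where "X = f o\<^sub>L x o\<^sub>L f" and "Y = f o\<^sub>L y o\<^sub>L f"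
    have X: "X v = k *\<^sub>C e (z v) + l *\<^sub>C e (w (z v))" for v
      using arg_cong[OF x'[of "z v"], of z] commutantD(3)[OF z' x]
      by (simp add: X_def f blinfun.add_right Bounded_opsD[OF zp(1)] ze zw zp(4) e(5))
    have Y: "Y v = m *\<^sub>C e (z v) + n *\<^sub>C e (w (z v))" for v
      using arg_cong[OF y'[of "z v"], of z] commutantD(3)[OF z' y]
      by (simp add: Y_def f blinfun.add_right Bounded_opsD[OF zp(1)] ze zw zp(4) e(5))
    have "X (Y v) = Y (X v)" for v
      unfolding X Y
      by (simp add: ze zw zp(4) e(1,5) w(6) eB wB blinfun.add_right Bounded_opsD[OF zp(1)] scaleC_add_right
          scaleC_scaleC mult.commute add_ac)
    then have "X o\<^sub>L Y = Y o\<^sub>L X" by (intro blinfun_eqI) simp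
    then show ?thesis by (simp only: X_def Y_def)
  qed
  ultimately show "\<exists>e\<in>M. projection_op e \<and> e \<noteq> 0 \<and> e o\<^sub>L z = e \<and>
    (\<forall>x\<in>M. \<forall>y\<in>M. (e o\<^sub>L x o\<^sub>L e) o\<^sub>L (e o\<^sub>L y o\<^sub>L e) = (e o\<^sub>L y o\<^sub>L e) o\<^sub>L (e o\<^sub>L x o\<^sub>L e))" by blast
qed

end

text \<open>
  A unitary \<open>R\<close> of the range of \<open>e\<close> extends to the operator \<open>a u \<mapsto> a (R u)\<close> in the commutant of
  \<open>S\<close>. Hence \<open>e x e\<close> commutes with all reflections \<open>R\<close>, and every vector in the range of
  \<open>e\<close> is an eigenvector.
\<close>

lemma bicommutant_scalar:
  fixes e :: "'a::chilbert_space op"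
  assumes S: "S \<subseteq> Bounded_ops" "id_blinfun \<in> S" "\<And>a b. a \<in> S \<Longrightarrow> b \<in> S \<Longrightarrow> a o\<^sub>L b \<in> S" "\<And>a. a \<in> S \<Longrightarrow> adj a \<in> S"
    and e: "projection_op e" "e \<in> commutant (commutant S)"
    and scalar: "\<And>a. a \<in> S \<Longrightarrow> \<exists>k. e o\<^sub>L (a o\<^sub>L e) = scale_op k e"
    and x: "x \<in> commutant (commutant S)"
  shows "\<exists>k. e o\<^sub>L (x o\<^sub>L e) = scale_op k e"
proof -
  note eD = projection_opD[OF e(1)]
  have ec: "cinner (e u) v = cinner u (e v)" for u v using cinner_adj[OF eD(1)] eD(2) by simp
  have eigen: "e (x \<zeta>) = cinner \<zeta> (x \<zeta>) *\<^sub>C \<zeta>" if \<zeta>: "e \<zeta> = \<zeta>" "norm \<zeta> = 1" for \<zeta>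
  proof -
    \<comment> \<open>The reflection in the line of \<open>\<zeta>\<close>, a unitary of the range
      of \<open>e\<close> whose eigenvectors for -1 are the multiples of
      \<open>\<zeta>\<close>.\<close>
    define R where "R u = u - (2 * cinner \<zeta> u) *\<^sub>C \<zeta>" for u
    have \<zeta>\<zeta>: "cinner \<zeta> \<zeta> = 1" using \<zeta>(2) by (simp add: cinner_self)
    have eR: "e (R u) = R u" if "e u = u" for u
      using that by (simp add: R_def blinfun.diff_right Bounded_opsD[OF eD(1)] \<zeta>(1))
    have Rc: "cinner (R u) (R v) = cinner u v" for u v
      using cinner_commute[of u \<zeta>]
      by (simp add: R_def cinner_diff_left cinner_diff_right cinner_scaleC_left cinner_scaleC_right \<zeta>\<zeta> algebra_simps)
    define I where "I = S \<times> range e"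
    define D where "D = (\<lambda>(a :: 'a op, u). a u)"
    define F where "F = (\<lambda>(a :: 'a op, u). a (R u))"
    have "F i \<bullet> F j = D i \<bullet> D j" if ij: "i \<in> I" "j \<in> I" for i j
    proof -
      obtain a u b v where i: "i = (a, u)" "j = (b, v)" "a \<in> S" "b \<in> S" "e u = u" "e v = v"
        using ij eD(4) by (auto simp: I_def)
      obtain k where "e o\<^sub>L ((adj a o\<^sub>L b) o\<^sub>L e) = scale_op k e" using scalar[OF S(3)[OF S(4)]] i by blast
      then have k: "e (adj a (b (e y))) = k *\<^sub>C e y" for y
        using compose_eqD[of e "(adj a o\<^sub>L b) o\<^sub>L e" _ y] by simp
      have aB: "a \<in> Bounded_ops" using i S(1) by blast
      have *: "cinner (a y) (b z) = k * cinner y z" if "e y = y" "e z = z" for y z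
        using ec[of y "adj a (b z)"] k[of z] that by (simp add: cinner_adj[OF aB] cinner_scaleC_right)
      have "cinner (a (R u)) (b (R v)) = cinner (a u) (b v)"
        unfolding *[OF eR[OF i(5)] eR[OF i(6)]] *[OF i(5,6)] Rc ..
      then show ?thesis by (simp add: i(1,2) F_def D_def flip: Re_cinner)
    qed
    then obtain V :: "'a op" where V: "\<And>i. i \<in> I \<Longrightarrow> V (D i) = F i"
      "\<And>y. (\<And>i. i \<in> I \<Longrightarrow> y \<bullet> D i = 0) \<Longrightarrow> V y = 0"
      "\<And>x y. x \<in> clspan (D ` I) \<Longrightarrow> y \<in> clspan (D ` I) \<Longrightarrow> V x \<bullet> V y = x \<bullet> y"
      using isometry_extension[of I F D] by blast
    let ?D = "D ` I"
    have DE: "\<exists>a u. d = blinfun_apply a u \<and> a \<in> S \<and> e u = u" if "d \<in> ?D" for d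
      using that eD(4) by (auto simp: I_def D_def)
    have I: "(a, u) \<in> I" if "a \<in> S" "e u = u" for a u
      unfolding I_def using that by (metis SigmaI rangeI)
    have DI: "blinfun_apply a u \<in> ?D" if "a \<in> S" "e u = u" for a u
      using imageI[OF I[OF that], of D] by (simp add: D_def)
    have Va: "V (a u) = a (R u)" if "a \<in> S" "e u = u" for a u
      using V(1)[OF I[OF that]] by (simp add: D_def F_def)
    have V0: "V y = 0" if "\<And>d. d \<in> ?D \<Longrightarrow> y \<bullet> d = 0" for y using V(2) that by blast
    have scale: "c *\<^sub>C d \<in> ?D" "V (c *\<^sub>C d) = c *\<^sub>C V d" if d: "d \<in> ?D" for c d
    proof -
      obtain a u where a: "d = blinfun_apply a u" "a \<in> S" "e u = u" using DE[OF d] by blast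
      have aB: "a (c *\<^sub>C y) = c *\<^sub>C a y" for y using S(1) a(2) Bounded_opsD by blast
      have cu: "e (c *\<^sub>C u) = c *\<^sub>C u" using a(3) by (simp add: Bounded_opsD[OF eD(1)])
      show "c *\<^sub>C d \<in> ?D" using DI[OF a(2) cu] by (simp add: a(1) aB)
      have "R (c *\<^sub>C u) = c *\<^sub>C R u"
        by (simp add: R_def cinner_scaleC_right scaleC_diff_right scaleC_scaleC mult_ac)
      then show "V (c *\<^sub>C d) = c *\<^sub>C V d" using Va[OF a(2) cu] Va[OF a(2,3)] by (simp add: a(1) aB)
    qed
    have "semilinear 0 V" by (rule semilinear_extension[of ?D]) (use scale V0 in auto)
    then have VB: "V \<in> Bounded_ops" by (simp add: Bounded_ops_iff)
    have V': "V \<in> commutant S"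
      unfolding commutant_iff
    proof (intro conjI ballI VB)
      fix b assume b: "b \<in> S"
      show "V o\<^sub>L b = b o\<^sub>L V"
      proof (rule blinfun_eqI_clspan[of ?D])
        fix d assume "d \<in> ?D"
        then obtain a u where a: "d = blinfun_apply a u" "a \<in> S" "e u = u" using DE by blast
        show "(V o\<^sub>L b) d = (b o\<^sub>L V) d"
          using Va[OF S(3)[OF b a(2)] a(3)] Va[OF a(2,3)] by (simp add: a(1))
      next
        fix y assume y: "\<And>d. d \<in> ?D \<Longrightarrow> y \<bullet> d = 0"
        have "b y \<bullet> d = 0" if d: "d \<in> ?D" for d
        proof -
          obtain a u where a: "d = blinfun_apply a u" "a \<in> S" "e u = u" using DE[OF d] by blast
          have "adj b d \<in> ?D" using DI[OF S(3)[OF S(4)[OF b] a(2)] a(3)] by (simp add: a(1))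
          then show ?thesis by (simp add: inner_adj y)
        qed
        then show "(V o\<^sub>L b) y = (b o\<^sub>L V) y" using V0[of y] V0[of "b y"] y by (simp add: blinfun.zero_right)
      qed
    qed
    have Vu: "V u = R u" if "e u = u" for u using Va[OF S(2) that] by simp
    \<comment> \<open>\<open>x\<close> and \<open>e\<close> commute with the extension
      \<open>V\<close>, so \<open>e (x \<zeta>)\<close> is again an eigenvector for -1, hence a
      multiple of \<open>\<zeta>\<close>.\<close>
    have "R \<zeta> = - \<zeta>" using scaleC_add_left[of 1 1 \<zeta>] by (simp add: R_def \<zeta>\<zeta>)
    then have "- e (x \<zeta>) = e (x (V \<zeta>))" by (simp add: Vu[OF \<zeta>(1)] blinfun.minus_right)
    also have "\<dots> = V (e (x \<zeta>))"
      using commutantD(3)[OF x V'] commutantD(3)[OF e(2) V'] by simp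
    also have "\<dots> = R (e (x \<zeta>))" by (rule Vu) (rule eD(4))
    finally have "2 *\<^sub>R e (x \<zeta>) = (2 * cinner \<zeta> (x \<zeta>)) *\<^sub>C \<zeta>"
      using ec[of \<zeta> "x \<zeta>"] \<zeta>(1) by (simp add: R_def scaleR_2 algebra_simps)
    also have "\<dots> = 2 *\<^sub>R (cinner \<zeta> (x \<zeta>) *\<^sub>C \<zeta>)" using scaleC_of_real[of 2] by (simp flip: scaleC_scaleC)
    finally show ?thesis by simp
  qed
  have xB: "x \<in> Bounded_ops" by (rule commutantD(1)[OF x])
  have eig: "\<exists>k. e (x u) = k *\<^sub>C u" if u: "e u = u" for u
  proof (cases "u = 0")
    case False
    let ?\<zeta> = "(1 / norm u) *\<^sub>R u"
    have "e (x ?\<zeta>) = cinner ?\<zeta> (x ?\<zeta>) *\<^sub>C ?\<zeta>" using False u by (intro eigen) (simp_all add: blinfun.scaleR_right)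
    then have "(1 / norm u) *\<^sub>R e (x u) = (1 / norm u) *\<^sub>R (cinner ?\<zeta> (x ?\<zeta>) *\<^sub>C u)"
      by (simp only: blinfun.scaleR_right scaleR_scaleC_commute)
    then have "e (x u) = cinner ?\<zeta> (x ?\<zeta>) *\<^sub>C u" using False by (simp only: scaleR_cancel_left) simp
    then show ?thesis by blast
  qed (simp add: blinfun.zero_right)
  show ?thesis
  proof (cases "e = 0")
    case False
    then obtain y where "e y \<noteq> 0" using blinfun_eqI[of e 0] by auto
    then obtain u where u: "e u = u" "u \<noteq> 0" using eD(4) by blast
    obtain k where k: "e (x u) = k *\<^sub>C u" using eig[OF u(1)] by blast
    \<comment> \<open>Two vectors and their sum are all eigenvectors: either the eigenvalues agree
      or the vectors are proportional.\<close>
    have "e (x v) = k *\<^sub>C v" if v: "e v = v" for v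
    proof -
      obtain l where l: "e (x v) = l *\<^sub>C v" using eig[OF v] by blast
      obtain m where "e (x (u + v)) = m *\<^sub>C (u + v)" using eig[of "u + v"] u v by (auto simp: blinfun.add_right)
      then have *: "(k - m) *\<^sub>C u = (m - l) *\<^sub>C v"
        by (simp add: blinfun.add_right k l scaleC_add_right scaleC_diff_left algebra_simps)
      show ?thesis
      proof (cases "m = l")
        case True
        then show ?thesis using * u(2) l by simp
      next
        case False
        then have "v = ((k - m) / (m - l)) *\<^sub>C u" using arg_cong[OF *, of "\<lambda>y. (1 / (m - l)) *\<^sub>C y"] by (simp add: scaleC_scaleC)
        then show ?thesis by (simp add: Bounded_opsD[OF xB] Bounded_opsD[OF eD(1)] k scaleC_scaleC mult.commute)
      qed
    qed
    then have "e o\<^sub>L (x o\<^sub>L e) = scale_op k e" by (intro blinfun_eqI) (simp add: eD(4))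
    then show ?thesis by blast
  qed simp
qed

section \<open>The frame of the graded tensor product\<close>

locale framed_pair = graded_pair t M1 \<Gamma>1 M2 \<Gamma>2
  for t :: "'a::chilbert_space \<Rightarrow> 'b::chilbert_space \<Rightarrow> 'c::chilbert_space"
    and M1 :: "'a op set" and \<Gamma>1 and M2 :: "'b op set" and \<Gamma>2 +
  fixes \<kappa>1 e1 w1 \<kappa>2 e2 w2
  assumes fr1: "A.frame \<kappa>1 e1 w1" and fr2: "B.frame \<kappa>2 e2 w2"
begin

lemmas w1 = A.frameD[OF fr1]
lemmas w2 = B.frameD[OF fr2]
lemmas e1 = A.frame_e[OF fr1]
lemmas e2 = B.frame_e[OF fr2]

text \<open>The graded tensor product of two odd self-adjoint unitaries is skew-adjoint with square
  -1; the factor \<open>\<i>\<close> repairs both.\<close>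

definition c :: complex where "c = (if \<kappa>1 * \<kappa>2 = 1 then \<i> else 1)"
definition w :: "'c op" where "w = scale_op c (T w1 \<kappa>2 w2)"
definition e0 :: "'c op" where "e0 = T e1 0 e2"
definition e :: "'c op"
  where "e = (if \<kappa>1 * \<kappa>2 = 1 then (1/2) *\<^sub>R (e0 + (w o\<^sub>L e0)) else e0)"
text \<open>Defined in all cases so that the compression argument is uniform. It equals
  \<open>e\<close> when \<open>\<kappa>1 + \<kappa>2 = 0\<close> (\<open>e_f\<close>) and is
  auxiliary otherwise.\<close>

definition f :: "'c op" where "f = (1/2) *\<^sub>R (e0 + (w o\<^sub>L e0))"

lemma c: "c * c = sign (\<kappa>1 * \<kappa>2)" "cnj c * sign (\<kappa>1 * \<kappa>2) = c" "c \<noteq> 0" "conj_pow s c = sign (\<kappa>1 * \<kappa>2 * s) * c"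
  by (cases s; auto simp: c_def)+

lemma w_Hom: "w \<in> C.H (\<kappa>1 + \<kappa>2)"
  unfolding w_def by (rule C.Hom_scale[OF T_Hom[OF w1(3) w2(3)]])

lemma w_S: "w \<in> S" unfolding w_def by (rule S_scale[OF S_I[OF w1(3) w2(3)]])

lemma e0_Hom: "e0 \<in> C.H 0" unfolding e0_def using T_Hom[OF w1(2) w2(2)] by simp

lemma e0_S: "e0 \<in> S" unfolding e0_def by (rule S_I[OF w1(2) w2(2)])

lemma w_apply: "w (t u v) = c *\<^sub>C t (w1 (P \<kappa>2 u)) (w2 v)"
  by (simp add: w_def T_apply[OF w1(11) w2(11)])

lemma e0_apply: "e0 (t u v) = t (e1 u) (e2 v)"
  by (simp add: e0_def T_apply[OF e1(3) e2(3)])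

lemma w_adj: "adj w = w"
  using T_adj[OF w1(3) w2(3)] T_Bounded[OF w1(11) w2(11)] by (simp add: w_def w1(4) w2(4) c(2))

lemma w_w: "w o\<^sub>L w = id_blinfun"
  using T_compose[OF w1(11) w2(11) w1(3) w2(11), of \<kappa>2 \<kappa>2] T_Bounded[OF w1(11) w2(11)]
  by (simp add: w_def w1(5) w2(5) T_id mult.assoc[symmetric] c(1)) (simp add: mult.commute)

lemma e0_e0: "e0 o\<^sub>L e0 = e0"
  by (rule t_eqI) (simp add: e0_apply e1(1) e2(1))

lemma e0_adj: "adj e0 = e0"
  using T_adj[OF w1(2) w2(2)] by (simp add: e0_def e1(2) e2(2))

lemma e0_apply_apply: "e0 (e0 v) = e0 v" using e0_e0 by (rule compose_eqD)

lemma w_apply_apply: "w (w v) = v" using compose_eqD[OF w_w] by simp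

lemma w_T:
  assumes a: "a \<in> A.H r" and b: "b \<in> B.H s"
  shows "w (T a s b v) = sign ((1 + (\<kappa>1 + \<kappa>2)) * (r + s)) *\<^sub>C T a s b (w v)"
proof -
  \<comment> \<open>On the left the signs from moving \<open>w1\<close>, \<open>w2\<close> and the
    attached grading past \<open>a\<close> and \<open>b\<close>; on the right the claimed sign and
    the one from moving the grading attached to \<open>b\<close> past \<open>w1\<close>.\<close>
  have sgn: "sign (\<kappa>2 * r) * sign ((1 + \<kappa>1) * r) * sign ((1 + \<kappa>2) * s) =
      sign ((1 + (\<kappa>1 + \<kappa>2)) * (r + s)) * sign (s * \<kappa>1)"
    unfolding sign_add[symmetric] sign_eq_iff by (cases \<kappa>1; cases \<kappa>2; cases r; cases s) simp_all
  note aB = A.HomD(2)[OF a] and bB = B.HomD(2)[OF b]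
  note lin = Bounded_opsD[OF w1(11)] Bounded_opsD[OF w2(11)] Bounded_opsD[OF aB] Bounded_opsD[OF bB]
    Bounded_opsD[OF T_Bounded[OF aB bB]]
  have "w o\<^sub>L T a s b = scale_op (sign ((1 + (\<kappa>1 + \<kappa>2)) * (r + s))) (T a s b o\<^sub>L w)"
  proof (rule t_eqI)
    fix u v
    have "w (T a s b (t u v)) =
        (c * (sign (\<kappa>2 * r) * sign ((1 + \<kappa>1) * r) * sign ((1 + \<kappa>2) * s))) *\<^sub>C
          t (a (w1 (P (\<kappa>2 + s) u))) (b (w2 v))"
      by (simp add: T_apply[OF aB bB] w_apply P_hom[OF a] lin w1(8)[OF a] w2(8)[OF b] t_scale scaleC_scaleC mult_ac add.commute)
    moreover have "T a s b (w (t u v)) = (c * sign (s * \<kappa>1)) *\<^sub>C t (a (w1 (P (\<kappa>2 + s) u))) (b (w2 v))"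
      by (simp add: T_apply[OF aB bB] w_apply P_hom[OF w1(3)] lin t_scale scaleC_scaleC add.commute)
    ultimately show "(w o\<^sub>L T a s b) (t u v) = scale_op (sign ((1 + (\<kappa>1 + \<kappa>2)) * (r + s))) (T a s b o\<^sub>L w) (t u v)"
      unfolding sgn by (simp add: scaleC_scaleC mult_ac)
  qed
  from compose_eqD[OF this, of v] show ?thesis by simp
qed

text \<open>The relation is known on generators. It reaches the bicommutant by correcting
  \<open>w\<close> to an element of the commutant of \<open>S\<close>.\<close>

lemma w_comm:
  assumes x: "x \<in> C.H r"
  shows "w (x v) = sign ((1 + (\<kappa>1 + \<kappa>2)) * r) *\<^sub>C x (w v)"
proof -
  \<comment> \<open>When \<open>\<kappa>1 + \<kappa>2 = 0\<close>, both \<open>w\<close> and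
    \<open>\<Gamma>\<close> implement the grading on generators, so their product commutes with
    these; otherwise \<open>w\<close> already does.\<close>
  define k where "k = (if \<kappa>1 + \<kappa>2 = 1 then id_blinfun else \<Gamma>)"
  note wB = C.HomD(2)[OF w_Hom]
  have kB: "k \<in> Bounded_ops" and kk: "k (k v) = v" for v using C.\<Gamma>D by (auto simp: k_def)
  have kx: "k (x v) = sign ((1 + (\<kappa>1 + \<kappa>2)) * r) *\<^sub>C x (k v)" if "x \<in> C.H r" for x r v
    using C.HomD(3)[OF that] by (cases "\<kappa>1 + \<kappa>2 = 1") (auto simp: k_def)
  have "k o\<^sub>L w \<in> commutant S"
  proof (rule commutantI)
    fix y v assume "y \<in> S"
    then obtain a r b s where y: "a \<in> A.H r" "b \<in> B.H s" "y = T a s b" unfolding S_iff by blast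
    show "(k o\<^sub>L w) (y v) = y ((k o\<^sub>L w) v)"
      unfolding y(3) by (simp add: w_T[OF y(1,2)] kx[OF T_Hom[OF y(1,2)]] Bounded_opsD[OF kB] scaleC_scaleC)
  qed (use kB wB in simp)
  moreover have "x \<in> commutant (commutant S)" using C.HomD(1)[OF x] by (simp add: M_eq)
  ultimately have "x (k (w v)) = k (w (x v))" using commutantD(3)[of x _ "k o\<^sub>L w" v] by simp
  then have "k (k (w (x v))) = sign ((1 + (\<kappa>1 + \<kappa>2)) * r) *\<^sub>C x (k (k (w v)))"
    using kx[OF x, of "k (w v)"] by simp
  then show ?thesis by (simp add: kk)
qed

lemma e0_w: "w (e0 v) = e0 (w v)" using w_comm[OF e0_Hom] by simp

lemma f_apply: "f v = (1/2) *\<^sub>R (e0 v + w (e0 v))"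
  by (simp add: f_def blinfun.scaleR_left blinfun.add_left)

lemma fD: "w (f v) = f v" "f (w v) = f v" "e0 (f v) = f v" "f (e0 v) = f v" "f (f v) = f v"
proof -
  show 1: "w (f v) = f v" and 2: "f (w v) = f v" and 3: "e0 (f v) = f v" and "f (e0 v) = f v" for v
    by (simp_all add: f_apply blinfun.scaleR_right blinfun.add_right w_apply_apply e0_apply_apply
        add.commute flip: e0_w)
  have "f (f v) = (1/2) *\<^sub>R (f v + f v)" unfolding f_apply[of "f v"] by (simp add: 1 3)
  then show "f (f v) = f v" by (simp flip: scaleR_2)
qed

lemma e_f: "\<kappa>1 + \<kappa>2 = 0 \<Longrightarrow> e = f"
proof (cases "\<kappa>1 = 0")
  case True
  assume "\<kappa>1 + \<kappa>2 = 0"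
  then have \<kappa>: "\<kappa>1 = 0" "\<kappa>2 = 0" using True by simp_all
  have we: "w1 (e1 u) = e1 u" "w2 (e2 v) = e2 v" for u v
    using compose_eqD[OF w1(9)[OF \<kappa>(1)]] compose_eqD[OF w2(9)[OF \<kappa>(2)]] by blast+
  have P: "P \<kappa>2 = id_blinfun" and c: "c = 1" by (simp_all only: c_def) (simp_all add: \<kappa>)
  have "w o\<^sub>L e0 = e0" by (rule t_eqI) (simp add: w_apply e0_apply P c we)
  then have "f = e0" by (simp add: f_def flip: scaleR_2)
  moreover have "e = e0" by (simp only: e_def) (simp add: \<kappa>)
  ultimately show ?thesis by simp
next
  case False
  assume "\<kappa>1 + \<kappa>2 = 0"
  then show ?thesis using False unfolding e_def f_def by (cases \<kappa>2) auto
qed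

lemma f_M: "f \<in> M"
  unfolding f_def
  by (rule C.algD(9)[OF C.algD(3)[OF S_M[OF e0_S] C.algD(4)[OF S_M[OF w_S] S_M[OF e0_S]]]])

lemma f_proj: "projection_op f"
proof -
  have "adj f = f"
    using blinfun_eqI[of "w o\<^sub>L e0" "e0 o\<^sub>L w"] e0_w by (simp add: f_def e0_adj w_adj)
  moreover have "f o\<^sub>L f = f" by (rule blinfun_eqI) (simp add: fD)
  ultimately show ?thesis using C.algD(1)[OF f_M] by (simp add: projection_op_def)
qed

text \<open>Compressing a generator leaves a tensor product whose factors carry 1 or
  \<open>w1\<close> and 1 or \<open>w2\<close>. The surviving combinations are multiples of
  \<open>e0\<close> or of \<open>w e0\<close>, and \<open>f\<close> absorbs
  \<open>w\<close>.\<close>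

lemma S_scalar:
  assumes x: "x \<in> S"
  shows "\<exists>k. f o\<^sub>L (x o\<^sub>L f) = scale_op k f"
proof -
  obtain a r b s where ab: "a \<in> A.H r" "b \<in> B.H s" and x: "x = T a s b" using x unfolding S_iff by blast
  note aB = A.HomD(2)[OF ab(1)] and bB = B.HomD(2)[OF ab(2)]
  have xH: "x \<in> C.H (r + s)" unfolding x by (rule T_Hom[OF ab])
  have fB: "f \<in> Bounded_ops" using C.algD(1)[OF f_M] .
  obtain k1 where k1: "\<kappa>1 = 0 \<Longrightarrow> r = 1 \<Longrightarrow> k1 = 0"
    "\<And>v. e1 (a (e1 v)) = k1 *\<^sub>C (if r = 0 then e1 v else w1 (e1 v))"
    using A.frame_compress[OF fr1 ab(1)] by blast
  obtain k2 where k2: "\<kappa>2 = 0 \<Longrightarrow> s = 1 \<Longrightarrow> k2 = 0"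
    "\<And>v. e2 (b (e2 v)) = k2 *\<^sub>C (if s = 0 then e2 v else w2 (e2 v))"
    using B.frame_compress[OF fr2 ab(2)] by blast
  have e0x: "e0 (x (e0 (t u v))) =
      (k1 * k2) *\<^sub>C t (if r = 0 then e1 (P s u) else w1 (e1 (P s u))) (if s = 0 then e2 v else w2 (e2 v))" for u v
  proof -
    have "P s (e1 u) = e1 (P s u)" using P_hom[OF w1(2), of s u] by simp
    then show ?thesis
      by (simp only: e0_apply x T_apply[OF aB bB] k1(2) k2(2) t_scale scaleC_scaleC mult.commute[of k2 k1])
  qed
  have fin: "\<exists>k. f o\<^sub>L (x o\<^sub>L f) = scale_op k f" if "\<And>v. f (e0 (x (e0 (f v)))) = k *\<^sub>C f v" for k
    using that by (intro exI[of _ k] blinfun_eqI) (simp add: fD)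
  \<comment> \<open>In the first case the generator anticommutes with \<open>w\<close>, which
    \<open>f\<close> absorbs on both sides. Degrees outside the listed cases have a vanishing factor
    \<open>k1\<close> or \<open>k2\<close>.\<close>
  consider "\<kappa>1 + \<kappa>2 = 0" "r + s = 1" | "k1 * k2 = 0" | "r = 0" "s = 0" | "r = \<kappa>1" "s = \<kappa>2"
    using k1(1) k2(1) by (cases \<kappa>1; cases \<kappa>2; cases r; cases s) auto
  then show ?thesis
  proof cases
    case 1
    have "f (x (f v)) = - f (x (f v))" for v
      using w_comm[OF xH, of "f v"] fD(2)[of "x (f v)"] 1 by (simp add: fD blinfun.minus_right)
    then have "f (x (f v)) = 0" for v by (rule eq_neg_imp_0)
    then show ?thesis by (intro fin[of 0]) (simp add: fD)
  next
    case 2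
    then have "e0 o\<^sub>L x o\<^sub>L e0 = 0" by (intro t_eqI) (simp only: blinfun_apply_blinfun_compose e0x, simp)
    then have "e0 (x (e0 v)) = 0" for v using compose_eqD[of "e0 o\<^sub>L x" e0 0 v] by simp
    then show ?thesis by (intro fin[of 0]) (simp only:, simp add: blinfun.zero_right)
  next
    case 3
    then have "e0 o\<^sub>L x o\<^sub>L e0 = scale_op (k1 * k2) e0"
      by (intro t_eqI) (simp only: blinfun_apply_blinfun_compose e0x, simp add: e0_apply)
    then have "e0 (x (e0 v)) = (k1 * k2) *\<^sub>C e0 v" for v using compose_eqD[of "e0 o\<^sub>L x" e0 _ v] by simp
    then show ?thesis by (intro fin[of "k1 * k2"]) (simp only:, simp add: Bounded_opsD[OF fB] fD)
  next
    case 4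
    have we: "(if r = 0 then e1 u else w1 (e1 u)) = w1 (e1 u)" "(if s = 0 then e2 v else w2 (e2 v)) = w2 (e2 v)" for u v
      using compose_eqD[OF w1(9)] compose_eqD[OF w2(9)] 4 by auto
    have "e0 o\<^sub>L x o\<^sub>L e0 = scale_op (k1 * k2 / c) (w o\<^sub>L e0)"
    proof (rule t_eqI)
      fix u v
      have Pe: "e1 (P s u) = P s (e1 u)" using P_hom[OF w1(2), of s u] by simp
      show "(e0 o\<^sub>L x o\<^sub>L e0) (t u v) = scale_op (k1 * k2 / c) (w o\<^sub>L e0) (t u v)"
        by (simp only: blinfun_apply_blinfun_compose e0x we) (simp add: w_apply e0_apply scaleC_scaleC c(3) Pe[unfolded 4] 4)
    qed
    then have "e0 (x (e0 v)) = (k1 * k2 / c) *\<^sub>C w (e0 v)" for v using compose_eqD[of "e0 o\<^sub>L x" e0 _ v] by simp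
    then show ?thesis by (intro fin[of "k1 * k2 / c"]) (simp only:, simp add: Bounded_opsD[OF fB] fD)
  qed
qed

lemma M_scalar: "x \<in> M \<Longrightarrow> \<exists>k. f o\<^sub>L (x o\<^sub>L f) = scale_op k f"
  using f_M unfolding M_eq
  by (intro bicommutant_scalar[OF S_Bounded S_id S_compose S_adj f_proj _ S_scalar]) assumption+

lemma dense_e0: "clspan {blinfun_apply x (e0 v) | x v. x \<in> S} = UNIV"
proof -
  have "{t x y | x y. x \<in> {blinfun_apply a (e1 v) | a v r. a \<in> A.H r} \<and>
      y \<in> {blinfun_apply b (e2 v) | b v s. b \<in> B.H s}} \<subseteq> {blinfun_apply x (e0 v) | x v. x \<in> S}"
  proof clarify
    fix a u r b v s assume ab: "a \<in> A.H r" "b \<in> B.H s"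
    have "t (a (e1 u)) (b (e2 v)) = T a s b (e0 (t (P s u) v))"
      using P_hom[OF w1(2), of s "P s u"] by (simp add: e0_apply T_apply[OF A.HomD(2)[OF ab(1)] B.HomD(2)[OF ab(2)]])
    then show "\<exists>x y. t (a (e1 u)) (b (e2 v)) = blinfun_apply x (e0 y) \<and> x \<in> S" using S_I[OF ab] by blast
  qed
  from closure_mono[OF span_mono[OF this]] show ?thesis
    unfolding t_dense_product[OF A.frame_dense_hom[OF fr1] B.frame_dense_hom[OF fr2]] by (simp add: top.extremum_unique)
qed

lemma dense_e: "clspan {blinfun_apply x (e v) | x v. x \<in> S} = UNIV" (is "clspan ?D = _")
proof (cases "\<kappa>1 * \<kappa>2 = 1")
  case True
  then have \<kappa>: "\<kappa>1 = 1" "\<kappa>2 = 1" by (cases \<kappa>1; cases \<kappa>2; simp)+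
  then have ef: "e = f" by (intro e_f) simp
  \<comment> \<open>\<open>z\<close> anticommutes with \<open>w\<close> and commutes with
    \<open>e0\<close>, so it exchanges the two halves into which \<open>w\<close> cuts
    \<open>e0\<close>; the discarded half is recovered as \<open>z e z\<close>.\<close>
  define z where "z = T w1 0 id_blinfun"
  have zH: "z \<in> C.H 1" and zS: "z \<in> S"
    using T_Hom[OF w1(3) B.Hom_id] S_I[OF w1(3) B.Hom_id] \<kappa> by (simp_all add: z_def)
  have z_apply: "z (t u v) = t (w1 u) v" for u v by (simp add: z_def T_apply[OF w1(11)])
  have "z o\<^sub>L z = id_blinfun" by (rule t_eqI) (simp add: z_apply w1(6))
  then have zz: "z (z v) = v" for v using compose_eqD[of z z _ v] by simp
  have "z o\<^sub>L e0 = e0 o\<^sub>L z" by (rule t_eqI) (simp add: z_apply e0_apply e1(5))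
  then have ze: "z (e0 v) = e0 (z v)" for v using compose_eqD[of z e0 _ v] by simp
  have zw: "w (z v) = - z (w v)" for v using w_comm[OF zH] \<kappa> by simp
  have e0: "e0 v = e v + z (e (z v))" for v
  proof -
    have "z (e (z v)) = (1/2) *\<^sub>R (e0 v - w (e0 v))"
      by (simp add: ef f_apply blinfun.scaleR_right blinfun.add_right zw zz blinfun.diff_right flip: ze)
    then show ?thesis by (simp add: ef f_apply flip: scaleR_add_right)
  qed
  have "{blinfun_apply x (e0 v) | x v. x \<in> S} \<subseteq> clspan ?D"
  proof clarify
    fix x v assume x: "x \<in> S"
    have "x (e v) \<in> clspan ?D" "(x o\<^sub>L z) (e (z v)) \<in> clspan ?D"
      by (rule clspan_base; use x S_compose[OF x zS] in blast)+
    then show "x (e0 v) \<in> clspan ?D" unfolding e0[of v] blinfun.add_right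
      by (intro subspace_add[OF clspan(2)]) simp_all
  qed
  then have "clspan {blinfun_apply x (e0 v) | x v. x \<in> S} \<subseteq> clspan ?D" by (rule clspan_minimal) simp_all
  then show ?thesis unfolding dense_e0 by (simp add: top.extremum_unique)
qed (use dense_e0 in \<open>simp only: e_def if_False\<close>)

lemma e_S_eq: "e = (if \<kappa>1 * \<kappa>2 = 1 then f else e0)" by (simp add: e_def f_def)

lemma e_Hom: "e \<in> C.H 0"
proof (cases "\<kappa>1 * \<kappa>2 = 1")
  case True
  then have "\<kappa>1 + \<kappa>2 = 0" by (cases \<kappa>1; cases \<kappa>2) simp_all
  then have "w \<in> C.H 0" using w_Hom by metis
  then have "e0 + (w o\<^sub>L e0) \<in> C.H 0" using C.Hom_add[OF e0_Hom] C.Hom_compose[OF _ e0_Hom] by fastforce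
  then have "scale_op (of_real (1/2)) (e0 + (w o\<^sub>L e0)) \<in> C.H 0" by (rule C.Hom_scale)
  then have "f \<in> C.H 0" unfolding scale_op_of_real f_def .
  then show ?thesis using True e_S_eq by metis
qed (use e0_Hom in \<open>simp only: e_S_eq if_False\<close>)

theorem frame: "C.frame (\<kappa>1 + \<kappa>2) e w"
proof -
  let ?\<kappa> = "\<kappa>1 + \<kappa>2"
  let ?N = "C.N ?\<kappa>"
  have eN: "e \<in> ?N" using C.even_subset_corner e_Hom by blast
  have "e = f \<or> e = e0" using e_S_eq by metis
  moreover have "projection_op e0"
    using e0_adj e0_e0 C.HomD(2)[OF e0_Hom] by (simp add: projection_op_def)
  ultimately have proj: "projection_op e" using f_proj by metis
  have e_ne: "e \<noteq> 0"
  proof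
    assume "e = 0"
    then have "{blinfun_apply x (e v) | x v. x \<in> S} \<subseteq> {0}" by (auto simp: blinfun.zero_right)
    then have "clspan {blinfun_apply x (e v) | x v. x \<in> S} \<subseteq> {0}" by (rule clspan_minimal) simp_all
    then show False using nonzero_space[where 'a='c] unfolding dense_e by auto
  qed
  have scalar: "\<exists>k. e o\<^sub>L (x o\<^sub>L e) = scale_op k e" if x: "x \<in> ?N" for x
  proof (cases "?\<kappa> = 0")
    case True
    have "x \<in> M" using x C.corner_subset by blast
    then show ?thesis unfolding e_f[OF True] by (rule M_scalar)
  next
    case False
    then have \<kappa>: "?\<kappa> = 1" by simp
    have e: "e = e0" using \<kappa> e_S_eq by (cases \<kappa>1; cases \<kappa>2) auto
    have xH: "x \<in> C.H 0" using x \<kappa> by (simp add: corner_algebra_def)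
    have wH: "w \<in> C.H 1" using w_Hom \<kappa> by simp
    have wx: "w (x v) = x (w v)" for v using w_comm[OF xH] by simp
    \<comment> \<open>\<open>M_scalar\<close> concerns \<open>f\<close> and not \<open>e0\<close>.
      It gives an identity for \<open>y + w y\<close>; conjugating with \<open>\<Gamma>\<close>,
      which flips the odd \<open>w\<close>, gives one for \<open>y - w y\<close>, and the sum
      determines \<open>y\<close>.\<close>
    obtain k where k: "f o\<^sub>L (x o\<^sub>L f) = scale_op k f" using M_scalar[OF C.HomD(1)[OF xH]] by blast
    define y where "y = e0 o\<^sub>L (x o\<^sub>L e0)"
    have y: "y \<in> C.H 0"
      using C.Hom_compose[OF e0_Hom C.Hom_compose[OF xH e0_Hom]] by (simp add: y_def)
    have fxf: "f (x (f v)) = (1/2) *\<^sub>R (y v + w (y v))" for v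
    proof -
      have "f (x (w u)) = f (x u)" for u using fD(2)[of "x u"] by (simp add: wx)
      then have "f (x (f v)) = (1/2) *\<^sub>R (f (x (e0 v)) + f (x (e0 v)))"
        unfolding f_apply[of v] blinfun.scaleR_right blinfun.add_right by simp
      then show ?thesis by (simp add: f_apply y_def flip: scaleR_2)
    qed
    have 1: "y v + w (y v) = k *\<^sub>C (e0 v + w (e0 v))" for v
    proof -
      have "(1/2) *\<^sub>R (y v + w (y v)) = (1/2) *\<^sub>R (k *\<^sub>C (e0 v + w (e0 v)))"
        unfolding fxf[symmetric] using compose_eqD[OF k, of v] by (simp add: f_apply scaleR_scaleC_commute)
      then show ?thesis by (simp only: scaleR_cancel_left) simp
    qed
    have \<Gamma>w: "\<Gamma> (w v) = - w (\<Gamma> v)" for v using C.HomD(3)[OF wH] by simp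
    have \<Gamma>\<Gamma>: "\<Gamma> (\<Gamma> v) = v" for v by (rule sa_unitaryD(4)[OF \<Gamma>])
    have 2: "y v - w (y v) = k *\<^sub>C (e0 v - w (e0 v))" for v
      using arg_cong[OF 1[of "\<Gamma> v"], of \<Gamma>] C.HomD(3)[OF y] C.HomD(3)[OF e0_Hom]
      by (simp add: \<Gamma>w \<Gamma>\<Gamma> blinfun.add_right Bounded_opsD[OF C.\<Gamma>D(1)])
    have "y v = k *\<^sub>C e0 v" for v
    proof -
      have "(y v + w (y v)) + (y v - w (y v)) = k *\<^sub>C (e0 v + w (e0 v)) + k *\<^sub>C (e0 v - w (e0 v))"
        unfolding 1 2 ..
      then have "2 *\<^sub>R y v = 2 *\<^sub>R (k *\<^sub>C e0 v)"
        by (simp add: scaleR_2 scaleC_add_right scaleC_diff_right)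
      then show ?thesis by simp
    qed
    then show ?thesis unfolding e y_def by (intro exI[of _ k] blinfun_eqI) simp
  qed
  have full: "x = 0" if x: "x \<in> ?N" and 0: "\<And>a. a \<in> ?N \<Longrightarrow> x o\<^sub>L (a o\<^sub>L e) = 0" for x
  proof (rule blinfun_eqI_dense[OF _ dense_e])
    fix d assume "d \<in> {blinfun_apply a (e v) | a v. a \<in> S}"
    then obtain a v where d: "d = blinfun_apply a (e v)" "a \<in> S" by blast
    obtain r where aH: "a \<in> C.H r" using d(2) T_Hom unfolding S_iff by blast
    have 0: "x (a (e v)) = 0" if "a \<in> ?N" for a using compose_eqD[OF 0[OF that], of v] by simp
    \<comment> \<open>A generator outside the corner algebra is odd with
      \<open>?\<kappa> = 1\<close>; then \<open>w o\<^sub>L a\<close> is even, and the invertible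
      \<open>w\<close> can be cancelled since it commutes with the even \<open>x\<close>.\<close>
    have "x (a (e v)) = 0"
    proof (cases "a \<in> ?N")
      case False
      then have \<kappa>: "?\<kappa> = 1" "r = 1" using aH C.HomD(1)[OF aH] by (cases ?\<kappa>; cases r; auto simp: corner_algebra_def)+
      have "w o\<^sub>L a \<in> C.H (?\<kappa> + r)" by (rule C.Hom_compose[OF w_Hom aH])
      then have "w o\<^sub>L a \<in> ?N" using \<kappa> C.even_subset_corner by auto
      then have "x (w (a (e v))) = 0" using 0[of "w o\<^sub>L a"] by simp
      moreover have "x \<in> C.H 0" using x \<kappa>(1) by (simp add: corner_algebra_def)
      ultimately have "w (x (a (e v))) = 0" using w_comm[of x 0] by simp
      then show ?thesis using w_apply_apply[of "x (a (e v))"] by (simp add: blinfun.zero_right)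
    qed (rule 0)
    then show "x d = blinfun_apply 0 d" by (simp add: d)
  qed
  have mf: "minimal_full ?N e" unfolding minimal_full_def using eN proj e_ne scalar full by blast
  have comm: "w o\<^sub>L x = scale_op (sign ((1 + ?\<kappa>) * r)) (x o\<^sub>L w)" if "x \<in> C.H r" for r x
    by (rule blinfun_eqI) (simp add: w_comm[OF that])
  have "w o\<^sub>L e = e" if "?\<kappa> = 0" using e_f[OF that] fD(1) by (intro blinfun_eqI) simp
  then show ?thesis
    unfolding C.frame_def using mf e_Hom w_Hom w_adj w_w comm by blast
qed

end

section \<open>Automorphisms are determined by the generators\<close>

context framed_pair
begin

text \<open>Compressing \<open>x\<close> between generators gives a combination of \<open>e\<close>
  and \<open>w e\<close>, both fixed by \<open>\<gamma>\<close>. Hence \<open>\<gamma> x - x\<close>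
  has vanishing matrix coefficients on a dense set of vectors; continuity of \<open>\<gamma>\<close>
  is not involved.\<close>

lemma star_iso_fixed:
  assumes \<gamma>: "star_iso 0 M M \<gamma>" and S: "\<And>x. x \<in> S \<Longrightarrow> \<gamma> x = x" and x: "x \<in> M"
  shows "\<gamma> x = x"
proof -
  note iso = star_isoD[OF \<gamma>] and alg = C.algD and SM = S_M
  have w: "\<gamma> w = w" by (rule S[OF w_S])
  have eM: "e \<in> M" by (rule C.HomD(1)[OF e_Hom])
  have wM: "w \<in> M" by (rule S_M[OF w_S])
  have e: "\<gamma> e = e"
  proof -
    have we: "w o\<^sub>L e0 \<in> S" by (rule S_compose[OF w_S e0_S])
    have "f = scale_op (of_real (1/2)) (e0 + (w o\<^sub>L e0))" by (simp only: f_def scale_op_of_real)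
    moreover have "\<gamma> (scale_op (of_real (1/2)) (e0 + (w o\<^sub>L e0))) = scale_op (of_real (1/2)) (e0 + (w o\<^sub>L e0))"
      using iso(8)[OF alg(3)[OF SM[OF e0_S] SM[OF we]]] iso(5)[OF SM[OF e0_S] SM[OF we]] S[OF e0_S] S[OF we] by simp
    ultimately have "\<gamma> f = f" by simp
    then show ?thesis using S[OF e0_S] e_S_eq by metis
  qed
  note ed = C.frame_e[OF frame]
  define y where "y = \<gamma> x - x"
  have zero: "e (adj a (y (b (e v)))) = 0" if ab: "a \<in> S" "b \<in> S" for a b v
  proof -
    note adjS = S_adj[OF ab(1)]
    have xM: "adj a o\<^sub>L (x o\<^sub>L b) \<in> M" by (intro alg SM ab x adjS)
    obtain k l where kl: "\<And>v. e ((adj a o\<^sub>L (x o\<^sub>L b)) (e v)) = k *\<^sub>C e v + l *\<^sub>C w (e v)"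
      using C.frame_compress_M[OF frame xM] by blast
    have 1: "e o\<^sub>L ((adj a o\<^sub>L (x o\<^sub>L b)) o\<^sub>L e) = scale_op k e + scale_op l (w o\<^sub>L e)"
      by (rule blinfun_eqI) (use kl in \<open>simp add: blinfun.add_left\<close>)
    have "\<gamma> (e o\<^sub>L ((adj a o\<^sub>L (x o\<^sub>L b)) o\<^sub>L e)) = e o\<^sub>L ((adj a o\<^sub>L (\<gamma> x o\<^sub>L b)) o\<^sub>L e)"
      using iso(6)[OF eM alg(4)[OF xM eM]] iso(6)[OF xM eM] iso(6)[OF SM[OF adjS] alg(4)[OF x SM[OF ab(2)]]]
        iso(6)[OF x SM[OF ab(2)]] by (simp add: e S[OF adjS] S[OF ab(2)])
    moreover have "\<gamma> (scale_op k e + scale_op l (w o\<^sub>L e)) = scale_op k e + scale_op l (w o\<^sub>L e)"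
      using iso(5)[OF alg(6)[OF eM] alg(6)[OF alg(4)[OF wM eM]]] iso(8)[OF eM] iso(8)[OF alg(4)[OF wM eM]]
        iso(6)[OF wM eM] by (simp add: e w)
    ultimately have "e o\<^sub>L ((adj a o\<^sub>L (\<gamma> x o\<^sub>L b)) o\<^sub>L e) = e o\<^sub>L ((adj a o\<^sub>L (x o\<^sub>L b)) o\<^sub>L e)"
      using 1 by simp
    from compose_eqD[OF this, of v] show ?thesis by (simp add: y_def blinfun.diff_left blinfun.diff_right)
  qed
  have "y = 0"
  proof (rule blinfun_eqI_dense[OF _ dense_e])
    fix d assume "d \<in> {blinfun_apply b (e v) | b v. b \<in> S}"
    then obtain b v where d: "d = blinfun_apply b (e v)" "b \<in> S" by blast
    have "y d \<bullet> d' = 0" if "d' \<in> {blinfun_apply b (e v) | b v. b \<in> S}" for d'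
    proof -
      obtain a u where d': "d' = blinfun_apply a (e u)" "a \<in> S"
        using \<open>d' \<in> {blinfun_apply b (e v) | b v. b \<in> S}\<close> by blast
      have "y d \<bullet> d' = e (adj a (y d)) \<bullet> u"
        unfolding d'(1) using inner_adj2[of "y d" a "e u"] inner_adj2[of "adj a (y d)" e u] ed(2) by simp
      then show ?thesis using zero[OF d'(2) d(2)] by (simp add: d(1))
    qed
    then have "y d \<bullet> y d = 0" by (rule clspan_orth) (assumption, unfold dense_e, rule UNIV_I)
    then show "y d = blinfun_apply 0 d" by simp
  qed
  then show ?thesis by (simp add: y_def)
qed

lemma star_iso_agree:
  assumes \<beta>: "star_iso s M M \<beta>" "star_iso s M M \<beta>'" and S: "\<And>x. x \<in> S \<Longrightarrow> \<beta> x = \<beta>' x" and x: "x \<in> M"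
  shows "\<beta> x = \<beta>' x"
proof -
  note iso = star_isoD[OF \<beta>(1)] and iso' = star_isoD[OF \<beta>(2)]
  have "star_iso (s + s) M M (inv_into M \<beta> \<circ> \<beta>')"
    by (rule star_iso_compose[OF \<beta>(2) star_iso_inv[OF \<beta>(1) C.M_star]])
  then have \<gamma>: "star_iso 0 M M (inv_into M \<beta> \<circ> \<beta>')" by simp
  have fix_S: "(inv_into M \<beta> \<circ> \<beta>') y = y" if "y \<in> S" for y
    using inv_into_f_f[OF iso(2) S_M[OF that]] by (simp flip: S[OF that])
  have "\<beta>' x \<in> \<beta> ` M" using iso'(4)[OF x] by (simp only: iso(3))
  from f_inv_into_f[OF this] show ?thesis using star_iso_fixed[OF \<gamma> fix_S x] by simp
qed

end

section \<open>The action on the graded tensor product\<close>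

locale indexed_pair = framed_pair t M1 \<Gamma>1 M2 \<Gamma>2 \<kappa>1 e1 w1 \<kappa>2 e2 w2 +
    A: graded_system M1 \<Gamma>1 G p \<alpha>1 + B: graded_system M2 \<Gamma>2 G p \<alpha>2
  for t :: "'a::chilbert_space \<Rightarrow> 'b::chilbert_space \<Rightarrow> 'c::chilbert_space"
    and M1 :: "'a op set" and \<Gamma>1 and M2 :: "'b op set" and \<Gamma>2 and \<kappa>1 e1 w1 \<kappa>2 e2 w2
    and G :: "('g, 'm) monoid_scheme" (structure) and p \<alpha>1 \<alpha>2 +
  fixes q1 v1 \<upsilon>1 q2 v2 \<upsilon>2
  assumes d1: "A.index_data \<kappa>1 q1 e1 w1 v1 \<upsilon>1" and d2: "B.index_data \<kappa>2 q2 e2 w2 v2 \<upsilon>2"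
begin

abbreviation \<alpha> :: "'g \<Rightarrow> 'c op \<Rightarrow> 'c op" where "\<alpha> \<equiv> graded_tensor_action p t M1 \<Gamma>1 \<alpha>1 M2 \<Gamma>2 \<alpha>2"

text \<open>The automorphism is conjugation by a tensor product of spatial implementers;
  \<open>bicommutant_Ad\<close> extends invariance from \<open>S\<close> to
  \<open>M\<close>.\<close>

lemma tensor_automorphism:
  assumes g: "g \<in> carrier G"
  obtains \<beta> where "star_iso (p g) M M \<beta>"
    "\<And>r s a b. a \<in> A.H r \<Longrightarrow> b \<in> B.H s \<Longrightarrow> \<beta> (T a s b) = T (\<alpha>1 g a) s (\<alpha>2 g b)"
proof -
  obtain V1 r1 where V1: "unitary_op (p g) V1" "\<And>x. x \<in> M1 \<Longrightarrow> V1 o\<^sub>L x = \<alpha>1 g x o\<^sub>L V1"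
    "V1 o\<^sub>L \<Gamma>1 = scale_op (sign r1) (\<Gamma>1 o\<^sub>L V1)" using A.spatial_implementation[OF d1 g] by blast
  obtain V2 where V2: "unitary_op (p g) V2" "\<And>x. x \<in> M2 \<Longrightarrow> V2 o\<^sub>L x = \<alpha>2 g x o\<^sub>L V2"
    using B.spatial_implementation[OF d2 g] by blast
  \<comment> \<open>\<open>V1\<close> commutes with \<open>\<Gamma>1\<close> only up to
    \<open>sign r1\<close>, which costs a sign depending on the degree of \<open>b\<close>; this
    power of \<open>\<Gamma>2\<close> produces the same sign and cancels it.\<close>
  define Z where "Z = (if r1 = 0 then id_blinfun else \<Gamma>2)"
  have Zb: "Z (b v) = sign (r1 * s) *\<^sub>C b (Z v)" if "b \<in> B.H s" for b s v
    using B.HomD(3)[OF that] by (auto simp: Z_def)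
  have "unitary_op 0 Z"
    using sa_unitaryD(5)[OF B.\<Gamma>] by (auto simp: Z_def unitary_op_def semilinear_def)
  then have U: "unitary_op (p g) (V2 o\<^sub>L Z)" using unitary_op_compose[OF V2(1)] by fastforce
  define V where "V = op_tensor t V1 (V2 o\<^sub>L Z)"
  have V: "unitary_op (p g) V" unfolding V_def by (rule op_tensor_unitary[OF V1(1) U])
  have V_apply: "V (t u v) = t (V1 u) (V2 (Z v))" for u v
    unfolding V_def using op_tensor_apply[OF unitary_opD(1)[OF V1(1)] unitary_opD(1)[OF U]] by simp
  have V1P: "V1 (P s u) = sign (r1 * s) *\<^sub>C P s (V1 u)" for s u
    using compose_eqD[OF V1(3), of u] by (auto simp: P_def)
  have AdT: "Ad V (T a s b) = T (\<alpha>1 g a) s (\<alpha>2 g b)" if a: "a \<in> A.H r" and b: "b \<in> B.H s" for a r b s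
    unfolding Ad_intertwine[OF V]
  proof (rule t_eqI)
    fix u v
    note aB = A.HomD(1,2)[OF a] A.HomD(2)[OF A.Hom_act[OF g a]]
      and bB = B.HomD(1,2)[OF b] B.HomD(2)[OF B.Hom_act[OF g b]]
    have "V1 (a x) = \<alpha>1 g a (V1 x)" "V2 (b y) = \<alpha>2 g b (V2 y)" for x y
      using compose_eqD[OF V1(2)[OF aB(1)], of x] compose_eqD[OF V2(2)[OF bB(1)], of y] by simp_all
    then show "(V o\<^sub>L T a s b) (t u v) = (T (\<alpha>1 g a) s (\<alpha>2 g b) o\<^sub>L V) (t u v)"
      by (simp add: T_apply[OF aB(2) bB(2)] T_apply[OF aB(3) bB(3)] V_apply V1P Zb[OF b] t_scale scaleC_scaleC
          Bounded_opsD[OF aB(3)] Bounded_opsD[OF bB(3)] semilinearD[OF unitary_opD(1)[OF V2(1)]])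
  qed
  have S1: "Ad V x \<in> S" if x: "x \<in> S" for x
  proof -
    obtain a r b s where "a \<in> A.H r" "b \<in> B.H s" "x = T a s b" using x unfolding S_iff by blast
    then show ?thesis using AdT[of a r b s] S_I[OF A.Hom_act[OF g] B.Hom_act[OF g]] by metis
  qed
  have S2: "Ad (adj V) x \<in> S" if xS: "x \<in> S" for x
  proof -
    obtain a r b s where x: "a \<in> A.H r" "b \<in> B.H s" "x = T a s b" using xS unfolding S_iff by blast
    obtain a' where a': "a' \<in> A.H r" "a = \<alpha>1 g a'" using A.Hom_act_surj[OF g x(1)] by blast
    obtain b' where b': "b' \<in> B.H s" "b = \<alpha>2 g b'" using B.Hom_act_surj[OF g x(2)] by blast
    have "Ad (adj V) x = T a' s b'"
      unfolding x(3) a'(2) b'(2) AdT[OF a'(1) b'(1), symmetric]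
      by (rule blinfun_eqI) (simp add: unitary_opD(4)[OF V])
    then show ?thesis using S_I[OF a'(1) b'(1)] by simp
  qed
  have "star_iso (p g) M M (Ad V)"
  proof (rule star_iso_Ad[OF V])
    show "M \<subseteq> Bounded_ops" using C.algD(1) by blast
    show "Ad V ` M \<subseteq> M" using bicommutant_Ad[OF V S_Bounded S1 S2] unfolding M_eq by blast
    have S3: "Ad (adj (adj V)) x \<in> S" if "x \<in> S" for x using S1[OF that] by simp
    show "Ad (adj V) ` M \<subseteq> M"
      using bicommutant_Ad[OF unitary_op_adj[OF V] S_Bounded S2 S3] unfolding M_eq by blast
  qed
  then show thesis using AdT by (rule that)
qed

text \<open>The description defining the action has a solution by
  \<open>tensor_automorphism\<close>, made extensional by restriction, and only one by
  \<open>star_iso_agree\<close>.\<close>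

lemma graded_tensor_action:
  assumes g: "g \<in> carrier G"
  shows "star_iso (p g) M M (\<alpha> g)"
    "a \<in> A.H r \<Longrightarrow> b \<in> B.H s \<Longrightarrow> \<alpha> g (T a s b) = T (\<alpha>1 g a) s (\<alpha>2 g b)"
proof -
  let ?P = "\<lambda>\<beta>. \<beta> \<in> extensional M \<and> star_iso (p g) M M \<beta> \<and>
    (\<forall>r s. \<forall>a\<in>A.H r. \<forall>b\<in>B.H s. \<beta> (T a s b) = T (\<alpha>1 g a) s (\<alpha>2 g b))"
  have "\<exists>!\<beta>. ?P \<beta>"
  proof (rule ex_ex1I)
    obtain \<beta> where \<beta>: "star_iso (p g) M M \<beta>"
      "\<And>r s a b. a \<in> A.H r \<Longrightarrow> b \<in> B.H s \<Longrightarrow> \<beta> (T a s b) = T (\<alpha>1 g a) s (\<alpha>2 g b)"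
      using tensor_automorphism[OF g] by blast
    have "star_iso (p g) M M (restrict \<beta> M)" by (rule star_iso_cong[OF \<beta>(1) C.M_star]) simp
    then have "?P (restrict \<beta> M)" using \<beta>(2) S_M[OF S_I] by simp
    then show "\<exists>\<beta>. ?P \<beta>" by blast
  next
    fix \<beta> \<beta>' assume P: "?P \<beta>" "?P \<beta>'"
    have "\<beta> x = \<beta>' x" if "x \<in> S" for x using P that unfolding S_iff by metis
    then have "\<beta> x = \<beta>' x" if "x \<in> M" for x
      using star_iso_agree[of "p g" \<beta> \<beta>'] P that by blast
    then show "\<beta> = \<beta>'" using P by (intro extensionalityI[of _ M]) auto
  qed
  from theI'[OF this] have "?P (\<alpha> g)" unfolding graded_tensor_action_def Let_def .
  then show "star_iso (p g) M M (\<alpha> g)"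
    "a \<in> A.H r \<Longrightarrow> b \<in> B.H s \<Longrightarrow> \<alpha> g (T a s b) = T (\<alpha>1 g a) s (\<alpha>2 g b)" by blast+
qed

lemma p_add: "g \<in> carrier G \<Longrightarrow> h \<in> carrier G \<Longrightarrow> p (g \<otimes> h) = p g + p h"
  using A.p_hom by (simp add: Z2_hom_def)

lemma graded_tensor_dynamical_system: "graded_dynamical_system G p M (Ad \<Gamma>) \<alpha>"
  unfolding graded_dynamical_system_def
proof (intro conjI ballI)
  show "graded_von_neumann_algebra M (Ad \<Gamma>)" using C.spatial by (simp add: spatially_graded_def)
  show "star_iso (p g) M M (\<alpha> g)" if "g \<in> carrier G" for g by (rule graded_tensor_action[OF that])
  show "\<alpha> (g \<otimes> h) x = \<alpha> g (\<alpha> h x)" if g: "g \<in> carrier G" and h: "h \<in> carrier G" and x: "x \<in> M" for g h x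
  proof -
    have gh: "g \<otimes> h \<in> carrier G" using g h by simp
    have 1: "star_iso (p (g \<otimes> h)) M M (\<alpha> g \<circ> \<alpha> h)"
      using star_iso_compose[OF graded_tensor_action(1)[OF h] graded_tensor_action(1)[OF g]]
      by (simp add: p_add[OF g h] add.commute)
    have "\<alpha> (g \<otimes> h) y = (\<alpha> g \<circ> \<alpha> h) y" if y: "y \<in> S" for y
    proof -
      obtain a r b s where ab: "a \<in> A.H r" "b \<in> B.H s" and y: "y = T a s b" using y unfolding S_iff by blast
      show ?thesis
        unfolding y using graded_tensor_action(2)[OF gh ab] graded_tensor_action(2)[OF h ab]
          graded_tensor_action(2)[OF g A.Hom_act[OF h ab(1)] B.Hom_act[OF h ab(2)]]
          A.act.act[OF g h A.HomD(1)[OF ab(1)]] B.act.act[OF g h B.HomD(1)[OF ab(2)]] by simp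
    qed
    then show ?thesis using star_iso_agree[OF graded_tensor_action(1)[OF gh] 1 _ x] by simp
  qed
  show "\<alpha> g (Ad \<Gamma> x) = Ad \<Gamma> (\<alpha> g x)" if g: "g \<in> carrier G" and x: "x \<in> M" for g x
  proof -
    have 1: "star_iso (p g) M M (\<alpha> g \<circ> Ad \<Gamma>)" "star_iso (p g) M M (Ad \<Gamma> \<circ> \<alpha> g)"
      using star_iso_compose[OF C.theta_iso graded_tensor_action(1)[OF g]]
        star_iso_compose[OF graded_tensor_action(1)[OF g] C.theta_iso] by simp_all
    have "(\<alpha> g \<circ> Ad \<Gamma>) y = (Ad \<Gamma> \<circ> \<alpha> g) y" if y: "y \<in> S" for y
    proof -
      obtain a r b s where ab: "a \<in> A.H r" "b \<in> B.H s" and y: "y = T a s b" using y unfolding S_iff by blast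
      show ?thesis
        unfolding y o_apply \<Gamma>_T[OF ab] graded_tensor_action(2)[OF g ab]
          \<Gamma>_T[OF A.Hom_act[OF g ab(1)] B.Hom_act[OF g ab(2)]]
        using star_isoD(8)[OF graded_tensor_action(1)[OF g] S_M[OF S_I[OF ab]]] graded_tensor_action(2)[OF g ab]
        by simp
    qed
    then show ?thesis using star_iso_agree[OF 1 _ x] by simp
  qed
qed

sublocale C: graded_system M \<Gamma> G p \<alpha>
  by unfold_locales (rule graded_tensor_dynamical_system, rule A.p_hom)

end

section \<open>Partial isometries and cocycle of the tensor product\<close>

context graded_system
begin

text \<open>
  Multiplying \<open>v\<close> by powers of the odd central unitary \<open>w\<close> makes the parity of the family
  adjustable when \<open>\<kappa> = 1\<close>, at the price of a sign in the cocycle.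
\<close>

definition twist :: "'a op \<Rightarrow> ('g \<Rightarrow> 'a op) \<Rightarrow> ('g \<Rightarrow> bit) \<Rightarrow> 'g \<Rightarrow> 'a op"
  where "twist w v k g = (if k g = 0 then v g else v g o\<^sub>L w)"

text \<open>For \<open>\<kappa> = 0\<close>, \<open>w\<close> fixes \<open>e\<close> and twisting
  changes nothing. For \<open>\<kappa> = 1\<close> the central \<open>w\<close> moves freely, and
  the only sign comes from \<open>\<alpha> g w\<close>.\<close>

lemma twist:
  assumes d: "index_data \<kappa> q e w v \<upsilon>" and g: "g \<in> carrier G"
  shows "twist w v k g \<in> H ((1 + \<kappa>) * q g + \<kappa> * k g)"
    "adj (twist w v k g) o\<^sub>L twist w v k g = e" "twist w v k g o\<^sub>L adj (twist w v k g) = \<alpha> g e"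
    "h \<in> carrier G \<Longrightarrow> k (g \<otimes> h) = k g + k h \<Longrightarrow>
      \<alpha> g (twist w v k h) o\<^sub>L twist w v k g =
        scale_op (\<upsilon> g h * sign (\<kappa> * (q g * k h))) (twist w v k (g \<otimes> h))"
proof -
  have fr: "frame \<kappa> e w" and c: "corner_cocycle G (N \<kappa>) \<alpha> e v \<upsilon>"
    and aw: "\<alpha> g w = scale_op (sign (q g)) w"
    using d g by (auto simp: index_data_def)
  interpret C: algebra_action G p "N \<kappa>" \<alpha> by (rule corner_action)
  interpret corner "N \<kappa>" e by (rule frameD(12)[OF fr])
  note w = frameD[OF fr] and e = frame_e[OF fr]
  note v = C.corner_cocycleD[OF c g] and ve = isometry_e[OF C.corner_cocycleD(1,2)[OF c g]]
  have deg: "v h \<in> H ((1 + \<kappa>) * q h)" if "h \<in> carrier G" for h by (rule index_data_degree[OF d that])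
  have vM: "v h \<in> M" if "h \<in> carrier G" for h by (rule HomD(1)[OF deg[OF that]])
  have vw: "v h o\<^sub>L w = v h" if "\<kappa> = 0" "h \<in> carrier G" for h
  proof -
    have "e (w x) = e x" for x using compose_eqD[OF w(9)[OF that(1)], of x] by (simp add: e(5))
    then have "v h (w x) = v h x" for x
      using isometry_e(3)[OF C.corner_cocycleD(1,2)[OF c that(2)]] by metis
    then show ?thesis by (intro blinfun_eqI) simp
  qed
  have tw: "twist w v k h = v h" if "\<kappa> = 0" "h \<in> carrier G" for h by (simp add: twist_def vw[OF that])
  have wc: "w (a x) = a (w x)" if "\<kappa> = 1" "a \<in> M" for a x using frame_1_central[of e w a x] fr that by simp
  show "twist w v k g \<in> H ((1 + \<kappa>) * q g + \<kappa> * k g)"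
  proof (cases "\<kappa> = 0")
    case False
    then show ?thesis using deg[OF g] Hom_compose[OF deg[OF g] w(3)] by (cases "k g = 0") (simp_all add: twist_def)
  qed (use deg[OF g] tw g in simp)
  show "adj (twist w v k g) o\<^sub>L twist w v k g = e"
    by (rule blinfun_eqI) (simp add: twist_def ve(5) w(4,6) e(5))
  show "twist w v k g o\<^sub>L adj (twist w v k g) = \<alpha> g e"
    using compose_eqD[OF v(3)] by (intro blinfun_eqI) (simp add: twist_def w(4,6))
  assume h: "h \<in> carrier G" and k: "k (g \<otimes> h) = k g + k h"
  have gh: "g \<otimes> h \<in> carrier G" using g h by simp
  show "\<alpha> g (twist w v k h) o\<^sub>L twist w v k g =
      scale_op (\<upsilon> g h * sign (\<kappa> * (q g * k h))) (twist w v k (g \<otimes> h))"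
  proof (cases "\<kappa> = 0")
    case True
    then show ?thesis using v(4)[OF h] by (simp add: tw g h gh)
  next
    case False
    then have \<kappa>: "\<kappa> = 1" by simp
    have vv: "\<alpha> g (v h) (v g x) = \<upsilon> g h *\<^sub>C v (g \<otimes> h) x" for x
      using compose_eqD[OF v(4)[OF h], of x] by simp
    have "\<alpha> g (v h o\<^sub>L w) = scale_op (sign (q g)) (\<alpha> g (v h) o\<^sub>L w)"
      using act.isoD(6)[OF g vM[OF h] w(10)] HomD(2)[OF Hom_act[OF g deg[OF h]]] aw by simp
    then show ?thesis
      using wc[OF \<kappa> vM[OF g]] w(6)
      by (intro blinfun_eqI) (auto simp: twist_def \<kappa> k vv wc[OF \<kappa> vM[OF g]] scaleC_scaleC mult.commute)
  qed
qed

end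

context indexed_pair
begin

lemma q_add:
  assumes "g \<in> carrier G" "h \<in> carrier G"
  shows "q1 (g \<otimes> h) = q1 g + q1 h" "q2 (g \<otimes> h) = q2 g + q2 h"
  using A.index_data_hom[OF d1] B.index_data_hom[OF d2] assms by (simp_all add: Z2_hom_def)

definition Q :: "'g \<Rightarrow> bit" where "Q g = q1 g + q2 g + \<kappa>1 * \<kappa>2 * p g"
text \<open>The exponents \<open>k1\<close> of \<open>w1\<close> and \<open>k2\<close> of
  \<open>w2\<close> solve the parity condition \<open>degree\<close>. They act only for the factor
  with \<open>\<kappa> = 1\<close>; if both have it, \<open>k2\<close> is zero and \<open>w1\<close>
  supplies the whole correction.\<close>

definition k1 :: "'g \<Rightarrow> bit" where "k1 g = q2 g + \<kappa>1 * \<kappa>2 * (q1 g + p g)"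
definition k2 :: "'g \<Rightarrow> bit" where "k2 g = (1 + \<kappa>1) * q1 g"
text \<open>\<open>r\<close> and \<open>s\<close> are the degrees of the twisted partial isometries
  in the two factors.\<close>

definition r :: "'g \<Rightarrow> bit" where "r g = (1 + \<kappa>1) * q1 g + \<kappa>1 * k1 g"
text \<open>\<open>Y\<close> below collects the signs of the two twists and the Koszul sign of the
  graded product.\<close>

definition s :: "'g \<Rightarrow> bit" where "s g = (1 + \<kappa>2) * q2 g + \<kappa>2 * k2 g"
definition Y :: "'g \<Rightarrow> 'g \<Rightarrow> bit"
  where "Y g h = \<kappa>1 * (q1 g * k1 h) + \<kappa>2 * (q2 g * k2 h) + r g * s h"
definition X :: "'g \<Rightarrow> 'c op" where "X g = T (A.twist w1 v1 k1 g) (s g) (B.twist w2 v2 k2 g)"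

text \<open>This is the degree that \<open>index_data_degree\<close> dictates: even when
  \<open>\<kappa>1 + \<kappa>2 = 1\<close>, and \<open>Q g\<close> when it is 0.\<close>

lemma degree: "r g + s g = (1 + (\<kappa>1 + \<kappa>2)) * Q g"
  unfolding r_def s_def k1_def k2_def Q_def
  by (cases \<kappa>1; cases \<kappa>2; cases "q1 g"; cases "q2 g"; cases "p g") simp_all

lemma add:
  assumes "g \<in> carrier G" "h \<in> carrier G"
  shows "k1 (g \<otimes> h) = k1 g + k1 h" "k2 (g \<otimes> h) = k2 g + k2 h" "s (g \<otimes> h) = s g + s h"
  by (simp_all add: k1_def k2_def s_def q_add[OF assms] p_add[OF assms] algebra_simps)

lemma action_w: "g \<in> carrier G \<Longrightarrow> \<alpha> g w = scale_op (sign (Q g)) w"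
proof -
  assume g: "g \<in> carrier G"
  have "\<alpha>1 g w1 = scale_op (sign (q1 g)) w1" "\<alpha>2 g w2 = scale_op (sign (q2 g)) w2"
    using d1 d2 g by (simp_all add: A.index_data_def B.index_data_def)
  then show ?thesis
    using star_isoD(8)[OF graded_tensor_action(1)[OF g] S_M[OF S_I[OF w1(3) w2(3)]], of c]
      graded_tensor_action(2)[OF g w1(3) w2(3)] T_scale w1(11) w2(11)
    by (simp add: w_def c(4) Q_def sign_add mult_ac)
qed

lemma action_e0: "g \<in> carrier G \<Longrightarrow> \<alpha> g e0 = T (\<alpha>1 g e1) 0 (\<alpha>2 g e2)"
  unfolding e0_def by (rule graded_tensor_action(2)[OF _ w1(2) w2(2)])

lemma X:
  assumes g: "g \<in> carrier G"
  shows "X g \<in> C.H (r g + s g)" "adj (X g) o\<^sub>L X g = e0" "X g o\<^sub>L adj (X g) = \<alpha> g e0"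
    "h \<in> carrier G \<Longrightarrow> \<alpha> g (X h) o\<^sub>L X g = scale_op (\<upsilon>1 g h * \<upsilon>2 g h * sign (Y g h)) (X (g \<otimes> h))"
proof -
  note a = A.twist[OF d1 g, where k = k1, folded r_def] and b = B.twist[OF d2 g, where k = k2, folded s_def]
  note aB = A.HomD(2)[OF a(1)] and bB = B.HomD(2)[OF b(1)]
  show "X g \<in> C.H (r g + s g)" unfolding X_def by (rule T_Hom[OF a(1) b(1)])
  show "adj (X g) o\<^sub>L X g = e0"
    unfolding X_def T_adj[OF a(1) b(1)] e0_def
    using T_compose[OF Bounded_ops_intros(9)[OF aB] Bounded_ops_intros(9)[OF bB] a(1) bB, of "s g" "s g"]
    by (simp add: a(2) b(2) mult.commute)
  show "X g o\<^sub>L adj (X g) = \<alpha> g e0"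
    unfolding X_def T_adj[OF a(1) b(1)] action_e0[OF g]
    using T_compose[OF aB bB A.Hom_adj[OF a(1)] Bounded_ops_intros(9)[OF bB], of "s g" "s g"] T_Bounded[OF aB bB]
    by (simp add: a(3) b(3) mult.commute)
  assume h: "h \<in> carrier G"
  note a' = A.twist(1)[OF d1 h, where k = k1, folded r_def] and b' = B.twist(1)[OF d2 h, where k = k2, folded s_def]
  have gh: "g \<otimes> h \<in> carrier G" using g h by simp
  note aB' = A.HomD(2)[OF A.Hom_act[OF g a']] and bB' = B.HomD(2)[OF B.Hom_act[OF g b']]
  note aB'' = A.HomD(2)[OF A.twist(1)[OF d1 gh, where k = k1]] and bB'' = B.HomD(2)[OF B.twist(1)[OF d2 gh, where k = k2]]
  show "\<alpha> g (X h) o\<^sub>L X g = scale_op (\<upsilon>1 g h * \<upsilon>2 g h * sign (Y g h)) (X (g \<otimes> h))"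
    unfolding X_def graded_tensor_action(2)[OF g a' b'] T_compose[OF aB' bB' a(1) bB]
      a(4)[OF h add(1)[OF g h]] b(4)[OF h add(2)[OF g h]]
    using T_scale(1)[OF aB'' Bounded_ops_intros(7)[OF bB'']] T_scale(2)[OF aB'' bB'']
    by (simp add: Y_def sign_add add(3)[OF g h] mult_ac add.commute)
qed

lemma action_f:
  assumes g: "g \<in> carrier G"
  shows "\<alpha> g f = (1/2) *\<^sub>R (\<alpha> g e0 + scale_op (sign (Q g)) (w o\<^sub>L \<alpha> g e0))"
proof -
  note iso = star_isoD[OF graded_tensor_action(1)[OF g]] and S0 = S_M[OF e0_S] and Sw = S_M[OF w_S]
  have "conj_pow (p g) 2 = 2" by (cases "p g") simp_all
  then have "\<alpha> g (scale_op (of_real (1/2)) (e0 + (w o\<^sub>L e0))) =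
      scale_op (of_real (1/2)) (\<alpha> g e0 + scale_op (sign (Q g)) (w o\<^sub>L \<alpha> g e0))"
    using iso(8)[OF C.algD(3)[OF S0 C.algD(4)[OF Sw S0]]] iso(5)[OF S0 C.algD(4)[OF Sw S0]] iso(6)[OF Sw S0]
      action_w[OF g] by simp
  then show ?thesis by (simp only: scale_op_of_real f_def)
qed

text \<open>When \<open>e\<close> is the half of \<open>e0\<close> cut out by \<open>w\<close>, the
  degree of \<open>X g\<close> makes it commute with \<open>w\<close> up to
  \<open>sign (Q g)\<close>, the same sign with which \<open>\<alpha> g\<close> acts on
  \<open>w\<close>.\<close>

lemma X_e:
  assumes g: "g \<in> carrier G"
  shows "X g o\<^sub>L (e o\<^sub>L adj (X g)) = \<alpha> g e"
proof -
  note Xg = X[OF g]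
  have e0X: "e0 (adj (X g) v) = adj (X g) v" for v
  proof -
    have "X g (e0 u) = X g u" for u
    proof -
      \<comment> \<open>The initial projection of \<open>X g\<close> is \<open>e0\<close>, so
        \<open>X g\<close> vanishes on the complement of its range.\<close>
      have "(norm (X g (e0 u - u)))\<^sup>2 = 0" unfolding norm_adj_compose Xg(2) by (simp add: blinfun.diff_right e0_apply_apply)
      then show ?thesis by (simp add: blinfun.diff_right)
    qed
    then have "X g o\<^sub>L e0 = X g" by (intro blinfun_eqI) simp
    from arg_cong[OF this, of adj] have "e0 o\<^sub>L adj (X g) = adj (X g)" by (simp add: e0_adj)
    from compose_eqD[OF this, of v] show ?thesis by simp
  qed
  have XX: "X g (adj (X g) v) = \<alpha> g e0 v" for v using compose_eqD[OF Xg(3), of v] by simp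
  show ?thesis
  proof (cases "\<kappa>1 * \<kappa>2 = 1")
    case True
    then have \<kappa>: "\<kappa>1 + \<kappa>2 = 0" by (cases \<kappa>1; cases \<kappa>2) simp_all
    have "X g (w v) = sign (Q g) *\<^sub>C w (X g v)" for v
    proof -
      have "r g + s g = Q g" unfolding degree \<kappa> by simp
      then have "w (X g v) = sign (Q g) *\<^sub>C X g (w v)"
        using w_comm[OF Xg(1), of v] unfolding \<kappa> by simp
      then show ?thesis by (simp add: scaleC_scaleC)
    qed
    then have "X g o\<^sub>L (f o\<^sub>L adj (X g)) = \<alpha> g f"
      by (intro blinfun_eqI)
        (simp add: f_apply action_f[OF g] e0X XX blinfun.scaleR_right blinfun.add_right blinfun.scaleR_left blinfun.add_left)
    then show ?thesis using True e_S_eq by metis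
  next
    case False
    then have "e = e0" using e_S_eq by metis
    moreover have "X g o\<^sub>L (e0 o\<^sub>L adj (X g)) = \<alpha> g e0" by (rule blinfun_eqI) (simp add: e0X XX)
    ultimately show ?thesis by simp
  qed
qed

text \<open>\<open>X g\<close> starts at \<open>e0\<close>, which may be larger than
  \<open>e\<close>; composing with \<open>e\<close> adjusts the initial projection and leaves the
  cocycle unchanged.\<close>

theorem tensor_index_data:
  "C.index_data (\<kappa>1 + \<kappa>2) (\<lambda>g\<in>carrier G. Q g) e w (\<lambda>g. X g o\<^sub>L e)
    (\<lambda>g h. \<upsilon>1 g h * \<upsilon>2 g h * sign (Y g h))"
  unfolding C.index_data_def corner_cocycle_def
proof (intro conjI ballI)
  note ed = C.frame_e[OF frame]
  show "C.frame (\<kappa>1 + \<kappa>2) e w" by (rule frame)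
  have e0e: "e0 (e v) = e v" for v using fD(3) e0_apply_apply e_S_eq by metis
  fix g assume g: "g \<in> carrier G"
  note Xg = X[OF g]
  show "\<alpha> g w = scale_op (sign ((\<lambda>g\<in>carrier G. Q g) g)) w" using action_w[OF g] g by simp
  have XeH: "X g o\<^sub>L e \<in> C.H ((1 + (\<kappa>1 + \<kappa>2)) * Q g)"
    using C.Hom_compose[OF Xg(1) e_Hom] by (simp add: degree)
  show "X g o\<^sub>L e \<in> C.N (\<kappa>1 + \<kappa>2)"
  proof (cases "\<kappa>1 + \<kappa>2 = 0")
    case True
    then show ?thesis using C.HomD(1)[OF XeH] unfolding corner_algebra_def by (simp only: if_True simp_thms)
  next
    case False
    then have "(1 + (\<kappa>1 + \<kappa>2)) * Q g = 0" by (cases "\<kappa>1 + \<kappa>2") simp_all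
    then show ?thesis using XeH False unfolding corner_algebra_def by (simp only: if_False)
  qed
  have XX: "adj (X g) (X g v) = e0 v" for v using compose_eqD[OF Xg(2), of v] by simp
  show star: "adj (X g o\<^sub>L e) o\<^sub>L (X g o\<^sub>L e) = e"
    by (rule blinfun_eqI) (simp add: ed(1,2) XX e0e)
  have XeX: "(X g o\<^sub>L e) o\<^sub>L adj (X g o\<^sub>L e) = \<alpha> g e"
    unfolding X_e[OF g, symmetric] by (rule blinfun_eqI) (simp add: ed(1,2))
  then show "(X g o\<^sub>L e) o\<^sub>L adj (X g o\<^sub>L e) = \<alpha> g e" .
  fix h assume h: "h \<in> carrier G"
  have 1: "\<alpha> g e (X g (e v)) = X g (e v)" for v
    using compose_eqD[OF XeX, of "X g (e v)"] by (simp add: ed(1,2) XX e0e)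
  have "\<alpha> g (X h o\<^sub>L e) = \<alpha> g (X h) o\<^sub>L \<alpha> g e"
    by (rule C.act.isoD(6)[OF g C.HomD(1)[OF X(1)[OF h]] ed(6)])
  moreover have "\<alpha> g (X h) (X g v) = (\<upsilon>1 g h * \<upsilon>2 g h * sign (Y g h)) *\<^sub>C X (g \<otimes> h) v" for v
    using compose_eqD[OF Xg(4)[OF h], of v] by simp
  ultimately show "\<alpha> g (X h o\<^sub>L e) o\<^sub>L (X g o\<^sub>L e) =
      scale_op (\<upsilon>1 g h * \<upsilon>2 g h * sign (Y g h)) (X (g \<otimes> h) o\<^sub>L e)"
    by (intro blinfun_eqI) (simp add: 1)
qed

end

section \<open>Coboundaries\<close>

lemma bit_add_left_self: "a + (a + b) = b" for a b :: bit
  by (simp add: add.assoc[symmetric])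

lemma cohomologous_times:
  "cohomologous G p b (\<lambda>_ _. 1) \<sigma> \<Longrightarrow> cohomologous G p b \<upsilon> (\<lambda>g h. \<upsilon> g h * \<sigma> g h)"
  by (simp add: cohomologous_def)

text \<open>Sign cocycles are handled through their exponents, so that products of cocycles become
  sums of bits.\<close>

definition trivial_exponent :: "('g, 'm) monoid_scheme \<Rightarrow> ('g \<Rightarrow> bit) \<Rightarrow> ('g \<Rightarrow> 'g \<Rightarrow> bit) \<Rightarrow> bool"
  where "trivial_exponent G p E \<longleftrightarrow> (\<exists>b. cohomologous G p b (\<lambda>_ _. 1) (\<lambda>g h. sign (E g h)))"

lemma trivial_exponent_add:
  assumes "trivial_exponent G p E" "trivial_exponent G p E'"
  shows "trivial_exponent G p (\<lambda>g h. E g h + E' g h)"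
proof -
  obtain b b' where b: "cohomologous G p b (\<lambda>_ _. 1) (\<lambda>g h. sign (E g h))"
    "cohomologous G p b' (\<lambda>_ _. 1) (\<lambda>g h. sign (E' g h))"
    using assms by (auto simp: trivial_exponent_def)
  from cohomologous_trans[OF b(1) cohomologous_times[OF b(2)]] show ?thesis
    unfolding trivial_exponent_def sign_add by blast
qed

text \<open>Polarisation: expanding the product of \<open>q\<close> and \<open>q'\<close> at a
  product of group elements leaves the symmetrised cross terms.\<close>

lemma trivial_exponent_swap:
  assumes "Z2_hom G q" "Z2_hom G q'"
  shows "trivial_exponent G p (\<lambda>g h. q g * q' h + q' g * q h)"
  unfolding trivial_exponent_def cohomologous_def
proof (intro exI[of _ "\<lambda>g. sign (q g * q' g)"] conjI ballI)
  fix g h assume "g \<in> carrier G" "h \<in> carrier G"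
  then have q: "q (g \<otimes>\<^bsub>G\<^esub> h) = q g + q h" "q' (g \<otimes>\<^bsub>G\<^esub> h) = q' g + q' h" using assms by (auto simp: Z2_hom_def)
  show "sign (q g * q' h + q' g * q h) = 1 * (sign (q g * q' g) * conj_pow (p g) (sign (q h * q' h)) /
      sign (q (g \<otimes>\<^bsub>G\<^esub> h) * q' (g \<otimes>\<^bsub>G\<^esub> h)))"
    unfolding q by (cases "q g"; cases "q h"; cases "q' g"; cases "q' h") simp_all
qed simp

text \<open>The powers of \<open>\<i>\<close> produce a carry when \<open>q g\<close> and
  \<open>q h\<close> are both 1; an anti-linear \<open>g\<close> conjugates the second power, which
  adds the term with \<open>p g\<close>.\<close>

lemma trivial_exponent_square:
  assumes "Z2_hom G q"
  shows "trivial_exponent G p (\<lambda>g h. q g * q h + p g * q h)"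
  unfolding trivial_exponent_def cohomologous_def
proof (intro exI[of _ "\<lambda>g. if q g = 0 then 1 else \<i>"] conjI ballI)
  fix g h assume "g \<in> carrier G" "h \<in> carrier G"
  then have q: "q (g \<otimes>\<^bsub>G\<^esub> h) = q g + q h" using assms by (auto simp: Z2_hom_def)
  show "sign (q g * q h + p g * q h) = 1 * ((if q g = 0 then 1 else \<i>) * conj_pow (p g) (if q h = 0 then 1 else \<i>) /
      (if q (g \<otimes>\<^bsub>G\<^esub> h) = 0 then 1 else \<i>))"
    unfolding q by (cases "q g"; cases "q h"; cases "p g") simp_all
qed simp

lemma trivial_exponent_square':
  assumes "Z2_hom G q" "Z2_hom G p"
  shows "trivial_exponent G p (\<lambda>g h. q g * q h + q g * p h)"
proof -
  have eq: "(\<lambda>g h. (q g * q h + p g * q h) + (p g * q h + q g * p h)) = (\<lambda>g h. q g * q h + q g * p h)"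
    by (intro ext) (simp add: add.assoc bit_add_left_self)
  show ?thesis
    using trivial_exponent_add[OF trivial_exponent_square[OF assms(1), of p] trivial_exponent_swap[OF assms(2,1)]]
    unfolding eq .
qed

text \<open>The exponents agree for \<open>\<kappa>1 = \<kappa>2 = 0\<close>. Otherwise they differ
  by a square term in \<open>q2\<close> if only \<open>\<kappa>1\<close> is 1, and by one in
  \<open>q1\<close> if \<open>\<kappa>2\<close> is 1, with an additional swap when
  \<open>\<kappa>1\<close> is 0.\<close>

lemma epsilon_difference_trivial:
  assumes "Z2_hom G p" "Z2_hom G q1" "Z2_hom G q2"
    and Y: "Y = (\<lambda>g h. \<kappa>1 * (q1 g * (q2 h + \<kappa>1 * \<kappa>2 * (q1 h + p h))) + \<kappa>2 * (q2 g * ((1 + \<kappa>1) * q1 h)) +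
      ((1 + \<kappa>1) * q1 g + \<kappa>1 * (q2 g + \<kappa>1 * \<kappa>2 * (q1 g + p g))) * ((1 + \<kappa>2) * q2 h + \<kappa>2 * ((1 + \<kappa>1) * q1 h)))"
  shows "trivial_exponent G p (\<lambda>g h. Y g h + (q1 g * q2 h + (\<kappa>1 - \<kappa>2) * (\<kappa>1 * q2 g + \<kappa>2 * q1 g) * p h))"
proof -
  have zero: "trivial_exponent G p (\<lambda>_ _. 0)"
    unfolding trivial_exponent_def using cohomologous_refl[of G p "\<lambda>_ _. 1"] by auto
  note sw = trivial_exponent_swap[OF assms(2,3)]
    and s1 = trivial_exponent_square'[OF assms(2,1)] and s2 = trivial_exponent_square'[OF assms(3,1)]
  consider "\<kappa>1 = 0" "\<kappa>2 = 0" | "\<kappa>1 = 0" "\<kappa>2 = 1" | "\<kappa>1 = 1" "\<kappa>2 = 0" | "\<kappa>1 = 1" "\<kappa>2 = 1"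
    by (cases \<kappa>1; cases \<kappa>2) auto
  then show ?thesis
  proof cases
    case 1
    show ?thesis using zero unfolding Y 1 by simp
  next
    case 2
    show ?thesis using trivial_exponent_add[OF sw s1] unfolding Y 2 by (simp add: add_ac)
  next
    case 3
    show ?thesis using s2 unfolding Y 3 by (simp add: algebra_simps bit_add_left_self)
  next
    case 4
    show ?thesis using s1 unfolding Y 4 by (simp add: algebra_simps bit_add_left_self)
  qed
qed

lemma epsilon_cocycle2:
  assumes "Z2_hom G p" "Z2_hom G q1" "Z2_hom G q2"
  shows "cocycle2 G p (epsilon_cocycle p \<kappa>1 q1 \<kappa>2 q2)"
  unfolding cocycle2_def
proof (intro conjI ballI)
  fix f g h assume "f \<in> carrier G" "g \<in> carrier G" "h \<in> carrier G"
  then have "p (g \<otimes>\<^bsub>G\<^esub> h) = p g + p h" "q1 (f \<otimes>\<^bsub>G\<^esub> g) = q1 f + q1 g" "q2 (f \<otimes>\<^bsub>G\<^esub> g) = q2 f + q2 g"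
    "q2 (g \<otimes>\<^bsub>G\<^esub> h) = q2 g + q2 h"
    using assms by (auto simp: Z2_hom_def)
  then show "conj_pow (p f) (epsilon_cocycle p \<kappa>1 q1 \<kappa>2 q2 g h) * epsilon_cocycle p \<kappa>1 q1 \<kappa>2 q2 f (g \<otimes>\<^bsub>G\<^esub> h) =
      epsilon_cocycle p \<kappa>1 q1 \<kappa>2 q2 f g * epsilon_cocycle p \<kappa>1 q1 \<kappa>2 q2 (f \<otimes>\<^bsub>G\<^esub> g) h"
    unfolding epsilon_cocycle_def by (simp add: algebra_simps flip: sign_add)
qed (simp add: epsilon_cocycle_def)

section \<open>The tensor product system and its index\<close>

theorem theorem4p1:
  fixes G :: "('g, 'm) monoid_scheme" and p :: "'g \<Rightarrow> bit"
    and M1 :: "'a::chilbert_space op set" and \<Gamma>1 :: "'a op" and \<alpha>1 :: "'g \<Rightarrow> 'a op \<Rightarrow> 'a op"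
    and M2 :: "'b::chilbert_space op set" and \<Gamma>2 :: "'b op" and \<alpha>2 :: "'g \<Rightarrow> 'b op \<Rightarrow> 'b op"
    and t :: "'a \<Rightarrow> 'b \<Rightarrow> 'c::chilbert_space"
  defines "M \<equiv> graded_tensor t M1 \<Gamma>1 M2 \<Gamma>2"
    and "\<Gamma> \<equiv> op_tensor t \<Gamma>1 \<Gamma>2"
    and "\<alpha> \<equiv> graded_tensor_action p t M1 \<Gamma>1 \<alpha>1 M2 \<Gamma>2 \<alpha>2"
  assumes "group G" and "finite (carrier G)" and "Z2_hom G p"
    and "hilbert_tensor t"
    and "graded_dynamical_system G p M1 (Ad \<Gamma>1) \<alpha>1" and "spatially_graded M1 (Ad \<Gamma>1) \<Gamma>1"
    and "balanced M1 (Ad \<Gamma>1)" and "central M1 (Ad \<Gamma>1)" and "type_I M1"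
    and "graded_dynamical_system G p M2 (Ad \<Gamma>2) \<alpha>2" and "spatially_graded M2 (Ad \<Gamma>2) \<Gamma>2"
    and "balanced M2 (Ad \<Gamma>2)" and "central M2 (Ad \<Gamma>2)" and "type_I M2"
  shows "(graded_dynamical_system G p M (Ad \<Gamma>) \<alpha> \<and> spatially_graded M (Ad \<Gamma>) \<Gamma> \<and>
      balanced M (Ad \<Gamma>) \<and> central M (Ad \<Gamma>) \<and> type_I M) \<and>
    (\<forall>\<kappa>1 q1 \<upsilon>1 \<kappa>2 q2 \<upsilon>2.
      cocycle2 G p \<upsilon>1 \<and> cocycle2 G p \<upsilon>2 \<and>
      Ind G p M1 (Ad \<Gamma>1) \<alpha>1 = (\<kappa>1, q1, cocycle_class G p \<upsilon>1) \<and>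
      Ind G p M2 (Ad \<Gamma>2) \<alpha>2 = (\<kappa>2, q2, cocycle_class G p \<upsilon>2) \<longrightarrow>
      cocycle2 G p (epsilon_cocycle p \<kappa>1 q1 \<kappa>2 q2) \<and>
      Ind G p M (Ad \<Gamma>) \<alpha> =
        (\<kappa>1 + \<kappa>2,
         (\<lambda>g\<in>carrier G. q1 g + q2 g + \<kappa>1 * \<kappa>2 * p g),
         cocycle_class G p (\<lambda>g h. \<upsilon>1 g h * \<upsilon>2 g h * epsilon_cocycle p \<kappa>1 q1 \<kappa>2 q2 g h)))"
proof -
  interpret A: graded_system M1 \<Gamma>1 G p \<alpha>1
    using assms by (auto simp: graded_system_def graded_algebra_def graded_system_axioms_def)
  interpret B: graded_system M2 \<Gamma>2 G p \<alpha>2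
    using assms by (auto simp: graded_system_def graded_algebra_def graded_system_axioms_def)
  interpret tensor t using assms by unfold_locales
  \<comment> \<open>Needed twice: for some frame data, which establish the structure of the product,
    and for the same data rescaled to the prescribed cocycles.\<close>
  have P: "indexed_pair t M1 \<Gamma>1 M2 \<Gamma>2 \<kappa>1 e1 w1 \<kappa>2 e2 w2 G p \<alpha>1 \<alpha>2 q1 v1 \<upsilon>1 q2 v2 \<upsilon>2"
    if d: "A.index_data \<kappa>1 q1 e1 w1 v1 \<upsilon>1" "B.index_data \<kappa>2 q2 e2 w2 v2 \<upsilon>2"
    for \<kappa>1 e1 w1 \<kappa>2 e2 w2 q1 v1 \<upsilon>1 q2 v2 \<upsilon>2
  proof -
    have "A.frame \<kappa>1 e1 w1" "B.frame \<kappa>2 e2 w2" using d by (simp_all add: A.index_data_def B.index_data_def)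
    then show ?thesis using d by unfold_locales
  qed
  obtain \<kappa>1' e1 w1 where f1: "A.frame \<kappa>1' e1 w1" using A.frame_exists assms by blast
  obtain \<kappa>2' e2 w2 where f2: "B.frame \<kappa>2' e2 w2" using B.frame_exists assms by blast
  obtain q1' v1 \<upsilon>1' where d1: "q1' \<in> extensional (carrier G)" "A.index_data \<kappa>1' q1' e1 w1 v1 \<upsilon>1'"
    using A.index_data_exists[OF f1] by blast
  obtain q2' v2 \<upsilon>2' where d2: "q2' \<in> extensional (carrier G)" "B.index_data \<kappa>2' q2' e2 w2 v2 \<upsilon>2'"
    using B.index_data_exists[OF f2] by blast
  interpret I: indexed_pair t M1 \<Gamma>1 M2 \<Gamma>2 \<kappa>1' e1 w1 \<kappa>2' e2 w2 G p \<alpha>1 \<alpha>2 q1' v1 \<upsilon>1' q2' v2 \<upsilon>2'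
    by (rule P[OF d1(2) d2(2)])
  have bal: "balanced M (Ad \<Gamma>)"
    using I.graded_tensor_balanced assms by (simp add: M_def \<Gamma>_def)
  have 1: "graded_dynamical_system G p M (Ad \<Gamma>) \<alpha> \<and> spatially_graded M (Ad \<Gamma>) \<Gamma> \<and>
      balanced M (Ad \<Gamma>) \<and> central M (Ad \<Gamma>) \<and> type_I M"
    using I.graded_tensor_dynamical_system I.C.spatial bal I.C.frame_imp_central[OF I.frame]
      I.C.frame_imp_type_I[OF I.frame] by (simp add: M_def \<Gamma>_def \<alpha>_def)
  have 2: "cocycle2 G p (epsilon_cocycle p \<kappa>1 q1 \<kappa>2 q2) \<and>
      Ind G p M (Ad \<Gamma>) \<alpha> = (\<kappa>1 + \<kappa>2, (\<lambda>g\<in>carrier G. q1 g + q2 g + \<kappa>1 * \<kappa>2 * p g),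
        cocycle_class G p (\<lambda>g h. \<upsilon>1 g h * \<upsilon>2 g h * epsilon_cocycle p \<kappa>1 q1 \<kappa>2 q2 g h))"
    if \<upsilon>: "cocycle2 G p \<upsilon>1" "cocycle2 G p \<upsilon>2"
      and ind: "Ind G p M1 (Ad \<Gamma>1) \<alpha>1 = (\<kappa>1, q1, cocycle_class G p \<upsilon>1)"
        "Ind G p M2 (Ad \<Gamma>2) \<alpha>2 = (\<kappa>2, q2, cocycle_class G p \<upsilon>2)"
    for \<kappa>1 q1 \<upsilon>1 \<kappa>2 q2 \<upsilon>2
  proof -
    have eq: "\<kappa>1' = \<kappa>1" "q1' = q1" "cocycle_class G p \<upsilon>1' = cocycle_class G p \<upsilon>1"
      "\<kappa>2' = \<kappa>2" "q2' = q2" "cocycle_class G p \<upsilon>2' = cocycle_class G p \<upsilon>2"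
      using A.Ind_eq[OF d1(2,1)] B.Ind_eq[OF d2(2,1)] ind assms by simp_all
    \<comment> \<open>Equality of classes only becomes a coboundary because the prescribed functions
      are cocycles and hence members of their own classes.\<close>
    have "\<upsilon>1 \<in> cocycle_class G p \<upsilon>1'" "\<upsilon>2 \<in> cocycle_class G p \<upsilon>2'"
      unfolding eq cocycle_class_iff using \<upsilon> cohomologous_refl by blast+
    then obtain b1 b2 where b: "cohomologous G p b1 \<upsilon>1' \<upsilon>1" "cohomologous G p b2 \<upsilon>2' \<upsilon>2"
      unfolding cocycle_class_iff by blast
    note d1' = A.index_data_rescale[OF d1(2) b(1), unfolded eq] and d2' = B.index_data_rescale[OF d2(2) b(2), unfolded eq]
    interpret J: indexed_pair t M1 \<Gamma>1 M2 \<Gamma>2 \<kappa>1 e1 w1 \<kappa>2 e2 w2 G p \<alpha>1 \<alpha>2 q1 "\<lambda>g. scale_op (b1 g) (v1 g)" \<upsilon>1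
        q2 "\<lambda>g. scale_op (b2 g) (v2 g)" \<upsilon>2
      by (rule P[OF d1' d2'])
    have hom: "Z2_hom G p" "Z2_hom G q1" "Z2_hom G q2"
      by (rule A.p_hom A.index_data_hom[OF d1'] B.index_data_hom[OF d2'])+
    let ?E = "\<lambda>g h. q1 g * q2 h + (\<kappa>1 - \<kappa>2) * (\<kappa>1 * q2 g + \<kappa>2 * q1 g) * p h"
    have "trivial_exponent G p (\<lambda>g h. J.Y g h + ?E g h)"
      \<comment> \<open>Unfolding the degrees and twist exponents turns \<open>J.Y\<close> into the
        polynomial form expected by the lemma.\<close>
      by (rule epsilon_difference_trivial[OF hom]) (intro ext, simp only: J.Y_def J.r_def J.s_def J.k1_def J.k2_def)
    then obtain b where "cohomologous G p b (\<lambda>_ _. 1) (\<lambda>g h. sign (J.Y g h + ?E g h))"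
      unfolding trivial_exponent_def by blast
    from cohomologous_times[OF this, of "\<lambda>g h. \<upsilon>1 g h * \<upsilon>2 g h * sign (J.Y g h)"]
    have "cohomologous G p b (\<lambda>g h. \<upsilon>1 g h * \<upsilon>2 g h * sign (J.Y g h))
        (\<lambda>g h. \<upsilon>1 g h * \<upsilon>2 g h * epsilon_cocycle p \<kappa>1 q1 \<kappa>2 q2 g h)"
      by (simp add: sign_add epsilon_cocycle_def mult.assoc)
    note class_eq = cocycle_class_cong[OF \<open>group G\<close> this]
    have "Ind G p M (Ad \<Gamma>) \<alpha> = (\<kappa>1 + \<kappa>2, (\<lambda>g\<in>carrier G. J.Q g),
        cocycle_class G p (\<lambda>g h. \<upsilon>1 g h * \<upsilon>2 g h * sign (J.Y g h)))"
      unfolding M_def \<Gamma>_def \<alpha>_def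
      by (rule I.C.Ind_eq[OF J.tensor_index_data _ bal[unfolded M_def \<Gamma>_def]]) simp
    then show ?thesis using epsilon_cocycle2[OF hom] unfolding class_eq J.Q_def by blast
  qed
  show ?thesis using 1 2 by blast
qed

end
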